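(* Let $V$ be a discrete valuation ring with quotient field $F$, let $K/F$ be a finite Galois extension with group $G$, let $S$ be the integral closure of $V$ in $K$, and assume $S$ is unramified over $V$. Let $f\in Z^2(G,K\setminus\{0\})$ be a normalized two-cocycle with $f(G\times G)\subseteq S\setminus\{0\}$, and let $A_f=\sum_{\sigma\in G}Sx_\sigma$ be the associated crossed-product order. Then $A_f$ is hereditary if and only if $f(\tau,\tau^{-1})\notin M^2$ for all $\tau\in G$ and every maximal ideal $M$ of $S$.
   Context: A normalized two-cocycle is a map $f:G\times G\to K\setminus\{0\}$ with $\sigma(f(\tau,\gamma))\,f(\sigma,\tau\gamma)=f(\sigma,\tau)\,f(\sigma\tau,\gamma)$ and $f(1,\sigma)=f(\sigma,1)=1$ for all $\sigma,\tau,\gamma\in G$. It is not required that the values of $f$ be units of $S$. The crossed-product algebra is $\Sigma_f=(K/F,G,f)=\bigoplus_{\sigma\in G}Kx_\sigma$, with multiplication determined by $x_\sigma a=\sigma(a)x_\sigma$ ($a\in K$) and $x_\sigma x_\tau=f(\sigma,\tau)x_{\sigma\tau}$. The crossed-product order is the subring $A_f=\bigoplus_{\sigma\in G}Sx_\sigma$ of $\Sigma_f$; it is a $V$-order in $\Sigma_f$ with identity $1=x_1$. "Unramified" has its standard meaning: every maximal ideal of $S$ has ramification index $1$ over $V$ (so $J(V)S=J(S)$, where $J$ denotes the Jacobson radical) and separable residue field extension. A ring is hereditary if all its one-sided (left and right) ideals are projective modules. *)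

theory Defs
  imports "HOL-Algebra.Algebra"
begin

section \<open>Extensions of fields and of discrete valuation rings\<close>

text \<open>
  A ring extension is given by a ring record together with a subset of its carrier: \<open>F\<close> is a
  subfield and \<open>V\<close>, \<open>S\<close> are subrings of the field \<open>K\<close>; as a ring in its own right, \<open>V\<close> is
  \<open>K\<lparr>carrier := V\<rparr>\<close>.
\<close>

definition discrete_valuation_ring :: "('a, 'b) ring_scheme \<Rightarrow> bool" where
  "discrete_valuation_ring R \<longleftrightarrow>
     principal_domain R \<and> (\<exists>!M. maximalideal M R) \<and> \<not> field R"

definition quotient_field :: "('a, 'b) ring_scheme \<Rightarrow> 'a set \<Rightarrow> 'a set" where
  "quotient_field K V = {a \<otimes>\<^bsub>K\<^esub> inv\<^bsub>K\<^esub> b | a b. a \<in> V \<and> b \<in> V - {\<zero>\<^bsub>K\<^esub>}}"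

text \<open>Polynomials are lists of coefficients with the leading coefficient first.\<close>

definition integral_closure :: "('a, 'b) ring_scheme \<Rightarrow> 'a set \<Rightarrow> 'a set" where
  "integral_closure K V =
     {x \<in> carrier K. \<exists>p. p \<in> carrier (univ_poly K V) \<and> p \<noteq> [] \<and>
        lead_coeff p = \<one>\<^bsub>K\<^esub> \<and> ring.eval K p x = \<zero>\<^bsub>K\<^esub>}"

text \<open>
  Automorphisms of \<open>K\<close> fixing \<open>F\<close> pointwise; as in \<^const>\<open>BijGroup\<close>, they are extensional functions
  on the carrier of \<open>K\<close> and the group operation is composition.
\<close>

definition galois_group :: "('a, 'b) ring_scheme \<Rightarrow> 'a set \<Rightarrow> ('a \<Rightarrow> 'a) monoid" where
  "galois_group K F =
     (BijGroup (carrier K))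
       \<lparr>carrier := {\<sigma> \<in> Bij (carrier K). \<sigma> \<in> ring_hom K K \<and> (\<forall>x\<in>F. \<sigma> x = x)}\<rparr>"

definition finite_galois_extension :: "('a, 'b) ring_scheme \<Rightarrow> 'a set \<Rightarrow> bool" where
  "finite_galois_extension K F \<longleftrightarrow>
     field K \<and> subfield F K \<and> ring.finite_dimension K F (carrier K) \<and>
     {x \<in> carrier K. \<forall>\<sigma>\<in>carrier (galois_group K F). \<sigma> x = x} = F"

definition poly_deriv :: "('a, 'b) ring_scheme \<Rightarrow> 'a list \<Rightarrow> 'a list" where
  "poly_deriv R p =
     ring.normalize R (map (\<lambda>i. add_pow R i (ring.coeff R p i)) (rev [1..<length p]))"

text \<open>A polynomial over \<open>k\<close> is separable if it is coprime to its derivative.\<close>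

definition separable_poly :: "('a, 'b) ring_scheme \<Rightarrow> 'a set \<Rightarrow> 'a list \<Rightarrow> bool" where
  "separable_poly L k p \<longleftrightarrow>
     (\<exists>u\<in>carrier (univ_poly L k). \<exists>v\<in>carrier (univ_poly L k).
        u \<otimes>\<^bsub>univ_poly L k\<^esub> p \<oplus>\<^bsub>univ_poly L k\<^esub> v \<otimes>\<^bsub>univ_poly L k\<^esub> poly_deriv L p
          = \<one>\<^bsub>univ_poly L k\<^esub>)"

definition separable_extension :: "('a, 'b) ring_scheme \<Rightarrow> 'a set \<Rightarrow> bool" where
  "separable_extension L k \<longleftrightarrow>
     (\<forall>x\<in>carrier L. ring.algebraic L k x \<and> separable_poly L k (ring.Irr L k x))"

text \<open>
  For subrings \<open>V \<subseteq> S\<close> of \<open>K\<close> and a maximal ideal \<open>M\<close> of \<open>S\<close>, the ramification index is the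
  largest \<open>e\<close> with \<open>(M \<inter> V)S \<subseteq> M\<^sup>e\<close>. Powers of ideals are taken in the monoid of ideals.
\<close>

definition ramification_index :: "('a, 'b) ring_scheme \<Rightarrow> 'a set \<Rightarrow> 'a set \<Rightarrow> 'a set \<Rightarrow> nat" where
  "ramification_index K V S M =
     (GREATEST e::nat. Idl\<^bsub>K\<lparr>carrier := S\<rparr>\<^esub> (M \<inter> V) \<subseteq> M [^]\<^bsub>ideals_set (K\<lparr>carrier := S\<rparr>)\<^esub> e)"

definition unramified :: "('a, 'b) ring_scheme \<Rightarrow> 'a set \<Rightarrow> 'a set \<Rightarrow> bool" where
  "unramified K V S \<longleftrightarrow>
     (\<forall>M. maximalideal M (K\<lparr>carrier := S\<rparr>) \<longrightarrow>
        ramification_index K V S M = 1 \<and>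
        separable_extension (K\<lparr>carrier := S\<rparr> Quot M) ((\<lambda>v. M +>\<^bsub>K\<lparr>carrier := S\<rparr>\<^esub> v) ` V))"


section \<open>Crossed products\<close>

definition normalized_two_cocycle ::
  "('a, 'b) ring_scheme \<Rightarrow> 'a set \<Rightarrow> (('a \<Rightarrow> 'a) \<Rightarrow> ('a \<Rightarrow> 'a) \<Rightarrow> 'a) \<Rightarrow> bool" where
  "normalized_two_cocycle K F f \<longleftrightarrow>
     (let G = galois_group K F in
       (\<forall>\<sigma>\<in>carrier G. \<forall>\<tau>\<in>carrier G. f \<sigma> \<tau> \<in> carrier K - {\<zero>\<^bsub>K\<^esub>}) \<and>
       (\<forall>\<sigma>\<in>carrier G. \<forall>\<tau>\<in>carrier G. \<forall>\<gamma>\<in>carrier G.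
          \<sigma> (f \<tau> \<gamma>) \<otimes>\<^bsub>K\<^esub> f \<sigma> (\<tau> \<otimes>\<^bsub>G\<^esub> \<gamma>) = f \<sigma> \<tau> \<otimes>\<^bsub>K\<^esub> f (\<sigma> \<otimes>\<^bsub>G\<^esub> \<tau>) \<gamma>) \<and>
       (\<forall>\<sigma>\<in>carrier G. f \<one>\<^bsub>G\<^esub> \<sigma> = \<one>\<^bsub>K\<^esub> \<and> f \<sigma> \<one>\<^bsub>G\<^esub> = \<one>\<^bsub>K\<^esub>))"

text \<open>
  The element \<open>\<Sum>\<^sub>\<sigma> a\<^sub>\<sigma> x\<^sub>\<sigma>\<close> is represented by its coefficient function
  \<open>\<sigma> \<mapsto> a\<^sub>\<sigma>\<close>. The product is the bi-additive extension of
  \<open>(a x\<^sub>\<sigma>)(b x\<^sub>\<tau>) = a \<sigma>(b) f(\<sigma>,\<tau>) x\<^sub>\<sigma>\<^sub>\<tau>\<close>; the coefficient at \<open>\<rho>\<close> collects the pairs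
  with \<open>\<tau> = \<sigma>\<^sup>-\<^sup>1\<rho>\<close>.
\<close>

definition crossed_product_algebra ::
  "('a, 'b) ring_scheme \<Rightarrow> 'a set \<Rightarrow> (('a \<Rightarrow> 'a) \<Rightarrow> ('a \<Rightarrow> 'a) \<Rightarrow> 'a) \<Rightarrow> (('a \<Rightarrow> 'a) \<Rightarrow> 'a) ring" where
  "crossed_product_algebra K F f =
     (let G = galois_group K F in
       \<lparr>carrier = carrier G \<rightarrow>\<^sub>E carrier K,
        monoid.mult = (\<lambda>a b. \<lambda>\<rho>\<in>carrier G. \<Oplus>\<^bsub>K\<^esub>\<sigma>\<in>carrier G.
                  a \<sigma> \<otimes>\<^bsub>K\<^esub> \<sigma> (b (inv\<^bsub>G\<^esub> \<sigma> \<otimes>\<^bsub>G\<^esub> \<rho>)) \<otimes>\<^bsub>K\<^esub> f \<sigma> (inv\<^bsub>G\<^esub> \<sigma> \<otimes>\<^bsub>G\<^esub> \<rho>)),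
        one = (\<lambda>\<rho>\<in>carrier G. if \<rho> = \<one>\<^bsub>G\<^esub> then \<one>\<^bsub>K\<^esub> else \<zero>\<^bsub>K\<^esub>),
        ring.zero = (\<lambda>\<rho>\<in>carrier G. \<zero>\<^bsub>K\<^esub>),
        add = (\<lambda>a b. \<lambda>\<rho>\<in>carrier G. a \<rho> \<oplus>\<^bsub>K\<^esub> b \<rho>)\<rparr>)"

definition crossed_product_order ::
  "('a, 'b) ring_scheme \<Rightarrow> 'a set \<Rightarrow> 'a set \<Rightarrow> (('a \<Rightarrow> 'a) \<Rightarrow> ('a \<Rightarrow> 'a) \<Rightarrow> 'a)
     \<Rightarrow> (('a \<Rightarrow> 'a) \<Rightarrow> 'a) ring" where
  "crossed_product_order K F S f =
     (crossed_product_algebra K F f)\<lparr>carrier := carrier (galois_group K F) \<rightarrow>\<^sub>E S\<rparr>"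


section \<open>Projective modules and hereditary rings\<close>

text \<open>
  \<^locale>\<open>module\<close> requires a commutative ring. A left module over an arbitrary ring is encoded in
  the same record type; its fields \<open>mult\<close> and \<open>one\<close> play no role.
\<close>

locale left_module = R?: ring R + M?: abelian_group M
  for R :: "('a, 'b) ring_scheme" (structure) and M :: "('a, 'c, 'd) module_scheme" (structure) +
  assumes smult_closed:
      "\<lbrakk> a \<in> carrier R; x \<in> carrier M \<rbrakk> \<Longrightarrow> a \<odot>\<^bsub>M\<^esub> x \<in> carrier M"
    and smult_l_distr:
      "\<lbrakk> a \<in> carrier R; b \<in> carrier R; x \<in> carrier M \<rbrakk> \<Longrightarrow>
       (a \<oplus>\<^bsub>R\<^esub> b) \<odot>\<^bsub>M\<^esub> x = a \<odot>\<^bsub>M\<^esub> x \<oplus>\<^bsub>M\<^esub> b \<odot>\<^bsub>M\<^esub> x"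
    and smult_r_distr:
      "\<lbrakk> a \<in> carrier R; x \<in> carrier M; y \<in> carrier M \<rbrakk> \<Longrightarrow>
       a \<odot>\<^bsub>M\<^esub> (x \<oplus>\<^bsub>M\<^esub> y) = a \<odot>\<^bsub>M\<^esub> x \<oplus>\<^bsub>M\<^esub> a \<odot>\<^bsub>M\<^esub> y"
    and smult_assoc:
      "\<lbrakk> a \<in> carrier R; b \<in> carrier R; x \<in> carrier M \<rbrakk> \<Longrightarrow>
       (a \<otimes>\<^bsub>R\<^esub> b) \<odot>\<^bsub>M\<^esub> x = a \<odot>\<^bsub>M\<^esub> (b \<odot>\<^bsub>M\<^esub> x)"
    and smult_one: "x \<in> carrier M \<Longrightarrow> \<one>\<^bsub>R\<^esub> \<odot>\<^bsub>M\<^esub> x = x"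

definition left_module_hom ::
  "('a, 'b) ring_scheme \<Rightarrow> ('a, 'c, 'd) module_scheme \<Rightarrow> ('a, 'e, 'f) module_scheme \<Rightarrow> ('c \<Rightarrow> 'e) set"
  where
  "left_module_hom R M N =
     {h \<in> carrier M \<rightarrow> carrier N.
        (\<forall>x\<in>carrier M. \<forall>y\<in>carrier M. h (x \<oplus>\<^bsub>M\<^esub> y) = h x \<oplus>\<^bsub>N\<^esub> h y) \<and>
        (\<forall>a\<in>carrier R. \<forall>x\<in>carrier M. h (a \<odot>\<^bsub>M\<^esub> x) = a \<odot>\<^bsub>N\<^esub> h x)}"

definition free_module :: "('a, 'b) ring_scheme \<Rightarrow> 'i set \<Rightarrow> ('a, 'i \<Rightarrow> 'a) module" where
  "free_module R I =
     \<lparr>carrier = {a \<in> I \<rightarrow>\<^sub>E carrier R. finite {i \<in> I. a i \<noteq> \<zero>\<^bsub>R\<^esub>}},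
      monoid.mult = (\<lambda>a b. \<lambda>i\<in>I. a i \<otimes>\<^bsub>R\<^esub> b i),
      one = (\<lambda>i\<in>I. \<one>\<^bsub>R\<^esub>),
      ring.zero = (\<lambda>i\<in>I. \<zero>\<^bsub>R\<^esub>),
      add = (\<lambda>a b. \<lambda>i\<in>I. a i \<oplus>\<^bsub>R\<^esub> b i),
      smult = (\<lambda>r a. \<lambda>i\<in>I. r \<otimes>\<^bsub>R\<^esub> a i)\<rparr>"

text \<open>
  A module is projective if it is (isomorphic to) a direct summand of a free module. It is enough to
  allow bases indexed by sets over the type of its elements, since the free module on the set of
  all elements maps onto the module; the lemmas \<open>projective_module_lifting\<close> and
  \<open>projective_module_if_lifting\<close> below show that this is equivalent to the lifting property.
\<close>

definition projective_module ::
  "('a, 'b) ring_scheme \<Rightarrow> ('a, 'c, 'd) module_scheme \<Rightarrow> bool" where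
  "projective_module R P \<longleftrightarrow>
     left_module R P \<and>
     (\<exists>I :: 'c set. \<exists>s\<in>left_module_hom R P (free_module R I). \<exists>p\<in>left_module_hom R (free_module R I) P.
        \<forall>x\<in>carrier P. p (s x) = x)"

definition free_lift ::
  "('a, 'c, 'd) module_scheme \<Rightarrow> ('a, 'b) ring_scheme \<Rightarrow> 'i set \<Rightarrow> ('i \<Rightarrow> 'c) \<Rightarrow> ('i \<Rightarrow> 'a) \<Rightarrow> 'c"
where
  "free_lift M R I m a = (\<Oplus>\<^bsub>M\<^esub>i\<in>{i \<in> I. a i \<noteq> \<zero>\<^bsub>R\<^esub>}. a i \<odot>\<^bsub>M\<^esub> m i)"

lemma free_module_simps:
  "carrier (free_module R I) = {a \<in> I \<rightarrow>\<^sub>E carrier R. finite {i \<in> I. a i \<noteq> \<zero>\<^bsub>R\<^esub>}}"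
  "a \<oplus>\<^bsub>free_module R I\<^esub> b = (\<lambda>i\<in>I. a i \<oplus>\<^bsub>R\<^esub> b i)"
  "r \<odot>\<^bsub>free_module R I\<^esub> a = (\<lambda>i\<in>I. r \<otimes>\<^bsub>R\<^esub> a i)"
  "\<zero>\<^bsub>free_module R I\<^esub> = (\<lambda>i\<in>I. \<zero>\<^bsub>R\<^esub>)"
  by (simp_all add: free_module_def)

context left_module
begin

lemma smult_l_null: "x \<in> carrier M \<Longrightarrow> \<zero> \<odot>\<^bsub>M\<^esub> x = \<zero>\<^bsub>M\<^esub>"
  using smult_l_distr[of \<zero> \<zero> x] smult_closed[of \<zero> x] M.add.r_cancel_one by force

lemma smult_r_null: "a \<in> carrier R \<Longrightarrow> a \<odot>\<^bsub>M\<^esub> \<zero>\<^bsub>M\<^esub> = \<zero>\<^bsub>M\<^esub>"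
  using smult_r_distr[of a "\<zero>\<^bsub>M\<^esub>" "\<zero>\<^bsub>M\<^esub>"] smult_closed[of a "\<zero>\<^bsub>M\<^esub>"] M.add.r_cancel_one by force

lemma smult_finsum:
  assumes "finite A" "a \<in> carrier R" "g \<in> A \<rightarrow> carrier M"
  shows "a \<odot>\<^bsub>M\<^esub> (\<Oplus>\<^bsub>M\<^esub>i\<in>A. g i) = (\<Oplus>\<^bsub>M\<^esub>i\<in>A. a \<odot>\<^bsub>M\<^esub> g i)"
  using assms
proof (induction A rule: finite_induct)
  case empty
  then show ?case by (simp add: smult_r_null)
next
  case (insert j A)
  have *: "g \<in> A \<rightarrow> carrier M" "g j \<in> carrier M" using insert.prems by auto
  then have **: "(\<lambda>i. a \<odot>\<^bsub>M\<^esub> g i) \<in> A \<rightarrow> carrier M" "a \<odot>\<^bsub>M\<^esub> g j \<in> carrier M"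
    using insert.prems smult_closed by auto
  show ?case
    using insert.hyps insert.IH[OF insert.prems(1) *(1)] * ** insert.prems(1)
    by (simp add: smult_r_distr)
qed

lemma free_lift_superset:
  assumes "a \<in> I \<rightarrow>\<^sub>E carrier R" "m \<in> I \<rightarrow> carrier M" "finite A" "A \<subseteq> I"
    "{i \<in> I. a i \<noteq> \<zero>} \<subseteq> A"
  shows "free_lift M R I m a = (\<Oplus>\<^bsub>M\<^esub>i\<in>A. a i \<odot>\<^bsub>M\<^esub> m i)"
  unfolding free_lift_def
  by (rule M.add.finprod_mono_neutral_cong_left) 
     (use assms in \<open>auto intro!: smult_closed smult_l_null simp: PiE_mem Pi_def subset_iff\<close>)

lemma free_lift_hom:
  assumes m: "m \<in> I \<rightarrow> carrier M"
  shows "free_lift M R I m \<in> left_module_hom R (free_module R I) M"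
proof -
  have cl: "free_lift M R I m a \<in> carrier M" if "a \<in> carrier (free_module R I)" for a
    unfolding free_lift_def
    by (rule M.finsum_closed) (use that m in \<open>auto intro!: smult_closed simp: free_module_simps PiE_mem\<close>)
  have add: "free_lift M R I m (a \<oplus>\<^bsub>free_module R I\<^esub> b) = free_lift M R I m a \<oplus>\<^bsub>M\<^esub> free_lift M R I m b"
    if a: "a \<in> carrier (free_module R I)" and b: "b \<in> carrier (free_module R I)" for a b
  proof -
    let ?A = "{i \<in> I. a i \<noteq> \<zero>} \<union> {i \<in> I. b i \<noteq> \<zero>}"
    have A: "finite ?A" "?A \<subseteq> I" using a b by (auto simp: free_module_simps)
    have ma: "a \<in> I \<rightarrow>\<^sub>E carrier R" and mb: "b \<in> I \<rightarrow>\<^sub>E carrier R"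
      using a b by (auto simp: free_module_simps)
    have mab: "a \<oplus>\<^bsub>free_module R I\<^esub> b \<in> I \<rightarrow>\<^sub>E carrier R"
      using ma mb by (auto simp: free_module_simps PiE_mem)
    have "free_lift M R I m (a \<oplus>\<^bsub>free_module R I\<^esub> b) =
        (\<Oplus>\<^bsub>M\<^esub>i\<in>?A. (a \<oplus>\<^bsub>free_module R I\<^esub> b) i \<odot>\<^bsub>M\<^esub> m i)"
      by (rule free_lift_superset[OF mab m A]) (auto simp: free_module_simps)
    also have "\<dots> = (\<Oplus>\<^bsub>M\<^esub>i\<in>?A. (a i \<odot>\<^bsub>M\<^esub> m i) \<oplus>\<^bsub>M\<^esub> (b i \<odot>\<^bsub>M\<^esub> m i))"
      by (rule M.finsum_cong')
         (use ma mb m in \<open>auto simp: free_module_simps PiE_mem Pi_def intro!: smult_l_distr smult_closed M.a_closed\<close>)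
    also have "\<dots> = (\<Oplus>\<^bsub>M\<^esub>i\<in>?A. a i \<odot>\<^bsub>M\<^esub> m i) \<oplus>\<^bsub>M\<^esub> (\<Oplus>\<^bsub>M\<^esub>i\<in>?A. b i \<odot>\<^bsub>M\<^esub> m i)"
      by (rule M.finsum_addf) (use ma mb m in \<open>auto simp: PiE_mem Pi_def intro!: smult_closed\<close>)
    also have "(\<Oplus>\<^bsub>M\<^esub>i\<in>?A. a i \<odot>\<^bsub>M\<^esub> m i) = free_lift M R I m a"
      by (rule free_lift_superset[OF ma m A, symmetric]) auto
    also have "(\<Oplus>\<^bsub>M\<^esub>i\<in>?A. b i \<odot>\<^bsub>M\<^esub> m i) = free_lift M R I m b"
      by (rule free_lift_superset[OF mb m A, symmetric]) auto
    finally show ?thesis .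
  qed
  have smul: "free_lift M R I m (r \<odot>\<^bsub>free_module R I\<^esub> a) = r \<odot>\<^bsub>M\<^esub> free_lift M R I m a"
    if a: "a \<in> carrier (free_module R I)" and r: "r \<in> carrier R" for a r
  proof -
    let ?A = "{i \<in> I. a i \<noteq> \<zero>}"
    have A: "finite ?A" "?A \<subseteq> I" and ma: "a \<in> I \<rightarrow>\<^sub>E carrier R"
      using a by (auto simp: free_module_simps)
    have mra: "r \<odot>\<^bsub>free_module R I\<^esub> a \<in> I \<rightarrow>\<^sub>E carrier R"
      using ma r by (auto simp: free_module_simps PiE_mem)
    have "free_lift M R I m (r \<odot>\<^bsub>free_module R I\<^esub> a) =
        (\<Oplus>\<^bsub>M\<^esub>i\<in>?A. (r \<odot>\<^bsub>free_module R I\<^esub> a) i \<odot>\<^bsub>M\<^esub> m i)"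
      by (rule free_lift_superset[OF mra m A]) (auto simp: free_module_simps r)
    also have "\<dots> = (\<Oplus>\<^bsub>M\<^esub>i\<in>?A. r \<odot>\<^bsub>M\<^esub> (a i \<odot>\<^bsub>M\<^esub> m i))"
      by (rule M.finsum_cong')
         (use ma m r in \<open>auto simp: free_module_simps PiE_mem Pi_def intro!: smult_assoc smult_closed\<close>)
    also have "\<dots> = r \<odot>\<^bsub>M\<^esub> (\<Oplus>\<^bsub>M\<^esub>i\<in>?A. a i \<odot>\<^bsub>M\<^esub> m i)"
      by (rule smult_finsum[symmetric]) (use A ma m r in \<open>auto simp: PiE_mem Pi_def intro!: smult_closed\<close>)
    finally show ?thesis by (simp add: free_lift_def)
  qed
  show ?thesis unfolding left_module_hom_def using cl add smul by auto
qed

end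

lemma left_module_hom_finsum:
  assumes "left_module R M" "left_module R N" "h \<in> left_module_hom R M N"
    and "finite A" "g \<in> A \<rightarrow> carrier M"
  shows "h (\<Oplus>\<^bsub>M\<^esub>i\<in>A. g i) = (\<Oplus>\<^bsub>N\<^esub>i\<in>A. h (g i))"
proof -
  interpret M: left_module R M by fact
  interpret N: left_module R N by fact
  have hom: "h \<in> hom (add_monoid M) (add_monoid N)"
    using assms(3) by (auto simp: left_module_hom_def hom_def)
  have "h \<zero>\<^bsub>M\<^esub> = \<zero>\<^bsub>N\<^esub>"
    using hom_one[OF hom] M.M.a_group N.M.a_group by simp
  from assms(4,5) show ?thesis
  proof (induction A rule: finite_induct)
    case empty
    then show ?case using \<open>h \<zero>\<^bsub>M\<^esub> = \<zero>\<^bsub>N\<^esub>\<close> by simp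
  next
    case (insert j A)
    have *: "g \<in> A \<rightarrow> carrier M" "g j \<in> carrier M" using insert.prems by auto
    have hc: "\<And>x. x \<in> carrier M \<Longrightarrow> h x \<in> carrier N"
      using assms(3) by (auto simp: left_module_hom_def)
    have **: "(\<lambda>i. h (g i)) \<in> A \<rightarrow> carrier N" using * hc by auto
    have "(\<Oplus>\<^bsub>M\<^esub>i\<in>A. g i) \<in> carrier M" using *(1) by (rule M.M.finsum_closed)
    then show ?case
      using insert.hyps insert.IH[OF *(1)] * ** hc assms(3)
      by (simp add: left_module_hom_def)
  qed
qed

lemma left_module_free_module:
  fixes R (structure)
  assumes "ring R"
  shows "left_module R (free_module R I)"
proof -
  interpret ring R by fact
  have fin: "finite {i \<in> I. a i \<oplus> b i \<noteq> \<zero>}"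
    if "a \<in> I \<rightarrow>\<^sub>E carrier R" "b \<in> I \<rightarrow>\<^sub>E carrier R" "finite {i \<in> I. a i \<noteq> \<zero>}" "finite {i \<in> I. b i \<noteq> \<zero>}" for a b
    by (rule finite_subset[of _ "{i \<in> I. a i \<noteq> \<zero>} \<union> {i \<in> I. b i \<noteq> \<zero>}"]) (use that in auto)
  have fin': "finite {i \<in> I. r \<otimes> a i \<noteq> \<zero>}"
    if "r \<in> carrier R" "finite {i \<in> I. a i \<noteq> \<zero>}" for r a
    by (rule finite_subset[OF _ that(2)]) (use that in auto)
  have ag: "abelian_group (free_module R I)"
  proof (rule abelian_groupI)
    fix x assume x: "x \<in> carrier (free_module R I)"
    show "\<exists>y\<in>carrier (free_module R I). y \<oplus>\<^bsub>free_module R I\<^esub> x = \<zero>\<^bsub>free_module R I\<^esub>"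
    proof (rule bexI)
      show "(\<lambda>i\<in>I. \<ominus> x i) \<oplus>\<^bsub>free_module R I\<^esub> x = \<zero>\<^bsub>free_module R I\<^esub>"
        using x by (auto simp: free_module_simps fun_eq_iff intro!: l_neg)
      have "finite {i \<in> I. (\<lambda>i\<in>I. \<ominus> x i) i \<noteq> \<zero>}"
        by (rule finite_subset[of _ "{i \<in> I. x i \<noteq> \<zero>}"]) (use x in \<open>auto simp: free_module_simps\<close>)
      then show "(\<lambda>i\<in>I. \<ominus> x i) \<in> carrier (free_module R I)"
        using x by (auto simp: free_module_simps PiE_mem)
    qed
    show "\<zero>\<^bsub>free_module R I\<^esub> \<oplus>\<^bsub>free_module R I\<^esub> x = x"
      by (rule extensionalityI[of _ I]) (use x in \<open>auto simp: free_module_simps PiE_def Pi_def\<close>)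
    fix y assume y: "y \<in> carrier (free_module R I)"
    show "x \<oplus>\<^bsub>free_module R I\<^esub> y \<in> carrier (free_module R I)"
      using x y by (auto simp: free_module_simps PiE_mem fin cong: conj_cong)
    show "x \<oplus>\<^bsub>free_module R I\<^esub> y = y \<oplus>\<^bsub>free_module R I\<^esub> x"
      using x y by (auto simp: free_module_simps PiE_mem fun_eq_iff intro!: a_comm)
    fix z assume z: "z \<in> carrier (free_module R I)"
    show "x \<oplus>\<^bsub>free_module R I\<^esub> y \<oplus>\<^bsub>free_module R I\<^esub> z = x \<oplus>\<^bsub>free_module R I\<^esub> (y \<oplus>\<^bsub>free_module R I\<^esub> z)"
      using x y z by (auto simp: free_module_simps PiE_mem fun_eq_iff intro!: a_assoc)
  qed (auto simp: free_module_simps)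
  show ?thesis
  proof (intro left_module.intro left_module_axioms.intro ring_axioms ag)
    fix a x assume a: "a \<in> carrier R" and x: "x \<in> carrier (free_module R I)"
    show "a \<odot>\<^bsub>free_module R I\<^esub> x \<in> carrier (free_module R I)"
      using a x by (auto simp: free_module_simps PiE_mem fin' cong: conj_cong)
    fix y assume y: "y \<in> carrier (free_module R I)"
    show "a \<odot>\<^bsub>free_module R I\<^esub> (x \<oplus>\<^bsub>free_module R I\<^esub> y) =
        a \<odot>\<^bsub>free_module R I\<^esub> x \<oplus>\<^bsub>free_module R I\<^esub> a \<odot>\<^bsub>free_module R I\<^esub> y"
      using a x y by (auto simp: free_module_simps PiE_mem fun_eq_iff intro!: r_distr)
  next
    fix a b x assume a: "a \<in> carrier R" "b \<in> carrier R" and x: "x \<in> carrier (free_module R I)"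
    show "(a \<oplus> b) \<odot>\<^bsub>free_module R I\<^esub> x =
        a \<odot>\<^bsub>free_module R I\<^esub> x \<oplus>\<^bsub>free_module R I\<^esub> b \<odot>\<^bsub>free_module R I\<^esub> x"
      using a x by (auto simp: free_module_simps PiE_mem fun_eq_iff intro!: l_distr)
    show "(a \<otimes> b) \<odot>\<^bsub>free_module R I\<^esub> x = a \<odot>\<^bsub>free_module R I\<^esub> (b \<odot>\<^bsub>free_module R I\<^esub> x)"
      using a x by (auto simp: free_module_simps PiE_mem fun_eq_iff intro!: m_assoc)
  next
    fix x assume x: "x \<in> carrier (free_module R I)"
    show "\<one> \<odot>\<^bsub>free_module R I\<^esub> x = x"
      by (rule extensionalityI[of _ I]) (use x in \<open>auto simp: free_module_simps PiE_def Pi_def\<close>)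
  qed
qed

lemma projective_module_lifting:
  assumes "projective_module R P" "left_module R M" "left_module R N"
    and g: "g \<in> left_module_hom R M N" "g ` carrier M = carrier N" and h: "h \<in> left_module_hom R P N"
  shows "\<exists>k\<in>left_module_hom R P M. \<forall>x\<in>carrier P. g (k x) = h x"
proof -
  interpret P: left_module R P using assms(1) by (simp add: projective_module_def)
  interpret M: left_module R M by fact
  interpret N: left_module R N by fact
  obtain I :: "'c set" and s p where s: "s \<in> left_module_hom R P (free_module R I)"
    and p: "p \<in> left_module_hom R (free_module R I) P" and ps: "\<forall>x\<in>carrier P. p (s x) = x"
    using assms(1) unfolding projective_module_def by blast
  let ?F = "free_module R I"
  interpret F: left_module R ?F by (rule left_module_free_module) (rule P.R.ring_axioms)
  define e where "e i = (\<lambda>j\<in>I. if j = i then \<one>\<^bsub>R\<^esub> else \<zero>\<^bsub>R\<^esub>)" for i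
  have e: "e i \<in> carrier ?F" if "i \<in> I" for i
  proof -
    have "finite {j \<in> I. e i j \<noteq> \<zero>\<^bsub>R\<^esub>}"
      by (rule finite_subset[of _ "{i}"]) (auto simp: e_def)
    then show ?thesis by (auto simp: free_module_simps e_def)
  qed
  have ge: "\<forall>i\<in>I. \<exists>y\<in>carrier M. g y = h (p (e i))"
  proof
    fix i assume "i \<in> I"
    then have "h (p (e i)) \<in> carrier N" using e p h by (auto simp: left_module_hom_def)
    then show "\<exists>y\<in>carrier M. g y = h (p (e i))" using g(2) by (metis imageE)
  qed
  then obtain m where m: "\<And>i. i \<in> I \<Longrightarrow> m i \<in> carrier M" "\<And>i. i \<in> I \<Longrightarrow> g (m i) = h (p (e i))"
    by metis
  have mI: "m \<in> I \<rightarrow> carrier M" using m(1) by auto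
  have q: "free_lift M R I m \<in> left_module_hom R ?F M" by (rule M.free_lift_hom[OF mI])
  have expand: "a = free_lift ?F R I e a" if a: "a \<in> carrier ?F" for a
  proof -
    let ?A = "{i \<in> I. a i \<noteq> \<zero>\<^bsub>R\<^esub>}"
    have A: "finite ?A" and ma: "a \<in> I \<rightarrow>\<^sub>E carrier R" using a by (auto simp: free_module_simps)
    have aj: "a j \<in> carrier R" if "j \<in> I" for j using ma that by auto
    have ev: "(\<Oplus>\<^bsub>?F\<^esub>i\<in>B. a i \<odot>\<^bsub>?F\<^esub> e i) = (\<lambda>j\<in>I. if j \<in> B then a j else \<zero>\<^bsub>R\<^esub>)"
      if "finite B" "B \<subseteq> I" for B
      using that
    proof (induction B rule: finite_induct)
      case empty
      then show ?case by (simp add: free_module_simps)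
    next
      case (insert b B)
      have c: "(\<lambda>i. a i \<odot>\<^bsub>?F\<^esub> e i) \<in> B \<rightarrow> carrier ?F" "a b \<odot>\<^bsub>?F\<^esub> e b \<in> carrier ?F"
        using insert.prems ma e by (auto intro!: F.smult_closed simp: PiE_mem subset_iff)
      have "(\<Oplus>\<^bsub>?F\<^esub>i\<in>insert b B. a i \<odot>\<^bsub>?F\<^esub> e i) =
          a b \<odot>\<^bsub>?F\<^esub> e b \<oplus>\<^bsub>?F\<^esub> (\<lambda>j\<in>I. if j \<in> B then a j else \<zero>\<^bsub>R\<^esub>)"
        using insert.hyps c insert.IH insert.prems by (subst F.M.finsum_insert) (auto simp: restrict_def)
      also have "\<dots> = (\<lambda>j\<in>I. if j \<in> insert b B then a j else \<zero>\<^bsub>R\<^esub>)"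
        using insert.hyps insert.prems aj
        by (auto simp: free_module_simps e_def fun_eq_iff subset_iff)
      finally show ?case .
    qed
    have "(\<lambda>j\<in>I. if j \<in> ?A then a j else \<zero>\<^bsub>R\<^esub>) = a"
      by (rule extensionalityI[of _ I]) (use ma in \<open>auto simp: PiE_def\<close>)
    then show ?thesis
      using ev[OF A] by (simp add: free_lift_def)
  qed
  let ?k = "\<lambda>x. free_lift M R I m (s x)"
  have sF: "\<And>x. x \<in> carrier P \<Longrightarrow> s x \<in> carrier ?F" using s unfolding left_module_hom_def by blast
  have "?k \<in> left_module_hom R P M"
    using s q sF by (simp add: left_module_hom_def Pi_def)
  moreover have "g (?k x) = h x" if x: "x \<in> carrier P" for x
  proof -
    let ?a = "s x" and ?A = "{i \<in> I. s x i \<noteq> \<zero>\<^bsub>R\<^esub>}"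
    have a: "?a \<in> carrier ?F" using s x by (auto simp: left_module_hom_def)
    then have A: "finite ?A" and ma: "?a \<in> I \<rightarrow>\<^sub>E carrier R" by (auto simp: free_module_simps)
    have hp: "(\<lambda>y. h (p y)) \<in> left_module_hom R ?F N" using h p by (auto simp: left_module_hom_def Pi_def)
    have coeff: "s x i \<in> carrier R" if "i \<in> I" for i using ma that by auto
    have mc: "s x i \<odot>\<^bsub>M\<^esub> m i \<in> carrier M" and ec: "s x i \<odot>\<^bsub>?F\<^esub> e i \<in> carrier ?F" if "i \<in> I" for i
      using that coeff m e by (auto intro!: M.smult_closed F.smult_closed)
    have "g (?k x) = (\<Oplus>\<^bsub>N\<^esub>i\<in>?A. g (s x i \<odot>\<^bsub>M\<^esub> m i))" unfolding free_lift_def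
      by (rule left_module_hom_finsum[OF assms(2,3) g(1) A]) (use mc in auto)
    also have "\<dots> = (\<Oplus>\<^bsub>N\<^esub>i\<in>?A. h (p (s x i \<odot>\<^bsub>?F\<^esub> e i)))"
    proof (rule N.M.finsum_cong')
      show "(\<lambda>i. h (p (s x i \<odot>\<^bsub>?F\<^esub> e i))) \<in> ?A \<rightarrow> carrier N"
        using hp ec unfolding left_module_hom_def by blast
      show "g (s x i \<odot>\<^bsub>M\<^esub> m i) = h (p (s x i \<odot>\<^bsub>?F\<^esub> e i))" if "i \<in> ?A" for i
      proof -
        have i: "i \<in> I" using that by simp
        have "g (s x i \<odot>\<^bsub>M\<^esub> m i) = s x i \<odot>\<^bsub>N\<^esub> g (m i)"
          using g(1) coeff[OF i] m(1)[OF i] by (simp add: left_module_hom_def)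
        also have "\<dots> = s x i \<odot>\<^bsub>N\<^esub> h (p (e i))" using m(2)[OF i] by simp
        also have "\<dots> = h (p (s x i \<odot>\<^bsub>?F\<^esub> e i))"
          using hp coeff[OF i] e[OF i] by (simp add: left_module_hom_def)
        finally show ?thesis .
      qed
    qed simp
    also have "\<dots> = h (p (\<Oplus>\<^bsub>?F\<^esub>i\<in>?A. s x i \<odot>\<^bsub>?F\<^esub> e i))"
      by (rule left_module_hom_finsum[OF F.left_module_axioms assms(3) hp A, symmetric])
         (use ec in auto)
    also have "\<dots> = h (p (s x))" using arg_cong[OF expand[OF a], of "\<lambda>y. h (p y)"] unfolding free_lift_def by (rule sym)
    finally show ?thesis using ps x by simp
  qed
  ultimately show ?thesis by (intro bexI[of _ ?k] ballI)
qed

lemma projective_module_if_lifting: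
  fixes R :: "('a, 'b) ring_scheme" and P :: "('a, 'c, 'd) module_scheme"
  assumes P: "left_module R P"
    and lift: "\<And>(M :: ('a, 'c \<Rightarrow> 'a) module) g.
        left_module R M \<Longrightarrow> g \<in> left_module_hom R M P \<Longrightarrow> g ` carrier M = carrier P \<Longrightarrow>
        \<exists>k\<in>left_module_hom R P M. \<forall>x\<in>carrier P. g (k x) = x"
  shows "projective_module R P"
proof -
  interpret P: left_module R P by fact
  let ?I = "carrier P" and ?F = "free_module R (carrier P)"
  let ?g = "free_lift P R ?I (\<lambda>x. x)"
  have g: "?g \<in> left_module_hom R ?F P" by (rule P.free_lift_hom) auto
  have "x \<in> ?g ` carrier ?F" if x: "x \<in> carrier P" for x
  proof -
    let ?e = "\<lambda>j\<in>?I. if j = x then \<one>\<^bsub>R\<^esub> else \<zero>\<^bsub>R\<^esub>"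
    have "finite {j \<in> ?I. ?e j \<noteq> \<zero>\<^bsub>R\<^esub>}" by (rule finite_subset[of _ "{x}"]) auto
    then have "?e \<in> carrier ?F" by (auto simp: free_module_simps)
    moreover have "?g ?e = (\<Oplus>\<^bsub>P\<^esub>i\<in>{x}. ?e i \<odot>\<^bsub>P\<^esub> i)"
      by (rule P.free_lift_superset) (use x in auto)
    then have "?g ?e = x" using x by (simp add: P.smult_one P.smult_closed)
    ultimately show ?thesis using imageI[of ?e "carrier ?F" ?g] by simp
  qed
  then have "?g ` carrier ?F = carrier P" using g by (auto simp: left_module_hom_def)
  then obtain k where "k \<in> left_module_hom R P ?F" "\<forall>x\<in>carrier P. ?g (k x) = x"
    using lift[OF left_module_free_module[OF P.R.ring_axioms] g] by blast
  then show ?thesis unfolding projective_module_def using P g by blast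
qed

locale left_ideal = additive_subgroup I R + ring R
  for I and R (structure) +
  assumes left_ideal_closed: "\<lbrakk> x \<in> I; a \<in> carrier R \<rbrakk> \<Longrightarrow> a \<otimes> x \<in> I"

definition left_ideal_module :: "('a, 'b) ring_scheme \<Rightarrow> 'a set \<Rightarrow> ('a, 'a) module" where
  "left_ideal_module R I =
     \<lparr>carrier = I, monoid.mult = monoid.mult R, one = \<one>\<^bsub>R\<^esub>, ring.zero = \<zero>\<^bsub>R\<^esub>,
      add = add R, smult = monoid.mult R\<rparr>"

definition left_hereditary :: "('a, 'b) ring_scheme \<Rightarrow> bool" where
  "left_hereditary R \<longleftrightarrow>
     ring R \<and> (\<forall>I. left_ideal I R \<longrightarrow> projective_module R (left_ideal_module R I))"

definition opposite_ring :: "('a, 'b) ring_scheme \<Rightarrow> ('a, 'b) ring_scheme" where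
  "opposite_ring R = R\<lparr>monoid.mult := (\<lambda>x y. y \<otimes>\<^bsub>R\<^esub> x)\<rparr>"

text \<open>Right ideals and right modules of \<open>R\<close> are left ideals and left modules of its opposite.\<close>

definition hereditary :: "('a, 'b) ring_scheme \<Rightarrow> bool" where
  "hereditary R \<longleftrightarrow> left_hereditary R \<and> left_hereditary (opposite_ring R)"

end

theory Submission
  imports Defs
begin

text \<open>
  Write \<open>\<Lambda>\<close> for the crossed product order. Since \<open>S\<close> is unramified over \<open>V\<close>, the ring \<open>S \<otimes>\<^sub>V S\<close> contains the
  idempotents that split it as \<open>\<Prod>\<^sub>\<sigma> S\<close>, and the trace \<open>S \<rightarrow> V\<close> is onto. An element of trace \<open>1\<close> makes a
  left ideal of \<open>\<Lambda>\<close> a retract of a submodule of a power of \<open>\<Lambda>\<close> stable under a twisted right action of \<open>S\<close>, and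
  a filtration of the latter reduces projectivity to that of left ideals stable under right
  multiplication by \<open>S\<close>. The idempotents split these as
  \<open>\<Sum> x\<^sub>\<sigma> J\<^sub>\<sigma>\<close> with \<open>J\<^sub>\<sigma> \<subseteq> S\<close>. If no \<open>f(\<tau>, \<tau>\<^sup>-\<^sup>1)\<close> lies in \<open>M\<^sup>2\<close>, then at \<open>M\<close> such an ideal is generated by
  one suitable component, and the local generators patch to a dual basis.

  Conversely, if \<open>f(\<beta>\<^sup>-\<^sup>1, \<beta>) \<in> M\<^sup>2\<close>, a dual basis of the left ideal \<open>\<Lambda>p + \<Lambda>x\<^sub>\<beta>\<close>, where \<open>p\<close> is a uniformizer of
  \<open>V\<close>, would express \<open>p\<close> by elements whose coefficients at \<open>1\<close> lie in \<open>M\<^sup>2\<close>.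

  The opposite of \<open>\<Lambda>\<close> is again a crossed product order with the same values \<open>f(\<tau>, \<tau>\<^sup>-\<^sup>1)\<close>, so that it suffices
  to consider left ideals.
\<close>

section \<open>Discrete valuation rings\<close>

text \<open>The obstacle is that values of \<open>f\<close> may be non-units of \<open>S\<close>, so
  that multiplication by \<open>x\<^sub>\<tau>\<close> need not identify the components of an ideal.
  It carries the component at \<mu> into the one at \<rho> with a loss
  \<open>g \<rho> \<mu>\<close>, which at \<open>M\<close> is an exponent
  \<open>d \<rho> \<mu>\<close>. The cocycle identity yields the triangle inequality for
  \<open>d\<close>, and the condition on \<open>M\<^sup>2\<close> yields
  \<open>d \<rho> \<mu> + d \<mu> \<rho> \<le> 1\<close>. This bound, between integers, is what
  singles out a component that generates all the others locally. The condition is demanded at every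
  \<open>M\<close> because Galois conjugates of the values occur. Unramifiedness is turned into two
  statements. Some \<open>s\<close> outside \<open>M\<close> satisfies
  \<open>s M \<subseteq> p S\<close>, so valuations can be handled by explicit denominators instead
  of localizations or completions. And no \<alpha> except the identity acts trivially on
  \<open>S/M\<close>; this produces the idempotents. The integral closure is treated as the set of
  elements with bounded powers, and the dimension of \<open>K\<close> over \<open>F\<close> supplies
  the finiteness that a Noetherian argument would use.\<close>

lemma dvr_uniformizer:
  fixes R (structure)
  assumes "discrete_valuation_ring R"
  obtains p where "p \<in> carrier R" "p \<noteq> \<zero>" "p \<notin> Units R"
    "\<And>a. a \<in> carrier R \<Longrightarrow> a \<notin> Units R \<Longrightarrow> \<exists>b\<in>carrier R. a = p \<otimes> b"
    "\<And>a. a \<in> carrier R \<Longrightarrow> a \<noteq> \<zero> \<Longrightarrow> \<exists>n::nat. \<exists>u\<in>Units R. a = u \<otimes> p [^] n"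
proof -
  interpret principal_domain R using assms by (simp add: discrete_valuation_ring_def)
  obtain M where M: "maximalideal M R" and uniq: "\<And>N. maximalideal N R \<Longrightarrow> N = M"
    using assms unfolding discrete_valuation_ring_def by blast
  interpret M: maximalideal M R by fact
  obtain p where p: "p \<in> carrier R" and Mp: "M = PIdl p"
    using exists_gen[OF M.is_ideal] by blast
  have p0: "p \<noteq> \<zero>"
  proof
    assume "p = \<zero>"
    then have "M = {\<zero>}" using Mp cgenideal_eq_genideal[of \<zero>] genideal_zero by simp
    then have "field R" using M zeromaximalideal_eq_field by simp
    then show False using assms by (simp add: discrete_valuation_ring_def)
  qed
  have pu: "p \<notin> Units R"
    using ideal_eq_carrier_iff[OF p] Mp M.I_notcarr by auto
  \<comment> \<open>An irreducible divisor of \<open>a\<close> generates a maximal ideal, which can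
    only be \<open>M\<close>; hence it is a multiple of \<open>p\<close>.\<close>
  have div: "\<exists>b\<in>carrier R. a = p \<otimes> b" if a: "a \<in> carrier R" "a \<notin> Units R" for a
  proof (cases "a = \<zero>")
    case True then show ?thesis using p by (intro bexI[of _ \<zero>]) auto
  next
    case False
    obtain q where q: "q \<in> carrier R" "ring_irreducible q" "q divides a"
      using exists_irreducible_divisor[of a] a False by blast
    have "PIdl q = M" using uniq irreducible_imp_maximalideal q by blast
    moreover have "q \<in> PIdl q" by (rule cgenideal_self[OF q(1)])
    ultimately obtain c where c: "c \<in> carrier R" "q = c \<otimes> p" unfolding Mp by (auto simp: cgenideal_def)
    obtain d where d: "d \<in> carrier R" "a = q \<otimes> d" using q(3) by (auto simp: factor_def)
    have "a = p \<otimes> (c \<otimes> d)" using c d p by (simp add: m_ac)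
    then show ?thesis using c d by blast
  qed
  \<comment> \<open>Krull intersection for \<open>p\<close>: the elements divisible by all powers of
    \<open>p\<close> form an ideal generated by some \<open>c\<close>. Writing
    \<open>c = p b\<close>, cancellation puts \<open>b\<close> back into this ideal, so
    \<open>b = e c\<close> and \<open>p e = 1\<close>.\<close>
  have krull: "\<exists>n::nat. \<not> (\<exists>b\<in>carrier R. a = p [^] n \<otimes> b)" if a: "a \<in> carrier R" "a \<noteq> \<zero>" for a
  proof (rule ccontr)
    assume neg: "\<not> ?thesis"
    define I where "I = {x \<in> carrier R. \<forall>n::nat. \<exists>b\<in>carrier R. x = p [^] n \<otimes> b}"
    have aI: "a \<in> I" using neg a by (auto simp: I_def)
    have "ideal I R"
    proof (rule idealI[OF ring_axioms])
      show "subgroup I (add_monoid R)"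
      proof (rule add.subgroupI)
        show "I \<subseteq> carrier R" "I \<noteq> {}" using aI by (auto simp: I_def)
        fix x assume x: "x \<in> I"
        show "\<ominus> x \<in> I" unfolding I_def
        proof (clarsimp, intro conjI allI)
          show "\<ominus> x \<in> carrier R" using x by (auto simp: I_def)
          fix n :: nat
          obtain b where "b \<in> carrier R" "x = p [^] n \<otimes> b" using x by (auto simp: I_def)
          then show "\<exists>b\<in>carrier R. \<ominus> x = p [^] n \<otimes> b" using p by (intro bexI[of _ "\<ominus> b"]) (auto simp: r_minus)
        qed
        fix y assume y: "y \<in> I"
        show "x \<oplus> y \<in> I" unfolding I_def
        proof (clarsimp, intro conjI allI)
          show "x \<oplus> y \<in> carrier R" using x y by (auto simp: I_def)
          fix n :: nat
          obtain b c where "b \<in> carrier R" "x = p [^] n \<otimes> b" "c \<in> carrier R" "y = p [^] n \<otimes> c"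
            using x y by (fastforce simp: I_def)
          then show "\<exists>b\<in>carrier R. x \<oplus> y = p [^] n \<otimes> b" using p
            by (intro bexI[of _ "b \<oplus> c"]) (auto simp: r_distr)
        qed
      qed
      fix x y assume x: "x \<in> I" and y: "y \<in> carrier R"
      show "y \<otimes> x \<in> I" unfolding I_def
      proof (clarsimp, intro conjI allI)
        show "y \<otimes> x \<in> carrier R" using x y by (auto simp: I_def)
        fix n :: nat
        obtain b where "b \<in> carrier R" "x = p [^] n \<otimes> b" using x by (auto simp: I_def)
        then show "\<exists>b\<in>carrier R. y \<otimes> x = p [^] n \<otimes> b"
          using p y by (intro bexI[of _ "y \<otimes> b"]) (auto simp: m_ac)
      qed
      then show "x \<otimes> y \<in> I" using x y by (simp add: I_def m_comm)
    qed
    then obtain c where c: "c \<in> carrier R" "I = PIdl c" using exists_gen by blast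
    have cI: "c \<in> I" using c cgenideal_self by auto
    then obtain b where b: "b \<in> carrier R" "c = p [^] (1::nat) \<otimes> b" unfolding I_def by blast
    have c0: "c \<noteq> \<zero>" using c a aI by (auto simp: cgenideal_def)
    have "b \<in> I" unfolding I_def
    proof (clarsimp simp: b(1))
      fix n
      obtain d where d: "d \<in> carrier R" "c = p [^] (Suc n) \<otimes> d" using cI unfolding I_def by blast
      then have "p \<otimes> b = p \<otimes> (p [^] n \<otimes> d)" using b p by (simp add: m_ac)
      then have "b = p [^] n \<otimes> d" using m_lcancel[OF p0 p] b d p by simp
      then show "\<exists>d\<in>carrier R. b = p [^] n \<otimes> d" using d by blast
    qed
    then obtain e where e: "e \<in> carrier R" "b = e \<otimes> c" using c by (auto simp: cgenideal_def)
    have "c \<otimes> (p \<otimes> e) = p \<otimes> (e \<otimes> c)" using e c p by (simp add: m_ac)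
    also have "\<dots> = c \<otimes> \<one>" using e(2) b c p by simp
    finally have "c \<otimes> (p \<otimes> e) = c \<otimes> \<one>" .
    then have "p \<otimes> e = \<one>" using m_lcancel[OF c0 c(1), of "p \<otimes> e" \<one>] e p by simp
    then show False using pu p e(1) m_comm[OF p e(1)] unfolding Units_def by auto
  qed
  have decomp: "\<exists>n::nat. \<exists>u\<in>Units R. a = u \<otimes> p [^] n" if a: "a \<in> carrier R" "a \<noteq> \<zero>" for a
  proof -
    \<comment> \<open>The predecessor of this least failing exponent still divides, and its cofactor
      cannot be divisible by \<open>p\<close>, hence is a unit.\<close>
    define n where "n = (LEAST n::nat. \<not> (\<exists>b\<in>carrier R. a = p [^] n \<otimes> b))"
    have n: "\<not> (\<exists>b\<in>carrier R. a = p [^] n \<otimes> b)" unfolding n_def by (rule LeastI_ex[OF krull[OF a]])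
    have "n \<noteq> 0"
    proof
      assume "n = 0" then show False using n a by auto
    qed
    then obtain m where m: "n = Suc m" using not0_implies_Suc by blast
    then have "\<exists>b\<in>carrier R. a = p [^] m \<otimes> b"
      using not_less_Least[of m "\<lambda>n. \<not> (\<exists>b\<in>carrier R. a = p [^] n \<otimes> b)"] unfolding n_def[symmetric] by auto
    then obtain b where b: "b \<in> carrier R" "a = p [^] m \<otimes> b" by blast
    have "b \<in> Units R"
    proof (rule ccontr)
      assume "b \<notin> Units R"
      then obtain c where c: "c \<in> carrier R" "b = p \<otimes> c" using div b by blast
      then have "a = p [^] n \<otimes> c" using b m p by (simp add: m_assoc)
      then show False using n c by blast
    qed
    then show ?thesis using b p m_comm by auto
  qed
  show ?thesis using that p p0 pu div decomp by blast
qed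

section \<open>Finite groups of field automorphisms\<close>

text \<open>Elements of \<open>G\<close> are functions, and the axioms speak of their values on the
  carrier only. This fits the extensional functions of \<open>galois_group\<close> and keeps its
  construction out of the algebra.\<close>

locale field_action = field K for K (structure) +
  fixes G :: "('a \<Rightarrow> 'a) monoid"
  assumes group_G: "group G" and fin_G: "finite (carrier G)"
    and act_hom: "\<alpha> \<in> carrier G \<Longrightarrow> \<alpha> \<in> ring_hom K K"
    and act_comp: "\<lbrakk>\<alpha> \<in> carrier G; \<tau> \<in> carrier G; x \<in> carrier K\<rbrakk> \<Longrightarrow> (\<alpha> \<otimes>\<^bsub>G\<^esub> \<tau>) x = \<alpha> (\<tau> x)"
    and act_one: "x \<in> carrier K \<Longrightarrow> \<one>\<^bsub>G\<^esub> x = x"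
    and faithful: "\<lbrakk>\<alpha> \<in> carrier G; \<alpha> \<noteq> \<one>\<^bsub>G\<^esub>\<rbrakk> \<Longrightarrow> \<exists>y\<in>carrier K. \<alpha> y \<noteq> y"
begin

sublocale G: group G by (rule group_G)

lemma act_closed [simp]: "\<alpha> \<in> carrier G \<Longrightarrow> x \<in> carrier K \<Longrightarrow> \<alpha> x \<in> carrier K"
  using act_hom ring_hom_closed by metis

lemma act_ring_hom_cring: "\<alpha> \<in> carrier G \<Longrightarrow> ring_hom_cring K K \<alpha>"
  using act_hom by (intro ring_hom_cring.intro ring_hom_cring_axioms.intro is_cring)

lemma
  assumes "\<alpha> \<in> carrier G"
  shows act_add: "x \<in> carrier K \<Longrightarrow> y \<in> carrier K \<Longrightarrow> \<alpha> (x \<oplus> y) = \<alpha> x \<oplus> \<alpha> y"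
    and act_mult: "x \<in> carrier K \<Longrightarrow> y \<in> carrier K \<Longrightarrow> \<alpha> (x \<otimes> y) = \<alpha> x \<otimes> \<alpha> y"
    and act_zero: "\<alpha> \<zero> = \<zero>"
    and act_1: "\<alpha> \<one> = \<one>"
    and act_uminus: "x \<in> carrier K \<Longrightarrow> \<alpha> (\<ominus> x) = \<ominus> \<alpha> x"
    and act_pow: "x \<in> carrier K \<Longrightarrow> \<alpha> (x [^] (n::nat)) = \<alpha> x [^] n"
    and act_finsum: "g \<in> A \<rightarrow> carrier K \<Longrightarrow> \<alpha> (\<Oplus>i\<in>A. g i) = (\<Oplus>i\<in>A. \<alpha> (g i))"
proof -
  interpret h: ring_hom_cring K K \<alpha> using act_ring_hom_cring assms by auto
  show "\<alpha> (\<Oplus>i\<in>A. g i) = (\<Oplus>i\<in>A. \<alpha> (g i))" if "g \<in> A \<rightarrow> carrier K"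
    using h.hom_finsum[OF that] by (simp add: comp_def)
  show "\<alpha> (x [^] (n::nat)) = \<alpha> x [^] n" if "x \<in> carrier K" for x n
    using that by (induction n) auto
  show "\<alpha> (x \<oplus> y) = \<alpha> x \<oplus> \<alpha> y" "\<alpha> (x \<otimes> y) = \<alpha> x \<otimes> \<alpha> y" if "x \<in> carrier K" "y \<in> carrier K" for x y
    using that by auto
  show "\<alpha> \<zero> = \<zero>" "\<alpha> \<one> = \<one>" by auto
  show "\<alpha> (\<ominus> x) = \<ominus> \<alpha> x" if "x \<in> carrier K" for x
    using that by auto
qed

lemma act_minus:
  assumes "\<alpha> \<in> carrier G" "x \<in> carrier K" "y \<in> carrier K"
  shows "\<alpha> (x \<ominus> y) = \<alpha> x \<ominus> \<alpha> y"
  using assms by (simp add: minus_eq act_add act_uminus)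

lemma act_inv [simp]:
  assumes "\<alpha> \<in> carrier G" "x \<in> carrier K"
  shows "\<alpha> ((inv\<^bsub>G\<^esub> \<alpha>) x) = x" "(inv\<^bsub>G\<^esub> \<alpha>) (\<alpha> x) = x"
  using assms act_comp[of \<alpha> "inv\<^bsub>G\<^esub> \<alpha>" x] act_comp[of "inv\<^bsub>G\<^esub> \<alpha>" \<alpha> x] by (simp_all add: act_one)

lemma act_eq_zero_iff: "\<alpha> \<in> carrier G \<Longrightarrow> x \<in> carrier K \<Longrightarrow> \<alpha> x = \<zero> \<longleftrightarrow> x = \<zero>"
  by (metis G.inv_closed act_inv(2) act_zero)

lemma finsum_translate:
  assumes "\<tau> \<in> carrier G" "h \<in> carrier G \<rightarrow> carrier K"
  shows "(\<Oplus>\<alpha>\<in>carrier G. h (\<tau> \<otimes>\<^bsub>G\<^esub> \<alpha>)) = (\<Oplus>\<alpha>\<in>carrier G. h \<alpha>)"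
proof -
  have "(\<Oplus>\<alpha>\<in>carrier G. h \<alpha>) = (\<Oplus>\<alpha>\<in>(\<lambda>\<alpha>. \<tau> \<otimes>\<^bsub>G\<^esub> \<alpha>) ` carrier G. h \<alpha>)"
    using assms by (simp add: G.surj_const_mult)
  also have "\<dots> = (\<Oplus>\<alpha>\<in>carrier G. h (\<tau> \<otimes>\<^bsub>G\<^esub> \<alpha>))"
    using assms by (intro finsum_reindex) (auto simp: G.surj_const_mult G.inj_on_cmult)
  finally show ?thesis by simp
qed

lemma finsum_delta:
  assumes "\<rho> \<in> carrier G" "g \<in> carrier G \<rightarrow> carrier K" "\<And>\<alpha>. \<alpha> \<in> carrier G \<Longrightarrow> \<alpha> \<noteq> \<rho> \<Longrightarrow> g \<alpha> = \<zero>"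
  shows "(\<Oplus>\<alpha>\<in>carrier G. g \<alpha>) = g \<rho>"
proof -
  have "(\<Oplus>\<alpha>\<in>carrier G. g \<alpha>) = (\<Oplus>\<alpha>\<in>{\<rho>}. g \<alpha>)"
    by (rule add.finprod_mono_neutral_cong_right) (use assms fin_G in auto)
  also have "\<dots> = g \<rho>" using assms(1) funcset_mem[OF assms(2,1)] by (subst finsum_insert) auto
  finally show ?thesis .
qed

definition Tr :: "'a \<Rightarrow> 'a" where "Tr x = (\<Oplus>\<alpha>\<in>carrier G. \<alpha> x)"

lemma Tr_closed [simp]: "x \<in> carrier K \<Longrightarrow> Tr x \<in> carrier K"
  unfolding Tr_def by (intro finsum_closed) auto

lemma Tr_add: "x \<in> carrier K \<Longrightarrow> y \<in> carrier K \<Longrightarrow> Tr (x \<oplus> y) = Tr x \<oplus> Tr y"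
proof -
  assume xy: "x \<in> carrier K" "y \<in> carrier K"
  have "Tr (x \<oplus> y) = (\<Oplus>\<alpha>\<in>carrier G. \<alpha> x \<oplus> \<alpha> y)"
    unfolding Tr_def using xy by (intro finsum_cong') (auto simp: act_add)
  also have "\<dots> = Tr x \<oplus> Tr y" unfolding Tr_def using xy by (intro finsum_addf) auto
  finally show ?thesis .
qed

lemma Tr_act: assumes "\<tau> \<in> carrier G" "x \<in> carrier K" shows "\<tau> (Tr x) = Tr x" "Tr (\<tau> x) = Tr x"
proof -
  have "\<tau> (Tr x) = (\<Oplus>\<alpha>\<in>carrier G. (\<tau> \<otimes>\<^bsub>G\<^esub> \<alpha>) x)"
    unfolding Tr_def using assms by (subst act_finsum) (auto intro!: finsum_cong' simp: act_comp)
  also have "\<dots> = Tr x" unfolding Tr_def using assms by (intro finsum_translate) auto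
  finally show "\<tau> (Tr x) = Tr x" .
  have "Tr (\<tau> x) = (\<Oplus>\<alpha>\<in>carrier G. (\<alpha> \<otimes>\<^bsub>G\<^esub> \<tau>) x)"
    unfolding Tr_def using assms by (intro finsum_cong') (auto simp: act_comp)
  also have "\<dots> = (\<Oplus>\<alpha>\<in>(\<lambda>\<alpha>. \<alpha> \<otimes>\<^bsub>G\<^esub> \<tau>) ` carrier G. \<alpha> x)"
    using assms by (intro finsum_reindex[symmetric]) (auto simp: G.inj_on_multc)
  also have "(\<lambda>\<alpha>. \<alpha> \<otimes>\<^bsub>G\<^esub> \<tau>) ` carrier G = carrier G"
  proof (intro equalityI subsetI)
    fix \<alpha> assume "\<alpha> \<in> carrier G"
    then have "\<alpha> = (\<alpha> \<otimes>\<^bsub>G\<^esub> inv\<^bsub>G\<^esub> \<tau>) \<otimes>\<^bsub>G\<^esub> \<tau>" using assms by (simp add: G.m_assoc)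
    then show "\<alpha> \<in> (\<lambda>\<alpha>. \<alpha> \<otimes>\<^bsub>G\<^esub> \<tau>) ` carrier G" using assms \<open>\<alpha> \<in> carrier G\<close> by (metis G.inv_closed G.m_closed imageI)
  qed (use assms in auto)
  finally show "Tr (\<tau> x) = Tr x" by (simp add: Tr_def)
qed

lemma Tr_mult_fixed:
  assumes "a \<in> carrier K" "x \<in> carrier K" "\<And>\<alpha>. \<alpha> \<in> carrier G \<Longrightarrow> \<alpha> a = a"
  shows "Tr (a \<otimes> x) = a \<otimes> Tr x"
proof -
  have "Tr (a \<otimes> x) = (\<Oplus>\<alpha>\<in>carrier G. a \<otimes> \<alpha> x)"
    unfolding Tr_def by (intro finsum_cong') (simp_all add: assms act_mult)
  also have "\<dots> = a \<otimes> Tr x" unfolding Tr_def using assms(1,2) fin_G by (subst finsum_rdistr) auto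
  finally show ?thesis .
qed

subsection \<open>Tensors as functions on the group\<close>

text \<open>The tensor \<open>\<Sum> s\<^sub>j \<otimes> t\<^sub>j\<close> over \<open>R\<close> is represented by the function \<open>\<alpha> \<mapsto> \<Sum> s\<^sub>j \<alpha>(t\<^sub>j)\<close>.\<close>

inductive_set tens :: "'a set \<Rightarrow> (('a \<Rightarrow> 'a) \<Rightarrow> 'a) set" for R where
  pure: "\<lbrakk>s \<in> R; t \<in> R; \<And>\<alpha>. \<alpha> \<in> carrier G \<Longrightarrow> w \<alpha> = s \<otimes> \<alpha> t\<rbrakk> \<Longrightarrow> w \<in> tens R"
| add: "\<lbrakk>u \<in> tens R; v \<in> tens R; \<And>\<alpha>. \<alpha> \<in> carrier G \<Longrightarrow> w \<alpha> = u \<alpha> \<oplus> v \<alpha>\<rbrakk> \<Longrightarrow> w \<in> tens R"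

text \<open>The function required here is the separability idempotent of the tensor square of
  \<open>R\<close>: it projects onto the factor at the identity when the tensor square is viewed
  inside the product indexed by \<open>G\<close>.\<close>

definition separating :: "'a set \<Rightarrow> bool" where
  "separating R \<longleftrightarrow> (\<exists>w\<in>tens R. \<forall>\<alpha>\<in>carrier G. w \<alpha> = (if \<alpha> = \<one>\<^bsub>G\<^esub> then \<one> else \<zero>))"

lemma tens_closed:
  assumes "w \<in> tens R" "R \<subseteq> carrier K" "\<alpha> \<in> carrier G"
  shows "w \<alpha> \<in> carrier K"
  using assms by (induction rule: tens.induct) (auto simp: subset_iff)

lemma tens_one_mem:
  assumes "w \<in> tens R" "subring R K"
  shows "w \<one>\<^bsub>G\<^esub> \<in> R"
  using assms(1) by (induction rule: tens.induct)
    (use subringE[OF assms(2)] in \<open>auto simp: act_one subset_iff\<close>)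

lemma tens_scale:
  assumes "w \<in> tens R" "subring R K" "a \<in> R" "\<And>\<alpha>. \<alpha> \<in> carrier G \<Longrightarrow> w' \<alpha> = a \<otimes> w \<alpha>"
  shows "w' \<in> tens R"
  using assms(1,4)
proof (induction arbitrary: w' rule: tens.induct)
  case (pure s t w)
  show ?case
    by (rule tens.pure[of "a \<otimes> s" R t])
       (use pure subringE[OF assms(2)] assms(3) in \<open>auto simp: subset_iff m_assoc\<close>)
next
  case (add u v w)
  have R: "R \<subseteq> carrier K" using subringE[OF assms(2)] by auto
  show ?case
    by (rule tens.add[of "\<lambda>\<alpha>. a \<otimes> u \<alpha>" R "\<lambda>\<alpha>. a \<otimes> v \<alpha>"])
       (use add R assms(3) in \<open>auto simp: tens_closed r_distr subset_iff\<close>)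
qed

lemma tens_mult:
  assumes "u \<in> tens R" "v \<in> tens R" "subring R K" "\<And>\<alpha>. \<alpha> \<in> carrier G \<Longrightarrow> w \<alpha> = u \<alpha> \<otimes> v \<alpha>"
  shows "w \<in> tens R"
proof -
  have R: "R \<subseteq> carrier K" using subringE[OF assms(3)] by auto
  have one: "w \<in> tens R" if "v \<in> tens R" "s \<in> R" "t \<in> R" "\<And>\<alpha>. \<alpha> \<in> carrier G \<Longrightarrow> w \<alpha> = (s \<otimes> \<alpha> t) \<otimes> v \<alpha>" for s t v w
    using that(1,4)
  proof (induction arbitrary: w rule: tens.induct)
    case (pure s' t' v)
    show ?case
    proof (rule tens.pure[of "s \<otimes> s'" R "t \<otimes> t'"])
      fix \<alpha> assume \<alpha>: "\<alpha> \<in> carrier G"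
      have "s \<in> carrier K" "t \<in> carrier K" "s' \<in> carrier K" "t' \<in> carrier K" using that pure R by auto
      then show "w \<alpha> = s \<otimes> s' \<otimes> \<alpha> (t \<otimes> t')" using pure \<alpha> by (simp add: act_mult m_ac)
    qed (use that pure subringE[OF assms(3)] in auto)
  next
    case (add u v w')
    show ?case
    proof (rule tens.add[of "\<lambda>\<alpha>. (s \<otimes> \<alpha> t) \<otimes> u \<alpha>" R "\<lambda>\<alpha>. (s \<otimes> \<alpha> t) \<otimes> v \<alpha>"])
      fix \<alpha> assume \<alpha>: "\<alpha> \<in> carrier G"
      have "s \<in> carrier K" "t \<in> carrier K" using that R by auto
      then show "w \<alpha> = s \<otimes> \<alpha> t \<otimes> u \<alpha> \<oplus> s \<otimes> \<alpha> t \<otimes> v \<alpha>"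
        using \<alpha> add tens_closed[OF _ R \<alpha>] by (simp add: r_distr)
    qed (use add in auto)
  qed
  from assms(1,4) show ?thesis
  proof (induction arbitrary: w rule: tens.induct)
    case (pure s t u)
    then show ?case using one[OF assms(2)] by auto
  next
    case (add u u' u'')
    show ?case
      by (rule tens.add[of "\<lambda>\<alpha>. u \<alpha> \<otimes> v \<alpha>" R "\<lambda>\<alpha>. u' \<alpha> \<otimes> v \<alpha>"])
         (use add tens_closed[OF assms(2) R] tens_closed[OF _ R] in \<open>auto simp: l_distr\<close>)
  qed
qed

text \<open>The tensor \<open>1 \<otimes> y - \<alpha>(y) \<otimes> 1\<close> is the function
  sending \<kappa> to \<open>\<kappa>(y) - \<alpha>(y)\<close>: zero at \<alpha>, and
  \<open>y - \<alpha>(y)\<close> at the identity. The product of one such tensor for each nontrivial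
  \<alpha> is the witness. The set \<open>M\<close> enters only through its multiplicatively closed
  complement, so the lemma covers both the zero ideal of \<open>K\<close> and the maximal ideals of
  \<open>S\<close>.\<close>

lemma tens_vanishing:
  assumes R: "subring R K" and stable: "\<And>\<alpha> x. \<alpha> \<in> carrier G \<Longrightarrow> x \<in> R \<Longrightarrow> \<alpha> x \<in> R"
    and M: "\<And>a b. a \<in> R - M \<Longrightarrow> b \<in> R - M \<Longrightarrow> a \<otimes> b \<notin> M" "\<one> \<notin> M"
    and sep: "\<And>\<alpha>. \<alpha> \<in> carrier G \<Longrightarrow> \<alpha> \<noteq> \<one>\<^bsub>G\<^esub> \<Longrightarrow> \<exists>y\<in>R. y \<ominus> \<alpha> y \<notin> M"
  shows "\<exists>w\<in>tens R. w \<one>\<^bsub>G\<^esub> \<notin> M \<and> (\<forall>\<alpha>\<in>carrier G. \<alpha> \<noteq> \<one>\<^bsub>G\<^esub> \<longrightarrow> w \<alpha> = \<zero>)"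
proof -
  have "finite T \<Longrightarrow> T \<subseteq> carrier G - {\<one>\<^bsub>G\<^esub>} \<Longrightarrow> \<exists>w\<in>tens R. w \<one>\<^bsub>G\<^esub> \<notin> M \<and> (\<forall>\<alpha>\<in>T. w \<alpha> = \<zero>)" for T
  proof (induction T rule: finite_induct)
    case empty
    have "(\<lambda>\<alpha>. \<one>) \<in> tens R"
      by (rule tens.pure[of \<one> _ \<one>]) (simp_all add: subringE[OF R] act_1)
    then show ?case using M by auto
  next
    case (insert \<alpha> T)
    then obtain w where w: "w \<in> tens R" "w \<one>\<^bsub>G\<^esub> \<notin> M" "\<forall>\<alpha>\<in>T. w \<alpha> = \<zero>" by auto
    have \<alpha>: "\<alpha> \<in> carrier G" "\<alpha> \<noteq> \<one>\<^bsub>G\<^esub>" using insert.prems by auto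
    obtain y where y: "y \<in> R" "y \<ominus> \<alpha> y \<notin> M" using sep[OF \<alpha>] by auto
    have RK: "R \<subseteq> carrier K" using subringE[OF R] by auto
    have yK: "y \<in> carrier K" "\<alpha> y \<in> carrier K" using y RK \<alpha> by auto
    define u where "u = (\<lambda>\<kappa>. \<kappa> y \<ominus> \<alpha> y)"
    have u: "u \<in> tens R"
    proof (rule tens.add[of "\<lambda>\<kappa>. \<one> \<otimes> \<kappa> y" R "\<lambda>\<kappa>. \<ominus> \<alpha> y \<otimes> \<kappa> \<one>"])
      show "(\<lambda>\<kappa>. \<one> \<otimes> \<kappa> y) \<in> tens R" by (rule tens.pure[of \<one> _ y]) (use subringE[OF R] y in auto)
      show "(\<lambda>\<kappa>. \<ominus> \<alpha> y \<otimes> \<kappa> \<one>) \<in> tens R"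
        by (rule tens.pure[of "\<ominus> \<alpha> y" _ \<one>]) (use subringE[OF R] y stable \<alpha> in auto)
    qed (use yK \<alpha> in \<open>auto simp: u_def act_1 minus_eq\<close>)
    define w' where "w' = (\<lambda>\<kappa>. w \<kappa> \<otimes> u \<kappa>)"
    have w': "w' \<in> tens R" by (rule tens_mult[OF w(1) u R]) (simp add: w'_def)
    have u1: "u \<one>\<^bsub>G\<^esub> = y \<ominus> \<alpha> y" using yK by (simp add: u_def act_one)
    have "w' \<one>\<^bsub>G\<^esub> \<notin> M" unfolding w'_def
      using w tens_one_mem[OF w(1) R] tens_one_mem[OF u R] u1 y by (intro M) auto
    moreover have "w' \<kappa> = \<zero>" if "\<kappa> \<in> insert \<alpha> T" for \<kappa>
    proof -
      have \<kappa>: "\<kappa> \<in> carrier G" using that insert.prems by auto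
      have "w \<kappa> \<in> carrier K" "u \<kappa> \<in> carrier K" using tens_closed[OF _ RK \<kappa>] w u by auto
      moreover have "u \<alpha> = \<zero>" using yK by (simp add: u_def minus_eq r_neg)
      ultimately show ?thesis using that w by (auto simp: w'_def)
    qed
    ultimately show ?case using w' by auto
  qed
  from this[of "carrier G - {\<one>\<^bsub>G\<^esub>}"] show ?thesis using fin_G by fastforce
qed

lemma separating_field: "separating (carrier K)"
proof -
  have "\<exists>w\<in>tens (carrier K). w \<one>\<^bsub>G\<^esub> \<notin> {\<zero>} \<and> (\<forall>\<alpha>\<in>carrier G. \<alpha> \<noteq> \<one>\<^bsub>G\<^esub> \<longrightarrow> w \<alpha> = \<zero>)"
  proof (rule tens_vanishing[OF carrier_is_subring])
    fix \<alpha> assume \<alpha>: "\<alpha> \<in> carrier G" "\<alpha> \<noteq> \<one>\<^bsub>G\<^esub>"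
    obtain y where y: "y \<in> carrier K" "\<alpha> y \<noteq> y" using faithful \<alpha> by auto
    then have "y \<ominus> \<alpha> y \<noteq> \<zero>" using \<alpha> by (simp add: r_right_minus_eq)
    then show "\<exists>y\<in>carrier K. y \<ominus> \<alpha> y \<notin> {\<zero>}" using y by auto
  qed (auto simp: integral_iff)
  then obtain w where w: "w \<in> tens (carrier K)" "w \<one>\<^bsub>G\<^esub> \<noteq> \<zero>" "\<forall>\<alpha>\<in>carrier G. \<alpha> \<noteq> \<one>\<^bsub>G\<^esub> \<longrightarrow> w \<alpha> = \<zero>"
    by auto
  have w1: "w \<one>\<^bsub>G\<^esub> \<in> carrier K" using tens_closed w by auto
  then have i: "inv (w \<one>\<^bsub>G\<^esub>) \<in> carrier K" "inv (w \<one>\<^bsub>G\<^esub>) \<otimes> w \<one>\<^bsub>G\<^esub> = \<one>"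
    using w field_Units by auto
  have "(\<lambda>\<alpha>. inv (w \<one>\<^bsub>G\<^esub>) \<otimes> w \<alpha>) \<in> tens (carrier K)"
    by (rule tens_scale[OF w(1) carrier_is_subring i(1)]) simp
  moreover have "inv (w \<one>\<^bsub>G\<^esub>) \<otimes> w \<alpha> = (if \<alpha> = \<one>\<^bsub>G\<^esub> then \<one> else \<zero>)" if "\<alpha> \<in> carrier G" for \<alpha>
    using that w i by auto
  ultimately show ?thesis unfolding separating_def by (intro bexI[of _ "\<lambda>\<alpha>. inv (w \<one>\<^bsub>G\<^esub>) \<otimes> w \<alpha>"]) simp
qed

text \<open>If \<open>w\<close> comes from the tensor with terms
  \<open>s\<^sub>j \<otimes> t\<^sub>j\<close>, the sum in question equals the sum of
  \<open>s\<^sub>j Tr(t\<^sub>j x)\<close>. An additive predicate \<open>P\<close> in place of this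
  formula avoids carrying finite families through the induction.\<close>

lemma tens_Tr:
  assumes "w \<in> tens R" "R \<subseteq> carrier K" "x \<in> carrier K" 
    and pure: "\<And>s t. s \<in> R \<Longrightarrow> t \<in> R \<Longrightarrow> P (s \<otimes> Tr (t \<otimes> x))"
    and add: "\<And>a b. a \<in> carrier K \<Longrightarrow> b \<in> carrier K \<Longrightarrow> P a \<Longrightarrow> P b \<Longrightarrow> P (a \<oplus> b)"
  shows "P (\<Oplus>\<alpha>\<in>carrier G. w \<alpha> \<otimes> \<alpha> x)"
  using assms(1)
proof (induction rule: tens.induct)
  case (pure s t w)
  have st: "s \<in> carrier K" "t \<in> carrier K" using pure assms(2) by auto
  have "(\<Oplus>\<alpha>\<in>carrier G. w \<alpha> \<otimes> \<alpha> x) = (\<Oplus>\<alpha>\<in>carrier G. s \<otimes> \<alpha> (t \<otimes> x))"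
    using st assms(3) pure by (intro finsum_cong') (auto simp: act_mult m_assoc)
  also have "\<dots> = s \<otimes> Tr (t \<otimes> x)"
    unfolding Tr_def using st assms(3) fin_G by (subst finsum_rdistr) auto
  finally show ?case using assms(4) pure by simp
next
  case (add u v w)
  note cl = tens_closed[OF add(1) assms(2)] tens_closed[OF add(2) assms(2)]
  have "(\<Oplus>\<alpha>\<in>carrier G. w \<alpha> \<otimes> \<alpha> x) = (\<Oplus>\<alpha>\<in>carrier G. u \<alpha> \<otimes> \<alpha> x \<oplus> v \<alpha> \<otimes> \<alpha> x)"
    using cl add assms(3) by (intro finsum_cong') (auto simp: l_distr)
  also have "\<dots> = (\<Oplus>\<alpha>\<in>carrier G. u \<alpha> \<otimes> \<alpha> x) \<oplus> (\<Oplus>\<alpha>\<in>carrier G. v \<alpha> \<otimes> \<alpha> x)"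
    using cl assms(3) by (intro finsum_addf) auto
  finally show ?case using assms(5) add cl assms(3) by (auto intro!: finsum_closed)
qed

text \<open>For the idempotent, the sum of \<open>tens_Tr\<close> collapses to \<open>x\<close>:
  this is the expansion of \<open>x\<close> in dual bases for the trace form.\<close>

lemma separating_Tr:
  assumes "separating R" "R \<subseteq> carrier K" "x \<in> carrier K" 
    and pure: "\<And>s t. s \<in> R \<Longrightarrow> t \<in> R \<Longrightarrow> P (s \<otimes> Tr (t \<otimes> x))"
    and add: "\<And>a b. a \<in> carrier K \<Longrightarrow> b \<in> carrier K \<Longrightarrow> P a \<Longrightarrow> P b \<Longrightarrow> P (a \<oplus> b)"
  shows "P x"
proof -
  obtain w where w: "w \<in> tens R" "\<forall>\<alpha>\<in>carrier G. w \<alpha> = (if \<alpha> = \<one>\<^bsub>G\<^esub> then \<one> else \<zero>)"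
    using assms(1) unfolding separating_def by auto
  have "(\<Oplus>\<alpha>\<in>carrier G. w \<alpha> \<otimes> \<alpha> x) = w \<one>\<^bsub>G\<^esub> \<otimes> \<one>\<^bsub>G\<^esub> x"
    using w assms by (intro finsum_delta) auto
  also have "\<dots> = x" using w assms by (simp add: act_one)
  finally show ?thesis using tens_Tr[OF w(1) assms(2,3), of P] pure add by auto
qed

text \<open>If the trace vanished identically, the expansion of 1 would be 0. A nonzero trace is
  fixed by \<open>G\<close>, and so is its inverse, which may therefore be pulled into the
  trace.\<close>

lemma ex_Tr_eq_1: "\<exists>t\<in>carrier K. Tr t = \<one>"
proof -
  have "\<exists>t\<in>carrier K. Tr t \<noteq> \<zero>"
  proof (rule ccontr)
    assume "\<not> ?thesis"
    then have *: "\<And>t. t \<in> carrier K \<Longrightarrow> Tr t = \<zero>" by auto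
    have "\<one> = \<zero>"
      by (rule separating_Tr[OF separating_field, of \<one> "\<lambda>x. x = \<zero>"]) (auto simp: *)
    then show False by simp
  qed
  then obtain t where t: "t \<in> carrier K" "Tr t \<noteq> \<zero>" by auto
  then have i: "inv (Tr t) \<in> carrier K" "inv (Tr t) \<otimes> Tr t = \<one>" using field_Units by auto
  have "\<alpha> (inv (Tr t)) = inv (Tr t)" if "\<alpha> \<in> carrier G" for \<alpha>
  proof -
    have "\<alpha> (inv (Tr t)) \<otimes> Tr t = \<alpha> (inv (Tr t) \<otimes> Tr t)"
      using t i(1) that Tr_act(1)[OF that t(1)] act_mult[OF that i(1), of "Tr t"] by simp
    then have "\<alpha> (inv (Tr t)) \<otimes> Tr t = inv (Tr t) \<otimes> Tr t" using i that by (simp add: act_1)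
    then show ?thesis using t i that m_rcancel[of "Tr t" "\<alpha> (inv (Tr t))" "inv (Tr t)"] by auto
  qed
  then have "Tr (inv (Tr t) \<otimes> t) = \<one>" using Tr_mult_fixed[of "inv (Tr t)" t] i t by simp
  then show ?thesis using i t by (intro bexI[of _ "inv (Tr t) \<otimes> t"]) auto
qed

end

section \<open>Integral closures of discrete valuation rings in Galois extensions\<close>

locale galois_dvr = field_action +
  fixes F V :: "'a set" and p :: 'a
  assumes fixed: "F = {x \<in> carrier K. \<forall>\<alpha>\<in>carrier G. \<alpha> x = x}"
    and V_subring: "subring V K" and V_F: "V \<subseteq> F"
    and p_V: "p \<in> V" and p_nz: "p \<noteq> \<zero>"
    and p_nonunit: "b \<in> V \<Longrightarrow> p \<otimes> b \<noteq> \<one>"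
    and V_local: "a \<in> V \<Longrightarrow> (\<exists>b\<in>V. a = p \<otimes> b) \<or> (\<exists>b\<in>V. a \<otimes> b = \<one>)"
    and V_decomp: "a \<in> V \<Longrightarrow> a \<noteq> \<zero> \<Longrightarrow> \<exists>n::nat. \<exists>u\<in>V. \<exists>w\<in>V. u \<otimes> w = \<one> \<and> a = u \<otimes> p [^] n"
    and frac: "x \<in> F \<Longrightarrow> \<exists>n::nat. p [^] n \<otimes> x \<in> V"
begin

lemmas V_props = subringE(1-3,5-7)[OF V_subring]

lemma F_act: "x \<in> F \<Longrightarrow> \<alpha> \<in> carrier G \<Longrightarrow> \<alpha> x = x"
  and F_carrier: "x \<in> F \<Longrightarrow> x \<in> carrier K"
  and F_I: "x \<in> carrier K \<Longrightarrow> (\<And>\<alpha>. \<alpha> \<in> carrier G \<Longrightarrow> \<alpha> x = x) \<Longrightarrow> x \<in> F"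
  by (simp_all add: fixed)

lemma V_carrier: "x \<in> V \<Longrightarrow> x \<in> carrier K"
  using V_props by auto

lemma p_closed [simp]: "p \<in> carrier K"
  using p_V V_carrier by auto

lemma V_pow: "x \<in> V \<Longrightarrow> x [^] (n::nat) \<in> V"
  by (induction n) (auto intro: V_props)

lemma p_pow_nz [simp]: "p [^] (n::nat) \<noteq> \<zero>"
  by (induction n) (simp_all add: p_nz integral_iff)

lemma p_pow_mono:
  assumes "p [^] (r::nat) \<otimes> x \<in> V" "x \<in> carrier K" "r \<le> r'"
  shows "p [^] r' \<otimes> x \<in> V"
proof -
  have "p [^] r' = p [^] (r' - r) \<otimes> p [^] r" using assms by (simp add: nat_pow_mult)
  then have "p [^] r' \<otimes> x = p [^] (r' - r) \<otimes> (p [^] r \<otimes> x)" using assms by (simp add: m_assoc)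
  then show ?thesis using assms V_props(5) V_pow p_V by simp
qed

lemma Tr_F: "x \<in> carrier K \<Longrightarrow> Tr x \<in> F"
  by (intro F_I) (auto simp: Tr_act)

lemma Tr_F_mult: "a \<in> F \<Longrightarrow> x \<in> carrier K \<Longrightarrow> Tr (a \<otimes> x) = a \<otimes> Tr x"
  using F_act F_carrier by (intro Tr_mult_fixed) auto

text \<open>Complete integral closedness of \<open>V\<close>: an element \<open>u / p^d\<close> with
  \<open>u\<close> a unit and \<open>d > 0\<close> has powers with unbounded denominators.\<close>

lemma F_pow_bounded_imp_V:
  assumes x: "x \<in> F" and r: "\<And>n::nat. p [^] (r::nat) \<otimes> x [^] n \<in> V"
  shows "x \<in> V"
proof (cases "x = \<zero>")
  case True then show ?thesis using V_props by simp
next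
  case False
  have xK [simp]: "x \<in> carrier K" using x F_carrier by auto
  obtain m :: nat where m: "p [^] m \<otimes> x \<in> V" using frac x by auto
  have "p [^] m \<otimes> x \<noteq> \<zero>" using False integral[of "p [^] m" x] by auto
  then obtain k u w where k: "u \<in> V" "w \<in> V" "u \<otimes> w = \<one>" "p [^] m \<otimes> x = u \<otimes> p [^] (k::nat)"
    using V_decomp m by blast
  note kK [simp] = V_carrier[OF k(1)] V_carrier[OF k(2)]
  show ?thesis
  proof (cases "m \<le> k")
    case True
    then have "p [^] m \<otimes> x = p [^] m \<otimes> (u \<otimes> p [^] (k - m))"
      using k(4) nat_pow_mult[of p m "k - m"] by (simp add: m_ac)
    then have "x = u \<otimes> p [^] (k - m)" using m_lcancel[of "p [^] m" x "u \<otimes> p [^] (k - m)"] by simp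
    then show ?thesis using k V_props(5) V_pow p_V by simp
  next
    case False
    define d where "d = m - k"
    have d: "m = k + d" "d > 0" using False by (auto simp: d_def)
    have "p [^] k \<otimes> (p [^] d \<otimes> x) = p [^] k \<otimes> u"
      using k(4) by (simp add: d(1) nat_pow_mult[symmetric] m_ac)
    then have u: "p [^] d \<otimes> x = u" using m_lcancel[of "p [^] k" "p [^] d \<otimes> x" u] by simp
    \<comment> \<open>With this \<open>n\<close> the exponent \<open>d n\<close> exceeds
      \<open>r\<close>, so a factor \<open>p\<close> of the unit \<open>u^n\<close> is left over
      after \<open>p^r\<close> has absorbed the denominator of \<open>x^n\<close>.\<close>
    define n where "n = Suc r"
    have "u [^] n = p [^] (d * n) \<otimes> x [^] n" by (simp add: u[symmetric] nat_pow_distrib nat_pow_pow)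
    also have "d * n = Suc (d * n - Suc r) + r" using d(2) by (cases d) (auto simp: n_def)
    also have "p [^] (Suc (d * n - Suc r) + r) \<otimes> x [^] n = p \<otimes> (p [^] (d * n - Suc r) \<otimes> (p [^] r \<otimes> x [^] n))"
      by (simp only: nat_pow_mult[symmetric] p_closed nat_pow_Suc) (simp add: m_ac)
    finally obtain b where b: "b \<in> V" "u [^] n = p \<otimes> b" using r[of n] V_props(5) V_pow p_V by blast
    have "p \<otimes> (b \<otimes> w [^] n) = u [^] n \<otimes> w [^] n" using b V_carrier[OF b(1)] by (simp add: m_assoc)
    also have "\<dots> = (u \<otimes> w) [^] n" by (simp add: nat_pow_distrib)
    also have "\<dots> = \<one>" using k by simp
    finally show ?thesis using p_nonunit[of "b \<otimes> w [^] n"] b k V_props(5) V_pow by auto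
  qed
qed

subsection \<open>Bounded sets\<close>

text \<open>
  Boundedness, tested by means of the trace form, means being contained in a finitely generated \<open>V\<close>-submodule of \<open>K\<close>.
  The integral closure is the set of elements with bounded powers; that this is a ring is much easier to see.
\<close>

definition bounded :: "'a set \<Rightarrow> bool" where
  "bounded B \<longleftrightarrow> (\<forall>t\<in>carrier K. \<exists>r::nat. \<forall>x\<in>B. p [^] r \<otimes> Tr (t \<otimes> x) \<in> V)"

lemma bounded_subset: "bounded B \<Longrightarrow> Y \<subseteq> B \<Longrightarrow> bounded Y"
  unfolding bounded_def by (meson subset_iff)

text \<open>Insert the expansion of \<open>x\<close> into \<open>Tr(t x z)\<close>. Each term
  \<open>s Tr(s' x)\<close> contributes \<open>Tr(s' x) Tr(t s z)\<close>, because a scalar from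
  \<open>F\<close> leaves the trace, and each of the two factors is controlled by one of the sets.
  The induction runs over arbitrary tensors and is specialised to the idempotent at the end.\<close>

lemma bounded_mult:
  assumes B: "bounded B" "B \<subseteq> carrier K" and C: "bounded C" "C \<subseteq> carrier K"
  shows "bounded {x \<otimes> z | x z. x \<in> B \<and> z \<in> C}"
  unfolding bounded_def
proof
  fix t assume t: "t \<in> carrier K"
  have *: "\<exists>r::nat. \<forall>x\<in>B. \<forall>z\<in>C. p [^] r \<otimes> Tr (t \<otimes> (\<Oplus>\<alpha>\<in>carrier G. w \<alpha> \<otimes> \<alpha> x) \<otimes> z) \<in> V"
    if "w \<in> tens (carrier K)" for w
    using that
  proof (induction rule: tens.induct)
    case (pure s s' w)
    obtain r1 :: nat where r1: "\<And>x. x \<in> B \<Longrightarrow> p [^] r1 \<otimes> Tr (s' \<otimes> x) \<in> V"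
      using bspec[OF B(1)[unfolded bounded_def] pure(2)] by blast
    obtain r2 :: nat where r2: "\<And>z. z \<in> C \<Longrightarrow> p [^] r2 \<otimes> Tr (t \<otimes> s \<otimes> z) \<in> V"
      using C(1) t pure(1) m_closed[of t s] unfolding bounded_def by blast
    have "p [^] (r1 + r2) \<otimes> Tr (t \<otimes> (\<Oplus>\<alpha>\<in>carrier G. w \<alpha> \<otimes> \<alpha> x) \<otimes> z) \<in> V" if x: "x \<in> B" and z: "z \<in> C" for x z
    proof -
      have xz [simp]: "x \<in> carrier K" "z \<in> carrier K" using x z B C by auto
      have "(\<Oplus>\<alpha>\<in>carrier G. w \<alpha> \<otimes> \<alpha> x) = (\<Oplus>\<alpha>\<in>carrier G. s \<otimes> \<alpha> (s' \<otimes> x))"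
        using pure by (intro finsum_cong') (auto simp: act_mult m_assoc)
      also have "\<dots> = s \<otimes> Tr (s' \<otimes> x)"
        unfolding Tr_def using pure fin_G by (subst finsum_rdistr) auto
      finally have "t \<otimes> (\<Oplus>\<alpha>\<in>carrier G. w \<alpha> \<otimes> \<alpha> x) \<otimes> z = Tr (s' \<otimes> x) \<otimes> (t \<otimes> s \<otimes> z)"
        using t pure by (simp add: m_ac)
      then have "Tr (t \<otimes> (\<Oplus>\<alpha>\<in>carrier G. w \<alpha> \<otimes> \<alpha> x) \<otimes> z) = Tr (s' \<otimes> x) \<otimes> Tr (t \<otimes> s \<otimes> z)"
        using Tr_F_mult[OF Tr_F, of "s' \<otimes> x" "t \<otimes> s \<otimes> z"] t pure by simp
      then have "p [^] (r1 + r2) \<otimes> Tr (t \<otimes> (\<Oplus>\<alpha>\<in>carrier G. w \<alpha> \<otimes> \<alpha> x) \<otimes> z) =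
          (p [^] r1 \<otimes> Tr (s' \<otimes> x)) \<otimes> (p [^] r2 \<otimes> Tr (t \<otimes> s \<otimes> z))"
        using t pure by (simp add: nat_pow_mult[symmetric] m_ac)
      then show ?thesis using r1[OF x] r2[OF z] V_props(5) by simp
    qed
    then show ?case by blast
  next
    case (add u v w)
    note cl = tens_closed[OF add(1)] tens_closed[OF add(2)]
    obtain r1 r2 :: nat where
      r1: "\<And>x z. x \<in> B \<Longrightarrow> z \<in> C \<Longrightarrow> p [^] r1 \<otimes> Tr (t \<otimes> (\<Oplus>\<alpha>\<in>carrier G. u \<alpha> \<otimes> \<alpha> x) \<otimes> z) \<in> V" and
      r2: "\<And>x z. x \<in> B \<Longrightarrow> z \<in> C \<Longrightarrow> p [^] r2 \<otimes> Tr (t \<otimes> (\<Oplus>\<alpha>\<in>carrier G. v \<alpha> \<otimes> \<alpha> x) \<otimes> z) \<in> V"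
      using add by blast
    have "p [^] (r1 + r2) \<otimes> Tr (t \<otimes> (\<Oplus>\<alpha>\<in>carrier G. w \<alpha> \<otimes> \<alpha> x) \<otimes> z) \<in> V" if x: "x \<in> B" and z: "z \<in> C" for x z
    proof -
      have xz [simp]: "x \<in> carrier K" "z \<in> carrier K" using x z B C by auto
      let ?A = "\<Oplus>\<alpha>\<in>carrier G. u \<alpha> \<otimes> \<alpha> x" and ?D = "\<Oplus>\<alpha>\<in>carrier G. v \<alpha> \<otimes> \<alpha> x"
      have AB [simp]: "?A \<in> carrier K" "?D \<in> carrier K" using cl by (auto intro!: finsum_closed)
      have "(\<Oplus>\<alpha>\<in>carrier G. w \<alpha> \<otimes> \<alpha> x) = (\<Oplus>\<alpha>\<in>carrier G. u \<alpha> \<otimes> \<alpha> x \<oplus> v \<alpha> \<otimes> \<alpha> x)"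
        using cl add by (intro finsum_cong') (auto simp: l_distr)
      also have "\<dots> = ?A \<oplus> ?D" using cl by (intro finsum_addf) auto
      finally have "t \<otimes> (\<Oplus>\<alpha>\<in>carrier G. w \<alpha> \<otimes> \<alpha> x) \<otimes> z = t \<otimes> ?A \<otimes> z \<oplus> t \<otimes> ?D \<otimes> z"
        using t by (simp add: l_distr r_distr)
      then have "p [^] (r1 + r2) \<otimes> Tr (t \<otimes> (\<Oplus>\<alpha>\<in>carrier G. w \<alpha> \<otimes> \<alpha> x) \<otimes> z) =
         p [^] (r1 + r2) \<otimes> Tr (t \<otimes> ?A \<otimes> z) \<oplus> p [^] (r1 + r2) \<otimes> Tr (t \<otimes> ?D \<otimes> z)"
        using t by (simp add: Tr_add r_distr)
      moreover have "p [^] (r1 + r2) \<otimes> Tr (t \<otimes> ?A \<otimes> z) \<in> V"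
        by (rule p_pow_mono[OF r1[OF x z]]) (use t in auto)
      moreover have "p [^] (r1 + r2) \<otimes> Tr (t \<otimes> ?D \<otimes> z) \<in> V"
        by (rule p_pow_mono[OF r2[OF x z]]) (use t in auto)
      ultimately show ?thesis using V_props(6) by simp
    qed
    then show ?case by blast
  qed
  obtain w where w: "w \<in> tens (carrier K)" "\<forall>\<alpha>\<in>carrier G. w \<alpha> = (if \<alpha> = \<one>\<^bsub>G\<^esub> then \<one> else \<zero>)"
    using separating_field unfolding separating_def by auto
  have wx: "(\<Oplus>\<alpha>\<in>carrier G. w \<alpha> \<otimes> \<alpha> x) = x" if "x \<in> carrier K" for x
  proof -
    have "(\<Oplus>\<alpha>\<in>carrier G. w \<alpha> \<otimes> \<alpha> x) = w \<one>\<^bsub>G\<^esub> \<otimes> \<one>\<^bsub>G\<^esub> x"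
      using w that by (intro finsum_delta) auto
    then show ?thesis using w that by (simp add: act_one)
  qed
  obtain r :: nat where r: "\<forall>x\<in>B. \<forall>z\<in>C. p [^] r \<otimes> Tr (t \<otimes> (\<Oplus>\<alpha>\<in>carrier G. w \<alpha> \<otimes> \<alpha> x) \<otimes> z) \<in> V"
    using *[OF w(1)] by blast
  have "\<forall>x\<in>B. \<forall>z\<in>C. p [^] r \<otimes> Tr (t \<otimes> (x \<otimes> z)) \<in> V"
  proof (intro ballI)
    fix x z assume xz: "x \<in> B" "z \<in> C"
    then have "x \<in> carrier K" "z \<in> carrier K" using B C by auto
    moreover have "p [^] r \<otimes> Tr (t \<otimes> (\<Oplus>\<alpha>\<in>carrier G. w \<alpha> \<otimes> \<alpha> x) \<otimes> z) \<in> V" using r xz by blast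
    ultimately show "p [^] r \<otimes> Tr (t \<otimes> (x \<otimes> z)) \<in> V" using wx[of x] t by (simp add: m_assoc)
  qed
  then show "\<exists>r::nat. \<forall>x\<in>{x \<otimes> z |x z. x \<in> B \<and> z \<in> C}. p [^] r \<otimes> Tr (t \<otimes> x) \<in> V" by auto
qed

lemma bounded_act:
  assumes "bounded B" "B \<subseteq> carrier K" "\<tau> \<in> carrier G"
  shows "bounded (\<tau> ` B)"
  unfolding bounded_def
proof
  fix t assume t: "t \<in> carrier K"
  obtain r :: nat where r: "\<forall>x\<in>B. p [^] r \<otimes> Tr ((inv\<^bsub>G\<^esub> \<tau>) t \<otimes> x) \<in> V"
    using assms t unfolding bounded_def by (meson G.inv_closed act_closed)
  have "Tr (t \<otimes> \<tau> x) = Tr ((inv\<^bsub>G\<^esub> \<tau>) t \<otimes> x)" if "x \<in> B" for x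
  proof -
    have "x \<in> carrier K" using that assms by auto
    then have "t \<otimes> \<tau> x = \<tau> ((inv\<^bsub>G\<^esub> \<tau>) t \<otimes> x)" using assms t by (simp add: act_mult)
    then show ?thesis using Tr_act(2)[of \<tau> "(inv\<^bsub>G\<^esub> \<tau>) t \<otimes> x"] assms t \<open>x \<in> carrier K\<close> by simp
  qed
  then show "\<exists>r::nat. \<forall>x\<in>\<tau> ` B. p [^] r \<otimes> Tr (t \<otimes> x) \<in> V" using r by auto
qed

definition power_bounded :: "'a set" where
  "power_bounded = {x \<in> carrier K. bounded (range (\<lambda>n::nat. x [^] n))}"

lemma power_boundedD:
  "x \<in> power_bounded \<Longrightarrow> x \<in> carrier K" "x \<in> power_bounded \<Longrightarrow> bounded (range (\<lambda>n::nat. x [^] n))"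
  by (simp_all add: power_bounded_def)

lemma V_power_bounded: "V \<subseteq> power_bounded"
proof
  fix x assume x: "x \<in> V"
  have xK: "x \<in> carrier K" using V_carrier x by simp
  show "x \<in> power_bounded" unfolding power_bounded_def bounded_def
  proof (clarsimp simp: xK)
    fix t assume t: "t \<in> carrier K"
    obtain r :: nat where r: "p [^] r \<otimes> Tr t \<in> V" using frac Tr_F t by blast
    have "p [^] r \<otimes> Tr (t \<otimes> x [^] n) \<in> V" for n :: nat
    proof -
      have "x [^] n \<in> F" using V_pow x V_F by auto
      then have "Tr (t \<otimes> x [^] n) = x [^] n \<otimes> Tr t" using Tr_F_mult[of "x [^] n" t] t xK by (simp add: m_comm)
      then have "p [^] r \<otimes> Tr (t \<otimes> x [^] n) = x [^] n \<otimes> (p [^] r \<otimes> Tr t)" using t xK by (simp add: m_ac)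
      then show ?thesis using V_props(5)[OF V_pow[OF x] r] by simp
    qed
    then show "\<exists>r::nat. \<forall>n::nat. p [^] r \<otimes> Tr (t \<otimes> x [^] n) \<in> V" by blast
  qed
qed

lemma power_bounded_mult:
  assumes "x \<in> power_bounded" "y \<in> power_bounded"
  shows "x \<otimes> y \<in> power_bounded"
proof -
  have xy: "x \<in> carrier K" "y \<in> carrier K" using assms power_boundedD by auto
  have "bounded {a \<otimes> b | a b. a \<in> range (\<lambda>n::nat. x [^] n) \<and> b \<in> range (\<lambda>n::nat. y [^] n)}"
    using assms power_boundedD xy by (intro bounded_mult) auto
  then have "bounded (range (\<lambda>n::nat. (x \<otimes> y) [^] n))"
    by (rule bounded_subset) (auto simp: nat_pow_distrib xy)
  then show ?thesis using xy by (simp add: power_bounded_def)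
qed

text \<open>By \<open>bounded_mult\<close> one exponent \<open>r\<close> serves all monomials
  \<open>x^i y^j\<close>. Keeping a monomial factor general in the induction over the power of
  \<open>x + y\<close> replaces the binomial theorem.\<close>

lemma power_bounded_add:
  assumes "x \<in> power_bounded" "y \<in> power_bounded"
  shows "x \<oplus> y \<in> power_bounded"
proof -
  have xy: "x \<in> carrier K" "y \<in> carrier K" using assms power_boundedD by auto
  have b: "bounded {a \<otimes> b | a b. a \<in> range (\<lambda>n::nat. x [^] n) \<and> b \<in> range (\<lambda>n::nat. y [^] n)}"
    using assms power_boundedD xy by (intro bounded_mult) auto
  have "bounded (range (\<lambda>n::nat. (x \<oplus> y) [^] n))"
    unfolding bounded_def
  proof
    fix t assume t: "t \<in> carrier K"
    obtain r :: nat where "\<forall>z\<in>{a \<otimes> b | a b. a \<in> range (\<lambda>n::nat. x [^] n) \<and> b \<in> range (\<lambda>n::nat. y [^] n)}.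
        p [^] r \<otimes> Tr (t \<otimes> z) \<in> V"
      using bspec[OF b[unfolded bounded_def] t] by blast
    then have r: "p [^] r \<otimes> Tr (t \<otimes> (x [^] i \<otimes> y [^] j)) \<in> V" for i j :: nat by blast
    have "p [^] r \<otimes> Tr (t \<otimes> (x [^] i \<otimes> y [^] j) \<otimes> (x \<oplus> y) [^] n) \<in> V" for i j n :: nat
    proof (induction n arbitrary: i j)
      case 0 then show ?case using r xy t by simp
    next
      case (Suc n)
      have "t \<otimes> (x [^] i \<otimes> y [^] j) \<otimes> (x \<oplus> y) [^] Suc n =
        t \<otimes> (x [^] Suc i \<otimes> y [^] j) \<otimes> (x \<oplus> y) [^] n \<oplus> t \<otimes> (x [^] i \<otimes> y [^] Suc j) \<otimes> (x \<oplus> y) [^] n"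
        using xy t by (simp add: r_distr l_distr m_ac)
      then have "p [^] r \<otimes> Tr (t \<otimes> (x [^] i \<otimes> y [^] j) \<otimes> (x \<oplus> y) [^] Suc n) =
        p [^] r \<otimes> Tr (t \<otimes> (x [^] Suc i \<otimes> y [^] j) \<otimes> (x \<oplus> y) [^] n) \<oplus>
        p [^] r \<otimes> Tr (t \<otimes> (x [^] i \<otimes> y [^] Suc j) \<otimes> (x \<oplus> y) [^] n)"
        using xy t by (simp add: Tr_add r_distr del: nat_pow_Suc)
      then show ?case using V_props(6)[OF Suc[of "Suc i" j] Suc[of i "Suc j"]] by (simp del: nat_pow_Suc)
    qed
    from this[of 0 0] show "\<exists>r::nat. \<forall>x\<in>range (\<lambda>n::nat. (x \<oplus> y) [^] n). p [^] r \<otimes> Tr (t \<otimes> x) \<in> V"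
      using t xy by auto
  qed
  then show ?thesis using xy by (simp add: power_bounded_def)
qed

lemma power_bounded_subring: "subring power_bounded K"
proof (rule subringI)
  show "\<one> \<in> power_bounded" using V_power_bounded V_props by auto
  fix h assume h: "h \<in> power_bounded"
  have "\<ominus> \<one> \<otimes> h \<in> power_bounded" using V_power_bounded V_props h by (intro power_bounded_mult) auto
  then show "\<ominus> h \<in> power_bounded" using h power_boundedD by (simp add: l_minus)
qed (auto intro: power_bounded_mult power_bounded_add power_boundedD)

lemma power_bounded_act:
  assumes "x \<in> power_bounded" "\<tau> \<in> carrier G"
  shows "\<tau> x \<in> power_bounded"
proof -
  have x: "x \<in> carrier K" using assms power_boundedD by auto
  have "bounded (\<tau> ` range (\<lambda>n::nat. x [^] n))"
    using assms power_boundedD x by (intro bounded_act) auto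
  also have "\<tau> ` range (\<lambda>n::nat. x [^] n) = range (\<lambda>n::nat. \<tau> x [^] n)"
    using x assms by (auto simp: act_pow image_iff)
  finally show ?thesis using x assms by (simp add: power_bounded_def)
qed

text \<open>If \<open>Tr t = 1\<close> and \<open>x\<close> lies in \<open>F\<close>, then
  \<open>Tr(t x^n) = x^n\<close>. Boundedness tested at \<open>t\<close> is thus a common
  denominator of the powers themselves.\<close>

lemma power_bounded_F:
  assumes "x \<in> power_bounded" "x \<in> F"
  shows "x \<in> V"
proof -
  obtain t where t: "t \<in> carrier K" "Tr t = \<one>" using ex_Tr_eq_1 by auto
  have x: "x \<in> carrier K" using assms power_boundedD by auto
  obtain r :: nat where r: "\<And>n::nat. p [^] r \<otimes> Tr (t \<otimes> x [^] n) \<in> V"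
    using power_boundedD(2)[OF assms(1)] t unfolding bounded_def by blast
  have "x [^] n \<in> F" for n :: nat using assms x F_act by (intro F_I) (simp_all add: act_pow F_act[OF assms(2)])
  then have "Tr (t \<otimes> x [^] n) = x [^] n" for n :: nat using Tr_F_mult[of "x [^] n" t] t x by (simp add: m_comm)
  then show ?thesis using F_pow_bounded_imp_V[OF assms(2), of r] r by simp
qed

text \<open>A monic relation of degree \<open>m\<close> writes every higher power of
  \<open>x\<close> through the \<open>m\<close> preceding ones with coefficients in
  \<open>V\<close>, so a common denominator for the first \<open>m\<close> traces works for all of
  them.\<close>

lemma integral_imp_power_bounded:
  assumes x: "x \<in> carrier K" and qs: "set qs \<subseteq> V" "eval (\<one> # qs) x = \<zero>"
  shows "x \<in> power_bounded"
proof -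
  define m where "m = length qs"
  have qsK: "set qs \<subseteq> carrier K" using qs V_carrier by auto
  have rel: "x [^] m = \<ominus> eval qs x"
    using qs(2) x qsK eval_in_carrier[OF qsK x] by (simp add: m_def minus_equality[symmetric] minus_minus add.inv_equality)
  have "bounded (range (\<lambda>n::nat. x [^] n))" unfolding bounded_def
  proof
    fix t assume t: "t \<in> carrier K"
    have lin: "p [^] r \<otimes> Tr (t \<otimes> (x [^] k \<otimes> eval cs x)) \<in> V"
      if "set cs \<subseteq> V" "\<And>i. i < length cs \<Longrightarrow> p [^] r \<otimes> Tr (t \<otimes> x [^] (k + i)) \<in> V" for cs and r k :: nat
      using that
    proof (induction cs)
      case Nil
      have "Tr \<zero> = \<zero>" using Tr_F_mult[of \<zero> \<zero>] V_F V_props by auto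
      then show ?case using x t V_props by simp
    next
      case (Cons c cs)
      have c: "c \<in> V" "c \<in> F" "c \<in> carrier K" "set cs \<subseteq> carrier K" using Cons.prems V_F V_carrier by auto
      have ev: "eval cs x \<in> carrier K" using eval_in_carrier c x by simp
      have "t \<otimes> (x [^] k \<otimes> eval (c # cs) x) = c \<otimes> (t \<otimes> x [^] (k + length cs)) \<oplus> t \<otimes> (x [^] k \<otimes> eval cs x)"
        using ev c t x by (simp add: nat_pow_mult[symmetric] r_distr m_ac)
      then have "p [^] r \<otimes> Tr (t \<otimes> (x [^] k \<otimes> eval (c # cs) x)) =
         c \<otimes> (p [^] r \<otimes> Tr (t \<otimes> x [^] (k + length cs))) \<oplus> p [^] r \<otimes> Tr (t \<otimes> (x [^] k \<otimes> eval cs x))"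
        using ev c t x by (simp add: Tr_add Tr_F_mult r_distr m_ac)
      moreover have "p [^] r \<otimes> Tr (t \<otimes> (x [^] k \<otimes> eval cs x)) \<in> V" using Cons by simp
      moreover have "p [^] r \<otimes> Tr (t \<otimes> x [^] (k + length cs)) \<in> V" using Cons.prems by simp
      ultimately show ?case using c V_props(5,6) by simp
    qed
    have "\<exists>r::nat. \<forall>i<k. p [^] r \<otimes> Tr (t \<otimes> x [^] i) \<in> V" for k :: nat
    proof (induction k)
      case (Suc k)
      then obtain r1 :: nat where r1: "\<And>i. i < k \<Longrightarrow> p [^] r1 \<otimes> Tr (t \<otimes> x [^] i) \<in> V" by auto
      obtain r2 :: nat where r2: "p [^] r2 \<otimes> Tr (t \<otimes> x [^] k) \<in> V" using frac Tr_F t x by (meson m_closed nat_pow_closed)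
      have "p [^] (r1 + r2) \<otimes> Tr (t \<otimes> x [^] i) \<in> V" if "i < Suc k" for i
      proof (cases "i = k")
        case True then show ?thesis using p_pow_mono[OF r2, of "r1 + r2"] t x by simp
      next
        case False then show ?thesis using p_pow_mono[OF r1, of i "r1 + r2"] t x that by simp
      qed
      then show ?case by blast
    qed simp
    then obtain r :: nat where r: "\<forall>i<m. p [^] r \<otimes> Tr (t \<otimes> x [^] i) \<in> V" by blast
    have "p [^] r \<otimes> Tr (t \<otimes> x [^] n) \<in> V" for n :: nat
    proof (induction n rule: less_induct)
      case (less n)
      show ?case
      proof (cases "n < m")
        case True then show ?thesis using r by simp
      next
        case False
        then have "x [^] n = x [^] (n - m) \<otimes> x [^] m" using x by (simp add: nat_pow_mult)
        then have e: "x [^] n = \<ominus> (x [^] (n - m) \<otimes> eval qs x)"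
          using rel x eval_in_carrier[OF qsK x] by (simp add: r_minus)
        have in_V: "p [^] r \<otimes> Tr (t \<otimes> (x [^] (n - m) \<otimes> eval qs x)) \<in> V"
          using lin[OF qs(1), of r "n - m"] less False by (simp add: m_def)
        have "Tr (t \<otimes> x [^] n) = Tr (\<ominus> \<one> \<otimes> (t \<otimes> (x [^] (n - m) \<otimes> eval qs x)))"
          using e t x eval_in_carrier[OF qsK x] by (simp add: r_minus l_minus)
        also have "\<dots> = \<ominus> \<one> \<otimes> Tr (t \<otimes> (x [^] (n - m) \<otimes> eval qs x))"
          using t x eval_in_carrier[OF qsK x] V_props V_F by (intro Tr_F_mult) auto
        finally have "p [^] r \<otimes> Tr (t \<otimes> x [^] n) = \<ominus> \<one> \<otimes> (p [^] r \<otimes> Tr (t \<otimes> (x [^] (n - m) \<otimes> eval qs x)))"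
          using t x eval_in_carrier[OF qsK x] by (simp add: m_ac r_minus l_minus)
        then show ?thesis using V_props(5)[OF V_props(4)[OF V_props(3)] in_V] by simp
      qed
    qed
    then show "\<exists>r::nat. \<forall>x\<in>range (\<lambda>n::nat. x [^] n). p [^] r \<otimes> Tr (t \<otimes> x) \<in> V" by blast
  qed
  then show ?thesis using x by (simp add: power_bounded_def)
qed

subsection \<open>The characteristic polynomial\<close>

text \<open>The coefficient of \<open>X^i\<close> in the product of the linear factors
  \<open>X - y\<close>. As a function on all naturals it is zero beyond the degree, so the recursion
  needs no case distinction at the top.\<close>

primrec root_coeff :: "'a list \<Rightarrow> nat \<Rightarrow> 'a" where
  "root_coeff [] = (\<lambda>i. if i = 0 then \<one> else \<zero>)"
| "root_coeff (y # ys) = (\<lambda>i. (case i of 0 \<Rightarrow> \<zero> | Suc j \<Rightarrow> root_coeff ys j) \<ominus> y \<otimes> root_coeff ys i)"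

lemma root_coeff_closed: "set ys \<subseteq> carrier K \<Longrightarrow> root_coeff ys i \<in> carrier K"
  by (induction ys arbitrary: i) (auto split: nat.splits)

lemma root_coeff_subring:
  assumes "subring R K" "set ys \<subseteq> R"
  shows "root_coeff ys i \<in> R"
  using assms(2)
  by (induction ys arbitrary: i) (auto split: nat.splits simp: minus_eq subringE[OF assms(1)])

lemma root_coeff_high: "set ys \<subseteq> carrier K \<Longrightarrow> length ys < i \<Longrightarrow> root_coeff ys i = \<zero>"
  by (induction ys arbitrary: i) (auto split: nat.splits)

lemma root_coeff_lead: "set ys \<subseteq> carrier K \<Longrightarrow> root_coeff ys (length ys) = \<one>"
  by (induction ys) (auto simp: root_coeff_high minus_eq)

lemma root_coeff_act:
  "\<tau> \<in> carrier G \<Longrightarrow> set ys \<subseteq> carrier K \<Longrightarrow> \<tau> (root_coeff ys i) = root_coeff (map \<tau> ys) i"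
  by (induction ys arbitrary: i)
     (auto split: nat.splits simp: act_minus act_mult act_1 act_zero root_coeff_closed)

lemma root_coeff_swap:
  assumes "x \<in> carrier K" "y \<in> carrier K" "set ys \<subseteq> carrier K"
  shows "root_coeff (x # y # ys) = root_coeff (y # x # ys)"
proof
  fix i
  have swap0: "\<zero> \<ominus> x \<otimes> (\<zero> \<ominus> y \<otimes> a) = \<zero> \<ominus> y \<otimes> (\<zero> \<ominus> x \<otimes> a)" if "a \<in> carrier K" for a
    using that assms(1,2) by algebra
  have swap1: "\<zero> \<ominus> y \<otimes> a \<ominus> x \<otimes> (a \<ominus> y \<otimes> b) = \<zero> \<ominus> x \<otimes> a \<ominus> y \<otimes> (a \<ominus> x \<otimes> b)"
    if "a \<in> carrier K" "b \<in> carrier K" for a b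
    using that assms(1,2) by algebra
  have swap2: "a \<ominus> y \<otimes> b \<ominus> x \<otimes> (b \<ominus> y \<otimes> c) = a \<ominus> x \<otimes> b \<ominus> y \<otimes> (b \<ominus> x \<otimes> c)"
    if "a \<in> carrier K" "b \<in> carrier K" "c \<in> carrier K" for a b c
    using that assms(1,2) by algebra
  show "root_coeff (x # y # ys) i = root_coeff (y # x # ys) i"
  proof (cases i)
    case 0
    then show ?thesis using swap0 root_coeff_closed[OF assms(3)] by simp
  next
    case (Suc j)
    then show ?thesis
      using swap1[of "root_coeff ys 0" "root_coeff ys 1"] swap2[of "root_coeff ys (j - 1)" "root_coeff ys j" "root_coeff ys (Suc j)"]
        root_coeff_closed[OF assms(3)]
      by (cases j) auto
  qed
qed

lemma root_coeff_remove1: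
  "y \<in> set ys \<Longrightarrow> set ys \<subseteq> carrier K \<Longrightarrow> root_coeff ys = root_coeff (y # remove1 y ys)"
proof (induction ys)
  case (Cons x xs)
  show ?case
  proof (cases "x = y")
    case False
    then have "root_coeff xs = root_coeff (y # remove1 y xs)" using Cons by auto
    then have "root_coeff (x # xs) = root_coeff (x # y # remove1 y xs)"
      by (simp only: root_coeff.simps(2)[of x])
    also have "\<dots> = root_coeff (y # x # remove1 y xs)"
      using Cons.prems set_remove1_subset[of y xs] by (intro root_coeff_swap) auto
    finally show ?thesis using False by simp
  qed simp
qed simp

text \<open>Adjacent linear factors commute, so the coefficients are symmetric in the roots. This is
  the source of the invariance of an orbit polynomial under \<open>G\<close>.\<close>

lemma root_coeff_mset:
  "mset xs = mset ys \<Longrightarrow> set xs \<subseteq> carrier K \<Longrightarrow> root_coeff xs = root_coeff ys"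
proof (induction xs arbitrary: ys)
  case (Cons x xs)
  have x: "x \<in> set ys" "set ys \<subseteq> carrier K"
    using mset_eq_setD[OF Cons.prems(1)] Cons.prems(2) by auto
  have "mset xs = mset (remove1 x ys)" by (metis Cons.prems(1) add_mset_remove_trivial mset.simps(2) mset_remove1)
  then have "root_coeff xs = root_coeff (remove1 x ys)" using Cons by simp
  then have "root_coeff (x # xs) = root_coeff (x # remove1 x ys)" by (simp only: root_coeff.simps(2))
  then show ?case using root_coeff_remove1[OF x] by simp
qed simp

definition root_poly :: "'a list \<Rightarrow> 'a list" where
  "root_poly ys = map (root_coeff ys) (rev [0..<Suc (length ys)])"

lemma eval_root_poly_Cons:
  assumes "x \<in> carrier K" "y \<in> carrier K" "set ys \<subseteq> carrier K"
  shows "eval (root_poly (y # ys)) x = (x \<ominus> y) \<otimes> eval (root_poly ys) x"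
proof -
  have cl: "eval (map (root_coeff ys) (rev [0..<n])) x \<in> carrier K" for n
    using assms root_coeff_closed by (intro eval_in_carrier) auto
  \<comment> \<open>Cutting off both polynomials at degree \<open>n\<close> leaves a boundary term.
    It vanishes at \<open>n = Suc (length ys)\<close>, where the coefficient lies beyond the
    degree.\<close>
  have "eval (map (root_coeff (y # ys)) (rev [0..<Suc n])) x =
     (x \<ominus> y) \<otimes> eval (map (root_coeff ys) (rev [0..<n])) x \<ominus> y \<otimes> (root_coeff ys n \<otimes> x [^] n)" for n
  proof (induction n)
    case 0
    then show ?case using assms root_coeff_closed by (simp add: minus_eq l_minus)
  next
    case (Suc n)
    define a b c e where "a = root_coeff ys n" and "b = root_coeff ys (Suc n)" and "c = x [^] n"
      and "e = eval (map (root_coeff ys) (rev [0..<n])) x"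
    have abc: "a \<in> carrier K" "b \<in> carrier K" "c \<in> carrier K" "e \<in> carrier K"
      using assms root_coeff_closed cl by (auto simp: a_def b_def c_def e_def)
    have "eval (map (root_coeff (y # ys)) (rev [0..<Suc (Suc n)])) x =
      (a \<ominus> y \<otimes> b) \<otimes> (c \<otimes> x) \<oplus> eval (map (root_coeff (y # ys)) (rev [0..<Suc n])) x"
      by (simp add: a_def b_def c_def)
    also have "\<dots> = (a \<ominus> y \<otimes> b) \<otimes> (c \<otimes> x) \<oplus> ((x \<ominus> y) \<otimes> e \<ominus> y \<otimes> (a \<otimes> c))"
      using Suc by (simp add: a_def c_def e_def)
    also have "\<dots> = (x \<ominus> y) \<otimes> (a \<otimes> c \<oplus> e) \<ominus> y \<otimes> (b \<otimes> (c \<otimes> x))"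
      using abc assms(1,2) by algebra
    finally show ?case by (simp add: a_def b_def c_def e_def)
  qed
  from this[of "Suc (length ys)"] have "eval (root_poly (y # ys)) x = (x \<ominus> y) \<otimes> eval (root_poly ys) x \<ominus> \<zero>"
    using assms root_coeff_high[OF assms(3), of "Suc (length ys)"] unfolding root_poly_def
    by (simp only: list.size add_Suc_right add_0_right) simp
  then show ?thesis using assms cl[of "Suc (length ys)"] by (simp add: minus_eq root_poly_def)
qed

lemma eval_root_poly:
  "x \<in> set ys \<Longrightarrow> set ys \<subseteq> carrier K \<Longrightarrow> eval (root_poly ys) x = \<zero>"
proof (induction ys)
  case (Cons y ys)
  have "eval (root_poly ys) x \<in> carrier K"
    using Cons.prems root_coeff_closed by (intro eval_in_carrier) (auto simp: root_poly_def)
  then show ?case using Cons eval_root_poly_Cons[of x y ys] by (auto simp: minus_eq r_neg)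
qed simp

lemma charpoly:
  assumes R: "subring R K" and stable: "\<And>\<alpha> x. \<alpha> \<in> carrier G \<Longrightarrow> x \<in> R \<Longrightarrow> \<alpha> x \<in> R" and x: "x \<in> R"
  obtains qs where "set qs \<subseteq> R \<inter> F" "eval (\<one> # qs) x = \<zero>"
proof -
  obtain gs where gs: "set gs = carrier G" "distinct gs" using finite_distinct_list[OF fin_G] by blast
  \<comment> \<open>The orbit is listed with one entry for each group element, repetitions included;
    a translation of \<open>G\<close> then preserves it as a multiset.\<close>
  define ys where "ys = map (\<lambda>\<alpha>. \<alpha> x) gs"
  have xK: "x \<in> carrier K" using x subringE[OF R] by auto
  have ysR: "set ys \<subseteq> R" using stable x gs by (auto simp: ys_def)
  have ysK: "set ys \<subseteq> carrier K" using ysR subringE[OF R] by auto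
  have "root_coeff ys i \<in> F" for i
  proof (rule F_I)
    show "root_coeff ys i \<in> carrier K" using root_coeff_closed ysK by simp
    fix \<tau> assume \<tau>: "\<tau> \<in> carrier G"
    have "map \<tau> ys = map (\<lambda>\<alpha>. \<alpha> x) (map (\<lambda>\<alpha>. \<tau> \<otimes>\<^bsub>G\<^esub> \<alpha>) gs)"
      using gs \<tau> xK by (auto simp: ys_def act_comp)
    also have "mset \<dots> = mset ys"
    proof -
      have "mset (map (\<lambda>\<alpha>. \<tau> \<otimes>\<^bsub>G\<^esub> \<alpha>) gs) = mset gs"
        using gs \<tau> by (subst set_eq_iff_mset_eq_distinct[symmetric])
          (auto simp: distinct_map G.inj_on_cmult G.surj_const_mult)
      then show ?thesis unfolding ys_def by (metis mset_map)
    qed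
    finally have "root_coeff (map \<tau> ys) = root_coeff ys"
      using ysK \<tau> by (intro root_coeff_mset) auto
    then show "\<tau> (root_coeff ys i) = root_coeff ys i" using root_coeff_act[OF \<tau> ysK] by simp
  qed
  moreover have "x \<in> set ys" unfolding ys_def using gs xK
    by (auto intro!: image_eqI[of _ _ "\<one>\<^bsub>G\<^esub>"] simp: act_one)
  then have "eval (root_poly ys) x = \<zero>" using eval_root_poly ysK by simp
  moreover have "root_poly ys = \<one> # map (root_coeff ys) (rev [0..<length ys])"
    using root_coeff_lead ysK by (simp add: root_poly_def)
  ultimately show ?thesis
    using that[of "map (root_coeff ys) (rev [0..<length ys])"] root_coeff_subring[OF R ysR] by auto
qed

text \<open>For the harder inclusion, the orbit polynomial of a power-bounded element has
  coefficients that are power-bounded and fixed by \<open>G\<close>; by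
  \<open>power_bounded_F\<close> they lie in \<open>V\<close>.\<close>

lemma integral_closure_eq: "integral_closure K V = power_bounded"
proof (intro equalityI subsetI)
  fix x assume "x \<in> integral_closure K V"
  then obtain ps where ps: "x \<in> carrier K" "ps \<in> carrier (univ_poly K V)" "ps \<noteq> []" "lead_coeff ps = \<one>" "eval ps x = \<zero>"
    by (auto simp: integral_closure_def)
  then obtain qs where "ps = \<one> # qs" by (cases ps) auto
  then show "x \<in> power_bounded"
    using integral_imp_power_bounded[of x qs] ps by (auto simp: univ_poly_def polynomial_def)
next
  fix x assume x: "x \<in> power_bounded"
  obtain qs where "set qs \<subseteq> power_bounded \<inter> F" "eval (\<one> # qs) x = \<zero>"
    by (rule charpoly[OF power_bounded_subring _ x]) (auto intro: power_bounded_act)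
  moreover from calculation have "set qs \<subseteq> V" using power_bounded_F by blast
  then have "set (\<one> # qs) \<subseteq> V" using V_props by simp
  ultimately show "x \<in> integral_closure K V"
    using power_boundedD(1)[OF x] unfolding integral_closure_def
    by (auto intro!: exI[of _ "\<one> # qs"] simp: univ_poly_def polynomial_def)
qed

subsection \<open>The integral closure\<close>

abbreviation S :: "'a set" where "S \<equiv> power_bounded"

lemmas S_props = subringE(1-3,5-7)[OF power_bounded_subring]

lemma S_carrier: "x \<in> S \<Longrightarrow> x \<in> carrier K"
  using power_boundedD by auto

lemma V_S: "x \<in> V \<Longrightarrow> x \<in> S"
  using V_power_bounded by auto

lemma p_S [simp]: "p \<in> S"
  using V_S p_V by simp

lemma S_minus: "x \<in> S \<Longrightarrow> y \<in> S \<Longrightarrow> x \<ominus> y \<in> S"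
  by (simp add: minus_eq S_props)

lemma S_pow: "x \<in> S \<Longrightarrow> x [^] (n::nat) \<in> S"
  by (induction n) (auto intro: S_props)

lemma S_finsum: "finite A \<Longrightarrow> (\<And>i. i \<in> A \<Longrightarrow> g i \<in> S) \<Longrightarrow> (\<Oplus>i\<in>A. g i) \<in> S"
proof (induction A rule: finite_induct)
  case (insert a A)
  then have "g \<in> A \<rightarrow> carrier K" "g a \<in> carrier K" using S_carrier by auto
  then show ?case using insert by (auto simp: S_props)
qed (simp add: S_props)

lemma S_eval: "set qs \<subseteq> S \<Longrightarrow> x \<in> S \<Longrightarrow> eval qs x \<in> S"
  by (induction qs) (auto intro!: S_props(5,6) S_pow simp: S_props)

lemma S_fraction:
  assumes x: "x \<in> carrier K"
  obtains r :: nat where "p [^] r \<otimes> x \<in> S"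
proof -
  obtain qs where qs: "set qs \<subseteq> carrier K \<inter> F" "eval (\<one> # qs) x = \<zero>"
    by (rule charpoly[OF carrier_is_subring _ x]) auto
  have "\<exists>r::nat. \<forall>q\<in>set qs. p [^] r \<otimes> q \<in> V"
    using qs(1)
  proof (induction qs)
    case (Cons q qs)
    then obtain r1 :: nat where r1: "\<forall>q\<in>set qs. p [^] r1 \<otimes> q \<in> V" by auto
    obtain r2 :: nat where r2: "p [^] r2 \<otimes> q \<in> V" using frac[of q] Cons.prems by auto
    note r = r1 r2
    have "p [^] (r1 + r2) \<otimes> q' \<in> V" if "q' \<in> set (q # qs)" for q'
      using that r p_pow_mono[of r1 q' "r1 + r2"] p_pow_mono[of r2 q' "r1 + r2"] Cons.prems by auto
    then show ?case by blast
  qed simp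
  then obtain r :: nat where r: "\<And>q. q \<in> set qs \<Longrightarrow> p [^] r \<otimes> q \<in> V" by blast
  define c where "c = p [^] r"
  have c: "c \<in> carrier K" "c \<in> V" using V_pow p_V by (auto simp: c_def)
  \<comment> \<open>The usual substitution \<open>X \<mapsto> c X\<close>: in a list of length
    \<open>n\<close> the coefficient of \<open>X^j\<close> is multiplied by
    \<open>c^(n - j)\<close>. As \<open>j < n\<close>, each coefficient receives at least one factor
    \<open>c\<close> to clear its denominator.\<close>
  have scale: "\<exists>qs'. set qs' \<subseteq> V \<and> length qs' = length qs \<and> eval qs' (c \<otimes> x) = c [^] length qs \<otimes> eval qs x"
    if "set qs \<subseteq> carrier K" "\<And>q. q \<in> set qs \<Longrightarrow> c \<otimes> q \<in> V" for qs
    using that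
  proof (induction qs)
    case (Cons q qs)
    then obtain qs' where qs': "set qs' \<subseteq> V" "length qs' = length qs"
      "eval qs' (c \<otimes> x) = c [^] length qs \<otimes> eval qs x" by auto
    have map: "eval (map ((\<otimes>) c) qs') y = c \<otimes> eval qs' y" if "y \<in> carrier K" for y
      using qs'(1)
    proof (induction qs')
      case (Cons a as)
      then have "a \<in> carrier K" "set as \<subseteq> carrier K" "eval as y \<in> carrier K"
        using V_carrier that by (auto intro!: eval_in_carrier)
      then show ?case using Cons c that by (simp add: r_distr m_ac)
    qed (simp add: c)
    have cl: "eval qs x \<in> carrier K" "q \<in> carrier K" using Cons.prems x by (auto intro!: eval_in_carrier)
    show ?case
      by (rule exI[of _ "(c \<otimes> q) # map ((\<otimes>) c) qs'"])
         (use Cons.prems qs' map[of "c \<otimes> x"] cl c x in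
           \<open>auto simp: nat_pow_distrib r_distr m_ac intro: V_props(5)\<close>)
  qed simp
  then obtain qs' where qs': "set qs' \<subseteq> V" "length qs' = length qs" "eval qs' (c \<otimes> x) = c [^] length qs \<otimes> eval qs x"
    using qs r unfolding c_def by (metis Int_subset_iff)
  have "eval qs x \<in> carrier K" using qs x by (intro eval_in_carrier) auto
  then have "eval (\<one> # qs') (c \<otimes> x) = c [^] length qs \<otimes> eval (\<one> # qs) x"
    using qs' x c by (simp add: r_distr nat_pow_distrib)
  also have "\<dots> = \<zero>" using qs c by simp
  finally have "c \<otimes> x \<in> S" using integral_imp_power_bounded[of "c \<otimes> x" qs'] qs' c x by simp
  then show ?thesis using that c_def by blast
qed

text \<open>A power of \<open>p\<close> moves \<open>t\<close> into \<open>S\<close>; the trace of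
  an element of \<open>S\<close> then lies in \<open>S\<close> and in \<open>F\<close>, hence in
  \<open>V\<close>.\<close>

lemma bounded_S: "bounded S"
  unfolding bounded_def
proof
  fix t assume t: "t \<in> carrier K"
  obtain r :: nat where r: "p [^] r \<otimes> t \<in> S" using S_fraction t by blast
  have "p [^] r \<otimes> Tr (t \<otimes> x) \<in> V" if x: "x \<in> S" for x
  proof -
    have xK: "x \<in> carrier K" using S_carrier x by simp
    have "p [^] r \<otimes> Tr (t \<otimes> x) = Tr (p [^] r \<otimes> t \<otimes> x)"
      using Tr_F_mult[OF subsetD[OF V_F V_pow[OF p_V]], of "t \<otimes> x"] t xK by (simp add: m_assoc)
    moreover have "Tr (p [^] r \<otimes> t \<otimes> x) \<in> S"
      unfolding Tr_def using power_bounded_act[OF S_props(5)[OF r x]] fin_G by (intro S_finsum)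
    ultimately show ?thesis using power_bounded_F[of "p [^] r \<otimes> Tr (t \<otimes> x)"] Tr_F[of "p [^] r \<otimes> t \<otimes> x"] t xK by simp
  qed
  then show "\<exists>r::nat. \<forall>x\<in>S. p [^] r \<otimes> Tr (t \<otimes> x) \<in> V" by blast
qed

text \<open>Since \<open>S\<close> as a whole is bounded, a common denominator for the powers of
  \<open>x\<close> makes them bounded. This form of normality is what later refutes membership
  statements about a quotient \<open>b / p\<close> outside \<open>S\<close>.\<close>

lemma S_completely_integrally_closed:
  assumes x: "x \<in> carrier K" and r: "\<And>n::nat. p [^] (r::nat) \<otimes> x [^] n \<in> S"
  shows "x \<in> S"
proof -
  have "bounded (range (\<lambda>n::nat. x [^] n))" unfolding bounded_def
  proof
    fix t assume t: "t \<in> carrier K"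
    obtain k :: nat where k: "\<And>y. y \<in> S \<Longrightarrow> p [^] k \<otimes> Tr (t \<otimes> y) \<in> V"
      using bspec[OF bounded_S[unfolded bounded_def] t] by blast
    have "p [^] (k + r) \<otimes> Tr (t \<otimes> x [^] n) \<in> V" for n :: nat
    proof -
      have "p [^] r \<in> F" using V_pow p_V V_F by auto
      then have "Tr (t \<otimes> (p [^] r \<otimes> x [^] n)) = p [^] r \<otimes> Tr (t \<otimes> x [^] n)"
        using Tr_F_mult[of "p [^] r" "t \<otimes> x [^] n"] t x by (simp add: m_ac)
      then show ?thesis using k[OF r[of n]] t x by (simp add: nat_pow_mult[symmetric] m_assoc)
    qed
    then show "\<exists>r::nat. \<forall>x\<in>range (\<lambda>n::nat. x [^] n). p [^] r \<otimes> Tr (t \<otimes> x) \<in> V" by blast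
  qed
  then show ?thesis using x by (simp add: power_bounded_def)
qed

text \<open>The identity contributes the factor \<open>y\<close>, the remaining conjugates form the
  cofactor. Through its norm an element of \<open>S\<close> is compared with a power of
  \<open>p\<close>.\<close>

lemma norm_S:
  assumes y: "y \<in> S"
  shows "(\<Otimes>\<alpha>\<in>carrier G. \<alpha> y) \<in> V" "\<exists>z\<in>S. (\<Otimes>\<alpha>\<in>carrier G. \<alpha> y) = y \<otimes> z"
    "y \<noteq> \<zero> \<Longrightarrow> (\<Otimes>\<alpha>\<in>carrier G. \<alpha> y) \<noteq> \<zero>"
proof -
  have yK: "y \<in> carrier K" using S_carrier y by simp
  have prod_S: "(\<Otimes>\<alpha>\<in>A. \<alpha> y) \<in> S" if "finite A" "A \<subseteq> carrier G" for A
    using that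
  proof (induction A rule: finite_induct)
    case (insert \<alpha> A)
    then have "(\<lambda>\<alpha>. \<alpha> y) \<in> A \<rightarrow> carrier K" "\<alpha> y \<in> carrier K" using yK by auto
    then show ?case using insert S_props(5)[OF power_bounded_act[OF y]] by auto
  qed (simp add: S_props)
  have "\<tau> (\<Otimes>\<alpha>\<in>carrier G. \<alpha> y) = (\<Otimes>\<alpha>\<in>carrier G. \<alpha> y)" if \<tau>: "\<tau> \<in> carrier G" for \<tau>
  proof -
    interpret h: ring_hom_cring K K \<tau> using act_ring_hom_cring \<tau> by auto
    have "\<tau> (\<Otimes>\<alpha>\<in>carrier G. \<alpha> y) = (\<Otimes>\<alpha>\<in>carrier G. \<tau> (\<alpha> y))"
      using h.hom_finprod[of "\<lambda>\<alpha>. \<alpha> y" "carrier G"] yK by (simp add: comp_def)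
    also have "\<dots> = (\<Otimes>\<alpha>\<in>carrier G. (\<tau> \<otimes>\<^bsub>G\<^esub> \<alpha>) y)"
      using yK \<tau> by (intro finprod_cong') (auto simp: act_comp)
    also have "\<dots> = (\<Otimes>\<alpha>\<in>(\<lambda>\<alpha>. \<tau> \<otimes>\<^bsub>G\<^esub> \<alpha>) ` carrier G. \<alpha> y)"
      using \<tau> yK by (intro finprod_reindex[symmetric]) (auto simp: G.surj_const_mult G.inj_on_cmult)
    finally show ?thesis using \<tau> by (simp add: G.surj_const_mult)
  qed
  then have "(\<Otimes>\<alpha>\<in>carrier G. \<alpha> y) \<in> F" using yK by (intro F_I finprod_closed) auto
  then show "(\<Otimes>\<alpha>\<in>carrier G. \<alpha> y) \<in> V" using prod_S[OF fin_G] power_bounded_F by auto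
  have "(\<Otimes>\<alpha>\<in>insert \<one>\<^bsub>G\<^esub> (carrier G - {\<one>\<^bsub>G\<^esub>}). \<alpha> y) = \<one>\<^bsub>G\<^esub> y \<otimes> (\<Otimes>\<alpha>\<in>carrier G - {\<one>\<^bsub>G\<^esub>}. \<alpha> y)"
    using fin_G yK by (intro finprod_insert) auto
  moreover have "insert \<one>\<^bsub>G\<^esub> (carrier G - {\<one>\<^bsub>G\<^esub>}) = carrier G" by auto
  ultimately show "\<exists>z\<in>S. (\<Otimes>\<alpha>\<in>carrier G. \<alpha> y) = y \<otimes> z"
    using prod_S[of "carrier G - {\<one>\<^bsub>G\<^esub>}"] fin_G yK by (auto simp: act_one)
  have "(\<Otimes>\<alpha>\<in>A. \<alpha> y) \<noteq> \<zero>" if "finite A" "A \<subseteq> carrier G" "y \<noteq> \<zero>" for A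
    using that
  proof (induction A rule: finite_induct)
    case (insert \<alpha> A)
    then have "(\<lambda>\<alpha>. \<alpha> y) \<in> A \<rightarrow> carrier K" "\<alpha> y \<in> carrier K" using yK by auto
    then show ?case using insert yK by (auto simp: integral_iff act_eq_zero_iff)
  qed simp
  then show "y \<noteq> \<zero> \<Longrightarrow> (\<Otimes>\<alpha>\<in>carrier G. \<alpha> y) \<noteq> \<zero>" using fin_G by auto
qed

lemma p_divides_S_iff_V:
  assumes "z \<in> S" "p \<otimes> z \<in> V"
  shows "z \<in> V"
proof (rule power_bounded_F[OF assms(1)])
  have z: "z \<in> carrier K" using S_carrier assms by simp
  show "z \<in> F"
  proof (rule F_I[OF z])
    fix \<alpha> assume \<alpha>: "\<alpha> \<in> carrier G"
    have "p \<otimes> \<alpha> z = p \<otimes> z"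
      using F_act[OF subsetD[OF V_F assms(2)] \<alpha>] F_act[OF subsetD[OF V_F p_V] \<alpha>] act_mult[OF \<alpha> p_closed z] by simp
    then show "\<alpha> z = z" using m_lcancel[OF p_nz p_closed, of "\<alpha> z" z] \<alpha> z by simp
  qed
qed

lemma p_nonunit_S: "z \<in> S \<Longrightarrow> p \<otimes> z \<noteq> \<one>"
  using p_divides_S_iff_V[of z] p_nonunit V_props by auto

abbreviation SK :: "('a, 'b) ring_scheme" where "SK \<equiv> K\<lparr>carrier := S\<rparr>"

lemma SK_domain: "domain SK"
  by (rule subring_is_domain[OF power_bounded_subring])

lemma SK_cring: "cring SK"
  using SK_domain by (simp add: domain_def)

lemma SK_minus: "x \<in> S \<Longrightarrow> \<ominus>\<^bsub>SK\<^esub> x = \<ominus> x"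
proof -
  assume x: "x \<in> S"
  interpret SK: cring SK by (rule SK_cring)
  have "\<ominus> x \<oplus>\<^bsub>SK\<^esub> x = \<zero>\<^bsub>SK\<^esub>" using x S_carrier by (simp add: l_neg)
  then show ?thesis using SK.minus_equality[of "\<ominus> x" x] x S_props by simp
qed

end

section \<open>Maximal ideals of the integral closure\<close>

locale finite_galois_dvr = galois_dvr +
  assumes F_subfield: "subfield F K" and fin_dim: "finite_dimension F (carrier K)"

locale galois_dvr_max = finite_galois_dvr +
  fixes M :: "'a set"
  assumes M_max: "maximalideal M SK"
begin

lemma M_ideal: "ideal M SK"
  using M_max by (simp add: maximalideal.axioms)

lemma M_S: "m \<in> M \<Longrightarrow> m \<in> S"
  using ideal.Icarr[OF M_ideal] by simp

lemma M_carrier: "m \<in> M \<Longrightarrow> m \<in> carrier K"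
  using M_S S_carrier by simp

lemma M_add: "m \<in> M \<Longrightarrow> m' \<in> M \<Longrightarrow> m \<oplus> m' \<in> M"
  using additive_subgroup.a_closed[OF ideal.axioms(1)[OF M_ideal]] by simp

lemma M_zero: "\<zero> \<in> M"
  using additive_subgroup.zero_closed[OF ideal.axioms(1)[OF M_ideal]] by simp

lemma M_mult: "a \<in> S \<Longrightarrow> m \<in> M \<Longrightarrow> a \<otimes> m \<in> M"
  using ideal.I_l_closed[OF M_ideal] by simp

lemma M_mult': "m \<in> M \<Longrightarrow> a \<in> S \<Longrightarrow> m \<otimes> a \<in> M"
  using ideal.I_r_closed[OF M_ideal] by simp

lemma M_uminus: "m \<in> M \<Longrightarrow> \<ominus> m \<in> M"
  using M_mult[of "\<ominus> \<one>" m] S_props M_carrier by (simp add: l_minus)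

lemma M_minus: "m \<in> M \<Longrightarrow> m' \<in> M \<Longrightarrow> m \<ominus> m' \<in> M"
  by (simp add: minus_eq M_add M_uminus)

lemma one_notin_M: "\<one> \<notin> M"
proof
  assume "\<one> \<in> M"
  then have "a \<in> M" if "a \<in> S" for a using M_mult[OF that] S_carrier that by fastforce
  then have "M = carrier SK" using M_S by auto
  then show False using maximalideal.I_notcarr[OF M_max] by simp
qed

lemma M_prime: "a \<in> S \<Longrightarrow> b \<in> S \<Longrightarrow> a \<otimes> b \<in> M \<Longrightarrow> a \<in> M \<or> b \<in> M"
  using primeideal.I_prime[OF cring.maximalideal_prime[OF SK_cring M_max]] by simp

lemma M_prime': "a \<in> S - M \<Longrightarrow> b \<in> S - M \<Longrightarrow> a \<otimes> b \<in> S - M"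
  using M_prime S_props by auto

lemma M_prime_pow: "a \<in> S - M \<Longrightarrow> a [^] (n::nat) \<in> S - M"
proof (induction n)
  case (Suc n) then show ?case using M_prime'[of "a [^] n" a] by simp
qed (simp add: one_notin_M S_props)

lemma M_inverse:
  assumes a: "a \<in> S" "a \<notin> M"
  obtains b where "b \<in> S" "a \<otimes> b \<ominus> \<one> \<in> M"
proof -
  interpret SK: cring SK by (rule SK_cring)
  interpret M: maximalideal M SK by (rule M_max)
  let ?I = "{m \<oplus> a \<otimes> b | m b. m \<in> M \<and> b \<in> S}"
  have I_ideal: "ideal ?I SK"
  proof (rule idealI)
    show "ring SK" by (rule SK.ring_axioms)
    show "subgroup ?I (add_monoid SK)"
    proof (rule SK.add.subgroupI)
      show "?I \<subseteq> carrier SK" using M_S a by (auto intro!: S_props)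
      show "?I \<noteq> {}" using M_zero S_props by auto
      fix x assume "x \<in> ?I"
      then obtain m b where mb: "m \<in> M" "b \<in> S" "x = m \<oplus> a \<otimes> b" by auto
      have "\<ominus> x = \<ominus> m \<oplus> a \<otimes> (\<ominus> b)" using mb a M_carrier S_carrier by (simp add: minus_add r_minus)
      moreover have "x \<in> S" using mb a M_S by (auto intro!: S_props)
      ultimately have "\<ominus>\<^bsub>SK\<^esub> x = \<ominus> m \<oplus> a \<otimes> (\<ominus> b)" by (simp add: SK_minus)
      then show "\<ominus>\<^bsub>SK\<^esub> x \<in> ?I" using M_uminus[OF mb(1)] S_props(4)[OF mb(2)] by blast
      fix y assume "y \<in> ?I"
      then obtain m' b' where mb': "m' \<in> M" "b' \<in> S" "y = m' \<oplus> a \<otimes> b'" by auto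
      have "x \<oplus> y = (m \<oplus> m') \<oplus> a \<otimes> (b \<oplus> b')"
        using mb mb' a M_carrier S_carrier by (simp add: r_distr a_ac)
      then have "x \<oplus>\<^bsub>SK\<^esub> y = (m \<oplus> m') \<oplus> a \<otimes> (b \<oplus> b')" by simp
      then show "x \<oplus>\<^bsub>SK\<^esub> y \<in> ?I" using M_add[OF mb(1) mb'(1)] S_props(6)[OF mb(2) mb'(2)] by blast
    qed
    fix x c assume "x \<in> ?I" and c: "c \<in> carrier SK"
    then obtain m b where mb: "m \<in> M" "b \<in> S" "x = m \<oplus> a \<otimes> b" by auto
    have "c \<otimes> x = c \<otimes> m \<oplus> a \<otimes> (c \<otimes> b)" using mb c a M_carrier S_carrier by (simp add: r_distr m_ac)
    then have "c \<otimes>\<^bsub>SK\<^esub> x = c \<otimes> m \<oplus> a \<otimes> (c \<otimes> b)" by simp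
    then show *: "c \<otimes>\<^bsub>SK\<^esub> x \<in> ?I" using M_mult[of c m] S_props(5)[of c b] mb c by auto
    have "x \<in> S" using mb a M_S by (auto intro!: S_props)
    then show "x \<otimes>\<^bsub>SK\<^esub> c \<in> ?I" using * c SK.m_comm by simp
  qed
  have MI: "M \<subseteq> ?I"
  proof
    fix m assume "m \<in> M"
    then have "m = m \<oplus> a \<otimes> \<zero>" using M_carrier a S_carrier by simp
    then show "m \<in> ?I" using \<open>m \<in> M\<close> S_props(2) by blast
  qed
  have IS: "?I \<subseteq> carrier SK" using M_S a by (auto intro!: S_props)
  have disj: "?I = M \<or> ?I = carrier SK" by (rule M.I_maximal[OF I_ideal MI IS])
  have "a = \<zero> \<oplus> a \<otimes> \<one>" using a S_carrier by simp
  then have "a \<in> ?I" using M_zero S_props(3) by blast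
  then have "?I \<noteq> M" using a(2) by metis
  then have eq: "?I = carrier SK" using disj by metis
  have "\<one> \<in> carrier SK" using S_props(3) by simp
  then have "\<one> \<in> ?I" by (simp only: eq)
  then obtain m b where mb: "m \<in> M" "b \<in> S" "\<one> = m \<oplus> a \<otimes> b" by blast
  have K: "m \<in> carrier K" "a \<otimes> b \<in> carrier K" using M_carrier S_carrier mb a by auto
  have "a \<otimes> b \<ominus> \<one> = \<ominus> m" using K unfolding mb(3) by algebra
  then show ?thesis using that mb M_uminus by simp
qed

text \<open>The norm takes the place of lying over. If \<open>p b - 1\<close> were in
  \<open>M\<close>, its norm would lie in \<open>M\<close> and in \<open>V\<close> and be congruent
  to 1 or -1 modulo \<open>p S\<close>. Such an element of \<open>V\<close> is not divisible by
  \<open>p\<close>, so it is a unit inside \<open>M\<close>.\<close>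

lemma p_M: "p \<in> M"
proof (rule ccontr)
  assume "p \<notin> M"
  then obtain b where b: "b \<in> S" "p \<otimes> b \<ominus> \<one> \<in> M" using M_inverse p_S by blast
  define y where "y = p \<otimes> b \<ominus> \<one>"
  have y: "y \<in> S" "y \<in> M" using b by (auto simp: y_def intro!: S_minus S_props)
  have bK: "b \<in> carrier K" using S_carrier b by simp
  \<comment> \<open>Each conjugate of \<open>y\<close> is \<open>p \<alpha>(b) - 1\<close>, so a
    product of them is a sign modulo \<open>p S\<close>; the sign \<open>e\<close> depends on the
    parity of the number of factors, and \<open>e e = 1\<close> suffices afterwards.\<close>
  have prod: "\<exists>z\<in>S. \<exists>e\<in>{\<one>, \<ominus> \<one>}. (\<Otimes>\<alpha>\<in>A. \<alpha> y) = p \<otimes> z \<oplus> e" if "finite A" "A \<subseteq> carrier G" for A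
    using that
  proof (induction A rule: finite_induct)
    case empty then show ?case using S_props by (intro bexI[of _ \<zero>] bexI[of _ \<one>]) auto
  next
    case (insert \<alpha> A)
    then obtain z e where z: "z \<in> S" "e \<in> {\<one>, \<ominus> \<one>}" "(\<Otimes>\<alpha>\<in>A. \<alpha> y) = p \<otimes> z \<oplus> e" by auto
    have \<alpha>: "\<alpha> \<in> carrier G" using insert by auto
    have zK: "z \<in> carrier K" "\<alpha> b \<in> carrier K" "e \<in> carrier K" using S_carrier z bK \<alpha> by auto
    have "(\<Otimes>\<alpha>\<in>insert \<alpha> A. \<alpha> y) = \<alpha> y \<otimes> (p \<otimes> z \<oplus> e)"
      using insert z y S_carrier by (subst finprod_insert) auto
    also have "\<alpha> y = p \<otimes> \<alpha> b \<ominus> \<one>"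
      using \<alpha> bK F_act[of p \<alpha>] p_V V_F by (auto simp: y_def act_minus act_mult act_1)
    also have "(p \<otimes> \<alpha> b \<ominus> \<one>) \<otimes> (p \<otimes> z \<oplus> e) = p \<otimes> (\<alpha> b \<otimes> (p \<otimes> z \<oplus> e) \<ominus> z) \<oplus> (\<ominus> e)"
      using zK p_closed by algebra
    finally have e1: "(\<Otimes>\<alpha>\<in>insert \<alpha> A. \<alpha> y) = p \<otimes> (\<alpha> b \<otimes> (p \<otimes> z \<oplus> e) \<ominus> z) \<oplus> (\<ominus> e)" .
    have "e \<in> S" using z(2) S_props by auto
    then have e2: "\<alpha> b \<otimes> (p \<otimes> z \<oplus> e) \<ominus> z \<in> S"
      using power_bounded_act[OF b(1) \<alpha>] z(1) by (simp add: S_minus S_props)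
    have "\<ominus> e \<in> {\<one>, \<ominus> \<one>}" using z(2) by auto
    then show ?case using e1 e2 by blast
  qed
  obtain z e where z: "z \<in> S" "e \<in> {\<one>, \<ominus> \<one>}" "(\<Otimes>\<alpha>\<in>carrier G. \<alpha> y) = p \<otimes> z \<oplus> e"
    using prod[OF fin_G] by auto
  have zK: "z \<in> carrier K" "e \<in> carrier K" "e \<otimes> e = \<one>" using S_carrier z by (auto simp: l_minus r_minus)
  have eS: "e \<in> V" using z V_props by auto
  have N: "(\<Otimes>\<alpha>\<in>carrier G. \<alpha> y) \<in> V" "(\<Otimes>\<alpha>\<in>carrier G. \<alpha> y) \<in> M"
    using norm_S[OF y(1)] y M_mult' by auto
  have "(\<exists>a\<in>V. p \<otimes> z \<oplus> e = p \<otimes> a) \<or> (\<exists>a\<in>V. (p \<otimes> z \<oplus> e) \<otimes> a = \<one>)" using V_local N(1) z(3) by simp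
  then show False
  proof
    assume "\<exists>a\<in>V. p \<otimes> z \<oplus> e = p \<otimes> a"
    then obtain a where a: "a \<in> V" "p \<otimes> z \<oplus> e = p \<otimes> a" by auto
    have aK: "a \<in> carrier K" using V_carrier a by simp
    have "p \<otimes> (e \<otimes> (a \<ominus> z)) = e \<otimes> (p \<otimes> a \<ominus> p \<otimes> z)" using aK zK p_closed by algebra
    also have "\<dots> = e \<otimes> (p \<otimes> z \<oplus> e \<ominus> p \<otimes> z)" using a by simp
    also have "\<dots> = e \<otimes> e" using zK p_closed by algebra
    finally have "p \<otimes> (e \<otimes> (a \<ominus> z)) = \<one>" using zK by simp
    moreover have "e \<otimes> (a \<ominus> z) \<in> S" by (intro S_minus S_props(5) V_S eS a(1) z(1))
    ultimately show False using p_nonunit_S by blast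
  next
    assume "\<exists>a\<in>V. (p \<otimes> z \<oplus> e) \<otimes> a = \<one>"
    then show False using N(2) z(3) M_mult' V_S one_notin_M by metis
  qed
qed

end

section \<open>Linear relations over \<open>V\<close> and independence modulo
  \<open>p\<close>\<close>

context finite_galois_dvr
begin

lemma combine_scale:
  assumes "a \<in> carrier K" "set cs \<subseteq> carrier K" "set xs \<subseteq> carrier K"
  shows "combine (map ((\<otimes>) a) cs) xs = a \<otimes> combine cs xs"
  using assms(2,3)
proof (induction cs xs rule: combine.induct)
  case (1 k ks x xs)
  have "combine ks xs \<in> carrier K" by (rule combine_in_carrier) (use 1 in auto)
  then show ?case using 1 assms(1) by (simp add: r_distr m_assoc)
qed (simp_all add: assms(1))

text \<open>The bound is the dimension of \<open>K\<close> over \<open>F\<close>. A relation over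
  \<open>F\<close> is cleared of denominators and then divided by \<open>p\<close> as long as
  possible, so that it stays nontrivial modulo \<open>p\<close>.\<close>

lemma V_dependent:
  obtains d where "\<And>xs. set xs \<subseteq> carrier K \<Longrightarrow> d < length xs \<Longrightarrow>
    \<exists>cs. set cs \<subseteq> V \<and> length cs = length xs \<and> combine cs xs = \<zero> \<and> (\<exists>c\<in>set cs. \<forall>b\<in>V. c \<noteq> p \<otimes> b)"
proof -
  obtain d where d: "dimension d F (carrier K)" using fin_dim by auto
  have "\<exists>cs. set cs \<subseteq> V \<and> length cs = length xs \<and> combine cs xs = \<zero> \<and> (\<exists>c\<in>set cs. \<forall>b\<in>V. c \<noteq> p \<otimes> b)"
    if xs: "set xs \<subseteq> carrier K" "d < length xs" for xs
  proof -
    have "dependent F xs"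
      using independent_length_le_dimension[OF F_subfield d _ xs(1)] xs(2) by auto
    then obtain ks where ks: "length ks = length xs" "combine ks xs = \<zero>" "set ks \<subseteq> F" "set ks \<noteq> {\<zero>}"
      using dependent_imp_non_trivial_combine[OF F_subfield, of xs] xs by blast
    have "\<exists>r::nat. \<forall>q\<in>set ks. p [^] r \<otimes> q \<in> V"
      using ks(3)
    proof (induction ks)
      case (Cons q qs)
      then obtain r1 :: nat where r1: "\<forall>q\<in>set qs. p [^] r1 \<otimes> q \<in> V" by auto
      obtain r2 :: nat where r2: "p [^] r2 \<otimes> q \<in> V" using frac[of q] Cons.prems by auto
      have "p [^] (r1 + r2) \<otimes> q' \<in> V" if "q' \<in> set (q # qs)" for q'
        using that r1 r2 p_pow_mono[of r1 q' "r1 + r2"] p_pow_mono[of r2 q' "r1 + r2"] Cons.prems F_carrier by auto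
      then show ?case by blast
    qed simp
    then obtain r :: nat where r: "\<And>q. q \<in> set ks \<Longrightarrow> p [^] r \<otimes> q \<in> V" by blast
    define cs where "cs = map ((\<otimes>) (p [^] r)) ks"
    have ksK: "set ks \<subseteq> carrier K" using ks(3) F_carrier by auto
    have cs: "set cs \<subseteq> V" "length cs = length xs" "combine cs xs = \<zero>"
      using r ks combine_scale[OF _ ksK xs(1), of "p [^] r"] by (auto simp: cs_def)
    have "ks \<noteq> []" using ks(1) xs(2) by auto
    then have "\<exists>q\<in>set ks. q \<noteq> \<zero>" using ks(4) by (cases ks) auto
    then obtain q where q: "q \<in> set ks" "q \<noteq> \<zero>" by auto
    then have "p [^] r \<otimes> q \<noteq> \<zero>" using integral[of "p [^] r" q] ksK by auto
    then have "\<exists>c\<in>set cs. c \<noteq> \<zero>" using q by (auto simp: cs_def)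
    then obtain c k u where c: "c \<in> set cs" "c = u \<otimes> p [^] (k::nat)" "u \<in> V" "\<exists>w\<in>V. u \<otimes> w = \<one>"
      using V_decomp cs(1) by blast
    \<comment> \<open>Induction on the exponent \<open>k\<close> of \<open>p\<close> in one nonzero
      coefficient \<open>c\<close>: if \<open>p\<close> divides all coefficients, dividing the whole
      relation by \<open>p\<close> lowers \<open>k\<close>.\<close>
    have "\<exists>cs. set cs \<subseteq> V \<and> length cs = length xs \<and> combine cs xs = \<zero> \<and> (\<exists>c\<in>set cs. \<forall>b\<in>V. c \<noteq> p \<otimes> b)"
      using cs c(1,2)
    proof (induction k arbitrary: cs c)
      case 0
      obtain w where w: "w \<in> V" "u \<otimes> w = \<one>" using c(4) by auto
      have "u \<noteq> p \<otimes> b" if "b \<in> V" for b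
      proof
        assume "u = p \<otimes> b"
        then have "p \<otimes> (b \<otimes> w) = \<one>" using w that V_carrier by (simp add: m_assoc)
        then show False using p_nonunit V_props(5) that w by blast
      qed
      then show ?case using 0 c(3) V_carrier by (intro exI[of _ cs]) auto
    next
      case (Suc k)
      show ?case
      proof (cases "\<exists>c\<in>set cs. \<forall>b\<in>V. c \<noteq> p \<otimes> b")
        case True then show ?thesis using Suc by blast
      next
        case False
        then have "\<forall>c. \<exists>b. c \<in> set cs \<longrightarrow> b \<in> V \<and> c = p \<otimes> b" by blast
        then obtain h where h: "\<And>c. c \<in> set cs \<Longrightarrow> h c \<in> V \<and> c = p \<otimes> h c" by metis
        define cs' where "cs' = map h cs"
        have cs'K: "set cs' \<subseteq> V" "set cs' \<subseteq> carrier K" using h V_carrier by (auto simp: cs'_def)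
        have "map ((\<otimes>) p) cs' = cs" using h by (auto simp: cs'_def intro: map_idI)
        then have "p \<otimes> combine cs' xs = \<zero>" using combine_scale[OF p_closed cs'K(2) xs(1)] Suc by simp
        then have "combine cs' xs = \<zero>"
          using integral[of p "combine cs' xs"] p_nz combine_in_carrier[OF cs'K(2) xs(1)] by auto
        moreover have "h c = u \<otimes> p [^] k"
        proof -
          have "p \<otimes> h c = p \<otimes> (u \<otimes> p [^] k)" using h[of c] Suc.prems c(3) V_carrier by (simp add: m_ac)
          then show ?thesis using m_lcancel[OF p_nz p_closed, of "h c" "u \<otimes> p [^] k"] h[of c] Suc.prems c(3) V_carrier by simp
        qed
        moreover have "h c \<in> set cs'" using Suc.prems by (simp add: cs'_def)
        ultimately show ?thesis using Suc.IH[of cs' "h c"] cs'K Suc.prems by (simp add: cs'_def)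
      qed
    qed
    then show ?thesis .
  qed
  then show ?thesis using that by blast
qed

definition pS :: "'a set" where "pS = {p \<otimes> z | z. z \<in> S}"

lemma pS_add: "a \<in> pS \<Longrightarrow> b \<in> pS \<Longrightarrow> a \<oplus> b \<in> pS"
proof -
  assume "a \<in> pS" "b \<in> pS"
  then obtain y z where yz: "y \<in> S" "z \<in> S" "a = p \<otimes> y" "b = p \<otimes> z" by (auto simp: pS_def)
  then have "a \<oplus> b = p \<otimes> (y \<oplus> z)" using S_carrier by (simp add: r_distr)
  then show ?thesis using yz S_props(6) unfolding pS_def by blast
qed

lemma pS_mult: "a \<in> pS \<Longrightarrow> s \<in> S \<Longrightarrow> s \<otimes> a \<in> pS"
proof -
  assume "a \<in> pS" and s: "s \<in> S"
  then obtain y where y: "y \<in> S" "a = p \<otimes> y" by (auto simp: pS_def)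
  then have "s \<otimes> a = p \<otimes> (s \<otimes> y)" using S_carrier s by (simp add: m_ac)
  then show ?thesis using y s S_props(5) unfolding pS_def by blast
qed

lemma pS_S: "a \<in> pS \<Longrightarrow> a \<in> S"
  by (auto simp: pS_def S_props)

text \<open>Linear independence of the residues in \<open>S/pS\<close> over \<open>V/pV\<close>,
  phrased with coefficients in \<open>V\<close>. Together with \<open>V_dependent\<close> it bounds
  the length of such lists, which is the ascending chain condition in the form used below.\<close>

definition indep_mod_p :: "'a list \<Rightarrow> bool" where
  "indep_mod_p xs \<longleftrightarrow> (\<forall>cs. set cs \<subseteq> V \<longrightarrow> length cs = length xs \<longrightarrow> combine cs xs \<in> pS \<longrightarrow>
     (\<forall>c\<in>set cs. \<exists>b\<in>V. c = p \<otimes> b))"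

text \<open>If the coefficient of \<open>y\<close> were a unit, \<open>y\<close> would lie in
  \<open>Q\<close>. So \<open>p\<close> divides it, its term moves into \<open>p S\<close>, and the
  independence of \<open>xs\<close> applies. Consequently an ideal strictly above \<open>Q\<close>
  contains a longer independent list.\<close>

lemma indep_mod_p_Cons:
  assumes Q: "\<And>a b. a \<in> Q \<Longrightarrow> b \<in> Q \<Longrightarrow> a \<oplus> b \<in> Q" "\<And>s a. s \<in> S \<Longrightarrow> a \<in> Q \<Longrightarrow> s \<otimes> a \<in> Q" "pS \<subseteq> Q" "Q \<subseteq> S"
    and xs: "set xs \<subseteq> Q" "indep_mod_p xs" and y: "y \<in> S" "y \<notin> Q"
  shows "indep_mod_p (y # xs)"
  unfolding indep_mod_p_def
proof (intro allI impI)
  fix cs assume cs: "set cs \<subseteq> V" "length cs = length (y # xs)" "combine cs (y # xs) \<in> pS"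
  obtain c ks where ck: "cs = c # ks" "length ks = length xs" using cs(2) by (cases cs) auto
  have c: "c \<in> V" "c \<in> S" "set ks \<subseteq> V" using cs ck V_S by auto
  have "\<zero> = p \<otimes> \<zero>" by simp
  then have zero: "\<zero> \<in> pS" unfolding pS_def using S_props(2) by blast
  have comb: "combine ks xs \<in> Q" if "set ks \<subseteq> V" "set xs \<subseteq> Q" for ks xs
    using that
  proof (induction ks xs rule: combine.induct)
    case (1 k ks x xs)
    then show ?case using Q(1,2) V_S by simp
  qed (use zero Q(3) in auto)
  have K: "combine ks xs \<in> carrier K" "c \<in> carrier K" "y \<in> carrier K"
    using comb[OF c(3) xs(1)] Q(4) S_carrier c y by auto
  have "\<exists>b\<in>V. c = p \<otimes> b"
  proof (rule ccontr)
    assume "\<not> ?thesis"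
    then obtain w where w: "w \<in> V" "c \<otimes> w = \<one>" using V_local c(1) by blast
    have wS: "w \<in> S" "w \<in> carrier K" using V_S V_carrier w by auto
    have "y = (c \<otimes> w) \<otimes> y" using w K by simp
    also have "\<dots> = w \<otimes> ((c \<otimes> y \<oplus> combine ks xs) \<oplus> \<ominus> \<one> \<otimes> combine ks xs)"
      using K wS by algebra
    also have "\<dots> \<in> Q"
    proof -
      have "c \<otimes> y \<oplus> combine ks xs \<in> Q" using cs(3) ck Q(3) by auto
      moreover have "\<ominus> \<one> \<otimes> combine ks xs \<in> Q" by (rule Q(2)[OF S_props(4)[OF S_props(3)] comb[OF c(3) xs(1)]])
      ultimately show ?thesis by (rule Q(2)[OF wS(1) Q(1)])
    qed
    finally show False using y by simp
  qed
  then obtain b where b: "b \<in> V" "c = p \<otimes> b" by auto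
  have "combine ks xs = (c \<otimes> y \<oplus> combine ks xs) \<oplus> \<ominus> \<one> \<otimes> (y \<otimes> (p \<otimes> b))"
    unfolding b(2)[symmetric] using K by algebra
  also have "\<dots> \<in> pS"
  proof (rule pS_add)
    show "c \<otimes> y \<oplus> combine ks xs \<in> pS" using cs(3) ck by simp
    have "p \<otimes> b \<in> pS" using b V_S unfolding pS_def by blast
    then show "\<ominus> \<one> \<otimes> (y \<otimes> (p \<otimes> b)) \<in> pS" using y S_props pS_mult by simp
  qed
  finally have "\<forall>c\<in>set ks. \<exists>b\<in>V. c = p \<otimes> b" using xs(2) c ck unfolding indep_mod_p_def by blast
  then show "\<forall>c\<in>set cs. \<exists>b\<in>V. c = p \<otimes> b" using ck b by auto
qed

end

section \<open>Associated primes of \<open>pS\<close> and the ramification index\<close>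

context galois_dvr_max
begin

lemma pS_M: "pS \<subseteq> M"
  using M_mult'[OF p_M] by (auto simp: pS_def)

text \<open>A prime above \<open>p S\<close> is maximal. In a monic equation of \<open>y\<close>
  over \<open>V\<close>, constant coefficients divisible by \<open>p\<close> are dropped one after
  the other, cancelling a factor \<open>y\<close> by primeness, until a coefficient is a unit of
  \<open>V\<close> and the equation can be solved for an inverse of \<open>y\<close> modulo
  \<open>Q\<close>. The leading 1 ensures that this happens.\<close>

lemma prime_ideal_inverse:
  assumes Q: "\<And>a b. a \<in> Q \<Longrightarrow> b \<in> Q \<Longrightarrow> a \<oplus> b \<in> Q" "\<And>s a. s \<in> S \<Longrightarrow> a \<in> Q \<Longrightarrow> s \<otimes> a \<in> Q" "pS \<subseteq> Q" "Q \<subseteq> S"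
    and prime: "\<And>a b. a \<in> S \<Longrightarrow> b \<in> S \<Longrightarrow> a \<otimes> b \<in> Q \<Longrightarrow> a \<in> Q \<or> b \<in> Q"
    and y: "y \<in> S" "y \<notin> Q"
  shows "\<exists>z\<in>S. y \<otimes> z \<ominus> \<one> \<in> Q"
proof -
  obtain qs where qs: "set qs \<subseteq> S \<inter> F" "eval (\<one> # qs) y = \<zero>"
    by (rule charpoly[OF power_bounded_subring _ y(1)]) (auto intro: power_bounded_act)
  have yK: "y \<in> carrier K" using S_carrier y by simp
  have "\<zero> = p \<otimes> \<zero>" by simp
  then have zero: "\<zero> \<in> Q" using Q(3) S_props(2) unfolding pS_def by blast
  have "set cs \<subseteq> V \<Longrightarrow> eval cs y \<in> Q \<Longrightarrow> \<exists>c\<in>set cs. \<forall>b\<in>V. c \<noteq> p \<otimes> b \<Longrightarrow> \<exists>z\<in>S. y \<otimes> z \<ominus> \<one> \<in> Q" for cs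
  proof (induction cs rule: rev_induct)
    case (snoc c cs)
    have c: "c \<in> V" "c \<in> S" "c \<in> carrier K" "set cs \<subseteq> V" "set cs \<subseteq> S" "set cs \<subseteq> carrier K"
      using snoc.prems V_S V_carrier by auto
    have e: "eval cs y \<in> S" "eval cs y \<in> carrier K" using S_eval[OF c(5) y(1)] S_carrier by auto
    have ev: "eval (cs @ [c]) y = eval cs y \<otimes> y \<oplus> c" using eval_append_aux c yK by simp
    show ?case
    proof (cases "\<exists>b\<in>V. c = p \<otimes> b")
      case True
      then have "c \<in> pS" using V_S unfolding pS_def by blast
      then have cQ: "c \<in> Q" using Q(3) by auto
      have "eval cs y \<otimes> y = (eval cs y \<otimes> y \<oplus> c) \<oplus> \<ominus> \<one> \<otimes> c" using e c yK by algebra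
      also have "\<dots> \<in> Q" using snoc.prems(2) ev cQ Q(1,2) S_props by simp
      finally have "eval cs y \<in> Q" using prime e y by blast
      then show ?thesis using snoc True c by auto
    next
      case False
      then obtain w where w: "w \<in> V" "c \<otimes> w = \<one>" using V_local c(1) by blast
      have wS: "w \<in> S" "w \<in> carrier K" using V_S V_carrier w by auto
      have "y \<otimes> (\<ominus> (w \<otimes> eval cs y)) \<ominus> c \<otimes> w = \<ominus> w \<otimes> (eval cs y \<otimes> y \<oplus> c)"
        using e c yK wS by algebra
      moreover have "\<ominus> w \<otimes> (eval cs y \<otimes> y \<oplus> c) \<in> Q" using snoc.prems(2) ev wS Q(2) S_props by simp
      moreover have "\<ominus> (w \<otimes> eval cs y) \<in> S" using wS e S_props by simp
      ultimately show ?thesis using w(2) by metis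
    qed
  qed simp
  moreover have "set qs \<subseteq> V" using qs power_bounded_F by blast
  moreover have "\<forall>b\<in>V. \<one> \<noteq> p \<otimes> b" using p_nonunit by metis
  ultimately show ?thesis using qs(2) zero V_props(3) by (metis insert_subset list.set_intros(1) list.simps(15))
qed

text \<open>\<open>M\<close> is an associated prime of \<open>S/pS\<close>. The argument is the
  standard one with a maximal annihilator, carried out in the localization at \<open>M\<close> and
  with a dimension count instead of the Noetherian property.\<close>

lemma M_associated:
  obtains b where "b \<in> S" "b \<notin> pS" "\<And>m. m \<in> M \<Longrightarrow> b \<otimes> m \<in> pS"
proof -
  \<comment> \<open>\<open>B\<close> consists of the elements that stay nonzero in the localization
    of \<open>S/pS\<close> at \<open>M\<close>; \<open>Q b\<close> is the annihilator of
    \<open>b\<close> in \<open>S/pS\<close>.\<close>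
  define B where "B = {b \<in> S. \<forall>w\<in>S - M. w \<otimes> b \<notin> pS}"
  define Q where "Q b = {a \<in> S. a \<otimes> b \<in> pS}" for b
  have Q_add: "a \<in> Q b \<Longrightarrow> a' \<in> Q b \<Longrightarrow> a \<oplus> a' \<in> Q b" if "b \<in> S" for a a' b
    using that S_carrier pS_add by (auto simp: Q_def l_distr S_props)
  have Q_mult: "s \<in> S \<Longrightarrow> a \<in> Q b \<Longrightarrow> s \<otimes> a \<in> Q b" if "b \<in> S" for s a b
    using that S_carrier pS_mult by (auto simp: Q_def m_assoc S_props)
  have Q_pS: "pS \<subseteq> Q b" if "b \<in> S" for b
    using that S_carrier pS_mult pS_S m_comm by (auto simp: Q_def)
  have Q_S: "Q b \<subseteq> S" for b by (auto simp: Q_def)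
  obtain d where d: "\<And>xs. set xs \<subseteq> carrier K \<Longrightarrow> d < length xs \<Longrightarrow>
    \<exists>cs. set cs \<subseteq> V \<and> length cs = length xs \<and> combine cs xs = \<zero> \<and> (\<exists>c\<in>set cs. \<forall>b\<in>V. c \<noteq> p \<otimes> b)"
    using V_dependent by blast
  have "\<zero> = p \<otimes> \<zero>" by simp
  then have zero: "\<zero> \<in> pS" using S_props(2) unfolding pS_def by blast
  have len: "length xs \<le> d" if "indep_mod_p xs" "set xs \<subseteq> S" for xs
  proof (rule ccontr)
    assume "\<not> ?thesis"
    moreover have "set xs \<subseteq> carrier K" using that S_carrier by auto
    ultimately obtain cs where "set cs \<subseteq> V" "length cs = length xs" "combine cs xs = \<zero>" "\<exists>c\<in>set cs. \<forall>b\<in>V. c \<noteq> p \<otimes> b"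
      using d[of xs] by auto
    then show False using that(1) zero unfolding indep_mod_p_def by (metis (no_types, lifting))
  qed
  \<comment> \<open>The length of an independent list measures the annihilator that contains it. The
    greatest attainable length selects a \<open>b\<close> whose annihilator cannot grow within
    \<open>B\<close>.\<close>
  define P where "P n \<longleftrightarrow> (\<exists>b\<in>B. \<exists>xs. set xs \<subseteq> Q b \<and> indep_mod_p xs \<and> length xs = n)" for n
  have "P 0"
  proof -
    have "w \<otimes> \<one> \<notin> pS" if "w \<in> S - M" for w using that pS_M S_carrier by auto
    then have "\<one> \<in> B" by (auto simp: B_def S_props)
    then show ?thesis unfolding P_def by (auto simp: indep_mod_p_def intro!: bexI[of _ \<one>])
  qed
  moreover have P_le: "P n \<Longrightarrow> n \<le> d" for n using len Q_S unfolding P_def by blast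
  ultimately have "P (GREATEST n. P n)" by (rule GreatestI_nat)
  then obtain b xs where b: "b \<in> B" and xs: "set xs \<subseteq> Q b" "indep_mod_p xs" "length xs = (GREATEST n. P n)"
    unfolding P_def by blast
  have bS: "b \<in> S" using b by (auto simp: B_def)
  have maxQ: "Q b' \<subseteq> Q b" if b': "b' \<in> B" "Q b \<subseteq> Q b'" for b'
  proof (rule ccontr)
    assume "\<not> ?thesis"
    then obtain y where y: "y \<in> Q b'" "y \<notin> Q b" by auto
    have "indep_mod_p (y # xs)"
      by (rule indep_mod_p_Cons[OF Q_add[OF bS] Q_mult[OF bS] Q_pS[OF bS] Q_S xs(1,2)]) (use y Q_S in auto)
    then have "P (Suc (length xs))" unfolding P_def using b' y xs(1) by (intro bexI[of _ b'] exI[of _ "y # xs"]) auto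
    then show False using Greatest_le_nat[of P "Suc (length xs)" d] P_le xs(3) by auto
  qed
  \<comment> \<open>Multiplying \<open>b\<close> by \<open>w\<close> stays in \<open>B\<close> and
    can only enlarge the annihilator, so by maximality nothing is gained. The same idea with a
    factor \<open>v\<close> outside \<open>Q b\<close> then gives primeness.\<close>
  have sat: "a \<in> Q b" if w: "w \<in> S - M" "w \<otimes> a \<in> Q b" and a: "a \<in> S" for w a
  proof -
    have "w \<otimes> b \<in> B" unfolding B_def
    proof (clarsimp, intro conjI ballI)
      show "w \<otimes> b \<in> S" using w bS S_props by auto
      fix v assume v: "v \<in> S - M"
      have "v \<otimes> w \<in> S - M" using M_prime' v w by blast
      moreover have "v \<otimes> (w \<otimes> b) = (v \<otimes> w) \<otimes> b" using v w bS S_carrier by (simp add: m_assoc)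
      ultimately show "v \<otimes> (w \<otimes> b) \<notin> pS" using b unfolding B_def by auto
    qed
    moreover have "a' \<in> Q (w \<otimes> b)" if "a' \<in> Q b" for a'
    proof -
      have "a' \<otimes> (w \<otimes> b) = w \<otimes> (a' \<otimes> b)" using that w bS S_carrier by (simp add: Q_def m_ac)
      then show ?thesis using that w pS_mult by (auto simp: Q_def)
    qed
    ultimately have "Q (w \<otimes> b) \<subseteq> Q b" using maxQ by blast
    moreover have "a \<otimes> (w \<otimes> b) = (w \<otimes> a) \<otimes> b" using a w bS S_carrier by (simp add: m_ac)
    then have "a \<in> Q (w \<otimes> b)" using w a by (simp add: Q_def)
    ultimately show ?thesis by auto
  qed
  have prime: "u \<in> Q b \<or> v \<in> Q b" if uv: "u \<in> S" "v \<in> S" "u \<otimes> v \<in> Q b" for u v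
  proof (rule disjCI)
    assume v: "v \<notin> Q b"
    have vb: "v \<otimes> b \<in> B" unfolding B_def
    proof (clarsimp, intro conjI ballI)
      show "v \<otimes> b \<in> S" using uv bS S_props by auto
      fix w assume w: "w \<in> S - M"
      show "w \<otimes> (v \<otimes> b) \<notin> pS"
      proof
        assume "w \<otimes> (v \<otimes> b) \<in> pS"
        then have "w \<otimes> v \<in> Q b" using w uv bS S_carrier S_props by (auto simp: Q_def m_assoc)
        then show False using sat[OF w] uv v by blast
      qed
    qed
    moreover have "a' \<in> Q (v \<otimes> b)" if "a' \<in> Q b" for a'
    proof -
      have "a' \<otimes> (v \<otimes> b) = v \<otimes> (a' \<otimes> b)" using that uv bS S_carrier by (simp add: Q_def m_ac)
      then show ?thesis using that uv pS_mult by (auto simp: Q_def)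
    qed
    ultimately have "Q (v \<otimes> b) \<subseteq> Q b" using maxQ by blast
    moreover have "u \<otimes> (v \<otimes> b) = (u \<otimes> v) \<otimes> b" using uv bS S_carrier by (simp add: m_ac)
    then have "u \<in> Q (v \<otimes> b)" using uv by (simp add: Q_def)
    ultimately show "u \<in> Q b" by auto
  qed
  have Q_M: "Q b \<subseteq> M" using b unfolding B_def Q_def by blast
  \<comment> \<open>\<open>Q b\<close> is a prime above \<open>p S\<close>, hence maximal, and it is
    contained in \<open>M\<close>; an element of \<open>M\<close> outside it would be invertible
    modulo \<open>Q b\<close> and thus modulo \<open>M\<close>.\<close>
  have "m \<in> Q b" if m: "m \<in> M" for m
  proof (rule ccontr)
    assume "m \<notin> Q b"
    then obtain z where z: "z \<in> S" "m \<otimes> z \<ominus> \<one> \<in> Q b"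
      using prime_ideal_inverse[OF Q_add[OF bS] Q_mult[OF bS] Q_pS[OF bS] Q_S prime] m M_S by blast
    have "m \<otimes> z \<in> M" using M_mult' m z by simp
    moreover have "\<one> = m \<otimes> z \<ominus> (m \<otimes> z \<ominus> \<one>)" using z m M_carrier S_carrier one_closed by algebra
    ultimately show False using M_minus one_notin_M z Q_M by (metis subsetD)
  qed
  then have "m \<otimes> b \<in> pS" if "m \<in> M" for m using that by (simp add: Q_def)
  then have "b \<otimes> m \<in> pS" if "m \<in> M" for m
    using that m_comm[OF S_carrier[OF bS] M_carrier[OF that]] by simp
  moreover have "b \<notin> pS"
  proof
    assume "b \<in> pS"
    then have "\<one> \<otimes> b \<in> pS" using bS S_carrier by simp
    then show False using b one_notin_M S_props unfolding B_def by blast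
  qed
  ultimately show ?thesis using that bS by blast
qed

abbreviation M2 :: "'a set" where "M2 \<equiv> M [^]\<^bsub>ideals_set SK\<^esub> (2::nat)"

lemma ideal_pow_Suc: "M [^]\<^bsub>ideals_set SK\<^esub> Suc n = ideal_prod SK (M [^]\<^bsub>ideals_set SK\<^esub> n) M"
  by (simp add: nat_pow_def ideals_set_def)

lemma ideal_pow_ideal: "ideal (M [^]\<^bsub>ideals_set SK\<^esub> (n::nat)) SK"
proof (induction n)
  case 0
  interpret SK: cring SK by (rule SK_cring)
  show ?case using SK.oneideal by (simp add: nat_pow_def ideals_set_def)
next
  case (Suc n)
  interpret SK: cring SK by (rule SK_cring)
  show ?case unfolding ideal_pow_Suc by (rule SK.ideal_prod_is_ideal[OF Suc M_ideal])
qed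

lemma ideal_pow_1: "M [^]\<^bsub>ideals_set SK\<^esub> (1::nat) = M"
proof -
  interpret SK: cring SK by (rule SK_cring)
  have "M [^]\<^bsub>ideals_set SK\<^esub> (0::nat) = carrier SK" by (simp add: nat_pow_def ideals_set_def)
  then show ?thesis using ideal_pow_Suc[of 0] SK.ideal_prod_one[OF M_ideal] SK.ideal_prod_commute[OF M_ideal SK.oneideal] by simp
qed

lemma M2_eq: "M2 = ideal_prod SK M M"
  using ideal_pow_Suc[of 1] by (simp only: ideal_pow_1 Suc_1)

lemma M2_mult: "a \<in> S \<Longrightarrow> x \<in> M2 \<Longrightarrow> a \<otimes> x \<in> M2"
  using ideal.I_l_closed[OF ideal_pow_ideal] by simp

lemma M2_add: "x \<in> M2 \<Longrightarrow> y \<in> M2 \<Longrightarrow> x \<oplus> y \<in> M2"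
  using additive_subgroup.a_closed[OF ideal.axioms(1)[OF ideal_pow_ideal]] by simp

lemma M2_I: "a \<in> M \<Longrightarrow> b \<in> M \<Longrightarrow> a \<otimes> b \<in> M2"
  using ideal_prod.prod[of a M b M SK] unfolding M2_eq by simp

lemma M2_M: "x \<in> M2 \<Longrightarrow> x \<in> M"
proof -
  interpret SK: cring SK by (rule SK_cring)
  show "x \<in> M2 \<Longrightarrow> x \<in> M" using SK.ideal_prod_inter[OF M_ideal M_ideal] unfolding M2_eq by auto
qed

lemma M2_zero: "\<zero> \<in> M2"
  using additive_subgroup.zero_closed[OF ideal.axioms(1)[OF ideal_pow_ideal[of 2]]] by simp

text \<open>\<open>y\<close> already lies in \<open>M\<close> and \<open>t\<close> is invertible
  modulo \<open>M\<close>, so the error \<open>(t t' - 1) y\<close> of the inversion falls into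
  \<open>M\<^sup>2\<close>.\<close>

lemma M2_primary:
  assumes "t \<in> S - M" "y \<in> S" "t \<otimes> y \<in> M2"
  shows "y \<in> M2"
proof -
  obtain t' where t': "t' \<in> S" "t \<otimes> t' \<ominus> \<one> \<in> M" using M_inverse assms(1) by blast
  have yM: "y \<in> M" using M_prime[of t y] assms M2_M by auto
  have K: "t \<in> carrier K" "t' \<in> carrier K" "y \<in> carrier K" using assms t' S_carrier by auto
  have "y = t' \<otimes> (t \<otimes> y) \<oplus> \<ominus> \<one> \<otimes> ((t \<otimes> t' \<ominus> \<one>) \<otimes> y)" using K by algebra
  also have "\<dots> \<in> M2"
    by (rule M2_add[OF M2_mult[OF t'(1) assms(3)] M2_mult[OF _ M2_I[OF t'(2) yM]]]) (simp add: S_props)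
  finally show ?thesis .
qed

text \<open>The quotient \<open>x = b / p\<close>, with \<open>b\<close> from
  \<open>M_associated\<close>, is not in \<open>S\<close> although \<open>x M \<subseteq> S\<close>.
  By complete integral closedness its powers have no common denominator \<open>p\<close>. This
  refutes both that \<open>p\<close> lies in all powers of \<open>M\<close> and that
  \<open>x M \<subseteq> M\<close>.\<close>

lemma ramification_index_one:
  assumes "ramification_index K V S M = 1"
  shows "p \<notin> M2" "\<exists>s\<in>S - M. \<forall>m\<in>M. s \<otimes> m \<in> pS"
proof -
  interpret SK: cring SK by (rule SK_cring)
  obtain b where b: "b \<in> S" "b \<notin> pS" "\<And>m. m \<in> M \<Longrightarrow> b \<otimes> m \<in> pS" using M_associated by blast
  have bK: "b \<in> carrier K" using b S_carrier by simp
  define x where "x = b \<otimes> inv p"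
  have ip: "inv p \<in> carrier K" "inv p \<otimes> p = \<one>" using p_nz field_Units by auto
  have "p \<otimes> x = b \<otimes> (inv p \<otimes> p)" using bK ip(1) p_closed unfolding x_def by algebra
  then have x: "x \<in> carrier K" "p \<otimes> x = b" using bK ip by (simp_all add: x_def)
  have x_S: "x \<notin> S"
  proof
    assume "x \<in> S"
    then show False using x(2) b(2) unfolding pS_def by auto
  qed
  define P where "P = (\<lambda>e::nat. Idl\<^bsub>SK\<^esub> (M \<inter> V) \<subseteq> M [^]\<^bsub>ideals_set SK\<^esub> e)"
  have MV: "M \<inter> V \<subseteq> carrier SK" using M_S by auto
  have P_p: "P e \<longleftrightarrow> p \<in> M [^]\<^bsub>ideals_set SK\<^esub> e" for e
  proof
    assume "P e"
    then show "p \<in> M [^]\<^bsub>ideals_set SK\<^esub> e"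
      using SK.genideal_self[OF MV] p_M p_V unfolding P_def by auto
  next
    assume p: "p \<in> M [^]\<^bsub>ideals_set SK\<^esub> e"
    have "M \<inter> V \<subseteq> M [^]\<^bsub>ideals_set SK\<^esub> e"
    proof
      fix v assume v: "v \<in> M \<inter> V"
      have "\<not> (\<exists>w\<in>V. v \<otimes> w = \<one>)"
      proof
        assume "\<exists>w\<in>V. v \<otimes> w = \<one>"
        then show False using M_mult'[of v] v V_S one_notin_M by fastforce
      qed
      then obtain w where w: "w \<in> V" "v = p \<otimes> w" using V_local[of v] v by blast
      then show "v \<in> M [^]\<^bsub>ideals_set SK\<^esub> e"
        using ideal.I_r_closed[OF ideal_pow_ideal p] V_S by simp
    qed
    then show "P e" unfolding P_def by (rule SK.genideal_minimal[OF ideal_pow_ideal])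
  qed
  have pow: "y \<in> M [^]\<^bsub>ideals_set SK\<^esub> e \<Longrightarrow> y \<in> S \<and> (\<exists>z\<in>S. b [^] e \<otimes> y = p [^] e \<otimes> z)" for e :: nat and y
  proof (induction e arbitrary: y)
    case 0
    then have "y \<in> S" by (simp add: nat_pow_def ideals_set_def)
    then show ?case by auto
  next
    case (Suc e)
    have "y \<in> ideal_prod SK (M [^]\<^bsub>ideals_set SK\<^esub> e) M" using Suc.prems by (simp only: ideal_pow_Suc)
    then show ?case
    proof (induction y rule: ideal_prod.induct)
      case (prod i m)
      obtain z where z: "i \<in> S" "z \<in> S" "b [^] e \<otimes> i = p [^] e \<otimes> z" using Suc.IH prod by blast
      obtain z' where z': "z' \<in> S" "b \<otimes> m = p \<otimes> z'" using b(3) prod unfolding pS_def by blast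
      have K: "i \<in> carrier K" "m \<in> carrier K" "z \<in> carrier K" "z' \<in> carrier K"
        using z z' prod S_carrier M_carrier by auto
      have "b [^] Suc e \<otimes> (i \<otimes> m) = (b [^] e \<otimes> i) \<otimes> (b \<otimes> m)" using K bK by (simp add: m_ac)
      also have "\<dots> = p [^] Suc e \<otimes> (z \<otimes> z')" using K z z' by (simp add: m_ac)
      finally show ?case using z z' S_props(5) M_S prod by auto
    next
      case (sum y y')
      then obtain z z' where z: "y \<in> S" "y' \<in> S" "z \<in> S" "z' \<in> S" "b [^] Suc e \<otimes> y = p [^] Suc e \<otimes> z" "b [^] Suc e \<otimes> y' = p [^] Suc e \<otimes> z'"
        by blast
      then have "b [^] Suc e \<otimes> (y \<oplus> y') = p [^] Suc e \<otimes> (z \<oplus> z')"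
        using S_carrier bK by (simp add: r_distr del: nat_pow_Suc)
      then show ?case using z S_props(6) by auto
    qed
  qed
  \<comment> \<open>\<open>GREATEST\<close> yields a maximum only if the exponents are bounded. If
    \<open>p\<close> belonged to every \<open>M^e\<close>, then \<open>b^e p\<close> would be
    divisible by \<open>p^e\<close>, so \<open>p x^e\<close> would lie in \<open>S\<close> for all
    \<open>e\<close>.\<close>
  have "\<exists>e. \<not> P e"
  proof (rule ccontr)
    assume "\<not> ?thesis"
    then have "p [^] (1::nat) \<otimes> x [^] e \<in> S" for e :: nat
    proof -
      obtain z where z: "z \<in> S" "b [^] e \<otimes> p = p [^] e \<otimes> z" using pow P_p \<open>\<not> (\<exists>e. \<not> P e)\<close> by blast
      have "p [^] e \<otimes> (p \<otimes> x [^] e) = (p \<otimes> x) [^] e \<otimes> p" using x(1) by (simp add: nat_pow_distrib m_ac)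
      also have "\<dots> = p [^] e \<otimes> z" using z x(2) by simp
      finally have "p \<otimes> x [^] e = z"
        using m_lcancel[of "p [^] e" "p \<otimes> x [^] e" z] z x(1) S_carrier by simp
      then show ?thesis using z by simp
    qed
    then show False using S_completely_integrally_closed[OF x(1)] x_S by blast
  qed
  then obtain e0 where e0: "\<not> P e0" by blast
  have antimono: "P (Suc e) \<Longrightarrow> P e" for e
    using SK.ideal_prod_inter[OF ideal_pow_ideal M_ideal, of e] unfolding P_def ideal_pow_Suc by blast
  have "P e \<Longrightarrow> e \<le> e0" for e
  proof (rule ccontr)
    assume "P e" "\<not> e \<le> e0"
    have "P (e0 + n) \<Longrightarrow> P e0" for n by (induction n) (use antimono in auto)
    from this[of "e - e0"] show False using \<open>P e\<close> \<open>\<not> e \<le> e0\<close> e0 by simp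
  qed
  then have "P 2 \<Longrightarrow> 2 \<le> (GREATEST e. P e)" using Greatest_le_nat[of P 2 e0] by blast
  then show p2: "p \<notin> M2" using assms P_p[of 2] unfolding ramification_index_def P_def by auto
  \<comment> \<open>Otherwise multiplication by \<open>x\<close> preserves \<open>M\<close>, and
    \<open>p x^n\<close> stays in \<open>M\<close> for all \<open>n\<close>.\<close>
  have "\<exists>m\<in>M. \<exists>z\<in>S - M. b \<otimes> m = p \<otimes> z"
  proof (rule ccontr)
    assume neg: "\<not> ?thesis"
    have xm: "x \<otimes> m \<in> M" if m: "m \<in> M" for m
    proof -
      obtain z where z: "z \<in> S" "b \<otimes> m = p \<otimes> z" using b(3)[OF m] unfolding pS_def by blast
      have "p \<otimes> (x \<otimes> m) = p \<otimes> z" using z x M_carrier[OF m] by (simp add: m_assoc[symmetric])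
      then have "x \<otimes> m = z" using m_lcancel[OF p_nz p_closed, of "x \<otimes> m" z] x(1) M_carrier[OF m] z S_carrier by simp
      then show ?thesis using neg z m by blast
    qed
    have "x [^] n \<otimes> p \<in> M" for n :: nat
    proof (induction n)
      case (Suc n)
      have "x [^] Suc n \<otimes> p = x \<otimes> (x [^] n \<otimes> p)" using x(1) by (simp add: m_ac)
      then show ?case using xm Suc by simp
    qed (simp add: p_M)
    then have "p [^] (1::nat) \<otimes> x [^] n \<in> S" for n :: nat using M_S[of "x [^] n \<otimes> p"] x(1) by (simp add: m_comm)
    then show False using S_completely_integrally_closed[OF x(1)] x_S by blast
  qed
  then obtain m z where mz: "m \<in> M" "z \<in> S - M" "b \<otimes> m = p \<otimes> z" by blast
  \<comment> \<open>If \<open>b\<close> were in \<open>M\<close>, then \<open>p z = b m\<close>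
    would lie in \<open>M\<^sup>2\<close> with \<open>z\<close> outside \<open>M\<close>, and hence
    so would \<open>p\<close>. Thus \<open>b\<close> itself is the required
    \<open>s\<close>.\<close>
  have "b \<notin> M"
  proof
    assume "b \<in> M"
    then have "p \<otimes> z \<in> M2" using M2_I[of b m] mz by simp
    then have "z \<otimes> p \<in> M2" using mz S_carrier by (simp add: m_comm)
    then show False using M2_primary[of z p] mz p2 by simp
  qed
  then show "\<exists>s\<in>S - M. \<forall>m\<in>M. s \<otimes> m \<in> pS" using b by blast
qed

end

subsection \<open>The valuation at an unramified maximal ideal\<close>

locale unramified_max = galois_dvr_max +
  fixes s :: 'a
  assumes s: "s \<in> S - M" and s_M: "m \<in> M \<Longrightarrow> s \<otimes> m \<in> pS"
begin

lemma s_closed [simp]: "s \<in> carrier K" "s \<in> S"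
  using s S_carrier by auto

text \<open>
  The localization at \<open>M\<close> has the uniformizer \<open>p\<close>; as \<open>s M \<subseteq> p S\<close>, powers of \<open>s\<close> suffice as denominators.
\<close>

definition has_val :: "'a \<Rightarrow> nat \<Rightarrow> bool" where
  "has_val y n \<longleftrightarrow> (\<exists>u\<in>S - M. s [^] n \<otimes> y = p [^] n \<otimes> u)"

text \<open>Membership in \<open>p^n\<close> times the localization of \<open>S\<close> at
  \<open>M\<close>. Arbitrary denominators outside \<open>M\<close> make this compatible with sums,
  products and cancellation, whereas \<open>has_val\<close> with its prescribed denominator
  determines the exact exponent.\<close>

definition val_ge :: "nat \<Rightarrow> 'a \<Rightarrow> bool" where
  "val_ge n y \<longleftrightarrow> y \<in> S \<and> (\<exists>w\<in>S - M. \<exists>z\<in>S. w \<otimes> y = p [^] n \<otimes> z)"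

lemma has_val_val_ge:
  assumes y: "y \<in> S" "has_val y k"
  shows "val_ge n y \<longleftrightarrow> n \<le> k"
proof
  obtain u where u: "u \<in> S - M" "s [^] k \<otimes> y = p [^] k \<otimes> u" using y unfolding has_val_def by blast
  {
    assume "val_ge n y"
    then obtain w z where wz: "w \<in> S - M" "z \<in> S" "w \<otimes> y = p [^] n \<otimes> z" unfolding val_ge_def by blast
    have K: "u \<in> carrier K" "w \<in> carrier K" "z \<in> carrier K" "y \<in> carrier K" using u wz y S_carrier by auto
    show "n \<le> k"
    proof (rule ccontr)
      assume "\<not> n \<le> k"
      then obtain d where d: "n = k + Suc d" using less_imp_Suc_add[of k n] by auto
      have "p [^] k \<otimes> (w \<otimes> u) = w \<otimes> (s [^] k \<otimes> y)" unfolding u(2) using K by (simp add: m_ac)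
      also have "\<dots> = s [^] k \<otimes> (w \<otimes> y)" using K by (simp add: m_ac)
      also have "\<dots> = p [^] k \<otimes> (p \<otimes> (s [^] k \<otimes> (p [^] d \<otimes> z)))"
        unfolding wz(3) d using K by (simp add: nat_pow_mult[symmetric] m_ac)
      finally have "w \<otimes> u = p \<otimes> (s [^] k \<otimes> (p [^] d \<otimes> z))"
        using m_lcancel[of "p [^] k" "w \<otimes> u" "p \<otimes> (s [^] k \<otimes> (p [^] d \<otimes> z))"] K by simp
      then have "w \<otimes> u \<in> M" using M_mult'[OF p_M, of "s [^] k \<otimes> (p [^] d \<otimes> z)"] wz S_props(5) S_pow by simp
      then show False using M_prime' wz u by blast
    qed
  }
  assume n: "n \<le> k"
  then have "p [^] k = p [^] n \<otimes> p [^] (k - n)" by (simp add: nat_pow_mult)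
  then have "s [^] k \<otimes> y = p [^] n \<otimes> (p [^] (k - n) \<otimes> u)" using u S_carrier by (simp add: m_assoc)
  moreover have "p [^] (k - n) \<otimes> u \<in> S" using u by (simp add: S_props S_pow)
  ultimately show "val_ge n y" unfolding val_ge_def using y(1) M_prime_pow[OF s, of k] by blast
qed

text \<open>As long as the quotient \<open>z\<close> lies in \<open>M\<close>, one more factor
  \<open>s\<close> buys one more factor \<open>p\<close>. The first quotient outside
  \<open>M\<close> exhibits the valuation.\<close>

lemma has_val_or_divisible:
  assumes "y \<in> S"
  shows "(\<exists>z\<in>S. s [^] n \<otimes> y = p [^] n \<otimes> z) \<or> (\<exists>k<n. has_val y k)"
proof (induction n)
  case 0 then show ?case using assms by auto
next
  case (Suc n)
  show ?case
  proof (cases "\<exists>k<n. has_val y k")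
    case True then show ?thesis using less_SucI by blast
  next
    case False
    then obtain z where z: "z \<in> S" "s [^] n \<otimes> y = p [^] n \<otimes> z" using Suc by blast
    show ?thesis
    proof (cases "z \<in> M")
      case True
      then obtain z' where z': "z' \<in> S" "s \<otimes> z = p \<otimes> z'" using s_M unfolding pS_def by blast
      have "s [^] Suc n \<otimes> y = s \<otimes> (s [^] n \<otimes> y)" using assms S_carrier by (simp add: m_ac)
      also have "\<dots> = p [^] n \<otimes> (s \<otimes> z)" unfolding z(2) using z S_carrier by (simp add: m_ac)
      also have "\<dots> = p [^] Suc n \<otimes> z'" unfolding z'(2) using z' S_carrier by (simp add: m_ac)
      finally show ?thesis using z' by blast
    next
      case False
      then have "has_val y n" using z unfolding has_val_def by blast
      then show ?thesis by blast
    qed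
  qed
qed

text \<open>The norm is a multiple of \<open>y\<close> and a unit times \<open>p^r\<close>, so
  \<open>y\<close> cannot be divisible by all powers of \<open>p\<close> locally.\<close>

lemma has_val_exists:
  assumes y: "y \<in> S" "y \<noteq> \<zero>"
  shows "\<exists>k. has_val y k"
proof (rule ccontr)
  assume neg: "\<not> ?thesis"
  define N where "N = (\<Otimes>\<alpha>\<in>carrier G. \<alpha> y)"
  obtain z where z: "z \<in> S" "N = y \<otimes> z" using norm_S(2)[OF y(1)] by (auto simp: N_def)
  obtain r u w where r: "u \<in> V" "w \<in> V" "u \<otimes> w = \<one>" "N = u \<otimes> p [^] (r::nat)"
    using V_decomp[of N] norm_S[OF y(1)] y(2) unfolding N_def by blast
  \<comment> \<open>One more than the exponent of the norm: after multiplication by the cofactor of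
    \<open>y\<close>, cancelling \<open>p^r\<close> leaves a factor \<open>p\<close> in a power of
    \<open>s\<close>.\<close>
  obtain a where a: "a \<in> S" "s [^] Suc r \<otimes> y = p [^] Suc r \<otimes> a" using has_val_or_divisible[OF y(1)] neg by blast
  have K: "y \<in> carrier K" "z \<in> carrier K" "u \<in> carrier K" "w \<in> carrier K" "a \<in> carrier K"
    using y z r a S_carrier V_carrier by auto
  have "p [^] r \<otimes> s [^] Suc r = p [^] r \<otimes> s [^] Suc r \<otimes> (u \<otimes> w)" using r K by simp
  also have "\<dots> = s [^] Suc r \<otimes> (u \<otimes> p [^] r) \<otimes> w" using K by (simp add: m_ac)
  also have "\<dots> = (s [^] Suc r \<otimes> y) \<otimes> (z \<otimes> w)" unfolding r(4)[symmetric] z(2) using K by (simp add: m_ac)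
  also have "\<dots> = p [^] r \<otimes> (p \<otimes> (a \<otimes> (z \<otimes> w)))" unfolding a(2) using K by (simp add: m_ac)
  finally have "s [^] Suc r = p \<otimes> (a \<otimes> (z \<otimes> w))"
    using m_lcancel[of "p [^] r" "s [^] Suc r" "p \<otimes> (a \<otimes> (z \<otimes> w))"] K by simp
  then have "s [^] Suc r \<in> M" using M_mult'[OF p_M, of "a \<otimes> (z \<otimes> w)"] a z r V_S S_props(5) by simp
  then show False using M_prime_pow[OF s] by blast
qed

definition val :: "'a \<Rightarrow> nat" where "val y = (SOME k. has_val y k)"

lemma has_val_val: "y \<in> S \<Longrightarrow> y \<noteq> \<zero> \<Longrightarrow> has_val y (val y)"
  unfolding val_def by (rule someI_ex) (rule has_val_exists)

lemma val_ge_iff: "y \<in> S \<Longrightarrow> y \<noteq> \<zero> \<Longrightarrow> val_ge n y \<longleftrightarrow> n \<le> val y"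
  using has_val_val has_val_val_ge by blast

lemma val_eqI: "y \<in> S \<Longrightarrow> y \<noteq> \<zero> \<Longrightarrow> has_val y k \<Longrightarrow> val y = k"
  using has_val_val_ge has_val_val by (metis order.refl order_antisym)

lemma val_mult:
  assumes "y \<in> S" "y \<noteq> \<zero>" "z \<in> S" "z \<noteq> \<zero>"
  shows "val (y \<otimes> z) = val y + val z"
proof (rule val_eqI)
  obtain u u' where u: "u \<in> S - M" "s [^] val y \<otimes> y = p [^] val y \<otimes> u" "u' \<in> S - M" "s [^] val z \<otimes> z = p [^] val z \<otimes> u'"
    using has_val_val assms unfolding has_val_def by blast
  have K: "y \<in> carrier K" "z \<in> carrier K" "u \<in> carrier K" "u' \<in> carrier K" using assms u S_carrier by auto
  show "y \<otimes> z \<in> S" "y \<otimes> z \<noteq> \<zero>" using assms S_props(5) integral K by auto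
  have "s [^] (val y + val z) \<otimes> (y \<otimes> z) = (s [^] val y \<otimes> y) \<otimes> (s [^] val z \<otimes> z)"
    using K by (simp add: nat_pow_mult[symmetric] m_ac)
  also have "\<dots> = p [^] (val y + val z) \<otimes> (u \<otimes> u')" unfolding u using K by (simp add: nat_pow_mult[symmetric] m_ac)
  finally show "has_val (y \<otimes> z) (val y + val z)" unfolding has_val_def using M_prime'[OF u(1,3)] by blast
qed

lemma val_ge_add: "val_ge n y \<Longrightarrow> val_ge n z \<Longrightarrow> val_ge n (y \<oplus> z)"
proof -
  assume "val_ge n y" "val_ge n z"
  then obtain w a w' a' where w: "y \<in> S" "w \<in> S - M" "a \<in> S" "w \<otimes> y = p [^] n \<otimes> a"
    "z \<in> S" "w' \<in> S - M" "a' \<in> S" "w' \<otimes> z = p [^] n \<otimes> a'" unfolding val_ge_def by blast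
  have K: "y \<in> carrier K" "z \<in> carrier K" "w \<in> carrier K" "w' \<in> carrier K" "a \<in> carrier K" "a' \<in> carrier K"
    using w S_carrier by auto
  have "(w \<otimes> w') \<otimes> (y \<oplus> z) = w' \<otimes> (w \<otimes> y) \<oplus> w \<otimes> (w' \<otimes> z)" using K by algebra
  also have "\<dots> = p [^] n \<otimes> (w' \<otimes> a \<oplus> w \<otimes> a')" unfolding w using K by (simp add: r_distr m_ac)
  finally have "(w \<otimes> w') \<otimes> (y \<oplus> z) = p [^] n \<otimes> (w' \<otimes> a \<oplus> w \<otimes> a')" .
  moreover have "w' \<otimes> a \<oplus> w \<otimes> a' \<in> S" "y \<oplus> z \<in> S" using w by (auto intro!: S_props)
  ultimately show ?thesis unfolding val_ge_def using M_prime'[OF w(2,6)] by blast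
qed

lemma val_ge_mult: "val_ge n y \<Longrightarrow> val_ge m z \<Longrightarrow> val_ge (n + m) (y \<otimes> z)"
proof -
  assume "val_ge n y" "val_ge m z"
  then obtain w a w' a' where w: "y \<in> S" "w \<in> S - M" "a \<in> S" "w \<otimes> y = p [^] n \<otimes> a"
    "z \<in> S" "w' \<in> S - M" "a' \<in> S" "w' \<otimes> z = p [^] m \<otimes> a'" unfolding val_ge_def by blast
  have K: "y \<in> carrier K" "z \<in> carrier K" "w \<in> carrier K" "w' \<in> carrier K" "a \<in> carrier K" "a' \<in> carrier K"
    using w S_carrier by auto
  have "(w \<otimes> w') \<otimes> (y \<otimes> z) = (w \<otimes> y) \<otimes> (w' \<otimes> z)" using K by algebra
  also have "\<dots> = p [^] (n + m) \<otimes> (a \<otimes> a')" unfolding w using K by (simp add: nat_pow_mult[symmetric] m_ac)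
  finally have "(w \<otimes> w') \<otimes> (y \<otimes> z) = p [^] (n + m) \<otimes> (a \<otimes> a')" .
  moreover have "a \<otimes> a' \<in> S" "y \<otimes> z \<in> S" using w by (auto intro!: S_props)
  ultimately show ?thesis unfolding val_ge_def using M_prime'[OF w(2,6)] by blast
qed

lemma val_ge_cancel: "w \<in> S - M \<Longrightarrow> y \<in> S \<Longrightarrow> val_ge n (w \<otimes> y) \<Longrightarrow> val_ge n y"
proof -
  assume w: "w \<in> S - M" "y \<in> S" "val_ge n (w \<otimes> y)"
  then obtain w' a where a: "w' \<in> S - M" "a \<in> S" "w' \<otimes> (w \<otimes> y) = p [^] n \<otimes> a" unfolding val_ge_def by blast
  then have "(w' \<otimes> w) \<otimes> y = p [^] n \<otimes> a" using w S_carrier by (simp add: m_assoc)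
  then show ?thesis unfolding val_ge_def using w(2) a(2) M_prime'[OF a(1) w(1)] by blast
qed

lemma val_ge_0: "y \<in> S \<Longrightarrow> val_ge 0 y"
  unfolding val_ge_def using one_notin_M S_props(3) by (intro conjI bexI[of _ \<one>] bexI[of _ y]) (auto dest: S_carrier)

lemma val_ge_p: "val_ge 1 p"
  unfolding val_ge_def using one_notin_M S_props(3) by (intro conjI bexI[of _ \<one>] bexI[of _ \<one>]) auto

lemma val_ge_1_iff: "val_ge 1 y \<longleftrightarrow> y \<in> M"
proof
  assume "val_ge 1 y"
  then obtain w a where a: "y \<in> S" "w \<in> S - M" "a \<in> S" "w \<otimes> y = p \<otimes> a" unfolding val_ge_def by auto
  then show "y \<in> M" using M_mult'[OF p_M, of a] M_prime[of w y] by auto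
next
  assume "y \<in> M"
  then show "val_ge 1 y" using s_M[of y] s M_S unfolding val_ge_def pS_def by auto
qed

lemma val_ge_all_imp_zero: "y \<in> S \<Longrightarrow> (\<And>n. val_ge n y) \<Longrightarrow> y = \<zero>"
  using val_ge_iff[of y "Suc (val y)"] by auto

lemma val_ge_2_M2:
  assumes "val_ge 2 y"
  shows "y \<in> M2"
proof -
  obtain w a where a: "y \<in> S" "w \<in> S - M" "a \<in> S" "w \<otimes> y = p [^] (2::nat) \<otimes> a" using assms unfolding val_ge_def by auto
  have "p [^] (2::nat) = p \<otimes> p" by (simp add: numeral_2_eq_2)
  then have "w \<otimes> y = a \<otimes> (p \<otimes> p)" using a S_carrier by (simp add: m_comm)
  then show ?thesis using M2_primary[OF a(2,1)] M2_mult[OF a(3) M2_I[OF p_M p_M]] by simp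
qed

text \<open>The denominator \<open>s^n\<close> depends on \<open>n\<close> alone and not on
  \<open>y\<close>; a common multiplier for whole components is built from this.\<close>

lemma divisible_if_le_val:
  assumes "y \<in> S" "y = \<zero> \<or> n \<le> val y"
  shows "\<exists>z\<in>S. s [^] n \<otimes> y = p [^] n \<otimes> z"
proof (cases "y = \<zero>")
  case True then show ?thesis using S_props by (intro bexI[of _ \<zero>]) auto
next
  case False
  then show ?thesis using has_val_or_divisible[OF assms(1), of n] val_eqI[OF assms(1) False] assms by auto
qed

end

section \<open>Formal derivatives, residue fields and the inertia group\<close>

context finite_galois_dvr
begin

text \<open>The value of the formal derivative, leading coefficient first. At the constant term the
  exponent \<open>length as - 1\<close> is truncated to 0, but there the multiple taken is the
  zeroth.\<close>

primrec eval_deriv :: "'a list \<Rightarrow> 'a \<Rightarrow> 'a" where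
  "eval_deriv [] x = \<zero>"
| "eval_deriv (a # as) x = add_pow K (length as) (a \<otimes> x [^] (length as - 1)) \<oplus> eval_deriv as x"

lemma add_pow_S: "x \<in> S \<Longrightarrow> add_pow K (n::nat) x \<in> S"
  by (induction n) (auto simp: S_props)

lemma eval_deriv_S: "set as \<subseteq> S \<Longrightarrow> x \<in> S \<Longrightarrow> eval_deriv as x \<in> S"
  by (induction as) (auto intro!: S_props(5,6) add_pow_S S_pow simp: S_props)

end

context galois_dvr_max
begin

text \<open>The cofactors satisfy \<open>h(k+1) = y h(k) + x^k\<close>; modulo \<open>M\<close>,
  where \<open>x\<close> and \<open>y\<close> agree, this is the recursion of
  \<open>k x^(k-1)\<close>.\<close>

lemma pow_difference:
  assumes xy: "x \<in> S" "y \<in> S" "y \<ominus> x \<in> M"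
  shows "\<exists>h\<in>S. y [^] (k::nat) \<ominus> x [^] k = (y \<ominus> x) \<otimes> h \<and> h \<ominus> add_pow K k (x [^] (k - 1)) \<in> M"
proof (induction k)
  case 0
  then show ?case using xy S_carrier S_props M_zero by (intro bexI[of _ \<zero>]) (auto simp: minus_eq r_neg)
next
  case (Suc k)
  then obtain h where h: "h \<in> S" "y [^] k \<ominus> x [^] k = (y \<ominus> x) \<otimes> h" "h \<ominus> add_pow K k (x [^] (k - 1)) \<in> M" by blast
  define a b c where "a = y [^] k" and "b = x [^] k" and "c = add_pow K k (x [^] (k - 1))"
  have K: "x \<in> carrier K" "y \<in> carrier K" "h \<in> carrier K" "a \<in> carrier K" "b \<in> carrier K" "c \<in> carrier K"
    using xy h S_carrier by (auto simp: a_def b_def c_def)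
  have bS: "b \<in> S" using xy S_pow by (simp add: b_def)
  have xc: "x \<otimes> c = add_pow K k b"
  proof (cases k)
    case 0 then show ?thesis using K by (simp add: c_def)
  next
    case (Suc j)
    then show ?thesis using K add_pow_rdistr[of x "x [^] j" k] by (simp add: c_def b_def m_comm)
  qed
  have h2: "a \<ominus> b = (y \<ominus> x) \<otimes> h" using h(2) by (simp add: a_def b_def)
  have "y [^] Suc k \<ominus> x [^] Suc k = y \<otimes> (a \<ominus> b) \<oplus> (y \<ominus> x) \<otimes> b"
  proof -
    have "a \<otimes> y \<ominus> b \<otimes> x = y \<otimes> (a \<ominus> b) \<oplus> (y \<ominus> x) \<otimes> b" using K by algebra
    then show ?thesis by (simp add: a_def b_def)
  qed
  also have "\<dots> = (y \<ominus> x) \<otimes> (y \<otimes> h \<oplus> b)" unfolding h2 using K by algebra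
  finally have e1: "y [^] Suc k \<ominus> x [^] Suc k = (y \<ominus> x) \<otimes> (y \<otimes> h \<oplus> b)" .
  have "y \<otimes> h \<oplus> b \<ominus> add_pow K (Suc k) b = (y \<ominus> x) \<otimes> h \<oplus> x \<otimes> (h \<ominus> c)"
  proof -
    have "y \<otimes> h \<oplus> b \<ominus> (x \<otimes> c \<oplus> b) = (y \<ominus> x) \<otimes> h \<oplus> x \<otimes> (h \<ominus> c)" using K by algebra
    then show ?thesis using K by (simp add: xc)
  qed
  also have "\<dots> \<in> M" using M_add M_mult' M_mult xy h by (simp add: c_def)
  finally have "y \<otimes> h \<oplus> b \<ominus> add_pow K (Suc k) (x [^] (Suc k - 1)) \<in> M" by (simp add: b_def)
  then show ?case using e1 h(1) xy bS S_props(5,6) by blast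
qed

text \<open>Taylor expansion to first order, with the higher terms absorbed into the congruence of
  the cofactor \<open>h\<close> with the derivative.\<close>

lemma eval_difference:
  assumes xy: "x \<in> S" "y \<in> S" "y \<ominus> x \<in> M" and as: "set as \<subseteq> S"
  shows "\<exists>h\<in>S. eval as y \<ominus> eval as x = (y \<ominus> x) \<otimes> h \<and> h \<ominus> eval_deriv as x \<in> M"
  using as
proof (induction as)
  case Nil
  then show ?case using xy S_carrier S_props M_zero by (intro bexI[of _ \<zero>]) (auto simp: minus_eq r_neg)
next
  case (Cons a as)
  then obtain h where h: "h \<in> S" "eval as y \<ominus> eval as x = (y \<ominus> x) \<otimes> h" "h \<ominus> eval_deriv as x \<in> M" by auto
  obtain g where g: "g \<in> S" "y [^] length as \<ominus> x [^] length as = (y \<ominus> x) \<otimes> g"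
      "g \<ominus> add_pow K (length as) (x [^] (length as - 1)) \<in> M"
    using pow_difference[OF xy] by blast
  define b c d e where "b = y [^] length as" and "c = x [^] length as" and "d = add_pow K (length as) (x [^] (length as - 1))"
    and "e = eval_deriv as x"
  have aS: "a \<in> S" "set as \<subseteq> S" using Cons.prems by auto
  define u v where "u = eval as y" and "v = eval as x"
  have K: "x \<in> carrier K" "y \<in> carrier K" "h \<in> carrier K" "a \<in> carrier K" "b \<in> carrier K" "c \<in> carrier K"
     "d \<in> carrier K" "e \<in> carrier K" "g \<in> carrier K" "u \<in> carrier K" "v \<in> carrier K"
    using xy h g aS S_carrier eval_deriv_S S_eval by (auto simp: b_def c_def d_def e_def u_def v_def)
  have "add_pow K (length as) (a \<otimes> x [^] (length as - 1)) = a \<otimes> d"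
    using K add_pow_rdistr[of a "x [^] (length as - 1)" "length as"] by (simp add: d_def)
  then have D: "eval_deriv (a # as) x = a \<otimes> d \<oplus> e" by (simp add: e_def)
  have "eval (a # as) y \<ominus> eval (a # as) x = (a \<otimes> b \<oplus> u) \<ominus> (a \<otimes> c \<oplus> v)"
    by (simp add: b_def c_def u_def v_def)
  also have "\<dots> = a \<otimes> (b \<ominus> c) \<oplus> (u \<ominus> v)" using K by algebra
  also have "\<dots> = a \<otimes> ((y \<ominus> x) \<otimes> g) \<oplus> (y \<ominus> x) \<otimes> h" using h g by (simp add: b_def c_def u_def v_def)
  also have "\<dots> = (y \<ominus> x) \<otimes> (a \<otimes> g \<oplus> h)" using K by algebra
  finally have 1: "eval (a # as) y \<ominus> eval (a # as) x = (y \<ominus> x) \<otimes> (a \<otimes> g \<oplus> h)" .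
  have "(a \<otimes> g \<oplus> h) \<ominus> eval_deriv (a # as) x = a \<otimes> (g \<ominus> d) \<oplus> (h \<ominus> e)"
    unfolding D using K by algebra
  also have "\<dots> \<in> M" using M_add M_mult g h aS by (simp add: d_def e_def)
  finally show ?case using 1 aS g h S_props(5,6) by blast
qed

abbreviation L :: "'a set ring" where "L \<equiv> SK Quot M"

abbreviation res :: "'a \<Rightarrow> 'a set" where "res a \<equiv> M +>\<^bsub>SK\<^esub> a"

lemma L_field: "field L"
  using maximalideal.quotient_is_field[OF M_max SK_cring] .

lemma res_hom: "res \<in> ring_hom SK L"
  using ideal.rcos_ring_hom[OF M_ideal] .

lemma res_closed: "a \<in> S \<Longrightarrow> res a \<in> carrier L"
  using ring_hom_closed[OF res_hom] by simp

lemma res_add: "a \<in> S \<Longrightarrow> b \<in> S \<Longrightarrow> res (a \<oplus> b) = res a \<oplus>\<^bsub>L\<^esub> res b"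
  using ring_hom_add[OF res_hom] by simp

lemma res_mult: "a \<in> S \<Longrightarrow> b \<in> S \<Longrightarrow> res (a \<otimes> b) = res a \<otimes>\<^bsub>L\<^esub> res b"
  using ring_hom_mult[OF res_hom] by simp

lemma res_one: "res \<one> = \<one>\<^bsub>L\<^esub>"
  using ring_hom_one[OF res_hom] by simp

lemma res_zero: "res \<zero> = \<zero>\<^bsub>L\<^esub>"
proof -
  interpret L: field L by (rule L_field)
  have "res \<zero> \<oplus>\<^bsub>L\<^esub> res \<zero> = res \<zero>" using res_add[of \<zero> \<zero>] S_props by simp
  then show ?thesis using L.add.l_cancel_one[of "res \<zero>" "res \<zero>"] res_closed[of \<zero>] S_props by simp
qed

lemma res_uminus: "a \<in> S \<Longrightarrow> res (\<ominus> a) = \<ominus>\<^bsub>L\<^esub> res a"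
proof -
  assume a: "a \<in> S"
  interpret L: field L by (rule L_field)
  have "res (\<ominus> a) \<oplus>\<^bsub>L\<^esub> res a = res (\<ominus> a \<oplus> a)" using res_add[of "\<ominus> a" a] a S_props by simp
  also have "\<dots> = \<zero>\<^bsub>L\<^esub>" using a S_carrier res_zero by (simp add: l_neg)
  finally show ?thesis using L.minus_equality[of "res (\<ominus> a)" "res a"] res_closed a S_props by simp
qed

lemma res_pow: "a \<in> S \<Longrightarrow> res (a [^] (n::nat)) = res a [^]\<^bsub>L\<^esub> n"
proof (induction n)
  case 0
  then show ?case by (simp add: res_one)
next
  case (Suc n)
  then show ?case using res_mult[of "a [^] n" a] S_pow by simp
qed

lemma res_add_pow: "a \<in> S \<Longrightarrow> res (add_pow K (n::nat) a) = add_pow L n (res a)"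
proof (induction n)
  case 0
  interpret L: field L by (rule L_field)
  show ?case using res_zero by simp
next
  case (Suc n)
  interpret L: field L by (rule L_field)
  show ?case using Suc res_add[of "add_pow K n a" a] add_pow_S by simp
qed

lemma res_eq_zero_iff: "a \<in> S \<Longrightarrow> res a = \<zero>\<^bsub>L\<^esub> \<longleftrightarrow> a \<in> M"
proof -
  assume a: "a \<in> S"
  interpret SK: cring SK by (rule SK_cring)
  have "a \<ominus>\<^bsub>SK\<^esub> \<zero> = a" using a S_props S_carrier SK_minus[of \<zero>] by (simp add: SK.minus_eq)
  then show ?thesis
    using SK.quotient_eq_iff_same_a_r_cos[OF M_ideal, of a \<zero>] a S_props by (simp add: res_zero[symmetric])
qed

lemma eval_res:
  assumes "set as \<subseteq> S" "x \<in> S"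
  shows "ring.eval L (map res as) (res x) = res (eval as x)"
  using assms(1)
proof (induction as)
  case Nil
  interpret L: field L by (rule L_field)
  show ?case by (simp add: res_zero)
next
  case (Cons a as)
  interpret L: field L by (rule L_field)
  have "a \<otimes> x [^] length as \<in> S" "eval as x \<in> S" using Cons.prems assms(2) S_props(5) S_pow S_eval by auto
  then show ?case using Cons assms(2) S_pow by (simp add: res_add res_mult res_pow)
qed

lemma eval_poly_deriv_res:
  assumes "set as \<subseteq> S" "x \<in> S"
  shows "ring.eval L (poly_deriv L (map res as)) (res x) = res (eval_deriv as x)"
proof -
  interpret L: field L by (rule L_field)
  have raw: "L.eval (map (\<lambda>i. add_pow L i (L.coeff (map res as) i)) (rev [1..<length as])) (res x) = res (eval_deriv as x)"
    using assms(1)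
  proof (induction as)
    case Nil
    show ?case by (simp add: res_zero)
  next
    case (Cons a as)
    show ?case
    proof (cases "as = []")
      case True
      then show ?thesis using Cons.prems assms(2) S_carrier by (simp add: res_zero)
    next
      case False
      have aS: "a \<in> S" "set as \<subseteq> S" using Cons.prems by auto
      have list: "rev [1..<length (a # as)] = length as # rev [1..<length as]" using False by (cases as) auto
      have same: "map (\<lambda>i. add_pow L i (L.coeff (map res (a # as)) i)) (rev [1..<length as]) =
          map (\<lambda>i. add_pow L i (L.coeff (map res as) i)) (rev [1..<length as])"
        by (intro map_cong refl) auto
      have "L.eval (map (\<lambda>i. add_pow L i (L.coeff (map res (a # as)) i)) (rev [1..<length (a # as)])) (res x) =
          add_pow L (length as) (res a) \<otimes>\<^bsub>L\<^esub> res x [^]\<^bsub>L\<^esub> (length as - 1) \<oplus>\<^bsub>L\<^esub> res (eval_deriv as x)"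
        unfolding list list.map(2)[of "\<lambda>i. add_pow L i (L.coeff (map res (a # as)) i)"] same
        using Cons.IH[OF aS(2)] by simp
      also have "add_pow L (length as) (res a) \<otimes>\<^bsub>L\<^esub> res x [^]\<^bsub>L\<^esub> (length as - 1) =
          res (add_pow K (length as) (a \<otimes> x [^] (length as - 1)))"
        using aS assms(2) S_pow S_props(5) res_closed
        by (simp add: res_add_pow res_mult res_pow L.add_pow_ldistr)
      finally show ?thesis
        using aS assms(2) S_pow S_props(5) add_pow_S eval_deriv_S by (simp add: res_add)
    qed
  qed
  have cf: "L.coeff (map res as) i \<in> carrier L" for i
    using assms(1) res_closed by (intro L.coeff_in_carrier) auto
  have "L.eval (poly_deriv L (map res as)) (res x) =
      L.eval (map (\<lambda>i. add_pow L i (L.coeff (map res as) i)) (rev [1..<length as])) (res x)"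
    unfolding poly_deriv_def length_map using cf res_closed[OF assms(2)]
    by (intro L.eval_normalize) auto
  then show ?thesis using raw by simp
qed

text \<open>The list lifts the minimal polynomial of the residue of \<open>x\<close> to
  \<open>V\<close>. A Bezout identity between this polynomial and its derivative, evaluated at the
  residue, prevents both from vanishing there.\<close>

lemma separable_residue:
  assumes sep: "separable_extension L (res ` V)" and x: "x \<in> S"
  shows "\<exists>as. set as \<subseteq> V \<and> eval as x \<in> M \<and> eval_deriv as x \<notin> M"
proof -
  interpret L: field L by (rule L_field)
  have sub: "subring (res ` V) L"
  proof (rule L.subringI)
    show "res ` V \<subseteq> carrier L" using res_closed V_S by auto
    show "\<one>\<^bsub>L\<^esub> \<in> res ` V" using res_one V_props by (metis imageI)
    fix h assume "h \<in> res ` V"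
    then obtain v where v: "v \<in> V" "h = res v" by auto
    then show "\<ominus>\<^bsub>L\<^esub> h \<in> res ` V" using res_uminus V_S V_props by (metis imageI)
    fix h' assume "h' \<in> res ` V"
    then obtain v' where v': "v' \<in> V" "h' = res v'" by auto
    show "h \<otimes>\<^bsub>L\<^esub> h' \<in> res ` V" using v v' res_mult V_S V_props(5) by (metis imageI)
    show "h \<oplus>\<^bsub>L\<^esub> h' \<in> res ` V" using v v' res_add V_S V_props(6) by (metis imageI)
  qed
  have k: "subfield (res ` V) L"
  proof (rule L.subfieldI'[OF sub])
    fix h assume h: "h \<in> res ` V - {\<zero>\<^bsub>L\<^esub>}"
    then obtain v where v: "v \<in> V" "h = res v" by auto
    have "v \<notin> M" using h v res_eq_zero_iff V_S by auto
    then have "\<not> (\<exists>b\<in>V. v = p \<otimes> b)" using M_mult'[OF p_M] V_S by blast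
    then obtain w where w: "w \<in> V" "v \<otimes> w = \<one>" using V_local v by blast
    have "h \<otimes>\<^bsub>L\<^esub> res w = \<one>\<^bsub>L\<^esub>" using v w res_mult[of v w] V_S res_one by simp
    then have "inv\<^bsub>L\<^esub> h = res w"
      using v w res_closed V_S L.comm_inv_char by (metis L.m_comm)
    then show "inv\<^bsub>L\<^esub> h \<in> res ` V" using w by simp
  qed
  define q where "q = L.Irr (res ` V) (res x)"
  have alg: "L.algebraic (res ` V) (res x)" "separable_poly L (res ` V) q"
    using sep res_closed[OF x] unfolding separable_extension_def q_def by auto
  have "(L.algebraic over (res ` V)) (res x)" using alg(1) by (simp add: over_def)
  note q = L.IrrE[OF k res_closed[OF x] this, folded q_def]
  have qV: "set q \<subseteq> res ` V" using q(1) by (auto simp: univ_poly_def polynomial_def)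
  then have "\<exists>as. set as \<subseteq> V \<and> map res as = q"
  proof (induction q)
    case (Cons c q)
    then obtain as a where "set as \<subseteq> V" "map res as = q" "a \<in> V" "c = res a" by auto
    then show ?case by (intro exI[of _ "a # as"]) auto
  qed simp
  then obtain as where as: "set as \<subseteq> V" "map res as = q" by auto
  have asS: "set as \<subseteq> S" using as V_S by auto
  obtain u v where uv: "u \<in> carrier (univ_poly L (res ` V))" "v \<in> carrier (univ_poly L (res ` V))"
    "u \<otimes>\<^bsub>univ_poly L (res ` V)\<^esub> q \<oplus>\<^bsub>univ_poly L (res ` V)\<^esub> v \<otimes>\<^bsub>univ_poly L (res ` V)\<^esub> poly_deriv L q = \<one>\<^bsub>univ_poly L (res ` V)\<^esub>"
    using alg(2) unfolding separable_poly_def by blast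
  have dq: "poly_deriv L q \<in> carrier (univ_poly L (res ` V))"
  proof -
    have "add_pow L (i::nat) (L.coeff q i) \<in> res ` V" for i
    proof -
      have "L.coeff q i \<in> res ` V"
        using qV subringE(2)[OF sub] by (induction q) auto
      then obtain c where c: "c \<in> V" "L.coeff q i = res c" by auto
      have "add_pow K j c \<in> V" for j :: nat using c(1) V_props by (induction j) auto
      then show ?thesis using c res_add_pow V_S by (metis imageI)
    qed
    then show ?thesis unfolding poly_deriv_def univ_poly_def by (auto intro!: L.normalize_gives_polynomial)
  qed
  interpret UP: ring "univ_poly L (res ` V)" using L.univ_poly_is_ring[OF sub] .
  define ev where "ev = (\<lambda>q. L.eval q (res x))"
  have ev: "ev \<in> ring_hom (univ_poly L (res ` V)) L" unfolding ev_def by (rule L.eval_is_hom[OF sub res_closed[OF x]])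
  have "\<one>\<^bsub>L\<^esub> = ev (u \<otimes>\<^bsub>univ_poly L (res ` V)\<^esub> q \<oplus>\<^bsub>univ_poly L (res ` V)\<^esub> v \<otimes>\<^bsub>univ_poly L (res ` V)\<^esub> poly_deriv L q)"
    unfolding uv(3) using ring_hom_one[OF ev] by simp
  also have "\<dots> = ev u \<otimes>\<^bsub>L\<^esub> ev q \<oplus>\<^bsub>L\<^esub> ev v \<otimes>\<^bsub>L\<^esub> ev (poly_deriv L q)"
    using uv(1,2) q(1) dq by (simp add: ring_hom_add[OF ev] ring_hom_mult[OF ev])
  finally have one: "\<one>\<^bsub>L\<^esub> = ev u \<otimes>\<^bsub>L\<^esub> ev q \<oplus>\<^bsub>L\<^esub> ev v \<otimes>\<^bsub>L\<^esub> ev (poly_deriv L q)" .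
  have cl: "ev u \<in> carrier L" "ev v \<in> carrier L" using ring_hom_closed[OF ev] uv by auto
  have "ev q = \<zero>\<^bsub>L\<^esub>" using q(4) by (simp add: ev_def)
  moreover have "ev q = res (eval as x)" using eval_res[OF asS x] as by (simp add: ev_def)
  ultimately have 1: "eval as x \<in> M" using res_eq_zero_iff S_eval[OF asS x] by simp
  have "ev (poly_deriv L q) \<noteq> \<zero>\<^bsub>L\<^esub>"
  proof
    assume "ev (poly_deriv L q) = \<zero>\<^bsub>L\<^esub>"
    then have "\<one>\<^bsub>L\<^esub> = \<zero>\<^bsub>L\<^esub>" using one \<open>ev q = \<zero>\<^bsub>L\<^esub>\<close> cl by simp
    then show False by simp
  qed
  moreover have "ev (poly_deriv L q) = res (eval_deriv as x)" using eval_poly_deriv_res[OF asS x] as by (simp add: ev_def)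
  ultimately have "eval_deriv as x \<notin> M" using res_eq_zero_iff eval_deriv_S[OF asS x] by simp
  then show ?thesis using 1 as by blast
qed

end

lemma (in unramified_max) inertia_trivial:
  assumes sep: "\<And>x. x \<in> S \<Longrightarrow> \<exists>as. set as \<subseteq> V \<and> eval as x \<in> M \<and> eval_deriv as x \<notin> M"
    and \<alpha>: "\<alpha> \<in> carrier G" "\<alpha> \<noteq> \<one>\<^bsub>G\<^esub>"
  shows "\<exists>y\<in>S. y \<ominus> \<alpha> y \<notin> M"
proof (rule ccontr)
  assume "\<not> ?thesis"
  then have inert: "y \<ominus> \<alpha> y \<in> M" if "y \<in> S" for y using that by blast
  have \<alpha>S: "\<alpha> y \<in> S" if "y \<in> S" for y using power_bounded_act[OF that \<alpha>(1)] .
  have inert': "\<alpha> y \<ominus> y \<in> M" if y: "y \<in> S" for y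
  proof -
    have "y \<in> carrier K" "\<alpha> y \<in> carrier K" using y \<alpha> S_carrier by auto
    then have "\<alpha> y \<ominus> y = \<ominus> (y \<ominus> \<alpha> y)" by algebra
    then show ?thesis using M_uminus[OF inert[OF y]] by simp
  qed
  have \<alpha>M: "\<alpha> w \<in> S - M" if w: "w \<in> S - M" for w
  proof -
    have K: "w \<in> carrier K" "\<alpha> w \<in> carrier K" using w \<alpha> S_carrier by auto
    have "\<alpha> w \<notin> M"
    proof
      assume "\<alpha> w \<in> M"
      moreover have "w = \<alpha> w \<oplus> (w \<ominus> \<alpha> w)" using K by algebra
      ultimately show False using M_add inert w by (metis DiffD1 DiffD2)
    qed
    then show ?thesis using \<alpha>S w by auto
  qed
  have \<alpha>V: "\<alpha> v = v" if "v \<in> V" for v using F_act that V_F \<alpha> by auto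
  have \<alpha>eval: "\<alpha> (eval as x) = eval as (\<alpha> x)" if "set as \<subseteq> V" "x \<in> S" for as x
    using that(1)
  proof (induction as)
    case (Cons a as)
    have "eval as x \<in> carrier K" "a \<in> carrier K" "x \<in> carrier K"
      using S_eval[of as x] Cons.prems that(2) V_S S_carrier by auto
    then show ?case using Cons \<alpha> \<alpha>V by (simp add: act_add act_mult act_pow)
  qed (simp add: act_zero \<alpha>)
  \<comment> \<open>All \<open>x\<close> are treated at once because the step for \<open>x\<close>
    uses the bound at \<open>s\<close> and at the quotient \<open>t\<close>.\<close>
  have "\<forall>x\<in>S. val_ge (Suc n) (\<alpha> x \<ominus> x)" for n
  proof (induction n)
    case 0
    then show ?case using inert' val_ge_1_iff by simp
  next
    case (Suc n)
    show ?case
    proof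
      fix x assume x: "x \<in> S"
      obtain as where as: "set as \<subseteq> V" "eval as x \<in> M" "eval_deriv as x \<notin> M" using sep[OF x] by blast
      have asS: "set as \<subseteq> S" using as V_S by auto
      define m where "m = eval as x"
      have m: "m \<in> M" "m \<in> S" using as M_S by (auto simp: m_def)
      obtain h where h: "h \<in> S" "eval as (\<alpha> x) \<ominus> eval as x = (\<alpha> x \<ominus> x) \<otimes> h" "h \<ominus> eval_deriv as x \<in> M"
        using eval_difference[OF x \<alpha>S[OF x] inert'[OF x] asS] by blast
      have hM: "h \<in> S - M"
      proof -
        have "h \<in> carrier K" "eval_deriv as x \<in> carrier K" using h eval_deriv_S[OF asS x] S_carrier by auto
        then have "eval_deriv as x = h \<ominus> (h \<ominus> eval_deriv as x)" by algebra
        then show ?thesis using h as M_minus by (metis DiffI)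
      qed
      obtain t where t: "t \<in> S" "s \<otimes> m = p \<otimes> t" using s_M[OF m(1)] unfolding pS_def by blast
      have K: "m \<in> carrier K" "\<alpha> m \<in> carrier K" "t \<in> carrier K" "\<alpha> t \<in> carrier K" "\<alpha> s \<in> carrier K" "s \<in> carrier K"
         "h \<in> carrier K" "x \<in> carrier K" "\<alpha> x \<in> carrier K"
        using m t h x \<alpha> S_carrier by auto
      have e: "\<alpha> s \<otimes> \<alpha> m = p \<otimes> \<alpha> t" using arg_cong[OF t(2), of \<alpha>] \<alpha>(1) K \<alpha>V[OF p_V] by (simp add: act_mult)
      \<comment> \<open>Obtained by subtracting \<open>s m = p t\<close> from its image under
        \<alpha>. Both resulting terms gain one exponent, the first through the factor
        \<open>p\<close> and the second through \<open>m\<close> in \<open>M\<close>.\<close>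
      have "\<alpha> s \<otimes> (\<alpha> m \<ominus> m) = \<alpha> s \<otimes> \<alpha> m \<ominus> s \<otimes> m \<oplus> (s \<ominus> \<alpha> s) \<otimes> m" using K by algebra
      also have "\<dots> = p \<otimes> (\<alpha> t \<ominus> t) \<oplus> (s \<ominus> \<alpha> s) \<otimes> m" unfolding e t(2) using K p_closed by algebra
      also have "(s \<ominus> \<alpha> s) \<otimes> m = \<ominus> \<one> \<otimes> ((\<alpha> s \<ominus> s) \<otimes> m)" using K by algebra
      finally have e2: "\<alpha> s \<otimes> (\<alpha> m \<ominus> m) = p \<otimes> (\<alpha> t \<ominus> t) \<oplus> \<ominus> \<one> \<otimes> ((\<alpha> s \<ominus> s) \<otimes> m)" .
      have "val_ge (Suc (Suc n)) (\<alpha> s \<otimes> (\<alpha> m \<ominus> m))"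
        unfolding e2
      proof (rule val_ge_add)
        show "val_ge (Suc (Suc n)) (p \<otimes> (\<alpha> t \<ominus> t))" using val_ge_mult[OF val_ge_p] Suc t by fastforce
        have "val_ge (Suc n + 1) ((\<alpha> s \<ominus> s) \<otimes> m)"
          by (rule val_ge_mult) (use Suc m val_ge_1_iff in auto)
        from val_ge_mult[OF val_ge_0[of "\<ominus> \<one>"] this] show "val_ge (Suc (Suc n)) (\<ominus> \<one> \<otimes> ((\<alpha> s \<ominus> s) \<otimes> m))"
          using S_props by simp
      qed
      then have "val_ge (Suc (Suc n)) (\<alpha> m \<ominus> m)"
        using val_ge_cancel[OF \<alpha>M[OF s]] S_minus m \<alpha>S by blast
      moreover have "\<alpha> m \<ominus> m = h \<otimes> (\<alpha> x \<ominus> x)"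
        using h(2) \<alpha>eval[OF as(1) x] K by (simp add: m_def m_comm)
      ultimately show "val_ge (Suc (Suc n)) (\<alpha> x \<ominus> x)"
        using val_ge_cancel[OF hM] S_minus x \<alpha>S by simp
    qed
  qed
  then have ge: "val_ge n (\<alpha> x \<ominus> x)" if "x \<in> S" for x n
    using that val_ge_0[OF S_minus[OF \<alpha>S]] by (cases n) auto
  have fix_S: "\<alpha> x = x" if x: "x \<in> S" for x
    using val_ge_all_imp_zero[OF S_minus[OF \<alpha>S[OF x] x] ge[OF x]] x \<alpha> S_carrier by (simp add: r_right_minus_eq)
  have "\<alpha> x = x" if x: "x \<in> carrier K" for x
  proof -
    obtain r :: nat where r: "p [^] r \<otimes> x \<in> S" using S_fraction x by blast
    have "p [^] r \<otimes> \<alpha> x = p [^] r \<otimes> x"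
      using fix_S[OF r] \<alpha> x \<alpha>V[OF V_pow[OF p_V, of r]] by (simp add: act_mult)
    then show ?thesis using m_lcancel[of "p [^] r" "\<alpha> x" x] x \<alpha> by simp
  qed
  then show False using faithful[OF \<alpha>] by blast
qed

section \<open>The separability idempotent and the trace of an unramified extension\<close>

context finite_galois_dvr
begin

lemma ideal_in_maximal:
  assumes I: "ideal I SK" "\<one> \<notin> I"
  shows "\<exists>M. maximalideal M SK \<and> I \<subseteq> M"
proof -
  interpret SK: cring SK by (rule SK_cring)
  define A where "A = {J. ideal J SK \<and> I \<subseteq> J \<and> \<one> \<notin> J}"
  have "\<exists>M\<in>A. \<forall>J\<in>A. M \<subseteq> J \<longrightarrow> J = M"
  proof (rule subset_Zorn_nonempty)
    show "A \<noteq> {}" using I by (auto simp: A_def)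
    fix C assume C: "C \<noteq> {}" "subset.chain A C"
    have CA: "J \<in> C \<Longrightarrow> ideal J SK \<and> I \<subseteq> J \<and> \<one> \<notin> J" for J
      using C(2) by (auto simp: subset.chain_def A_def)
    have "ideal (\<Union>C) SK"
    proof (rule idealI)
      show "ring SK" by (rule SK.ring_axioms)
      show "subgroup (\<Union>C) (add_monoid SK)"
      proof (rule SK.add.subgroupI)
        show "\<Union>C \<subseteq> carrier SK" using CA ideal.Icarr by fastforce
        obtain J where J: "J \<in> C" using C(1) by blast
        then have "\<zero>\<^bsub>SK\<^esub> \<in> J" using CA ideal.axioms(1) additive_subgroup.zero_closed by blast
        then show "\<Union>C \<noteq> {}" using J by blast
        fix x assume "x \<in> \<Union>C"
        then obtain J where J: "J \<in> C" "x \<in> J" by blast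
        then have idJ: "ideal J SK" using CA by blast
        show "\<ominus>\<^bsub>SK\<^esub> x \<in> \<Union>C"
          using J additive_subgroup.a_inv_closed[OF ideal.axioms(1)[OF idJ] J(2)] by auto
        fix y assume "y \<in> \<Union>C"
        then obtain J' where J': "J' \<in> C" "y \<in> J'" by blast
        have "J \<subseteq> J' \<or> J' \<subseteq> J" using C(2) J(1) J'(1) unfolding subset.chain_def by blast
        then obtain J'' where J'': "J'' \<in> C" "x \<in> J''" "y \<in> J''" using J J' by (metis subsetD)
        have "x \<oplus>\<^bsub>SK\<^esub> y \<in> J''"
          by (rule additive_subgroup.a_closed[OF ideal.axioms(1)[OF conjunct1[OF CA[OF J''(1)]]] J''(2,3)])
        then show "x \<oplus>\<^bsub>SK\<^esub> y \<in> \<Union>C" using J'' by blast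
      qed
      fix x a assume "x \<in> \<Union>C" and a: "a \<in> carrier SK"
      then obtain J where J: "J \<in> C" "x \<in> J" by blast
      then have idJ: "ideal J SK" using CA by blast
      show "a \<otimes>\<^bsub>SK\<^esub> x \<in> \<Union>C" using ideal.I_l_closed[OF idJ J(2) a] J by blast
      show "x \<otimes>\<^bsub>SK\<^esub> a \<in> \<Union>C" using ideal.I_r_closed[OF idJ J(2) a] J by blast
    qed
    then show "\<Union>C \<in> A" unfolding A_def using CA C(1) by blast
  qed
  then obtain M where M: "M \<in> A" "\<forall>J\<in>A. M \<subseteq> J \<longrightarrow> J = M" by blast
  have "maximalideal M SK"
  proof (rule maximalidealI)
    show "ideal M SK" using M(1) by (simp add: A_def)
    show "carrier SK \<noteq> M" using M(1) S_props(3) by (auto simp: A_def)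
    fix J assume J: "ideal J SK" "M \<subseteq> J" "J \<subseteq> carrier SK"
    show "J = M \<or> J = carrier SK"
    proof (cases "\<one> \<in> J")
      case True then show ?thesis using ideal.one_imp_carrier[OF J(1)] by simp
    next
      case False then show ?thesis using M J unfolding A_def by blast
    qed
  qed
  then show ?thesis using M(1) by (auto simp: A_def)
qed

end

locale unramified_galois_dvr = finite_galois_dvr +
  assumes unramified: "unramified K V S"
begin

lemma unramified_at:
  assumes "maximalideal M SK"
  shows "galois_dvr_max K G F V p M" "p \<notin> M [^]\<^bsub>ideals_set SK\<^esub> (2::nat)" "\<exists>s. unramified_max K G F V p M s"
    "separable_extension (SK Quot M) ((\<lambda>v. M +>\<^bsub>SK\<^esub> v) ` V)"
proof -
  show g: "galois_dvr_max K G F V p M" by (intro galois_dvr_max.intro galois_dvr_max_axioms.intro finite_galois_dvr_axioms assms)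
  interpret galois_dvr_max K G F V p M by (rule g)
  have r: "ramification_index K V S M = 1"
    and sep: "separable_extension (SK Quot M) ((\<lambda>v. M +>\<^bsub>SK\<^esub> v) ` V)"
    using unramified assms unfolding unramified_def by auto
  show "p \<notin> M [^]\<^bsub>ideals_set SK\<^esub> (2::nat)" by (rule ramification_index_one(1)[OF r])
  obtain s where "s \<in> S - M" "\<forall>m\<in>M. s \<otimes> m \<in> pS" using ramification_index_one(2)[OF r] by blast
  then have "unramified_max K G F V p M s"
    by (intro unramified_max.intro galois_dvr_max_axioms unramified_max_axioms.intro) auto
  then show "\<exists>s. unramified_max K G F V p M s" by blast
  show "separable_extension (SK Quot M) ((\<lambda>v. M +>\<^bsub>SK\<^esub> v) ` V)" by (rule sep)
qed

text \<open>The values at the identity of tensors that vanish elsewhere form an ideal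
  \<open>I\<close> of \<open>S\<close>. At each maximal ideal, \<open>inertia_trivial\<close>
  provides the elements from which \<open>tens_vanishing\<close> builds a value outside it, so
  \<open>I\<close> contains 1. No rescaling by an inverse as for \<open>K\<close> is available
  here.\<close>

lemma separating_S: "separating S"
proof -
  interpret SK: cring SK by (rule SK_cring)
  define I where "I = {w \<one>\<^bsub>G\<^esub> | w. w \<in> tens S \<and> (\<forall>\<alpha>\<in>carrier G. \<alpha> \<noteq> \<one>\<^bsub>G\<^esub> \<longrightarrow> w \<alpha> = \<zero>)}"
  have SK': "S \<subseteq> carrier K" using S_carrier by auto
  have scale: "a \<otimes> x \<in> I" if x: "x \<in> I" and a: "a \<in> S" for a x
  proof -
    obtain w where w: "w \<in> tens S" "\<forall>\<alpha>\<in>carrier G. \<alpha> \<noteq> \<one>\<^bsub>G\<^esub> \<longrightarrow> w \<alpha> = \<zero>" "x = w \<one>\<^bsub>G\<^esub>" using x unfolding I_def by blast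
    define w' where "w' = (\<lambda>\<alpha>. a \<otimes> w \<alpha>)"
    have "w' \<in> tens S" by (rule tens_scale[OF w(1) power_bounded_subring a]) (simp add: w'_def)
    moreover have "\<forall>\<alpha>\<in>carrier G. \<alpha> \<noteq> \<one>\<^bsub>G\<^esub> \<longrightarrow> w' \<alpha> = \<zero>" using w(2) a S_carrier by (simp add: w'_def)
    ultimately show ?thesis unfolding I_def using w(3) by (auto simp: w'_def)
  qed
  have IS: "I \<subseteq> S" unfolding I_def using tens_one_mem[OF _ power_bounded_subring] by blast
  have I_ideal: "ideal I SK"
  proof (rule idealI)
    show "ring SK" by (rule SK.ring_axioms)
    show "subgroup I (add_monoid SK)"
    proof (rule SK.add.subgroupI)
      show "I \<subseteq> carrier SK" using IS by simp
      have "(\<lambda>\<alpha>. \<zero>) \<in> tens S" by (rule tens.pure[of \<zero> _ \<zero>]) (simp_all add: S_props act_zero)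
      then show "I \<noteq> {}" unfolding I_def by blast
      fix x assume x: "x \<in> I"
      have "\<ominus>\<^bsub>SK\<^esub> x = \<ominus> \<one> \<otimes> x" using x IS S_carrier SK_minus[of x] by (auto simp: l_minus)
      then show "\<ominus>\<^bsub>SK\<^esub> x \<in> I" using scale[OF x, of "\<ominus> \<one>"] S_props by simp
      fix y assume y: "y \<in> I"
      obtain w where w: "w \<in> tens S" "\<forall>\<alpha>\<in>carrier G. \<alpha> \<noteq> \<one>\<^bsub>G\<^esub> \<longrightarrow> w \<alpha> = \<zero>" "x = w \<one>\<^bsub>G\<^esub>" using x unfolding I_def by blast
      obtain v where v: "v \<in> tens S" "\<forall>\<alpha>\<in>carrier G. \<alpha> \<noteq> \<one>\<^bsub>G\<^esub> \<longrightarrow> v \<alpha> = \<zero>" "y = v \<one>\<^bsub>G\<^esub>" using y unfolding I_def by blast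
      define u where "u = (\<lambda>\<alpha>. w \<alpha> \<oplus> v \<alpha>)"
      have "u \<in> tens S" by (rule tens.add[OF w(1) v(1)]) (simp add: u_def)
      moreover have "\<forall>\<alpha>\<in>carrier G. \<alpha> \<noteq> \<one>\<^bsub>G\<^esub> \<longrightarrow> u \<alpha> = \<zero>" using w(2) v(2) by (simp add: u_def)
      moreover have "x \<oplus>\<^bsub>SK\<^esub> y = u \<one>\<^bsub>G\<^esub>" using w(3) v(3) by (simp add: u_def)
      ultimately show "x \<oplus>\<^bsub>SK\<^esub> y \<in> I" unfolding I_def by blast
    qed
    fix x a assume x: "x \<in> I" and a: "a \<in> carrier SK"
    show *: "a \<otimes>\<^bsub>SK\<^esub> x \<in> I" using scale x a by simp
    have "x \<otimes>\<^bsub>SK\<^esub> a = a \<otimes>\<^bsub>SK\<^esub> x" using x a IS by (intro SK.m_comm) auto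
    then show "x \<otimes>\<^bsub>SK\<^esub> a \<in> I" using * by simp
  qed
  have "\<one> \<in> I"
  proof (rule ccontr)
    assume "\<one> \<notin> I"
    then obtain M where M: "maximalideal M SK" "I \<subseteq> M" using ideal_in_maximal[OF I_ideal] by blast
    obtain s where s: "unramified_max K G F V p M s" using unramified_at(3)[OF M(1)] by blast
    interpret unramified_max K G F V p M s by (rule s)
    have "\<exists>w\<in>tens S. w \<one>\<^bsub>G\<^esub> \<notin> M \<and> (\<forall>\<alpha>\<in>carrier G. \<alpha> \<noteq> \<one>\<^bsub>G\<^esub> \<longrightarrow> w \<alpha> = \<zero>)"
    proof (rule tens_vanishing[OF power_bounded_subring])
      show "a \<in> S - M \<Longrightarrow> b \<in> S - M \<Longrightarrow> a \<otimes> b \<notin> M" for a b using M_prime' by blast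
      show "\<alpha> \<in> carrier G \<Longrightarrow> \<alpha> \<noteq> \<one>\<^bsub>G\<^esub> \<Longrightarrow> \<exists>y\<in>S. y \<ominus> \<alpha> y \<notin> M" for \<alpha>
        using inertia_trivial[OF separable_residue[OF unramified_at(4)[OF M(1)]]] by blast
      show "\<alpha> \<in> carrier G \<Longrightarrow> x \<in> S \<Longrightarrow> \<alpha> x \<in> S" for \<alpha> x by (rule power_bounded_act)
    qed (rule one_notin_M)
    then show False using M(2) unfolding I_def by blast
  qed
  then obtain w where "w \<in> tens S" "\<forall>\<alpha>\<in>carrier G. \<alpha> \<noteq> \<one>\<^bsub>G\<^esub> \<longrightarrow> w \<alpha> = \<zero>" "\<one> = w \<one>\<^bsub>G\<^esub>" unfolding I_def by blast
  then show ?thesis unfolding separating_def by (intro bexI[of _ w]) auto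
qed

lemma Tr_S_V: "x \<in> S \<Longrightarrow> Tr x \<in> V"
proof -
  assume x: "x \<in> S"
  have "Tr x \<in> S" unfolding Tr_def using power_bounded_act[OF x] fin_G by (intro S_finsum)
  then show ?thesis using power_bounded_F Tr_F x S_carrier by blast
qed

text \<open>If \<open>p\<close> divided all traces, the dual basis expansion would place 1 in
  \<open>p S\<close>. A trace not divisible by \<open>p\<close> is a unit of \<open>V\<close> and
  can be normalised.\<close>

lemma ex_Tr_eq_1_S: "\<exists>t\<in>S. Tr t = \<one>"
proof -
  have "\<exists>t\<in>S. \<forall>b\<in>V. Tr t \<noteq> p \<otimes> b"
  proof (rule ccontr)
    assume neg: "\<not> ?thesis"
    have "\<one> \<in> pS"
    proof (rule separating_Tr[OF separating_S _ one_closed, of "\<lambda>x. x \<in> pS"])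
      fix a t assume at: "a \<in> S" "t \<in> S"
      then obtain b where b: "b \<in> V" "Tr t = p \<otimes> b" using neg by blast
      then have "Tr t \<in> pS" using V_S unfolding pS_def by blast
      then show "a \<otimes> Tr (t \<otimes> \<one>) \<in> pS" using at S_carrier pS_mult by simp
    qed (use S_carrier pS_add in auto)
    then show False using p_nonunit_S unfolding pS_def by force
  qed
  then obtain t where t: "t \<in> S" "\<forall>b\<in>V. Tr t \<noteq> p \<otimes> b" by blast
  then obtain w where w: "w \<in> V" "Tr t \<otimes> w = \<one>" using V_local[OF Tr_S_V[OF t(1)]] by blast
  have "Tr (w \<otimes> t) = Tr t \<otimes> w"
    using Tr_F_mult[OF subsetD[OF V_F w(1)] S_carrier[OF t(1)]] m_comm[of w "Tr t"] V_carrier[OF w(1)] S_carrier[OF t(1)] by simp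
  then show ?thesis using w S_props(5)[OF V_S[OF w(1)] t(1)] by metis
qed

end

section \<open>Finitely generated projective modules\<close>

lemma left_ideal_module_simps [simp]:
  "carrier (left_ideal_module R I) = I" "x \<oplus>\<^bsub>left_ideal_module R I\<^esub> y = x \<oplus>\<^bsub>R\<^esub> y"
  "\<zero>\<^bsub>left_ideal_module R I\<^esub> = \<zero>\<^bsub>R\<^esub>" "x \<odot>\<^bsub>left_ideal_module R I\<^esub> y = x \<otimes>\<^bsub>R\<^esub> y"
  by (simp_all add: left_ideal_module_def)

lemma left_ideal_module_left_module:
  assumes "left_ideal I R"
  shows "left_module R (left_ideal_module R I)"
proof -
  interpret left_ideal I R by fact
  have cl: "x \<in> carrier R" if "x \<in> I" for x using a_subset that by auto
  have "abelian_group (left_ideal_module R I)"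
  proof (rule abelian_groupI)
    fix x assume x: "x \<in> carrier (left_ideal_module R I)"
    show "\<exists>y\<in>carrier (left_ideal_module R I). y \<oplus>\<^bsub>left_ideal_module R I\<^esub> x = \<zero>\<^bsub>left_ideal_module R I\<^esub>"
      using x cl by (intro bexI[of _ "\<ominus>\<^bsub>R\<^esub> x"]) (auto simp: l_neg)
  next
    fix x y z assume "x \<in> carrier (left_ideal_module R I)" "y \<in> carrier (left_ideal_module R I)"
      "z \<in> carrier (left_ideal_module R I)"
    then have "x \<in> carrier R" "y \<in> carrier R" "z \<in> carrier R" using cl by auto
    then show "x \<oplus>\<^bsub>left_ideal_module R I\<^esub> y \<oplus>\<^bsub>left_ideal_module R I\<^esub> z = x \<oplus>\<^bsub>left_ideal_module R I\<^esub> (y \<oplus>\<^bsub>left_ideal_module R I\<^esub> z)"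
      by (simp add: a_assoc)
  next
    fix x y assume "x \<in> carrier (left_ideal_module R I)" "y \<in> carrier (left_ideal_module R I)"
    then have "x \<in> carrier R" "y \<in> carrier R" using cl by auto
    then show "x \<oplus>\<^bsub>left_ideal_module R I\<^esub> y = y \<oplus>\<^bsub>left_ideal_module R I\<^esub> x"
      using a_comm by simp
  qed (simp_all add: cl)
  then show ?thesis
    by (intro left_module.intro left_module_axioms.intro ring_axioms)
       (auto simp: cl l_distr r_distr m_assoc left_ideal_closed)
qed

lemma left_module_homE:
  assumes "h \<in> left_module_hom R P Q"
  shows "x \<in> carrier P \<Longrightarrow> h x \<in> carrier Q"
    "x \<in> carrier P \<Longrightarrow> y \<in> carrier P \<Longrightarrow> h (x \<oplus>\<^bsub>P\<^esub> y) = h x \<oplus>\<^bsub>Q\<^esub> h y"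
    "a \<in> carrier R \<Longrightarrow> x \<in> carrier P \<Longrightarrow> h (a \<odot>\<^bsub>P\<^esub> x) = a \<odot>\<^bsub>Q\<^esub> h x"
  using assms by (auto simp: left_module_hom_def)

lemma left_module_homI:
  assumes "\<And>x. x \<in> carrier P \<Longrightarrow> h x \<in> carrier Q"
    "\<And>x y. x \<in> carrier P \<Longrightarrow> y \<in> carrier P \<Longrightarrow> h (x \<oplus>\<^bsub>P\<^esub> y) = h x \<oplus>\<^bsub>Q\<^esub> h y"
    "\<And>a x. a \<in> carrier R \<Longrightarrow> x \<in> carrier P \<Longrightarrow> h (a \<odot>\<^bsub>P\<^esub> x) = a \<odot>\<^bsub>Q\<^esub> h x"
  shows "h \<in> left_module_hom R P Q"
  using assms by (auto simp: left_module_hom_def)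

text \<open>
  The image of \<open>Hom(P, R) \<otimes> P\<close> in the endomorphisms of \<open>P\<close>; it contains the identity if and only
  if \<open>P\<close> is finitely generated and projective (dual basis lemma).
\<close>

inductive_set fin_endo :: "('a, 'b) ring_scheme \<Rightarrow> ('a, 'c, 'd) module_scheme \<Rightarrow> ('c \<Rightarrow> 'c) set" for R P where
  rank1: "\<lbrakk>\<phi> \<in> left_module_hom R P (left_ideal_module R (carrier R)); m \<in> carrier P;
      \<And>x. x \<in> carrier P \<Longrightarrow> h x = \<phi> x \<odot>\<^bsub>P\<^esub> m\<rbrakk> \<Longrightarrow> h \<in> fin_endo R P"
| add: "\<lbrakk>u \<in> fin_endo R P; v \<in> fin_endo R P; \<And>x. x \<in> carrier P \<Longrightarrow> h x = u x \<oplus>\<^bsub>P\<^esub> v x\<rbrakk> \<Longrightarrow> h \<in> fin_endo R P"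

definition fg_projective :: "('a, 'b) ring_scheme \<Rightarrow> ('a, 'c, 'd) module_scheme \<Rightarrow> bool" where
  "fg_projective R P \<longleftrightarrow> (\<exists>h\<in>fin_endo R P. \<forall>x\<in>carrier P. h x = x)"

text \<open>A map of rank one is lifted by lifting its single vector \<open>m\<close>; a sum of such
  maps is lifted term by term.\<close>

lemma fin_endo_lift:
  assumes P: "left_module R P" and N: "left_module R N" and g: "g \<in> left_module_hom R N P" "g ` carrier N = carrier P"
    and h: "h \<in> fin_endo R P"
  shows "\<exists>k\<in>left_module_hom R P N. \<forall>x\<in>carrier P. g (k x) = h x"
  using h
proof (induction rule: fin_endo.induct)
  case (rank1 \<phi> m h)
  interpret N: left_module R N by (rule N)
  obtain n where n: "n \<in> carrier N" "g n = m" using rank1(2) g(2) by (metis imageE)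
  note \<phi> = left_module_homE[OF rank1(1), simplified]
  have "(\<lambda>x. \<phi> x \<odot>\<^bsub>N\<^esub> n) \<in> left_module_hom R P N"
    using n \<phi> by (intro left_module_homI) (simp_all add: N.smult_closed N.smult_l_distr N.smult_assoc)
  moreover have "\<forall>x\<in>carrier P. g (\<phi> x \<odot>\<^bsub>N\<^esub> n) = h x"
    using n \<phi> rank1 left_module_homE(3)[OF g(1)] by simp
  ultimately show ?case by (intro bexI[of _ "\<lambda>x. \<phi> x \<odot>\<^bsub>N\<^esub> n"])
next
  case (add u v h)
  interpret N: left_module R N by (rule N)
  obtain k l where k: "k \<in> left_module_hom R P N" "\<forall>x\<in>carrier P. g (k x) = u x"
    and l: "l \<in> left_module_hom R P N" "\<forall>x\<in>carrier P. g (l x) = v x" using add by blast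
  note kE = left_module_homE[OF k(1)] and lE = left_module_homE[OF l(1)]
  have "(\<lambda>x. k x \<oplus>\<^bsub>N\<^esub> l x) \<in> left_module_hom R P N"
    using kE lE by (intro left_module_homI) (simp_all add: N.M.a_ac N.smult_r_distr)
  moreover have "\<forall>x\<in>carrier P. g (k x \<oplus>\<^bsub>N\<^esub> l x) = h x"
    using kE lE k l add left_module_homE(2)[OF g(1)] by simp
  ultimately show ?case by (intro bexI[of _ "\<lambda>x. k x \<oplus>\<^bsub>N\<^esub> l x"])
qed

lemma fg_projective_imp_projective:
  fixes R :: "('a, 'b) ring_scheme" and P :: "('a, 'c, 'd) module_scheme"
  assumes P: "left_module R P" and "fg_projective R P"
  shows "projective_module R P"
proof (rule projective_module_if_lifting[OF P])
  fix N :: "('a, 'c \<Rightarrow> 'a) module" and g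
  assume N: "left_module R N" and g: "g \<in> left_module_hom R N P" "g ` carrier N = carrier P"
  obtain h where h: "h \<in> fin_endo R P" "\<forall>x\<in>carrier P. h x = x" using assms(2) unfolding fg_projective_def by blast
  obtain k where k: "k \<in> left_module_hom R P N" "\<forall>x\<in>carrier P. g (k x) = h x"
    using fin_endo_lift[OF P N g h(1)] ..
  then show "\<exists>k\<in>left_module_hom R P N. \<forall>x\<in>carrier P. g (k x) = x"
    using h(2) by (intro bexI[OF _ k(1)]) simp
qed

lemma fin_endo_hom:
  assumes P: "left_module R P" and h: "h \<in> fin_endo R P"
  shows "h \<in> left_module_hom R P P"
  using h
proof (induction rule: fin_endo.induct)
  case (rank1 \<phi> m h)
  interpret P: left_module R P by (rule P)
  note \<phi> = left_module_homE[OF rank1(1), simplified]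
  show ?case
    using \<phi> rank1(2,3) by (intro left_module_homI) (simp_all add: P.smult_closed P.smult_l_distr P.smult_assoc)
next
  case (add u v h)
  interpret P: left_module R P by (rule P)
  note u = left_module_homE[OF add(4)] and v = left_module_homE[OF add(5)]
  show ?case using u v add(3) by (intro left_module_homI) (simp_all add: P.M.a_ac P.smult_r_distr P.smult_closed)
qed

lemma fin_endo_precomp:
  assumes Q: "left_module R Q" and h: "h \<in> fin_endo R Q" and \<iota>: "\<iota> \<in> left_module_hom R P Q" and r: "r \<in> left_module_hom R Q P"
  shows "(\<lambda>x. r (h (\<iota> x))) \<in> fin_endo R P"
  using h
proof (induction rule: fin_endo.induct)
  case (rank1 \<phi> m h)
  note \<phi> = left_module_homE[OF rank1(1), simplified] and \<iota>E = left_module_homE[OF \<iota>] and rE = left_module_homE[OF r]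
  show ?case
  proof (rule fin_endo.rank1[of "\<lambda>x. \<phi> (\<iota> x)" _ _ "r m"])
    show "(\<lambda>x. \<phi> (\<iota> x)) \<in> left_module_hom R P (left_ideal_module R (carrier R))"
      using \<phi> \<iota>E by (intro left_module_homI) simp_all
  qed (use \<phi> \<iota>E rE rank1 in auto)
next
  case (add u v h)
  show ?case
  proof (rule fin_endo.add[OF add(4,5)])
    fix x assume x: "x \<in> carrier P"
    have "u (\<iota> x) \<in> carrier Q" "v (\<iota> x) \<in> carrier Q"
      using left_module_homE(1)[OF fin_endo_hom[OF Q add(1)]] left_module_homE(1)[OF fin_endo_hom[OF Q add(2)]]
        left_module_homE(1)[OF \<iota> x] by auto
    then show "r (h (\<iota> x)) = r (u (\<iota> x)) \<oplus>\<^bsub>P\<^esub> r (v (\<iota> x))"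
      using left_module_homE(1)[OF \<iota> x] add(3) left_module_homE(2)[OF r] by simp
  qed
qed

lemma fg_projective_retract:
  assumes Q: "left_module R Q" "fg_projective R Q" and \<iota>: "\<iota> \<in> left_module_hom R P Q" and r: "r \<in> left_module_hom R Q P"
    and r\<iota>: "\<And>x. x \<in> carrier P \<Longrightarrow> r (\<iota> x) = x"
  shows "fg_projective R P"
proof -
  obtain h where h: "h \<in> fin_endo R Q" "\<forall>x\<in>carrier Q. h x = x" using Q unfolding fg_projective_def by blast
  have "r (h (\<iota> x)) = x" if "x \<in> carrier P" for x
    using h(2) left_module_homE(1)[OF \<iota> that] r\<iota>[OF that] by simp
  then show ?thesis using fin_endo_precomp[OF Q(1) h(1) \<iota> r] unfolding fg_projective_def
    by (intro bexI[of _ "\<lambda>x. r (h (\<iota> x))"]) simp_all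
qed

text \<open>Lifting the identity of \<open>Q\<close> gives a finite-rank \<open>H\<close> on
  \<open>P\<close> with \<open>\<pi> H = \<pi>\<close>. Then \<open>x - H x\<close> falls into the
  kernel \<open>N\<close>, where the identity has finite rank as well, and
  \<open>x = (x - H x) + H x\<close> writes the identity of \<open>P\<close> as a sum of two
  finite-rank maps. The kernel is allowed to be a different record, so the agreement of the
  operations is assumed.\<close>

lemma fg_projective_extension:
  assumes P: "left_module R P" and Q: "left_module R Q" "fg_projective R Q"
    and \<pi>: "\<pi> \<in> left_module_hom R P Q" "\<pi> ` carrier P = carrier Q"
    and N: "left_module R N" "fg_projective R N" "\<iota> \<in> left_module_hom R N P"
    and ker: "\<And>x. x \<in> carrier P \<Longrightarrow> \<pi> x = \<zero>\<^bsub>Q\<^esub> \<Longrightarrow> x \<in> carrier N \<and> \<iota> x = x"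
    and sub: "\<And>x y. x \<oplus>\<^bsub>N\<^esub> y = x \<oplus>\<^bsub>P\<^esub> y" "\<And>a x. a \<odot>\<^bsub>N\<^esub> x = a \<odot>\<^bsub>P\<^esub> x"
  shows "fg_projective R P"
proof -
  interpret P: left_module R P by (rule P)
  interpret Q: left_module R Q by (rule Q)
  have "\<exists>H\<in>fin_endo R P. \<forall>x\<in>carrier P. \<pi> (H x) = h (\<pi> x)" if "h \<in> fin_endo R Q" for h
    using that
  proof (induction rule: fin_endo.induct)
    case (rank1 \<phi> m h)
    note \<phi> = left_module_homE[OF rank1(1), simplified] and \<pi>E = left_module_homE[OF \<pi>(1)]
    obtain n where n: "n \<in> carrier P" "\<pi> n = m" using rank1(2) \<pi>(2) by (metis imageE)
    have "(\<lambda>x. \<phi> (\<pi> x)) \<in> left_module_hom R P (left_ideal_module R (carrier R))"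
      using \<phi> \<pi>E by (intro left_module_homI) simp_all
    then have "(\<lambda>x. \<phi> (\<pi> x) \<odot>\<^bsub>P\<^esub> n) \<in> fin_endo R P" using n by (intro fin_endo.rank1) auto
    moreover have "\<forall>x\<in>carrier P. \<pi> (\<phi> (\<pi> x) \<odot>\<^bsub>P\<^esub> n) = h (\<pi> x)" using \<phi> \<pi>E n rank1 by simp
    ultimately show ?case by (intro bexI[of _ "\<lambda>x. \<phi> (\<pi> x) \<odot>\<^bsub>P\<^esub> n"])
  next
    case (add u v h)
    obtain k l where k: "k \<in> fin_endo R P" "\<forall>x\<in>carrier P. \<pi> (k x) = u (\<pi> x)"
      and l: "l \<in> fin_endo R P" "\<forall>x\<in>carrier P. \<pi> (l x) = v (\<pi> x)" using add by blast
    have kl: "(\<lambda>x. k x \<oplus>\<^bsub>P\<^esub> l x) \<in> fin_endo R P" using fin_endo.add[OF k(1) l(1)] by simp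
    have "\<forall>x\<in>carrier P. \<pi> (k x \<oplus>\<^bsub>P\<^esub> l x) = h (\<pi> x)"
      using left_module_homE(1)[OF fin_endo_hom[OF P k(1)]] left_module_homE(1)[OF fin_endo_hom[OF P l(1)]]
        left_module_homE(1,2)[OF \<pi>(1)] k l add(3) by simp
    then show ?case using kl by (intro bexI[of _ "\<lambda>x. k x \<oplus>\<^bsub>P\<^esub> l x"])
  qed
  then obtain H where H: "H \<in> fin_endo R P" "\<forall>x\<in>carrier P. \<pi> (H x) = \<pi> x"
  proof -
    obtain h where h: "h \<in> fin_endo R Q" "\<forall>x\<in>carrier Q. h x = x" using Q(2) unfolding fg_projective_def by blast
    obtain H where H: "H \<in> fin_endo R P" "\<forall>x\<in>carrier P. \<pi> (H x) = h (\<pi> x)"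
      using \<open>\<And>h. h \<in> fin_endo R Q \<Longrightarrow> \<exists>H\<in>fin_endo R P. \<forall>x\<in>carrier P. \<pi> (H x) = h (\<pi> x)\<close>[OF h(1)] ..
    then show ?thesis using that h(2) left_module_homE(1)[OF \<pi>(1)] by simp
  qed
  note HE = left_module_homE[OF fin_endo_hom[OF P H(1)]] and \<pi>E = left_module_homE[OF \<pi>(1)]
  have \<pi>0: "\<pi> \<zero>\<^bsub>P\<^esub> = \<zero>\<^bsub>Q\<^esub>"
    using \<pi>E(3)[of "\<zero>\<^bsub>R\<^esub>" "\<zero>\<^bsub>P\<^esub>"] \<pi>E(1)[of "\<zero>\<^bsub>P\<^esub>"] P.smult_l_null Q.smult_l_null by simp
  have diff: "x \<ominus>\<^bsub>P\<^esub> H x \<in> carrier N" "\<iota> (x \<ominus>\<^bsub>P\<^esub> H x) = x \<ominus>\<^bsub>P\<^esub> H x" if x: "x \<in> carrier P" for x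
  proof -
    have "\<pi> (x \<ominus>\<^bsub>P\<^esub> H x) \<oplus>\<^bsub>Q\<^esub> \<pi> (H x) = \<pi> ((x \<ominus>\<^bsub>P\<^esub> H x) \<oplus>\<^bsub>P\<^esub> H x)" using x HE \<pi>E(2) by simp
    also have "(x \<ominus>\<^bsub>P\<^esub> H x) \<oplus>\<^bsub>P\<^esub> H x = x" using x HE by (simp add: P.M.minus_eq P.M.a_assoc P.M.l_neg)
    finally have "\<pi> (x \<ominus>\<^bsub>P\<^esub> H x) \<oplus>\<^bsub>Q\<^esub> \<pi> x = \<pi> x" using H(2) x by simp
    then have "\<pi> (x \<ominus>\<^bsub>P\<^esub> H x) = \<zero>\<^bsub>Q\<^esub>"
      using Q.M.add.r_cancel_one[of "\<pi> x" "\<pi> (x \<ominus>\<^bsub>P\<^esub> H x)"] \<pi>E(1) x HE by simp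
    then show "x \<ominus>\<^bsub>P\<^esub> H x \<in> carrier N" "\<iota> (x \<ominus>\<^bsub>P\<^esub> H x) = x \<ominus>\<^bsub>P\<^esub> H x" using ker x HE by auto
  qed
  have sm: "a \<odot>\<^bsub>P\<^esub> (\<ominus>\<^bsub>P\<^esub> y) = \<ominus>\<^bsub>P\<^esub> (a \<odot>\<^bsub>P\<^esub> y)" if a: "a \<in> carrier R" "y \<in> carrier P" for a y
  proof -
    have "a \<odot>\<^bsub>P\<^esub> (\<ominus>\<^bsub>P\<^esub> y) \<oplus>\<^bsub>P\<^esub> a \<odot>\<^bsub>P\<^esub> y = \<zero>\<^bsub>P\<^esub>"
      using a P.smult_r_distr[of a "\<ominus>\<^bsub>P\<^esub> y" y] by (simp add: P.M.l_neg P.smult_r_null)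
    then show ?thesis using P.M.minus_equality[of "a \<odot>\<^bsub>P\<^esub> (\<ominus>\<^bsub>P\<^esub> y)" "a \<odot>\<^bsub>P\<^esub> y"] a P.smult_closed by simp
  qed
  have D: "(\<lambda>x. x \<ominus>\<^bsub>P\<^esub> H x) \<in> left_module_hom R P N"
  proof (rule left_module_homI)
    fix x y assume xy: "x \<in> carrier P" "y \<in> carrier P"
    show "(x \<oplus>\<^bsub>P\<^esub> y) \<ominus>\<^bsub>P\<^esub> H (x \<oplus>\<^bsub>P\<^esub> y) = (x \<ominus>\<^bsub>P\<^esub> H x) \<oplus>\<^bsub>N\<^esub> (y \<ominus>\<^bsub>P\<^esub> H y)"
      using xy HE by (simp add: sub P.M.minus_eq P.M.minus_add P.M.a_ac)
  next
    fix a x assume "a \<in> carrier R" "x \<in> carrier P"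
    then show "a \<odot>\<^bsub>P\<^esub> x \<ominus>\<^bsub>P\<^esub> H (a \<odot>\<^bsub>P\<^esub> x) = a \<odot>\<^bsub>N\<^esub> (x \<ominus>\<^bsub>P\<^esub> H x)"
      using HE by (simp add: sub P.M.minus_eq P.smult_r_distr sm)
  qed (rule diff)
  obtain k where k: "k \<in> fin_endo R N" "\<forall>x\<in>carrier N. k x = x" using N(2) unfolding fg_projective_def by blast
  have "(\<lambda>x. \<iota> (k (x \<ominus>\<^bsub>P\<^esub> H x))) \<in> fin_endo R P" by (rule fin_endo_precomp[OF N(1) k(1) D N(3)])
  then have "(\<lambda>x. \<iota> (k (x \<ominus>\<^bsub>P\<^esub> H x)) \<oplus>\<^bsub>P\<^esub> H x) \<in> fin_endo R P"
    by (rule fin_endo.add[OF _ H(1)]) simp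
  moreover have "\<iota> (k (x \<ominus>\<^bsub>P\<^esub> H x)) \<oplus>\<^bsub>P\<^esub> H x = x" if x: "x \<in> carrier P" for x
    using k(2) diff[OF x] x HE by (simp add: P.M.minus_eq P.M.a_assoc P.M.l_neg)
  ultimately show ?thesis unfolding fg_projective_def
    by (intro bexI[of _ "\<lambda>x. \<iota> (k (x \<ominus>\<^bsub>P\<^esub> H x)) \<oplus>\<^bsub>P\<^esub> H x"]) simp_all
qed

lemma fg_projective_zero:
  assumes P: "left_module R P" and "carrier P = {\<zero>\<^bsub>P\<^esub>}"
  shows "fg_projective R P"
proof -
  interpret P: left_module R P by (rule P)
  have "(\<lambda>x. \<zero>\<^bsub>R\<^esub>) \<in> left_module_hom R P (left_ideal_module R (carrier R))"
    by (intro left_module_homI) auto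
  then have "(\<lambda>x. \<zero>\<^bsub>P\<^esub>) \<in> fin_endo R P"
    by (rule fin_endo.rank1[of _ _ _ "\<zero>\<^bsub>P\<^esub>"]) (simp_all add: P.smult_l_null)
  then show ?thesis using assms(2) unfolding fg_projective_def by (intro bexI[of _ "\<lambda>x. \<zero>\<^bsub>P\<^esub>"]) simp_all
qed

text \<open>Conjugation by \<theta> carries finite-rank maps to finite-rank maps. It is meant for
  the passage between the opposite ring of an order and the order of the opposite cocycle.\<close>

lemma fg_projective_ring_iso:
  assumes R: "ring R" and I: "left_ideal I R"
    and \<theta>: "\<theta> \<in> carrier R \<rightarrow> carrier R'" "\<And>x y. x \<in> carrier R \<Longrightarrow> y \<in> carrier R \<Longrightarrow> \<theta> (x \<oplus>\<^bsub>R\<^esub> y) = \<theta> x \<oplus>\<^bsub>R'\<^esub> \<theta> y"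
      "\<And>x y. x \<in> carrier R \<Longrightarrow> y \<in> carrier R \<Longrightarrow> \<theta> (x \<otimes>\<^bsub>R\<^esub> y) = \<theta> x \<otimes>\<^bsub>R'\<^esub> \<theta> y"
    and \<eta>: "\<And>x. x \<in> carrier R' \<Longrightarrow> \<eta> x \<in> carrier R" "\<And>x. x \<in> carrier R' \<Longrightarrow> \<theta> (\<eta> x) = x" "\<And>x. x \<in> carrier R \<Longrightarrow> \<eta> (\<theta> x) = x"
    and fgp: "fg_projective R (left_ideal_module R I)"
  shows "fg_projective R' (left_ideal_module R' (\<theta> ` I))"
proof -
  have IR: "I \<subseteq> carrier R" using I additive_subgroup.a_subset left_ideal.axioms(1) by blast
  have \<eta>_add: "\<eta> (x \<oplus>\<^bsub>R'\<^esub> y) = \<eta> x \<oplus>\<^bsub>R\<^esub> \<eta> y" if "x \<in> carrier R'" "y \<in> carrier R'" for x y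
    using that \<eta>(1,2) \<theta>(2)[of "\<eta> x" "\<eta> y"] \<eta>(3)[of "\<eta> x \<oplus>\<^bsub>R\<^esub> \<eta> y"] ring.ring_simprules(1)[OF R, of "\<eta> x" "\<eta> y"] by simp
  have \<eta>_mult: "\<eta> (x \<otimes>\<^bsub>R'\<^esub> y) = \<eta> x \<otimes>\<^bsub>R\<^esub> \<eta> y" if "x \<in> carrier R'" "y \<in> carrier R'" for x y
    using that \<eta>(1,2) \<theta>(3)[of "\<eta> x" "\<eta> y"] \<eta>(3)[of "\<eta> x \<otimes>\<^bsub>R\<^esub> \<eta> y"] ring.ring_simprules(5)[OF R, of "\<eta> x" "\<eta> y"] by simp
  have sub': "\<theta> ` I \<subseteq> carrier R'" using IR \<theta>(1) by auto
  have \<eta>I: "\<eta> x \<in> I" if "x \<in> \<theta> ` I" for x using that IR \<eta>(3) by auto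
  have "(\<lambda>x. \<theta> (h (\<eta> x))) \<in> fin_endo R' (left_ideal_module R' (\<theta> ` I))" if "h \<in> fin_endo R (left_ideal_module R I)" for h
    using that
  proof (induction rule: fin_endo.induct)
    case (rank1 \<phi> m h)
    note \<phi> = left_module_homE[OF rank1(1), simplified]
    show ?case
    proof (rule fin_endo.rank1[of "\<lambda>x. \<theta> (\<phi> (\<eta> x))" _ _ "\<theta> m"])
      show "(\<lambda>x. \<theta> (\<phi> (\<eta> x))) \<in> left_module_hom R' (left_ideal_module R' (\<theta> ` I)) (left_ideal_module R' (carrier R'))"
      proof (rule left_module_homI, simp_all)
        fix x assume x: "x \<in> \<theta> ` I"
        show "\<theta> (\<phi> (\<eta> x)) \<in> carrier R'" using \<phi>(1) \<eta>I[OF x] \<theta>(1) by auto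
        fix y assume y: "y \<in> \<theta> ` I"
        show "\<theta> (\<phi> (\<eta> (x \<oplus>\<^bsub>R'\<^esub> y))) = \<theta> (\<phi> (\<eta> x)) \<oplus>\<^bsub>R'\<^esub> \<theta> (\<phi> (\<eta> y))"
          using x y sub' \<eta>_add[of x y] \<phi> \<eta>I \<theta>(2) by (auto simp: subset_iff)
      next
        fix a x assume a: "a \<in> carrier R'" and x: "x \<in> \<theta> ` I"
        have "\<theta> (\<phi> (\<eta> a \<otimes>\<^bsub>R\<^esub> \<eta> x)) = \<theta> (\<eta> a) \<otimes>\<^bsub>R'\<^esub> \<theta> (\<phi> (\<eta> x))"
          using a \<phi>(1,3) \<eta>I[OF x] \<eta>(1) \<theta>(3) by simp
        then show "\<theta> (\<phi> (\<eta> (a \<otimes>\<^bsub>R'\<^esub> x))) = a \<otimes>\<^bsub>R'\<^esub> \<theta> (\<phi> (\<eta> x))"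
          using a x sub' \<eta>_mult[of a x] \<eta>(2) by (auto simp: subset_iff)
      qed
      show "\<theta> m \<in> carrier (left_ideal_module R' (\<theta> ` I))" using rank1(2) by simp
      fix x assume "x \<in> carrier (left_ideal_module R' (\<theta> ` I))"
      then have x: "\<eta> x \<in> I" using \<eta>I by simp
      have "m \<in> carrier R" using rank1(2) IR by auto
      then show "\<theta> (h (\<eta> x)) = \<theta> (\<phi> (\<eta> x)) \<odot>\<^bsub>left_ideal_module R' (\<theta> ` I)\<^esub> \<theta> m"
        using rank1(3) x \<phi>(1) \<theta>(3) by simp
    qed
  next
    case (add u v h)
    show ?case
    proof (rule fin_endo.add[OF add(4,5)])
      fix x assume "x \<in> carrier (left_ideal_module R' (\<theta> ` I))"
      then have x: "\<eta> x \<in> I" using \<eta>I by simp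
      have "u (\<eta> x) \<in> carrier R" "v (\<eta> x) \<in> carrier R"
        using left_module_homE(1)[OF fin_endo_hom[OF left_ideal_module_left_module[OF I] add(1)]]
          left_module_homE(1)[OF fin_endo_hom[OF left_ideal_module_left_module[OF I] add(2)]] x IR by auto
      then show "\<theta> (h (\<eta> x)) = \<theta> (u (\<eta> x)) \<oplus>\<^bsub>left_ideal_module R' (\<theta> ` I)\<^esub> \<theta> (v (\<eta> x))"
        using add(3) x \<theta>(2) by simp
    qed
  qed
  moreover obtain h where h: "h \<in> fin_endo R (left_ideal_module R I)" "\<forall>x\<in>I. h x = x"
    using fgp unfolding fg_projective_def by auto
  have "\<theta> (h (\<eta> x)) = x" if "x \<in> \<theta> ` I" for x using that h(2) \<eta>I \<eta>(2) sub' by auto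
  ultimately show ?thesis unfolding fg_projective_def using h(1)
    by (intro bexI[of _ "\<lambda>x. \<theta> (h (\<eta> x))"]) simp_all
qed

section \<open>Crossed products\<close>

lemma (in ring) finsum_swap:
  assumes "finite A" "finite B" "\<And>i j. i \<in> A \<Longrightarrow> j \<in> B \<Longrightarrow> g i j \<in> carrier R"
  shows "(\<Oplus>i\<in>A. \<Oplus>j\<in>B. g i j) = (\<Oplus>j\<in>B. \<Oplus>i\<in>A. g i j)"
  using assms(1,3)
proof (induction A rule: finite_induct)
  case (insert a A)
  have cl: "(\<lambda>i. \<Oplus>j\<in>B. g i j) \<in> A \<rightarrow> carrier R" "(\<Oplus>j\<in>B. g a j) \<in> carrier R"
    using insert by (auto intro!: finsum_closed)
  have "(\<Oplus>i\<in>insert a A. \<Oplus>j\<in>B. g i j) = (\<Oplus>j\<in>B. g a j) \<oplus> (\<Oplus>j\<in>B. \<Oplus>i\<in>A. g i j)"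
    using insert cl by simp
  also have "\<dots> = (\<Oplus>j\<in>B. g a j \<oplus> (\<Oplus>i\<in>A. g i j))"
    using insert by (intro finsum_addf[symmetric]) (auto intro!: finsum_closed)
  also have "\<dots> = (\<Oplus>j\<in>B. \<Oplus>i\<in>insert a A. g i j)"
  proof (rule finsum_cong')
    fix j assume j: "j \<in> B"
    then have "(\<lambda>i. g i j) \<in> A \<rightarrow> carrier R" "g a j \<in> carrier R" using insert by auto
    then show "g a j \<oplus> (\<Oplus>i\<in>A. g i j) = (\<Oplus>i\<in>insert a A. g i j)" using insert by simp
  qed (use insert in \<open>auto intro!: finsum_closed\<close>)
  finally show ?case .
qed simp

locale crossed_product = field_action +
  fixes f :: "('a \<Rightarrow> 'a) \<Rightarrow> ('a \<Rightarrow> 'a) \<Rightarrow> 'a"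
  assumes f_closed [simp]: "\<alpha> \<in> carrier G \<Longrightarrow> \<beta> \<in> carrier G \<Longrightarrow> f \<alpha> \<beta> \<in> carrier K"
    and cocycle: "\<lbrakk>\<alpha> \<in> carrier G; \<beta> \<in> carrier G; \<gamma> \<in> carrier G\<rbrakk> \<Longrightarrow>
      \<alpha> (f \<beta> \<gamma>) \<otimes> f \<alpha> (\<beta> \<otimes>\<^bsub>G\<^esub> \<gamma>) = f \<alpha> \<beta> \<otimes> f (\<alpha> \<otimes>\<^bsub>G\<^esub> \<beta>) \<gamma>"
    and f_one [simp]: "\<alpha> \<in> carrier G \<Longrightarrow> f \<one>\<^bsub>G\<^esub> \<alpha> = \<one>" "\<alpha> \<in> carrier G \<Longrightarrow> f \<alpha> \<one>\<^bsub>G\<^esub> = \<one>"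
begin

lemma G_cancel [simp]:
  assumes "\<alpha> \<in> carrier G" "\<beta> \<in> carrier G"
  shows "inv\<^bsub>G\<^esub> \<alpha> \<otimes>\<^bsub>G\<^esub> (\<alpha> \<otimes>\<^bsub>G\<^esub> \<beta>) = \<beta>" "\<alpha> \<otimes>\<^bsub>G\<^esub> (inv\<^bsub>G\<^esub> \<alpha> \<otimes>\<^bsub>G\<^esub> \<beta>) = \<beta>"
    "\<beta> \<otimes>\<^bsub>G\<^esub> \<alpha> \<otimes>\<^bsub>G\<^esub> inv\<^bsub>G\<^esub> \<alpha> = \<beta>" "\<beta> \<otimes>\<^bsub>G\<^esub> inv\<^bsub>G\<^esub> \<alpha> \<otimes>\<^bsub>G\<^esub> \<alpha> = \<beta>"
  using assms by (simp_all add: G.m_assoc[symmetric], simp_all add: G.m_assoc)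

text \<open>Only the carrier depends on \<open>R\<close>. The algebra over \<open>K\<close> and the
  order over \<open>S\<close> thus share their operations, and computations for the order can be
  done in the algebra, where coefficients may be inverted.\<close>

definition cp :: "'a set \<Rightarrow> (('a \<Rightarrow> 'a) \<Rightarrow> 'a) ring" where
  "cp R = \<lparr>carrier = carrier G \<rightarrow>\<^sub>E R,
        monoid.mult = (\<lambda>a b. \<lambda>\<rho>\<in>carrier G. \<Oplus>\<alpha>\<in>carrier G.
                  a \<alpha> \<otimes> \<alpha> (b (inv\<^bsub>G\<^esub> \<alpha> \<otimes>\<^bsub>G\<^esub> \<rho>)) \<otimes> f \<alpha> (inv\<^bsub>G\<^esub> \<alpha> \<otimes>\<^bsub>G\<^esub> \<rho>)),
        one = (\<lambda>\<rho>\<in>carrier G. if \<rho> = \<one>\<^bsub>G\<^esub> then \<one> else \<zero>),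
        ring.zero = (\<lambda>\<rho>\<in>carrier G. \<zero>),
        add = (\<lambda>a b. \<lambda>\<rho>\<in>carrier G. a \<rho> \<oplus> b \<rho>)\<rparr>"

abbreviation \<Sigma> :: "(('a \<Rightarrow> 'a) \<Rightarrow> 'a) ring" where "\<Sigma> \<equiv> cp (carrier K)"

lemma cp_simps:
  "carrier (cp R) = carrier G \<rightarrow>\<^sub>E R"
  "\<one>\<^bsub>cp R\<^esub> = (\<lambda>\<rho>\<in>carrier G. if \<rho> = \<one>\<^bsub>G\<^esub> then \<one> else \<zero>)"
  "\<zero>\<^bsub>cp R\<^esub> = (\<lambda>\<rho>\<in>carrier G. \<zero>)"
  "a \<oplus>\<^bsub>cp R\<^esub> b = (\<lambda>\<rho>\<in>carrier G. a \<rho> \<oplus> b \<rho>)"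
  "a \<otimes>\<^bsub>cp R\<^esub> b = (\<lambda>\<rho>\<in>carrier G. \<Oplus>\<alpha>\<in>carrier G.
                  a \<alpha> \<otimes> \<alpha> (b (inv\<^bsub>G\<^esub> \<alpha> \<otimes>\<^bsub>G\<^esub> \<rho>)) \<otimes> f \<alpha> (inv\<^bsub>G\<^esub> \<alpha> \<otimes>\<^bsub>G\<^esub> \<rho>))"
  by (simp_all add: cp_def)

lemma cp_ops:
  "\<one>\<^bsub>cp R\<^esub> = \<one>\<^bsub>\<Sigma>\<^esub>" "\<zero>\<^bsub>cp R\<^esub> = \<zero>\<^bsub>\<Sigma>\<^esub>" "a \<oplus>\<^bsub>cp R\<^esub> b = a \<oplus>\<^bsub>\<Sigma>\<^esub> b" "a \<otimes>\<^bsub>cp R\<^esub> b = a \<otimes>\<^bsub>\<Sigma>\<^esub> b"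
  by (simp_all only: cp_simps)

lemma cp_closed [simp]: "a \<in> carrier \<Sigma> \<Longrightarrow> \<rho> \<in> carrier G \<Longrightarrow> a \<rho> \<in> carrier K"
  by (auto simp: cp_simps)

lemma cp_eqI: "a \<in> carrier \<Sigma> \<Longrightarrow> b \<in> carrier \<Sigma> \<Longrightarrow> (\<And>\<rho>. \<rho> \<in> carrier G \<Longrightarrow> a \<rho> = b \<rho>) \<Longrightarrow> a = b"
  unfolding cp_simps by (rule PiE_ext)

lemma cp_mult_closed: "a \<in> carrier \<Sigma> \<Longrightarrow> b \<in> carrier \<Sigma> \<Longrightarrow> a \<otimes>\<^bsub>\<Sigma>\<^esub> b \<in> carrier \<Sigma>"
  by (auto simp: cp_simps intro!: finsum_closed PiE_mem)

lemma cp_mult_apply: "\<rho> \<in> carrier G \<Longrightarrow> (a \<otimes>\<^bsub>\<Sigma>\<^esub> b) \<rho> =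
   (\<Oplus>\<alpha>\<in>carrier G. a \<alpha> \<otimes> \<alpha> (b (inv\<^bsub>G\<^esub> \<alpha> \<otimes>\<^bsub>G\<^esub> \<rho>)) \<otimes> f \<alpha> (inv\<^bsub>G\<^esub> \<alpha> \<otimes>\<^bsub>G\<^esub> \<rho>))"
  by (simp add: cp_simps)

lemma cp_add_apply: "\<rho> \<in> carrier G \<Longrightarrow> (a \<oplus>\<^bsub>\<Sigma>\<^esub> b) \<rho> = a \<rho> \<oplus> b \<rho>"
  by (simp add: cp_simps)

lemma cp_assoc:
  assumes a: "a \<in> carrier \<Sigma>" and b: "b \<in> carrier \<Sigma>" and c: "c \<in> carrier \<Sigma>"
  shows "a \<otimes>\<^bsub>\<Sigma>\<^esub> b \<otimes>\<^bsub>\<Sigma>\<^esub> c = a \<otimes>\<^bsub>\<Sigma>\<^esub> (b \<otimes>\<^bsub>\<Sigma>\<^esub> c)"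
proof (rule cp_eqI)
  show "a \<otimes>\<^bsub>\<Sigma>\<^esub> b \<otimes>\<^bsub>\<Sigma>\<^esub> c \<in> carrier \<Sigma>" "a \<otimes>\<^bsub>\<Sigma>\<^esub> (b \<otimes>\<^bsub>\<Sigma>\<^esub> c) \<in> carrier \<Sigma>"
    using assms cp_mult_closed by auto
  fix \<rho> assume \<rho>: "\<rho> \<in> carrier G"
  \<comment> \<open>\<open>T \<alpha> \<tau>\<close> is the contribution to the coefficient at
    \<rho> of the terms of \<open>a\<close>, \<open>b\<close>, \<open>c\<close> at
    \<open>\<alpha>\<close>, \<open>\<alpha>\<^sup>-\<^sup>1\<tau>\<close> and
    \<open>\<tau>\<^sup>-\<^sup>1\<rho>\<close>.\<close>
  define T where "T = (\<lambda>\<alpha> \<tau>. a \<alpha> \<otimes> \<alpha> (b (inv\<^bsub>G\<^esub> \<alpha> \<otimes>\<^bsub>G\<^esub> \<tau>)) \<otimes> f \<alpha> (inv\<^bsub>G\<^esub> \<alpha> \<otimes>\<^bsub>G\<^esub> \<tau>) \<otimes>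
      (\<tau> (c (inv\<^bsub>G\<^esub> \<tau> \<otimes>\<^bsub>G\<^esub> \<rho>)) \<otimes> f \<tau> (inv\<^bsub>G\<^esub> \<tau> \<otimes>\<^bsub>G\<^esub> \<rho>)))"
  have T: "T \<alpha> \<tau> \<in> carrier K" if "\<alpha> \<in> carrier G" "\<tau> \<in> carrier G" for \<alpha> \<tau>
    using that assms \<rho> by (simp add: T_def)
  have "(a \<otimes>\<^bsub>\<Sigma>\<^esub> b \<otimes>\<^bsub>\<Sigma>\<^esub> c) \<rho> = (\<Oplus>\<tau>\<in>carrier G. \<Oplus>\<alpha>\<in>carrier G. T \<alpha> \<tau>)"
    unfolding cp_mult_apply[OF \<rho>]
  proof (rule finsum_cong')
    fix \<tau> assume \<tau>: "\<tau> \<in> carrier G"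
    have "(a \<otimes>\<^bsub>\<Sigma>\<^esub> b) \<tau> \<otimes> \<tau> (c (inv\<^bsub>G\<^esub> \<tau> \<otimes>\<^bsub>G\<^esub> \<rho>)) \<otimes> f \<tau> (inv\<^bsub>G\<^esub> \<tau> \<otimes>\<^bsub>G\<^esub> \<rho>) =
        (a \<otimes>\<^bsub>\<Sigma>\<^esub> b) \<tau> \<otimes> (\<tau> (c (inv\<^bsub>G\<^esub> \<tau> \<otimes>\<^bsub>G\<^esub> \<rho>)) \<otimes> f \<tau> (inv\<^bsub>G\<^esub> \<tau> \<otimes>\<^bsub>G\<^esub> \<rho>))"
      using assms \<tau> \<rho> cp_mult_closed by (simp add: m_assoc)
    also have "\<dots> = (\<Oplus>\<alpha>\<in>carrier G. T \<alpha> \<tau>)"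
      unfolding cp_mult_apply[OF \<tau>] T_def using assms \<tau> \<rho> fin_G by (intro finsum_ldistr) auto
    finally show "(a \<otimes>\<^bsub>\<Sigma>\<^esub> b) \<tau> \<otimes> \<tau> (c (inv\<^bsub>G\<^esub> \<tau> \<otimes>\<^bsub>G\<^esub> \<rho>)) \<otimes> f \<tau> (inv\<^bsub>G\<^esub> \<tau> \<otimes>\<^bsub>G\<^esub> \<rho>) = (\<Oplus>\<alpha>\<in>carrier G. T \<alpha> \<tau>)" .
  qed (use T in \<open>auto intro!: finsum_closed\<close>)
  also have "\<dots> = (\<Oplus>\<alpha>\<in>carrier G. \<Oplus>\<tau>\<in>carrier G. T \<alpha> \<tau>)"
    using T fin_G by (intro finsum_swap) auto
  also have "\<dots> = (\<Oplus>\<alpha>\<in>carrier G. a \<alpha> \<otimes> \<alpha> ((b \<otimes>\<^bsub>\<Sigma>\<^esub> c) (inv\<^bsub>G\<^esub> \<alpha> \<otimes>\<^bsub>G\<^esub> \<rho>)) \<otimes> f \<alpha> (inv\<^bsub>G\<^esub> \<alpha> \<otimes>\<^bsub>G\<^esub> \<rho>))"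
  proof (rule finsum_cong')
    fix \<alpha> assume \<alpha>: "\<alpha> \<in> carrier G"
    define \<delta> where "\<delta> = inv\<^bsub>G\<^esub> \<alpha> \<otimes>\<^bsub>G\<^esub> \<rho>"
    have \<delta>: "\<delta> \<in> carrier G" "\<rho> = \<alpha> \<otimes>\<^bsub>G\<^esub> \<delta>" using \<alpha> \<rho> by (simp_all add: \<delta>_def)
    have e1: "a \<alpha> \<otimes> \<alpha> ((b \<otimes>\<^bsub>\<Sigma>\<^esub> c) \<delta>) \<otimes> f \<alpha> \<delta> = a \<alpha> \<otimes> f \<alpha> \<delta> \<otimes> \<alpha> ((b \<otimes>\<^bsub>\<Sigma>\<^esub> c) \<delta>)"
      using assms \<alpha> \<delta> cp_mult_closed by (simp add: m_ac)
    have e2: "\<alpha> ((b \<otimes>\<^bsub>\<Sigma>\<^esub> c) \<delta>) = (\<Oplus>\<kappa>\<in>carrier G. \<alpha> (b \<kappa> \<otimes> \<kappa> (c (inv\<^bsub>G\<^esub> \<kappa> \<otimes>\<^bsub>G\<^esub> \<delta>)) \<otimes> f \<kappa> (inv\<^bsub>G\<^esub> \<kappa> \<otimes>\<^bsub>G\<^esub> \<delta>)))"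
      unfolding cp_mult_apply[OF \<delta>(1)] using assms \<alpha> \<delta> by (intro act_finsum) auto
    note e1
    also have "a \<alpha> \<otimes> f \<alpha> \<delta> \<otimes> \<alpha> ((b \<otimes>\<^bsub>\<Sigma>\<^esub> c) \<delta>) = (\<Oplus>\<kappa>\<in>carrier G. a \<alpha> \<otimes> f \<alpha> \<delta> \<otimes> \<alpha> (b \<kappa> \<otimes> \<kappa> (c (inv\<^bsub>G\<^esub> \<kappa> \<otimes>\<^bsub>G\<^esub> \<delta>)) \<otimes> f \<kappa> (inv\<^bsub>G\<^esub> \<kappa> \<otimes>\<^bsub>G\<^esub> \<delta>)))"
      unfolding e2 using assms \<alpha> \<delta> fin_G by (intro finsum_rdistr) auto
    \<comment> \<open>With \<open>\<tau> = \<alpha>\<kappa>\<close> the two bracketings differ by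
      exactly one instance of the cocycle identity, at \<alpha>, \<kappa>, \<gamma>.\<close>
    also have "\<dots> = (\<Oplus>\<kappa>\<in>carrier G. T \<alpha> (\<alpha> \<otimes>\<^bsub>G\<^esub> \<kappa>))"
    proof (rule finsum_cong')
      fix \<kappa> assume \<kappa>: "\<kappa> \<in> carrier G"
      define \<gamma> where "\<gamma> = inv\<^bsub>G\<^esub> \<kappa> \<otimes>\<^bsub>G\<^esub> \<delta>"
      have \<gamma>: "\<gamma> \<in> carrier G" "\<delta> = \<kappa> \<otimes>\<^bsub>G\<^esub> \<gamma>" using \<kappa> \<delta> by (simp_all add: \<gamma>_def)
      have \<gamma>': "inv\<^bsub>G\<^esub> (\<alpha> \<otimes>\<^bsub>G\<^esub> \<kappa>) \<otimes>\<^bsub>G\<^esub> \<rho> = \<gamma>"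
        using \<alpha> \<kappa> \<delta>(1) by (simp add: \<gamma>_def \<delta>(2) G.inv_mult_group G.m_assoc)
      have T1: "T \<alpha> (\<alpha> \<otimes>\<^bsub>G\<^esub> \<kappa>) = a \<alpha> \<otimes> \<alpha> (b \<kappa>) \<otimes> f \<alpha> \<kappa> \<otimes> (\<alpha> (\<kappa> (c \<gamma>)) \<otimes> f (\<alpha> \<otimes>\<^bsub>G\<^esub> \<kappa>) \<gamma>)"
        unfolding T_def \<gamma>' using assms \<alpha> \<kappa> \<gamma> by (simp add: act_comp)
      define u v w x y z where "u = a \<alpha>" and "v = \<alpha> (b \<kappa>)" and "w = \<alpha> (\<kappa> (c \<gamma>))" and "x = f \<alpha> \<kappa>" and "y = f (\<alpha> \<otimes>\<^bsub>G\<^esub> \<kappa>) \<gamma>" and "z = \<alpha> (f \<kappa> \<gamma>)"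
      have cl: "u \<in> carrier K" "v \<in> carrier K" "w \<in> carrier K" "x \<in> carrier K" "y \<in> carrier K" "z \<in> carrier K" "f \<alpha> \<delta> \<in> carrier K"
        using assms \<alpha> \<kappa> \<gamma> \<delta> by (simp_all add: u_def v_def w_def x_def y_def z_def)
      have "a \<alpha> \<otimes> f \<alpha> \<delta> \<otimes> \<alpha> (b \<kappa> \<otimes> \<kappa> (c \<gamma>) \<otimes> f \<kappa> \<gamma>) = u \<otimes> f \<alpha> \<delta> \<otimes> (v \<otimes> w \<otimes> z)"
        using assms \<alpha> \<kappa> \<gamma>(1) by (simp add: act_mult u_def v_def w_def z_def)
      also have "\<dots> = u \<otimes> v \<otimes> w \<otimes> (z \<otimes> f \<alpha> \<delta>)" using cl by (simp add: m_ac)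
      also have "z \<otimes> f \<alpha> \<delta> = x \<otimes> y" using cocycle[OF \<alpha> \<kappa> \<gamma>(1)] by (simp add: \<gamma>(2) x_def y_def z_def)
      also have "u \<otimes> v \<otimes> w \<otimes> (x \<otimes> y) = u \<otimes> v \<otimes> x \<otimes> (w \<otimes> y)" using cl by (simp add: m_ac)
      also have "\<dots> = T \<alpha> (\<alpha> \<otimes>\<^bsub>G\<^esub> \<kappa>)" unfolding T1 by (simp add: u_def v_def w_def x_def y_def)
      finally show "a \<alpha> \<otimes> f \<alpha> \<delta> \<otimes> \<alpha> (b \<kappa> \<otimes> \<kappa> (c (inv\<^bsub>G\<^esub> \<kappa> \<otimes>\<^bsub>G\<^esub> \<delta>)) \<otimes> f \<kappa> (inv\<^bsub>G\<^esub> \<kappa> \<otimes>\<^bsub>G\<^esub> \<delta>)) = T \<alpha> (\<alpha> \<otimes>\<^bsub>G\<^esub> \<kappa>)"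
        unfolding \<gamma>_def .
    qed (use T \<alpha> in auto)
    also have "\<dots> = (\<Oplus>\<tau>\<in>carrier G. T \<alpha> \<tau>)" using T \<alpha> by (intro finsum_translate) auto
    finally show "(\<Oplus>\<tau>\<in>carrier G. T \<alpha> \<tau>) = a \<alpha> \<otimes> \<alpha> ((b \<otimes>\<^bsub>\<Sigma>\<^esub> c) (inv\<^bsub>G\<^esub> \<alpha> \<otimes>\<^bsub>G\<^esub> \<rho>)) \<otimes> f \<alpha> (inv\<^bsub>G\<^esub> \<alpha> \<otimes>\<^bsub>G\<^esub> \<rho>)"
      unfolding \<delta>_def by (rule sym)
  qed (use assms \<rho> cp_mult_closed in auto)
  also have "\<dots> = (a \<otimes>\<^bsub>\<Sigma>\<^esub> (b \<otimes>\<^bsub>\<Sigma>\<^esub> c)) \<rho>" by (rule cp_mult_apply[OF \<rho>, symmetric])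
  finally show "(a \<otimes>\<^bsub>\<Sigma>\<^esub> b \<otimes>\<^bsub>\<Sigma>\<^esub> c) \<rho> = (a \<otimes>\<^bsub>\<Sigma>\<^esub> (b \<otimes>\<^bsub>\<Sigma>\<^esub> c)) \<rho>" .
qed

text \<open>The monomial \<open>a x\<^sub>\<mu>\<close>.\<close>

definition mono :: "'a \<Rightarrow> ('a \<Rightarrow> 'a) \<Rightarrow> ('a \<Rightarrow> 'a) \<Rightarrow> 'a" where
  "mono a \<mu> = (\<lambda>\<rho>\<in>carrier G. if \<rho> = \<mu> then a else \<zero>)"

lemma mono_closed [simp]: "a \<in> carrier K \<Longrightarrow> mono a \<mu> \<in> carrier \<Sigma>"
  by (auto simp: mono_def cp_simps)

lemma mono_apply: "\<rho> \<in> carrier G \<Longrightarrow> mono a \<mu> \<rho> = (if \<rho> = \<mu> then a else \<zero>)"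
  by (simp add: mono_def)

lemma mono_one: "mono \<one> \<one>\<^bsub>G\<^esub> = \<one>\<^bsub>\<Sigma>\<^esub>"
  by (simp add: mono_def cp_simps)

lemma mono_mult_apply:
  assumes "a \<in> carrier K" "\<mu> \<in> carrier G" "y \<in> carrier \<Sigma>" "\<rho> \<in> carrier G"
  shows "(mono a \<mu> \<otimes>\<^bsub>\<Sigma>\<^esub> y) \<rho> = a \<otimes> \<mu> (y (inv\<^bsub>G\<^esub> \<mu> \<otimes>\<^bsub>G\<^esub> \<rho>)) \<otimes> f \<mu> (inv\<^bsub>G\<^esub> \<mu> \<otimes>\<^bsub>G\<^esub> \<rho>)"
proof -
  have "(mono a \<mu> \<otimes>\<^bsub>\<Sigma>\<^esub> y) \<rho> = mono a \<mu> \<mu> \<otimes> \<mu> (y (inv\<^bsub>G\<^esub> \<mu> \<otimes>\<^bsub>G\<^esub> \<rho>)) \<otimes> f \<mu> (inv\<^bsub>G\<^esub> \<mu> \<otimes>\<^bsub>G\<^esub> \<rho>)"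
    unfolding cp_mult_apply[OF assms(4)] using assms by (intro finsum_delta) (auto simp: mono_apply)
  then show ?thesis using assms by (simp add: mono_apply)
qed

lemma mult_mono_apply:
  assumes "c \<in> carrier K" "\<nu> \<in> carrier G" "y \<in> carrier \<Sigma>" "\<rho> \<in> carrier G"
  shows "(y \<otimes>\<^bsub>\<Sigma>\<^esub> mono c \<nu>) \<rho> = y (\<rho> \<otimes>\<^bsub>G\<^esub> inv\<^bsub>G\<^esub> \<nu>) \<otimes> (\<rho> \<otimes>\<^bsub>G\<^esub> inv\<^bsub>G\<^esub> \<nu>) c \<otimes> f (\<rho> \<otimes>\<^bsub>G\<^esub> inv\<^bsub>G\<^esub> \<nu>) \<nu>"
proof -
  let ?\<mu> = "\<rho> \<otimes>\<^bsub>G\<^esub> inv\<^bsub>G\<^esub> \<nu>"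
  have \<mu>: "inv\<^bsub>G\<^esub> ?\<mu> \<otimes>\<^bsub>G\<^esub> \<rho> = \<nu>" using assms by (simp add: G.inv_mult_group G.m_assoc)
  have "(y \<otimes>\<^bsub>\<Sigma>\<^esub> mono c \<nu>) \<rho> = y ?\<mu> \<otimes> ?\<mu> (mono c \<nu> (inv\<^bsub>G\<^esub> ?\<mu> \<otimes>\<^bsub>G\<^esub> \<rho>)) \<otimes> f ?\<mu> (inv\<^bsub>G\<^esub> ?\<mu> \<otimes>\<^bsub>G\<^esub> \<rho>)"
    unfolding cp_mult_apply[OF assms(4)]
  proof (rule finsum_delta)
    fix \<alpha> assume \<alpha>: "\<alpha> \<in> carrier G" "\<alpha> \<noteq> ?\<mu>"
    have "inv\<^bsub>G\<^esub> \<alpha> \<otimes>\<^bsub>G\<^esub> \<rho> \<noteq> \<nu>"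
    proof
      assume "inv\<^bsub>G\<^esub> \<alpha> \<otimes>\<^bsub>G\<^esub> \<rho> = \<nu>"
      then have "?\<mu> = \<rho> \<otimes>\<^bsub>G\<^esub> (inv\<^bsub>G\<^esub> \<rho> \<otimes>\<^bsub>G\<^esub> \<alpha>)" using assms(4) \<alpha> by (auto simp: G.inv_mult_group)
      then show False using assms(4) \<alpha> by simp
    qed
    then show "y \<alpha> \<otimes> \<alpha> (mono c \<nu> (inv\<^bsub>G\<^esub> \<alpha> \<otimes>\<^bsub>G\<^esub> \<rho>)) \<otimes> f \<alpha> (inv\<^bsub>G\<^esub> \<alpha> \<otimes>\<^bsub>G\<^esub> \<rho>) = \<zero>"
      using assms \<alpha> by (simp add: mono_apply act_zero)
  qed (use assms in \<open>auto simp: mono_apply\<close>)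
  then show ?thesis using assms unfolding \<mu> by (simp add: mono_apply)
qed

lemma \<Sigma>_ring: "ring \<Sigma>"
proof (rule ringI)
  show "abelian_group \<Sigma>"
  proof (rule abelian_groupI)
    show "\<zero>\<^bsub>\<Sigma>\<^esub> \<in> carrier \<Sigma>" by (auto simp: cp_simps)
    fix x assume x: "x \<in> carrier \<Sigma>"
    show "\<zero>\<^bsub>\<Sigma>\<^esub> \<oplus>\<^bsub>\<Sigma>\<^esub> x = x" by (rule cp_eqI) (use x in \<open>auto simp: cp_simps\<close>)
    have "(\<lambda>\<rho>\<in>carrier G. \<ominus> x \<rho>) \<oplus>\<^bsub>\<Sigma>\<^esub> x = \<zero>\<^bsub>\<Sigma>\<^esub>"
      by (rule cp_eqI) (use x in \<open>auto simp: cp_simps l_neg\<close>)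
    moreover have "(\<lambda>\<rho>\<in>carrier G. \<ominus> x \<rho>) \<in> carrier \<Sigma>" using x by (auto simp: cp_simps)
    ultimately show "\<exists>y\<in>carrier \<Sigma>. y \<oplus>\<^bsub>\<Sigma>\<^esub> x = \<zero>\<^bsub>\<Sigma>\<^esub>" by blast
    fix y assume y: "y \<in> carrier \<Sigma>"
    show xy: "x \<oplus>\<^bsub>\<Sigma>\<^esub> y \<in> carrier \<Sigma>" using x y by (auto simp: cp_simps)
    show "x \<oplus>\<^bsub>\<Sigma>\<^esub> y = y \<oplus>\<^bsub>\<Sigma>\<^esub> x" by (rule cp_eqI) (use x y in \<open>auto simp: cp_simps a_comm PiE_mem\<close>)
    fix z assume z: "z \<in> carrier \<Sigma>"
    show "x \<oplus>\<^bsub>\<Sigma>\<^esub> y \<oplus>\<^bsub>\<Sigma>\<^esub> z = x \<oplus>\<^bsub>\<Sigma>\<^esub> (y \<oplus>\<^bsub>\<Sigma>\<^esub> z)"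
      by (rule cp_eqI) (use x y z in \<open>auto simp: cp_simps a_assoc PiE_mem\<close>)
  qed
  show "monoid \<Sigma>"
  proof (rule monoidI)
    show "\<one>\<^bsub>\<Sigma>\<^esub> \<in> carrier \<Sigma>" unfolding mono_one[symmetric] by simp
    fix x assume x: "x \<in> carrier \<Sigma>"
    show "\<one>\<^bsub>\<Sigma>\<^esub> \<otimes>\<^bsub>\<Sigma>\<^esub> x = x" unfolding mono_one[symmetric]
      by (rule cp_eqI) (use x in \<open>auto simp: mono_mult_apply act_one cp_mult_closed\<close>)
    show "x \<otimes>\<^bsub>\<Sigma>\<^esub> \<one>\<^bsub>\<Sigma>\<^esub> = x" unfolding mono_one[symmetric]
      by (rule cp_eqI) (use x in \<open>auto simp: mult_mono_apply act_1 cp_mult_closed\<close>)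
  qed (use cp_mult_closed cp_assoc in auto)
  fix x y z assume xyz: "x \<in> carrier \<Sigma>" "y \<in> carrier \<Sigma>" "z \<in> carrier \<Sigma>"
  have add_closed: "u \<oplus>\<^bsub>\<Sigma>\<^esub> v \<in> carrier \<Sigma>" if "u \<in> carrier \<Sigma>" "v \<in> carrier \<Sigma>" for u v
    using that by (auto simp: cp_simps)
  show "(x \<oplus>\<^bsub>\<Sigma>\<^esub> y) \<otimes>\<^bsub>\<Sigma>\<^esub> z = x \<otimes>\<^bsub>\<Sigma>\<^esub> z \<oplus>\<^bsub>\<Sigma>\<^esub> y \<otimes>\<^bsub>\<Sigma>\<^esub> z"
  proof (rule cp_eqI)
    fix \<rho> assume \<rho>: "\<rho> \<in> carrier G"
    let ?t = "\<lambda>w \<alpha>. w \<alpha> \<otimes> \<alpha> (z (inv\<^bsub>G\<^esub> \<alpha> \<otimes>\<^bsub>G\<^esub> \<rho>)) \<otimes> f \<alpha> (inv\<^bsub>G\<^esub> \<alpha> \<otimes>\<^bsub>G\<^esub> \<rho>)"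
    have "((x \<oplus>\<^bsub>\<Sigma>\<^esub> y) \<otimes>\<^bsub>\<Sigma>\<^esub> z) \<rho> = (\<Oplus>\<alpha>\<in>carrier G. ?t x \<alpha> \<oplus> ?t y \<alpha>)"
      unfolding cp_mult_apply[OF \<rho>] using xyz \<rho> by (intro finsum_cong') (auto simp: cp_add_apply l_distr)
    also have "\<dots> = (\<Oplus>\<alpha>\<in>carrier G. ?t x \<alpha>) \<oplus> (\<Oplus>\<alpha>\<in>carrier G. ?t y \<alpha>)"
      using xyz \<rho> by (intro finsum_addf) auto
    finally show "((x \<oplus>\<^bsub>\<Sigma>\<^esub> y) \<otimes>\<^bsub>\<Sigma>\<^esub> z) \<rho> = (x \<otimes>\<^bsub>\<Sigma>\<^esub> z \<oplus>\<^bsub>\<Sigma>\<^esub> y \<otimes>\<^bsub>\<Sigma>\<^esub> z) \<rho>"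
      using \<rho> by (simp add: cp_mult_apply cp_add_apply)
  qed (use xyz add_closed cp_mult_closed in auto)
  show "z \<otimes>\<^bsub>\<Sigma>\<^esub> (x \<oplus>\<^bsub>\<Sigma>\<^esub> y) = z \<otimes>\<^bsub>\<Sigma>\<^esub> x \<oplus>\<^bsub>\<Sigma>\<^esub> z \<otimes>\<^bsub>\<Sigma>\<^esub> y"
  proof (rule cp_eqI)
    fix \<rho> assume \<rho>: "\<rho> \<in> carrier G"
    let ?t = "\<lambda>w \<alpha>. z \<alpha> \<otimes> \<alpha> (w (inv\<^bsub>G\<^esub> \<alpha> \<otimes>\<^bsub>G\<^esub> \<rho>)) \<otimes> f \<alpha> (inv\<^bsub>G\<^esub> \<alpha> \<otimes>\<^bsub>G\<^esub> \<rho>)"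
    have "(z \<otimes>\<^bsub>\<Sigma>\<^esub> (x \<oplus>\<^bsub>\<Sigma>\<^esub> y)) \<rho> = (\<Oplus>\<alpha>\<in>carrier G. ?t x \<alpha> \<oplus> ?t y \<alpha>)"
      unfolding cp_mult_apply[OF \<rho>] using xyz \<rho> by (intro finsum_cong') (auto simp: cp_add_apply act_add l_distr r_distr)
    also have "\<dots> = (\<Oplus>\<alpha>\<in>carrier G. ?t x \<alpha>) \<oplus> (\<Oplus>\<alpha>\<in>carrier G. ?t y \<alpha>)"
      using xyz \<rho> by (intro finsum_addf) auto
    finally show "(z \<otimes>\<^bsub>\<Sigma>\<^esub> (x \<oplus>\<^bsub>\<Sigma>\<^esub> y)) \<rho> = (z \<otimes>\<^bsub>\<Sigma>\<^esub> x \<oplus>\<^bsub>\<Sigma>\<^esub> z \<otimes>\<^bsub>\<Sigma>\<^esub> y) \<rho>"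
      using \<rho> by (simp add: cp_mult_apply cp_add_apply)
  qed (use xyz add_closed cp_mult_closed in auto)
qed

lemma cp_ring:
  assumes R: "subring R K" and stable: "\<And>\<alpha> x. \<alpha> \<in> carrier G \<Longrightarrow> x \<in> R \<Longrightarrow> \<alpha> x \<in> R"
    and fR: "\<And>\<alpha> \<beta>. \<alpha> \<in> carrier G \<Longrightarrow> \<beta> \<in> carrier G \<Longrightarrow> f \<alpha> \<beta> \<in> R"
  shows "ring (cp R)"
proof -
  interpret \<Sigma>: ring \<Sigma> by (rule \<Sigma>_ring)
  note Rp = subringE[OF R]
  have sum_R: "finite A \<Longrightarrow> (\<And>i. i \<in> A \<Longrightarrow> h i \<in> R) \<Longrightarrow> (\<Oplus>i\<in>A. h i) \<in> R" for A :: "('a \<Rightarrow> 'a) set" and h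
  proof (induction A rule: finite_induct)
    case (insert a A)
    then have "h \<in> A \<rightarrow> carrier K" "h a \<in> carrier K" using Rp(1) by auto
    then show ?case using insert by (auto intro!: Rp)
  qed (simp add: Rp)
  have sub: "carrier (cp R) \<subseteq> carrier \<Sigma>" using Rp(1) by (auto simp: cp_simps PiE_def)
  have inR: "x \<rho> \<in> R" if "x \<in> carrier (cp R)" "\<rho> \<in> carrier G" for x \<rho> using that by (auto simp: cp_simps)
  have inI: "x \<in> carrier (cp R)" if "x \<in> carrier \<Sigma>" "\<And>\<rho>. \<rho> \<in> carrier G \<Longrightarrow> x \<rho> \<in> R" for x
    using that by (auto simp: cp_simps PiE_def)
  have "subring (carrier (cp R)) \<Sigma>"
  proof (rule \<Sigma>.subringI[OF sub])
    show "\<one>\<^bsub>\<Sigma>\<^esub> \<in> carrier (cp R)" by (rule inI) (simp_all add: mono_one[symmetric] mono_apply Rp)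
    fix h assume h: "h \<in> carrier (cp R)"
    then have h\<Sigma>: "h \<in> carrier \<Sigma>" using sub by auto
    have "\<ominus>\<^bsub>\<Sigma>\<^esub> h = (\<lambda>\<rho>\<in>carrier G. \<ominus> h \<rho>)"
    proof (rule \<Sigma>.minus_equality)
      show "(\<lambda>\<rho>\<in>carrier G. \<ominus> h \<rho>) \<oplus>\<^bsub>\<Sigma>\<^esub> h = \<zero>\<^bsub>\<Sigma>\<^esub>"
        by (rule cp_eqI) (use h\<Sigma> in \<open>auto simp: cp_simps l_neg\<close>)
      show "(\<lambda>\<rho>\<in>carrier G. \<ominus> h \<rho>) \<in> carrier \<Sigma>" using h\<Sigma> by (auto simp: cp_simps)
    qed (rule h\<Sigma>)
    then show "\<ominus>\<^bsub>\<Sigma>\<^esub> h \<in> carrier (cp R)" using h Rp(5) by (auto simp: cp_simps)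
    fix h' assume h': "h' \<in> carrier (cp R)"
    then have h'\<Sigma>: "h' \<in> carrier \<Sigma>" using sub by auto
    show "h \<oplus>\<^bsub>\<Sigma>\<^esub> h' \<in> carrier (cp R)"
      by (rule inI) (use h\<Sigma> h'\<Sigma> inR[OF h] inR[OF h'] Rp(7) in \<open>auto simp: cp_add_apply\<close>)
    show "h \<otimes>\<^bsub>\<Sigma>\<^esub> h' \<in> carrier (cp R)"
    proof (rule inI)
      fix \<rho> assume \<rho>: "\<rho> \<in> carrier G"
      show "(h \<otimes>\<^bsub>\<Sigma>\<^esub> h') \<rho> \<in> R" unfolding cp_mult_apply[OF \<rho>]
      proof (rule sum_R[OF fin_G])
        fix \<alpha> assume \<alpha>: "\<alpha> \<in> carrier G"
        show "h \<alpha> \<otimes> \<alpha> (h' (inv\<^bsub>G\<^esub> \<alpha> \<otimes>\<^bsub>G\<^esub> \<rho>)) \<otimes> f \<alpha> (inv\<^bsub>G\<^esub> \<alpha> \<otimes>\<^bsub>G\<^esub> \<rho>) \<in> R"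
          using stable[OF \<alpha> inR[OF h', of "inv\<^bsub>G\<^esub> \<alpha> \<otimes>\<^bsub>G\<^esub> \<rho>"]] inR[OF h \<alpha>] fR[OF \<alpha>, of "inv\<^bsub>G\<^esub> \<alpha> \<otimes>\<^bsub>G\<^esub> \<rho>"] \<alpha> \<rho> Rp(6)
          by simp
      qed
    qed (use h\<Sigma> h'\<Sigma> cp_mult_closed in auto)
  qed
  moreover have "\<Sigma>\<lparr>carrier := carrier (cp R)\<rparr> = cp R" by (simp add: cp_def)
  ultimately show ?thesis using \<Sigma>.subring_is_ring[of "carrier (cp R)"] by simp
qed

end

section \<open>Hereditary crossed product orders\<close>

locale crossed_order = unramified_galois_dvr + crossed_product +
  assumes f_S: "\<alpha> \<in> carrier G \<Longrightarrow> \<beta> \<in> carrier G \<Longrightarrow> f \<alpha> \<beta> \<in> S"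
    and f_nz: "\<alpha> \<in> carrier G \<Longrightarrow> \<beta> \<in> carrier G \<Longrightarrow> f \<alpha> \<beta> \<noteq> \<zero>"
begin

lemma preimage_ideal:
  assumes I: "ideal I SK" and \<alpha>: "\<alpha> \<in> carrier G"
  shows "ideal {x \<in> S. \<alpha> x \<in> I} SK"
proof -
  interpret SK: cring SK by (rule SK_cring)
  have add: "a \<oplus> b \<in> I" if "a \<in> I" "b \<in> I" for a b
    using additive_subgroup.a_closed[OF ideal.axioms(1)[OF I] that] by simp
  have mult: "a \<otimes> b \<in> I" if "a \<in> S" "b \<in> I" for a b
    using ideal.I_l_closed[OF I that(2), of a] that by simp
  have mS: "\<ominus> \<one> \<in> S" using S_props by simp
  show ?thesis
  proof (rule idealI)
    show "ring SK" by (rule SK.ring_axioms)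
    show "subgroup {x \<in> S. \<alpha> x \<in> I} (add_monoid SK)"
    proof (rule SK.add.subgroupI)
      have "\<zero> \<in> I" using additive_subgroup.zero_closed[OF ideal.axioms(1)[OF I]] by simp
      then show "{x \<in> S. \<alpha> x \<in> I} \<noteq> {}" using S_props(2) act_zero[OF \<alpha>] by force
      fix x assume x: "x \<in> {x \<in> S. \<alpha> x \<in> I}"
      then have xK: "x \<in> carrier K" using S_carrier by auto
      have "\<alpha> (\<ominus> x) = \<ominus> \<one> \<otimes> \<alpha> x" using xK \<alpha> by (simp add: act_uminus l_minus)
      then have "\<alpha> (\<ominus> x) \<in> I" using mult[OF mS] x by simp
      then show "\<ominus>\<^bsub>SK\<^esub> x \<in> {x \<in> S. \<alpha> x \<in> I}" using x S_props(4) by (simp add: SK_minus)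
      fix y assume y: "y \<in> {x \<in> S. \<alpha> x \<in> I}"
      then have yK: "y \<in> carrier K" using S_carrier by auto
      show "x \<oplus>\<^bsub>SK\<^esub> y \<in> {x \<in> S. \<alpha> x \<in> I}" using x y xK yK add \<alpha> S_props(6) by (simp add: act_add)
    qed auto
    fix x a assume x: "x \<in> {x \<in> S. \<alpha> x \<in> I}" and a: "a \<in> carrier SK"
    then have K: "x \<in> carrier K" "a \<in> carrier K" using S_carrier by auto
    have "\<alpha> (a \<otimes> x) \<in> I" using mult[of "\<alpha> a" "\<alpha> x"] x a K \<alpha> power_bounded_act[of a \<alpha>] by (simp add: act_mult)
    then show *: "a \<otimes>\<^bsub>SK\<^esub> x \<in> {x \<in> S. \<alpha> x \<in> I}" using x a S_props(5) by simp
    have "x \<otimes>\<^bsub>SK\<^esub> a = a \<otimes>\<^bsub>SK\<^esub> x" using K by (simp add: m_comm)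
    then show "x \<otimes>\<^bsub>SK\<^esub> a \<in> {x \<in> S. \<alpha> x \<in> I}" using * by simp
  qed
qed

lemma preimage_maximal:
  assumes M: "maximalideal M SK" and \<alpha>: "\<alpha> \<in> carrier G"
  shows "maximalideal {x \<in> S. \<alpha> x \<in> M} SK"
proof (rule maximalidealI)
  interpret M: galois_dvr_max K G F V p M by (rule unramified_at(1)[OF M])
  let ?N = "{x \<in> S. \<alpha> x \<in> M}"
  show "ideal ?N SK" by (rule preimage_ideal[OF M.M_ideal \<alpha>])
  have "\<one> \<notin> ?N" using M.one_notin_M act_1[OF \<alpha>] by simp
  then show "carrier SK \<noteq> ?N" using S_props(3) by auto
  fix J assume J: "ideal J SK" "?N \<subseteq> J" "J \<subseteq> carrier SK"
  let ?\<beta> = "inv\<^bsub>G\<^esub> \<alpha>"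
  have \<beta>: "?\<beta> \<in> carrier G" using \<alpha> by simp
  have id: "ideal {x \<in> S. ?\<beta> x \<in> J} SK" by (rule preimage_ideal[OF J(1) \<beta>])
  have "M \<subseteq> {x \<in> S. ?\<beta> x \<in> J}"
  proof
    fix m assume m: "m \<in> M"
    have "?\<beta> m \<in> ?N" using m M.M_S[OF m] M.M_carrier[OF m] power_bounded_act[OF M.M_S[OF m] \<beta>] \<alpha> by simp
    then show "m \<in> {x \<in> S. ?\<beta> x \<in> J}" using M.M_S[OF m] J(2) by blast
  qed
  moreover have "{x \<in> S. ?\<beta> x \<in> J} \<subseteq> carrier SK" by auto
  ultimately have "{x \<in> S. ?\<beta> x \<in> J} = M \<or> {x \<in> S. ?\<beta> x \<in> J} = carrier SK"
    by (rule maximalideal.I_maximal[OF M id])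
  then show "J = ?N \<or> J = carrier SK"
  proof
    assume eq: "{x \<in> S. ?\<beta> x \<in> J} = M"
    have "J \<subseteq> ?N"
    proof
      fix y assume y: "y \<in> J"
      then have yS: "y \<in> S" "y \<in> carrier K" using J(3) S_carrier by auto
      then have "\<alpha> y \<in> {x \<in> S. ?\<beta> x \<in> J}" using y \<alpha> power_bounded_act[of y \<alpha>] by simp
      then show "y \<in> ?N" using eq yS by blast
    qed
    then show ?thesis using J(2) by blast
  next
    assume eq: "{x \<in> S. ?\<beta> x \<in> J} = carrier SK"
    then have "\<one> \<in> {x \<in> S. ?\<beta> x \<in> J}" using S_props(3) by simp
    then have "\<one>\<^bsub>SK\<^esub> \<in> J" using act_1[OF \<beta>] by simp
    then show ?thesis using ideal.one_imp_carrier[OF J(1)] by simp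
  qed
qed

text \<open>Valuations at \<open>M\<close> see conjugates of the values of \<open>f\<close>. This
  moves such a conjugate back to the value itself at the cost of replacing \<open>M\<close> by a
  conjugate maximal ideal, where the hypothesis on \<open>f\<close> is available too.\<close>

lemma preimage_square:
  assumes M: "maximalideal M SK" and \<alpha>: "\<alpha> \<in> carrier G" and y: "y \<in> S" "\<alpha> y \<in> M [^]\<^bsub>ideals_set SK\<^esub> (2::nat)"
  shows "y \<in> {x \<in> S. \<alpha> x \<in> M} [^]\<^bsub>ideals_set SK\<^esub> (2::nat)"
proof -
  interpret M: galois_dvr_max K G F V p M by (rule unramified_at(1)[OF M])
  let ?N = "{x \<in> S. \<alpha> x \<in> M}"
  interpret N: galois_dvr_max K G F V p ?N by (rule unramified_at(1)[OF preimage_maximal[OF M \<alpha>]])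
  let ?\<beta> = "inv\<^bsub>G\<^esub> \<alpha>"
  have \<beta>: "?\<beta> \<in> carrier G" using \<alpha> by simp
  have \<beta>N: "?\<beta> m \<in> ?N" if m: "m \<in> M" for m
    using m M.M_S[OF m] M.M_carrier[OF m] power_bounded_act[OF M.M_S[OF m] \<beta>] \<alpha> by simp
  have "x \<in> S \<and> ?\<beta> x \<in> N.M2" if "x \<in> ideal_prod SK M M" for x
    using that
  proof (induction rule: ideal_prod.induct)
    case (prod i j)
    then show ?case using N.M2_I[OF \<beta>N \<beta>N] M.M_carrier M.M_S \<beta> S_props(5) by (simp add: act_mult)
  next
    case (sum x y)
    then show ?case using N.M2_add[of "?\<beta> x" "?\<beta> y"] \<beta> S_props(6) S_carrier by (simp add: act_add)
  qed
  then have "?\<beta> (\<alpha> y) \<in> N.M2" using y M.M2_eq by simp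
  then show ?thesis using y S_carrier \<alpha> by simp
qed

text \<open>In the crossed product, left multiplication by \<open>x\<^sub>\<tau>\<close> with \<open>\<tau> = \<rho>\<mu>\<^sup>-\<^sup>1\<close> maps \<open>x\<^sub>\<mu> b\<close> to \<open>x\<^sub>\<rho> (g \<rho> \<mu> b)\<close>.\<close>

definition g :: "('a \<Rightarrow> 'a) \<Rightarrow> ('a \<Rightarrow> 'a) \<Rightarrow> 'a" where
  "g \<rho> \<mu> = (inv\<^bsub>G\<^esub> \<rho>) (f (\<rho> \<otimes>\<^bsub>G\<^esub> inv\<^bsub>G\<^esub> \<mu>) \<mu>)"

lemma
  assumes "\<rho> \<in> carrier G" "\<mu> \<in> carrier G"
  shows g_S: "g \<rho> \<mu> \<in> S" and g_nz: "g \<rho> \<mu> \<noteq> \<zero>" and g_closed: "g \<rho> \<mu> \<in> carrier K"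
    and act_g: "\<rho> (g \<rho> \<mu>) = f (\<rho> \<otimes>\<^bsub>G\<^esub> inv\<^bsub>G\<^esub> \<mu>) \<mu>"
  using assms power_bounded_act[OF f_S] f_nz act_eq_zero_iff by (simp_all add: g_def)

lemma g_refl: "\<rho> \<in> carrier G \<Longrightarrow> g \<rho> \<rho> = \<one>"
  by (simp add: g_def act_1)

text \<open>By the cocycle identity the quotient is a conjugate of a value of \<open>f\<close>. Its
  lying in \<open>S\<close> and being nonzero is the triangle inequality for the valuations of
  \<open>g\<close>.\<close>

lemma g_triangle:
  assumes "\<rho> \<in> carrier G" "\<mu> \<in> carrier G" "\<nu> \<in> carrier G"
  shows "\<exists>z\<in>S. g \<rho> \<mu> \<otimes> g \<mu> \<nu> = z \<otimes> g \<rho> \<nu> \<and> z \<noteq> \<zero>"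
proof -
  let ?\<tau> = "\<rho> \<otimes>\<^bsub>G\<^esub> inv\<^bsub>G\<^esub> \<mu>" and ?\<kappa> = "\<mu> \<otimes>\<^bsub>G\<^esub> inv\<^bsub>G\<^esub> \<nu>"
  have \<tau>: "?\<tau> \<in> carrier G" "?\<kappa> \<in> carrier G" "?\<tau> \<otimes>\<^bsub>G\<^esub> ?\<kappa> = \<rho> \<otimes>\<^bsub>G\<^esub> inv\<^bsub>G\<^esub> \<nu>" "?\<kappa> \<otimes>\<^bsub>G\<^esub> \<nu> = \<mu>"
    "inv\<^bsub>G\<^esub> \<rho> \<otimes>\<^bsub>G\<^esub> ?\<tau> = inv\<^bsub>G\<^esub> \<mu>"
    using assms by (simp_all add: G.m_assoc)
  let ?b = "inv\<^bsub>G\<^esub> \<rho>"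
  have b: "?b \<in> carrier G" using assms by simp
  have "g \<rho> \<mu> \<otimes> g \<mu> \<nu> = ?b (f ?\<tau> \<mu>) \<otimes> ?b (?\<tau> (f ?\<kappa> \<nu>))"
    using act_comp[OF b \<tau>(1), of "f ?\<kappa> \<nu>"] \<tau> assms by (simp add: g_def)
  also have "\<dots> = ?b (?\<tau> (f ?\<kappa> \<nu>) \<otimes> f ?\<tau> (?\<kappa> \<otimes>\<^bsub>G\<^esub> \<nu>))"
    using \<tau> assms b by (simp add: act_mult m_comm)
  also have "\<dots> = ?b (f ?\<tau> ?\<kappa>) \<otimes> g \<rho> \<nu>"
    unfolding cocycle[OF \<tau>(1,2) assms(3)] using \<tau> assms b by (simp add: act_mult g_def)
  finally show ?thesis
    using power_bounded_act[OF f_S[OF \<tau>(1,2)] b] f_nz[OF \<tau>(1,2)] act_eq_zero_iff[OF b, of "f ?\<tau> ?\<kappa>"] \<tau>(1,2) by auto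
qed

text \<open>The loss on going from \<mu> to \<rho> and back is a conjugate of a value
  \<open>f(\<tau>, \<tau>\<^sup>-\<^sup>1)\<close>; this is where these particular values enter the
  criterion.\<close>

lemma g_sym:
  assumes "\<rho> \<in> carrier G" "\<mu> \<in> carrier G"
  shows "g \<rho> \<mu> \<otimes> g \<mu> \<rho> = (inv\<^bsub>G\<^esub> \<rho>) (f (\<rho> \<otimes>\<^bsub>G\<^esub> inv\<^bsub>G\<^esub> \<mu>) (inv\<^bsub>G\<^esub> (\<rho> \<otimes>\<^bsub>G\<^esub> inv\<^bsub>G\<^esub> \<mu>)))"
proof -
  let ?\<tau> = "\<rho> \<otimes>\<^bsub>G\<^esub> inv\<^bsub>G\<^esub> \<mu>" and ?\<kappa> = "\<mu> \<otimes>\<^bsub>G\<^esub> inv\<^bsub>G\<^esub> \<rho>"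
  have \<tau>: "?\<tau> \<in> carrier G" "?\<kappa> \<in> carrier G" "?\<tau> \<otimes>\<^bsub>G\<^esub> ?\<kappa> = \<one>\<^bsub>G\<^esub>" "?\<kappa> \<otimes>\<^bsub>G\<^esub> \<rho> = \<mu>"
    "inv\<^bsub>G\<^esub> \<rho> \<otimes>\<^bsub>G\<^esub> ?\<tau> = inv\<^bsub>G\<^esub> \<mu>" "inv\<^bsub>G\<^esub> ?\<tau> = ?\<kappa>"
    using assms by (simp_all add: G.m_assoc G.inv_mult_group)
  let ?b = "inv\<^bsub>G\<^esub> \<rho>"
  have b: "?b \<in> carrier G" using assms by simp
  have "g \<rho> \<mu> \<otimes> g \<mu> \<rho> = ?b (f ?\<tau> \<mu>) \<otimes> ?b (?\<tau> (f ?\<kappa> \<rho>))"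
    using act_comp[OF b \<tau>(1), of "f ?\<kappa> \<rho>"] \<tau> assms by (simp add: g_def)
  also have "\<dots> = ?b (?\<tau> (f ?\<kappa> \<rho>) \<otimes> f ?\<tau> (?\<kappa> \<otimes>\<^bsub>G\<^esub> \<rho>))"
    using \<tau> assms b by (simp add: act_mult m_comm)
  also have "\<dots> = ?b (f ?\<tau> ?\<kappa>)"
    unfolding cocycle[OF \<tau>(1,2) assms(1)] using \<tau>(1-3) assms by simp
  finally show ?thesis unfolding \<tau>(6) .
qed

text \<open>
  Locally at \<open>M\<close>, an irreducible lattice of the hereditary order is given by the exponents
  \<open>j \<rho>\<close> below; the failure of \<open>j \<rho> \<ge> d \<rho> \<mu> + j \<mu>\<close> is a strict partial order in \<open>\<rho>\<close> and \<open>\<mu>\<close>, so a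
  minimal \<open>\<mu>\<close> exhibits the lattice as generated by its component at \<open>\<mu>\<close>.
\<close>

lemma local_generator:
  assumes hyp: "\<And>\<tau> M. \<tau> \<in> carrier G \<Longrightarrow> maximalideal M SK \<Longrightarrow> f \<tau> (inv\<^bsub>G\<^esub> \<tau>) \<notin> M [^]\<^bsub>ideals_set SK\<^esub> (2::nat)"
    and M: "maximalideal M SK"
    and J: "\<And>\<rho>. \<rho> \<in> carrier G \<Longrightarrow> J \<rho> \<subseteq> S" "\<And>\<rho>. \<rho> \<in> carrier G \<Longrightarrow> \<exists>a\<in>J \<rho>. a \<noteq> \<zero>"
      "\<And>\<tau> \<rho> b. \<tau> \<in> carrier G \<Longrightarrow> \<rho> \<in> carrier G \<Longrightarrow> b \<in> J \<rho> \<Longrightarrow> g \<tau> \<rho> \<otimes> b \<in> J \<tau>"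
  shows "\<exists>\<mu>\<in>carrier G. \<exists>a\<in>J \<mu>. \<exists>c\<in>carrier K. c \<otimes> a \<in> S - M \<and>
    (\<forall>\<rho>\<in>carrier G. \<forall>b\<in>J \<rho>. \<exists>z\<in>S. c \<otimes> b = g \<rho> \<mu> \<otimes> z)"
proof -
  obtain s where "unramified_max K G F V p M s" using unramified_at(3)[OF M] by blast
  then interpret unramified_max K G F V p M s .
  define d where "d \<rho> \<mu> = val (g \<rho> \<mu>)" for \<rho> \<mu>
  define j where "j \<rho> = (LEAST n. \<exists>a\<in>J \<rho>. a \<noteq> \<zero> \<and> val a = n)" for \<rho>
  have j_attained: "\<exists>a\<in>J \<rho>. a \<noteq> \<zero> \<and> val a = j \<rho>" if "\<rho> \<in> carrier G" for \<rho>
    unfolding j_def by (rule LeastI_ex) (use J(2)[OF that] in auto)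
  have j_le: "j \<rho> \<le> val b" if "b \<in> J \<rho>" "b \<noteq> \<zero>" for \<rho> b
    unfolding j_def by (rule Least_le) (use that in auto)
  have d_refl: "d \<rho> \<rho> = 0" if "\<rho> \<in> carrier G" for \<rho>
    unfolding d_def g_refl[OF that] using one_notin_M S_props(3) by (intro val_eqI) (auto simp: has_val_def intro!: bexI[of _ \<one>])
  have d_tri: "d \<rho> \<nu> \<le> d \<rho> \<mu> + d \<mu> \<nu>" if mem: "\<rho> \<in> carrier G" "\<mu> \<in> carrier G" "\<nu> \<in> carrier G" for \<rho> \<mu> \<nu>
  proof -
    obtain z where z: "z \<in> S" "g \<rho> \<mu> \<otimes> g \<mu> \<nu> = z \<otimes> g \<rho> \<nu>" "z \<noteq> \<zero>" using g_triangle[OF mem] by blast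
    have "d \<rho> \<mu> + d \<mu> \<nu> = val (z \<otimes> g \<rho> \<nu>)" unfolding d_def z(2)[symmetric] using mem g_S g_nz by (simp add: val_mult)
    also have "\<dots> = val z + d \<rho> \<nu>" unfolding d_def using mem g_S g_nz z by (simp add: val_mult)
    finally show ?thesis by simp
  qed
  \<comment> \<open>A value of at least 2 would put the conjugate of
    \<open>f(\<tau>, \<tau>\<^sup>-\<^sup>1)\<close> from \<open>g_sym\<close> into
    \<open>M\<^sup>2\<close>, contradicting the hypothesis at the preimage of
    \<open>M\<close>.\<close>
  have d_sym: "d \<rho> \<mu> + d \<mu> \<rho> \<le> 1" if "\<rho> \<in> carrier G" "\<mu> \<in> carrier G" for \<rho> \<mu>
  proof (rule ccontr)
    assume neg: "\<not> ?thesis"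
    let ?\<tau> = "\<rho> \<otimes>\<^bsub>G\<^esub> inv\<^bsub>G\<^esub> \<mu>" and ?b = "inv\<^bsub>G\<^esub> \<rho>"
    let ?x = "f ?\<tau> (inv\<^bsub>G\<^esub> ?\<tau>)"
    have \<tau>: "?\<tau> \<in> carrier G" "inv\<^bsub>G\<^esub> ?\<tau> \<in> carrier G" "?b \<in> carrier G" using that by auto
    have x: "?x \<in> S" "?x \<noteq> \<zero>" using f_S f_nz \<tau> by auto
    have bx: "?b ?x \<in> S" "?b ?x \<noteq> \<zero>" using power_bounded_act[OF x(1) \<tau>(3)] act_eq_zero_iff[OF \<tau>(3) S_carrier[OF x(1)]] x(2) by auto
    have "val (?b ?x) = d \<rho> \<mu> + d \<mu> \<rho>"
      unfolding d_def g_sym[OF that, symmetric] using that g_S g_nz by (simp add: val_mult)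
    then have "val_ge 2 (?b ?x)" using val_ge_iff[OF bx] neg by simp
    then have "?b ?x \<in> M2" by (rule val_ge_2_M2)
    then have "?x \<in> {x \<in> S. ?b x \<in> M} [^]\<^bsub>ideals_set SK\<^esub> (2::nat)" by (rule preimage_square[OF M \<tau>(3) x(1)])
    then show False using hyp[OF \<tau>(1) preimage_maximal[OF M \<tau>(3)]] by simp
  qed
  have j_tri: "j \<tau> \<le> d \<tau> \<rho> + j \<rho>" if mem: "\<tau> \<in> carrier G" "\<rho> \<in> carrier G" for \<tau> \<rho>
  proof -
    obtain a where a: "a \<in> J \<rho>" "a \<noteq> \<zero>" "val a = j \<rho>" using j_attained[OF mem(2)] by blast
    have aS: "a \<in> S" using J(1)[OF mem(2)] a by auto
    have "g \<tau> \<rho> \<otimes> a \<noteq> \<zero>" using integral[of "g \<tau> \<rho>" a] g_nz g_closed mem a S_carrier[OF aS] by auto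
    then have "j \<tau> \<le> val (g \<tau> \<rho> \<otimes> a)" using j_le J(3)[OF mem a(1)] by blast
    also have "\<dots> = d \<tau> \<rho> + j \<rho>" unfolding d_def using g_S g_nz mem aS a by (simp add: val_mult)
    finally show ?thesis .
  qed
  define bad where "bad = {(\<rho>, \<mu>). \<rho> \<in> carrier G \<and> \<mu> \<in> carrier G \<and> j \<rho> < d \<rho> \<mu> + j \<mu>}"
  have "trans bad"
  proof (rule transI)
    fix \<rho> \<mu> \<nu> assume *: "(\<rho>, \<mu>) \<in> bad" "(\<mu>, \<nu>) \<in> bad"
    then have mem: "\<rho> \<in> carrier G" "\<mu> \<in> carrier G" "\<nu> \<in> carrier G" by (auto simp: bad_def)
    \<comment> \<open>Integrality matters: each strict inequality gains 1, and with the triangle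
      inequality for \<mu>, \<rho>, \<nu> the negation would force
      \<open>d \<rho> \<mu> + d \<mu> \<rho> \<ge> 2\<close>.\<close>
    have "j \<rho> < d \<rho> \<nu> + j \<nu>"
    proof (rule ccontr)
      assume "\<not> ?thesis"
      moreover have "j \<rho> < d \<rho> \<mu> + j \<mu>" "j \<mu> < d \<mu> \<nu> + j \<nu>" using * by (auto simp: bad_def)
      moreover have "d \<rho> \<mu> + d \<mu> \<rho> \<le> 1" "d \<mu> \<nu> + d \<nu> \<mu> \<le> 1" "d \<mu> \<nu> \<le> d \<mu> \<rho> + d \<rho> \<nu>"
        using mem d_sym d_tri by auto
      ultimately show False by linarith
    qed
    then show "(\<rho>, \<nu>) \<in> bad" using mem by (simp add: bad_def)
  qed
  moreover have "irrefl bad" using d_refl by (auto simp: irrefl_def bad_def)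
  ultimately have "acyclic bad" by (simp add: acyclic_irrefl)
  moreover have "finite bad"
    by (rule finite_subset[of _ "carrier G \<times> carrier G"]) (use fin_G in \<open>auto simp: bad_def\<close>)
  ultimately have wf: "wf bad" by (simp add: finite_acyclic_wf)
  have "\<exists>\<mu>\<in>carrier G. \<forall>\<rho>. (\<rho>, \<mu>) \<in> bad \<longrightarrow> \<rho> \<notin> carrier G"
    by (rule wfE_min[OF wf G.one_closed]) blast
  then obtain \<mu> where \<mu>: "\<mu> \<in> carrier G" "\<And>\<rho>. (\<rho>, \<mu>) \<in> bad \<Longrightarrow> \<rho> \<notin> carrier G" by blast
  have j_ge: "d \<rho> \<mu> + j \<mu> \<le> j \<rho>" if "\<rho> \<in> carrier G" for \<rho>
    using \<mu>(2)[of \<rho>] that \<mu>(1) by (force simp: bad_def)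
  obtain a where a: "a \<in> J \<mu>" "a \<noteq> \<zero>" "val a = j \<mu>" using j_attained[OF \<mu>(1)] by blast
  define n where "n = j \<mu>"
  have aS: "a \<in> S" using J(1)[OF \<mu>(1)] a by auto
  obtain u where u: "u \<in> S - M" "s [^] n \<otimes> a = p [^] n \<otimes> u"
    using has_val_val[OF aS a(2)] unfolding has_val_def a(3) n_def by blast
  \<comment> \<open>A common denominator outside \<open>M\<close>: up to \<open>E\<close>, each
    power \<open>p^(d \<rho> \<mu>)\<close> is divisible by \<open>g \<rho> \<mu>\<close>. It is a
    product of the cofactors \<open>v\<close> from the valuations of the
    \<open>g \<rho> \<mu>\<close>.\<close>
  have ex: "\<exists>E\<in>S - M. \<forall>\<rho>\<in>T. \<exists>z\<in>S. E \<otimes> p [^] d \<rho> \<mu> = g \<rho> \<mu> \<otimes> z" if "finite T" "T \<subseteq> carrier G" for T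
    using that
  proof (induction T rule: finite_induct)
    case empty
    then show ?case using one_notin_M S_props(3) by auto
  next
    case (insert \<tau> T)
    then obtain E where E: "E \<in> S - M" "\<forall>\<rho>\<in>T. \<exists>z\<in>S. E \<otimes> p [^] d \<rho> \<mu> = g \<rho> \<mu> \<otimes> z" by auto
    have \<tau>: "\<tau> \<in> carrier G" using insert by auto
    obtain v where v: "v \<in> S - M" "s [^] d \<tau> \<mu> \<otimes> g \<tau> \<mu> = p [^] d \<tau> \<mu> \<otimes> v"
      using has_val_val[OF g_S[OF \<tau> \<mu>(1)] g_nz[OF \<tau> \<mu>(1)]] unfolding has_val_def d_def by blast
    have vE: "v \<in> carrier K" "E \<in> carrier K" using v E S_carrier by auto
    have "\<exists>z\<in>S. (E \<otimes> v) \<otimes> p [^] d \<rho> \<mu> = g \<rho> \<mu> \<otimes> z" if \<rho>: "\<rho> \<in> insert \<tau> T" for \<rho>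
    proof (cases "\<rho> = \<tau>")
      case True
      have "(E \<otimes> v) \<otimes> p [^] d \<tau> \<mu> = E \<otimes> (p [^] d \<tau> \<mu> \<otimes> v)" using vE by (simp add: m_ac)
      also have "\<dots> = g \<tau> \<mu> \<otimes> (E \<otimes> s [^] d \<tau> \<mu>)" unfolding v(2)[symmetric] using vE g_closed[OF \<tau> \<mu>(1)] by (simp add: m_ac)
      finally show ?thesis using True E S_props(5) S_pow by auto
    next
      case False
      then obtain z where z: "z \<in> S" "E \<otimes> p [^] d \<rho> \<mu> = g \<rho> \<mu> \<otimes> z" using E \<rho> by auto
      have gK: "g \<rho> \<mu> \<in> carrier K" using g_closed \<mu>(1) insert.prems \<rho> by auto
      have "(E \<otimes> v) \<otimes> p [^] d \<rho> \<mu> = v \<otimes> (E \<otimes> p [^] d \<rho> \<mu>)" using vE by (simp add: m_ac)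
      also have "\<dots> = g \<rho> \<mu> \<otimes> (v \<otimes> z)" unfolding z(2) using vE gK S_carrier[OF z(1)] by (simp add: m_ac)
      finally show ?thesis using v z S_props(5) by auto
    qed
    then show ?case using M_prime'[OF E(1) v(1)] by blast
  qed
  obtain E where E: "E \<in> S - M" and E_all: "\<forall>\<rho>\<in>carrier G. \<exists>z\<in>S. E \<otimes> p [^] d \<rho> \<mu> = g \<rho> \<mu> \<otimes> z"
    using ex[OF fin_G subset_refl] ..
  define q where "q = inv (p [^] n)"
  have q: "q \<in> carrier K" "q \<otimes> p [^] n = \<one>" using p_pow_nz[of n] field_Units by (auto simp: q_def)
  \<comment> \<open>\<open>s^n / p^n\<close> turns \<open>a\<close> into the element
    \<open>u\<close> outside \<open>M\<close>. The additional factor \<open>s\<close> covers the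
    components that need the denominator \<open>s^(n + d \<rho> \<mu>)\<close>, whose exponent is at
    most \<open>n + 1\<close>.\<close>
  define c where "c = E \<otimes> s [^] Suc n \<otimes> q"
  have K: "E \<in> carrier K" "u \<in> carrier K" "a \<in> carrier K" using E u aS S_carrier by auto
  have c: "c \<in> carrier K" using K q by (simp add: c_def)
  have "c \<otimes> a = E \<otimes> s \<otimes> q \<otimes> (s [^] n \<otimes> a)" using K q by (simp add: c_def m_ac)
  also have "\<dots> = E \<otimes> s \<otimes> u \<otimes> (q \<otimes> p [^] n)" unfolding u(2) using K q(1) by (simp add: m_ac)
  also have "\<dots> = E \<otimes> s \<otimes> u" using K q by simp
  finally have ca: "c \<otimes> a \<in> S - M" using M_prime' E s u(1) by simp
  have "\<exists>z\<in>S. c \<otimes> b = g \<rho> \<mu> \<otimes> z" if \<rho>: "\<rho> \<in> carrier G" and b: "b \<in> J \<rho>" for \<rho> b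
  proof -
    have bS: "b \<in> S" "b \<in> carrier K" using J(1)[OF \<rho>] b S_carrier by auto
    have "b = \<zero> \<or> n + d \<rho> \<mu> \<le> val b" using j_le[OF b] j_ge[OF \<rho>] by (force simp: n_def)
    then obtain w where w: "w \<in> S" "s [^] (n + d \<rho> \<mu>) \<otimes> b = p [^] (n + d \<rho> \<mu>) \<otimes> w"
      using divisible_if_le_val[OF bS(1)] by blast
    obtain z where z: "z \<in> S" "E \<otimes> p [^] d \<rho> \<mu> = g \<rho> \<mu> \<otimes> z" using bspec[OF E_all \<rho>] by (rule bexE)
    have wz: "w \<in> carrier K" "z \<in> carrier K" "g \<rho> \<mu> \<in> carrier K" using w z S_carrier g_closed \<rho> \<mu>(1) by auto
    have "d \<rho> \<mu> \<le> 1" using d_sym[OF \<rho> \<mu>(1)] by simp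
    then have "Suc n = (1 - d \<rho> \<mu>) + (n + d \<rho> \<mu>)" by simp
    then have "s [^] Suc n = s [^] (1 - d \<rho> \<mu>) \<otimes> s [^] (n + d \<rho> \<mu>)"
      using nat_pow_mult[of s "1 - d \<rho> \<mu>" "n + d \<rho> \<mu>"] by (simp del: nat_pow_Suc)
    then have "c \<otimes> b = E \<otimes> q \<otimes> s [^] (1 - d \<rho> \<mu>) \<otimes> (s [^] (n + d \<rho> \<mu>) \<otimes> b)"
      using K q bS by (simp add: c_def m_ac del: nat_pow_Suc)
    also have "\<dots> = (q \<otimes> p [^] n) \<otimes> (s [^] (1 - d \<rho> \<mu>) \<otimes> w) \<otimes> (E \<otimes> p [^] d \<rho> \<mu>)"
      unfolding w(2) using K q(1) wz by (simp add: nat_pow_mult[symmetric] m_ac)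
    also have "\<dots> = g \<rho> \<mu> \<otimes> (s [^] (1 - d \<rho> \<mu>) \<otimes> w \<otimes> z)"
      unfolding z(2) q(2) using wz by (simp add: m_ac)
    finally show ?thesis using w z S_props(5) S_pow by auto
  qed
  then show ?thesis using \<mu>(1) a(1) c ca by blast
qed

text \<open>
  The ideal generated by the scalars \<open>x\<close> for which multiplication by \<open>x\<close> on \<open>\<Sum> x\<^sub>\<rho> J \<rho>\<close> factors through \<open>\<Lambda>\<close>.
\<close>

inductive_set gen :: "(('a \<Rightarrow> 'a) \<Rightarrow> 'a set) \<Rightarrow> 'a set" for J where
  base: "\<lbrakk>\<mu> \<in> carrier G; a \<in> J \<mu>; c \<in> carrier K;
    \<And>\<rho> b. \<rho> \<in> carrier G \<Longrightarrow> b \<in> J \<rho> \<Longrightarrow> \<exists>z\<in>S. c \<otimes> b = g \<rho> \<mu> \<otimes> z; x = c \<otimes> a\<rbrakk> \<Longrightarrow> x \<in> gen J"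
| add: "x \<in> gen J \<Longrightarrow> y \<in> gen J \<Longrightarrow> x \<oplus> y \<in> gen J"

text \<open>Passage from local to global: \<open>gen J\<close> is an ideal of \<open>S\<close>,
  since multipliers \<open>c\<close> may be scaled by \<open>S\<close>, and
  \<open>local_generator\<close> provides an element of it outside any given maximal ideal.\<close>

lemma one_in_gen:
  assumes hyp: "\<And>\<tau> M. \<tau> \<in> carrier G \<Longrightarrow> maximalideal M SK \<Longrightarrow> f \<tau> (inv\<^bsub>G\<^esub> \<tau>) \<notin> M [^]\<^bsub>ideals_set SK\<^esub> (2::nat)"
    and J: "\<And>\<rho>. \<rho> \<in> carrier G \<Longrightarrow> J \<rho> \<subseteq> S" "\<And>\<rho>. \<rho> \<in> carrier G \<Longrightarrow> \<exists>a\<in>J \<rho>. a \<noteq> \<zero>"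
      "\<And>\<tau> \<rho> b. \<tau> \<in> carrier G \<Longrightarrow> \<rho> \<in> carrier G \<Longrightarrow> b \<in> J \<rho> \<Longrightarrow> g \<tau> \<rho> \<otimes> b \<in> J \<tau>"
  shows "\<one> \<in> gen J"
proof (rule ccontr)
  assume neg: "\<one> \<notin> gen J"
  interpret SK: cring SK by (rule SK_cring)
  have gen_S: "x \<in> S" if "x \<in> gen J" for x
    using that
  proof (induction rule: gen.induct)
    case (base \<mu> a c x)
    obtain z where "z \<in> S" "c \<otimes> a = g \<mu> \<mu> \<otimes> z" using base(4)[OF base(1,2)] by blast
    then show ?case using base S_carrier by (simp add: g_refl)
  qed (rule S_props(6))
  have scale: "t \<otimes> x \<in> gen J" if x: "x \<in> gen J" and t: "t \<in> S" for x t
    using x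
  proof (induction rule: gen.induct)
    case (base \<mu> a c x)
    have aK: "a \<in> carrier K" using J(1)[OF base(1)] base(2) S_carrier by auto
    have tK: "t \<in> carrier K" using t S_carrier by auto
    show ?case
    proof (rule gen.base[of \<mu> a _ "t \<otimes> c"])
      fix \<rho> b assume \<rho>: "\<rho> \<in> carrier G" "b \<in> J \<rho>"
      then obtain z where z: "z \<in> S" "c \<otimes> b = g \<rho> \<mu> \<otimes> z" using base(4) by blast
      have "b \<in> carrier K" using J(1)[OF \<rho>(1)] \<rho>(2) S_carrier by auto
      then have "t \<otimes> c \<otimes> b = t \<otimes> (c \<otimes> b)" using base(3) tK by (simp add: m_assoc)
      also have "\<dots> = g \<rho> \<mu> \<otimes> (t \<otimes> z)"
        unfolding z(2) using tK S_carrier[OF z(1)] g_closed[OF \<rho>(1) base(1)] by (simp add: m_ac)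
      finally have "t \<otimes> c \<otimes> b = g \<rho> \<mu> \<otimes> (t \<otimes> z)" .
      then show "\<exists>z\<in>S. t \<otimes> c \<otimes> b = g \<rho> \<mu> \<otimes> z" using S_props(5)[OF t z(1)] by blast
    qed (use base aK tK in \<open>auto simp: m_assoc\<close>)
  next
    case (add x y)
    then show ?case using gen.add[OF add(3,4)] gen_S[OF add(1)] gen_S[OF add(2)] S_carrier t by (simp add: r_distr)
  qed
  obtain a where a: "a \<in> J \<one>\<^bsub>G\<^esub>" using J(2)[OF G.one_closed] by blast
  have "\<zero> \<in> gen J"
  proof (rule gen.base[of "\<one>\<^bsub>G\<^esub>" a J \<zero>])
    fix \<rho> b assume \<rho>: "\<rho> \<in> carrier G" "b \<in> J \<rho>"
    then have "b \<in> carrier K" using J(1)[OF \<rho>(1)] S_carrier by auto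
    then show "\<exists>z\<in>S. \<zero> \<otimes> b = g \<rho> \<one>\<^bsub>G\<^esub> \<otimes> z" using g_closed[OF \<rho>(1) G.one_closed] S_props(2) by (intro bexI[of _ \<zero>]) simp_all
  qed (use a J(1)[OF G.one_closed] S_carrier in auto)
  have "ideal (gen J) SK"
  proof (rule idealI)
    show "ring SK" by (rule SK.ring_axioms)
    show "subgroup (gen J) (add_monoid SK)"
    proof (rule SK.add.subgroupI)
      show "gen J \<subseteq> carrier SK" using gen_S by auto
      show "gen J \<noteq> {}" using \<open>\<zero> \<in> gen J\<close> by blast
      fix x assume x: "x \<in> gen J"
      have "\<ominus>\<^bsub>SK\<^esub> x = \<ominus> \<one> \<otimes> x" using gen_S[OF x] S_carrier by (simp add: SK_minus l_minus)
      then show "\<ominus>\<^bsub>SK\<^esub> x \<in> gen J" using scale[OF x, of "\<ominus> \<one>"] S_props by simp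
      fix y assume "y \<in> gen J"
      then show "x \<oplus>\<^bsub>SK\<^esub> y \<in> gen J" using gen.add[OF x] by simp
    qed
    fix x t assume x: "x \<in> gen J" and t: "t \<in> carrier SK"
    show *: "t \<otimes>\<^bsub>SK\<^esub> x \<in> gen J" using scale x t by simp
    have "x \<otimes>\<^bsub>SK\<^esub> t = t \<otimes>\<^bsub>SK\<^esub> x" using gen_S[OF x] t by (intro SK.m_comm) simp_all
    then show "x \<otimes>\<^bsub>SK\<^esub> t \<in> gen J" using * by simp
  qed
  then obtain M where M: "maximalideal M SK" "gen J \<subseteq> M" using ideal_in_maximal neg by blast
  obtain \<mu> a c where "\<mu> \<in> carrier G" "a \<in> J \<mu>" "c \<in> carrier K" "c \<otimes> a \<in> S - M"
    "\<forall>\<rho>\<in>carrier G. \<forall>b\<in>J \<rho>. \<exists>z\<in>S. c \<otimes> b = g \<rho> \<mu> \<otimes> z"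
    using local_generator[OF hyp M(1) J] by blast
  moreover from this have "c \<otimes> a \<in> gen J" by (intro gen.base[of \<mu> a J c]) auto
  ultimately show False using M(2) by blast
qed

end

section \<open>Left ideals stable under right multiplication by \<open>S\<close>\<close>

context crossed_product
begin

lemma mono_mult_mono:
  assumes "a \<in> carrier K" "b \<in> carrier K" "\<mu> \<in> carrier G" "\<nu> \<in> carrier G"
  shows "mono a \<mu> \<otimes>\<^bsub>\<Sigma>\<^esub> mono b \<nu> = mono (a \<otimes> \<mu> b \<otimes> f \<mu> \<nu>) (\<mu> \<otimes>\<^bsub>G\<^esub> \<nu>)"
proof (rule cp_eqI)
  fix \<rho> assume \<rho>: "\<rho> \<in> carrier G"
  have "inv\<^bsub>G\<^esub> \<mu> \<otimes>\<^bsub>G\<^esub> \<rho> = \<nu> \<longleftrightarrow> \<rho> = \<mu> \<otimes>\<^bsub>G\<^esub> \<nu>" using assms \<rho> by (auto simp: G.m_assoc[symmetric])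
  then show "(mono a \<mu> \<otimes>\<^bsub>\<Sigma>\<^esub> mono b \<nu>) \<rho> = mono (a \<otimes> \<mu> b \<otimes> f \<mu> \<nu>) (\<mu> \<otimes>\<^bsub>G\<^esub> \<nu>) \<rho>"
    using assms \<rho> by (auto simp: mono_mult_apply mono_apply act_zero)
qed (use assms cp_mult_closed in auto)

lemma mono_add:
  assumes "a \<in> carrier K" "b \<in> carrier K"
  shows "mono a \<mu> \<oplus>\<^bsub>\<Sigma>\<^esub> mono b \<mu> = mono (a \<oplus> b) \<mu>"
  using assms by (auto simp: mono_def cp_simps fun_eq_iff)

end

context crossed_order
begin

abbreviation \<Lambda> :: "(('a \<Rightarrow> 'a) \<Rightarrow> 'a) ring" where "\<Lambda> \<equiv> cp S"

lemma \<Lambda>_ring: "ring \<Lambda>"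
proof (rule cp_ring[OF power_bounded_subring])
  show "\<alpha> \<in> carrier G \<Longrightarrow> x \<in> S \<Longrightarrow> \<alpha> x \<in> S" for \<alpha> x by (rule power_bounded_act)
qed (rule f_S)

lemma \<Lambda>_\<Sigma>: "x \<in> carrier \<Lambda> \<Longrightarrow> x \<in> carrier \<Sigma>"
  using S_carrier by (auto simp: cp_simps PiE_def)

lemma \<Lambda>_S: "x \<in> carrier \<Lambda> \<Longrightarrow> \<rho> \<in> carrier G \<Longrightarrow> x \<rho> \<in> S"
  by (auto simp: cp_simps)

lemma \<Lambda>_I: "x \<in> carrier \<Sigma> \<Longrightarrow> (\<And>\<rho>. \<rho> \<in> carrier G \<Longrightarrow> x \<rho> \<in> S) \<Longrightarrow> x \<in> carrier \<Lambda>"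
  by (auto simp: cp_simps PiE_def)

lemma mono_\<Lambda>: "a \<in> S \<Longrightarrow> mono a \<mu> \<in> carrier \<Lambda>"
  using S_carrier S_props(2) by (intro \<Lambda>_I) (auto simp: mono_apply)

lemma \<Lambda>_ops: "\<one>\<^bsub>\<Lambda>\<^esub> = \<one>\<^bsub>\<Sigma>\<^esub>" "\<zero>\<^bsub>\<Lambda>\<^esub> = \<zero>\<^bsub>\<Sigma>\<^esub>" "x \<oplus>\<^bsub>\<Lambda>\<^esub> y = x \<oplus>\<^bsub>\<Sigma>\<^esub> y" "x \<otimes>\<^bsub>\<Lambda>\<^esub> y = x \<otimes>\<^bsub>\<Sigma>\<^esub> y"
  by (rule cp_ops)+

lemma \<Lambda>_closed: "x \<in> carrier \<Lambda> \<Longrightarrow> y \<in> carrier \<Lambda> \<Longrightarrow> x \<otimes>\<^bsub>\<Sigma>\<^esub> y \<in> carrier \<Lambda>"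
    "x \<in> carrier \<Lambda> \<Longrightarrow> y \<in> carrier \<Lambda> \<Longrightarrow> x \<oplus>\<^bsub>\<Sigma>\<^esub> y \<in> carrier \<Lambda>"
  using ring.ring_simprules(1,5)[OF \<Lambda>_ring] by (simp_all add: \<Lambda>_ops)

lemma left_idealE:
  assumes "left_ideal Y \<Lambda>"
  shows "y \<in> Y \<Longrightarrow> y \<in> carrier \<Lambda>" "y \<in> Y \<Longrightarrow> y' \<in> Y \<Longrightarrow> y \<oplus>\<^bsub>\<Sigma>\<^esub> y' \<in> Y" "\<zero>\<^bsub>\<Sigma>\<^esub> \<in> Y"
    "a \<in> carrier \<Lambda> \<Longrightarrow> y \<in> Y \<Longrightarrow> a \<otimes>\<^bsub>\<Sigma>\<^esub> y \<in> Y"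
  using additive_subgroup.a_subset[OF left_ideal.axioms(1)[OF assms]] additive_subgroup.a_closed[OF left_ideal.axioms(1)[OF assms]]
    additive_subgroup.zero_closed[OF left_ideal.axioms(1)[OF assms]] left_ideal.left_ideal_closed[OF assms]
  by (auto simp: \<Lambda>_ops)

lemma left_idealI:
  assumes "Y \<subseteq> carrier \<Lambda>" "\<And>y y'. y \<in> Y \<Longrightarrow> y' \<in> Y \<Longrightarrow> y \<oplus>\<^bsub>\<Sigma>\<^esub> y' \<in> Y" "\<zero>\<^bsub>\<Sigma>\<^esub> \<in> Y"
    "\<And>a y. a \<in> carrier \<Lambda> \<Longrightarrow> y \<in> Y \<Longrightarrow> a \<otimes>\<^bsub>\<Sigma>\<^esub> y \<in> Y"
  shows "left_ideal Y \<Lambda>"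
proof -
  interpret \<Lambda>: ring \<Lambda> by (rule \<Lambda>_ring)
  show ?thesis
  proof (intro left_ideal.intro left_ideal_axioms.intro \<Lambda>_ring additive_subgroupI \<Lambda>.add.subgroupI)
    fix y assume y: "y \<in> Y"
    then have y\<Lambda>: "y \<in> carrier \<Lambda>" using assms(1) by auto
    have "\<ominus>\<^bsub>\<Lambda>\<^esub> \<one>\<^bsub>\<Lambda>\<^esub> \<otimes>\<^bsub>\<Lambda>\<^esub> y = \<ominus>\<^bsub>\<Lambda>\<^esub> y" using y\<Lambda> by (simp add: \<Lambda>.l_minus)
    then show "\<ominus>\<^bsub>\<Lambda>\<^esub> y \<in> Y" using assms(4)[of "\<ominus>\<^bsub>\<Lambda>\<^esub> \<one>\<^bsub>\<Lambda>\<^esub>" y] y by (simp add: \<Lambda>_ops(4)[symmetric])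
  next
    show "Y \<noteq> {}" using assms(3) by blast
  qed (use assms in \<open>simp_all add: \<Lambda>_ops\<close>)
qed

text \<open>For a tensor with terms \<open>s \<otimes> t\<close>, the sum of the products
  \<open>s y \<rho>\<^sup>-\<^sup>1(t)\<close> has the coefficient
  \<open>w(\<alpha>\<rho>\<^sup>-\<^sup>1) y(\<alpha>)\<close> at \<alpha>. It lies in
  \<open>Y\<close>, by the left and the right action of \<open>S\<close>, and for the idempotent
  \<open>w\<close> only the coefficient at \<rho> survives.\<close>

lemma component_mem:
  assumes Y: "left_ideal Y \<Lambda>" and right: "\<And>y s. y \<in> Y \<Longrightarrow> s \<in> S \<Longrightarrow> y \<otimes>\<^bsub>\<Sigma>\<^esub> mono s \<one>\<^bsub>G\<^esub> \<in> Y"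
    and y: "y \<in> Y" and \<rho>: "\<rho> \<in> carrier G"
  shows "mono (y \<rho>) \<rho> \<in> Y"
proof -
  note Yp = left_idealE[OF Y]
  have y\<Sigma>: "y \<in> carrier \<Sigma>" using Yp(1)[OF y] \<Lambda>_\<Sigma> by simp
  have SK': "S \<subseteq> carrier K" using S_carrier by auto
  have r: "inv\<^bsub>G\<^esub> \<rho> \<in> carrier G" using \<rho> by simp
  have *: "(\<lambda>\<alpha>\<in>carrier G. w (\<alpha> \<otimes>\<^bsub>G\<^esub> inv\<^bsub>G\<^esub> \<rho>) \<otimes> y \<alpha>) \<in> Y" if "w \<in> tens S" for w
    using that
  proof (induction rule: tens.induct)
    case (pure s t w)
    have K: "s \<in> carrier K" "t \<in> carrier K" "(inv\<^bsub>G\<^esub> \<rho>) t \<in> S" "(inv\<^bsub>G\<^esub> \<rho>) t \<in> carrier K"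
      using pure S_carrier power_bounded_act[OF pure(2) r] by auto
    have "(\<lambda>\<alpha>\<in>carrier G. w (\<alpha> \<otimes>\<^bsub>G\<^esub> inv\<^bsub>G\<^esub> \<rho>) \<otimes> y \<alpha>) =
        mono s \<one>\<^bsub>G\<^esub> \<otimes>\<^bsub>\<Sigma>\<^esub> (y \<otimes>\<^bsub>\<Sigma>\<^esub> mono ((inv\<^bsub>G\<^esub> \<rho>) t) \<one>\<^bsub>G\<^esub>)"
    proof (rule cp_eqI)
      show "(\<lambda>\<alpha>\<in>carrier G. w (\<alpha> \<otimes>\<^bsub>G\<^esub> inv\<^bsub>G\<^esub> \<rho>) \<otimes> y \<alpha>) \<in> carrier \<Sigma>"
        using pure(3) K y\<Sigma> r by (auto simp: cp_simps PiE_mem)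
      show "mono s \<one>\<^bsub>G\<^esub> \<otimes>\<^bsub>\<Sigma>\<^esub> (y \<otimes>\<^bsub>\<Sigma>\<^esub> mono ((inv\<^bsub>G\<^esub> \<rho>) t) \<one>\<^bsub>G\<^esub>) \<in> carrier \<Sigma>"
        using K y\<Sigma> by (intro cp_mult_closed) auto
      fix \<alpha> assume \<alpha>: "\<alpha> \<in> carrier G"
      have yt: "y \<otimes>\<^bsub>\<Sigma>\<^esub> mono ((inv\<^bsub>G\<^esub> \<rho>) t) \<one>\<^bsub>G\<^esub> \<in> carrier \<Sigma>" using K y\<Sigma> by (intro cp_mult_closed) auto
      have e: "(\<alpha> \<otimes>\<^bsub>G\<^esub> inv\<^bsub>G\<^esub> \<rho>) t = \<alpha> ((inv\<^bsub>G\<^esub> \<rho>) t)" using act_comp[OF \<alpha> r K(2)] .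
      have "(mono s \<one>\<^bsub>G\<^esub> \<otimes>\<^bsub>\<Sigma>\<^esub> (y \<otimes>\<^bsub>\<Sigma>\<^esub> mono ((inv\<^bsub>G\<^esub> \<rho>) t) \<one>\<^bsub>G\<^esub>)) \<alpha> = s \<otimes> (y \<alpha> \<otimes> \<alpha> ((inv\<^bsub>G\<^esub> \<rho>) t))"
        using K y\<Sigma> \<alpha> yt by (simp add: mono_mult_apply mult_mono_apply act_one)
      also have "\<dots> = s \<otimes> (\<alpha> \<otimes>\<^bsub>G\<^esub> inv\<^bsub>G\<^esub> \<rho>) t \<otimes> y \<alpha>" unfolding e using K y\<Sigma> \<alpha> by (simp add: m_ac)
      finally show "(\<lambda>\<alpha>\<in>carrier G. w (\<alpha> \<otimes>\<^bsub>G\<^esub> inv\<^bsub>G\<^esub> \<rho>) \<otimes> y \<alpha>) \<alpha> =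
          (mono s \<one>\<^bsub>G\<^esub> \<otimes>\<^bsub>\<Sigma>\<^esub> (y \<otimes>\<^bsub>\<Sigma>\<^esub> mono ((inv\<^bsub>G\<^esub> \<rho>) t) \<one>\<^bsub>G\<^esub>)) \<alpha>"
        using \<alpha> r pure(3)[of "\<alpha> \<otimes>\<^bsub>G\<^esub> inv\<^bsub>G\<^esub> \<rho>"] by simp
    qed
    then show ?case using Yp(4)[OF mono_\<Lambda>[OF pure(1)] right[OF y K(3)]] by simp
  next
    case (add u v w)
    have e: "(\<lambda>\<alpha>\<in>carrier G. w (\<alpha> \<otimes>\<^bsub>G\<^esub> inv\<^bsub>G\<^esub> \<rho>) \<otimes> y \<alpha>) =
      (\<lambda>\<alpha>\<in>carrier G. u (\<alpha> \<otimes>\<^bsub>G\<^esub> inv\<^bsub>G\<^esub> \<rho>) \<otimes> y \<alpha>) \<oplus>\<^bsub>\<Sigma>\<^esub> (\<lambda>\<alpha>\<in>carrier G. v (\<alpha> \<otimes>\<^bsub>G\<^esub> inv\<^bsub>G\<^esub> \<rho>) \<otimes> y \<alpha>)"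
      using add(3) tens_closed[OF add(1) SK'] tens_closed[OF add(2) SK'] y\<Sigma> r
      by (auto simp: cp_simps(4) l_distr fun_eq_iff)
    show ?case unfolding e by (rule Yp(2)[OF add(4,5)])
  qed
  obtain w where w: "w \<in> tens S" "\<forall>\<alpha>\<in>carrier G. w \<alpha> = (if \<alpha> = \<one>\<^bsub>G\<^esub> then \<one> else \<zero>)"
    using separating_S unfolding separating_def by blast
  have "(\<lambda>\<alpha>\<in>carrier G. w (\<alpha> \<otimes>\<^bsub>G\<^esub> inv\<^bsub>G\<^esub> \<rho>) \<otimes> y \<alpha>) = mono (y \<rho>) \<rho>"
    unfolding mono_def
  proof (rule restrict_ext)
    fix \<alpha> assume \<alpha>: "\<alpha> \<in> carrier G"
    have "\<alpha> = \<rho>" if eq: "\<alpha> \<otimes>\<^bsub>G\<^esub> inv\<^bsub>G\<^esub> \<rho> = \<one>\<^bsub>G\<^esub>"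
    proof -
      have "\<alpha> = (\<alpha> \<otimes>\<^bsub>G\<^esub> inv\<^bsub>G\<^esub> \<rho>) \<otimes>\<^bsub>G\<^esub> \<rho>" using \<alpha> \<rho> by simp
      then show ?thesis unfolding eq using \<rho> by simp
    qed
    then have "\<alpha> \<otimes>\<^bsub>G\<^esub> inv\<^bsub>G\<^esub> \<rho> = \<one>\<^bsub>G\<^esub> \<longleftrightarrow> \<alpha> = \<rho>" using \<rho> by auto
    then show "w (\<alpha> \<otimes>\<^bsub>G\<^esub> inv\<^bsub>G\<^esub> \<rho>) \<otimes> y \<alpha> = (if \<alpha> = \<rho> then y \<rho> else \<zero>)" using w(2) \<alpha> \<rho> r y\<Sigma> by simp
  qed
  then show ?thesis using *[OF w(1)] by simp
qed

text \<open>Right multiplication by a generator \<open>c a\<close> of \<open>gen J\<close> factors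
  as multiplication by an element \<open>z\<close> of the algebra that maps \<open>Y\<close> into
  the order, followed by multiplication by a homogeneous element of \<open>Y\<close>. It therefore
  has rank one, and 1 in \<open>gen J\<close> makes the identity of finite rank.\<close>

lemma bimodule_fg_projective:
  assumes hyp: "\<And>\<tau> M. \<tau> \<in> carrier G \<Longrightarrow> maximalideal M SK \<Longrightarrow> f \<tau> (inv\<^bsub>G\<^esub> \<tau>) \<notin> M [^]\<^bsub>ideals_set SK\<^esub> (2::nat)"
    and Y: "left_ideal Y \<Lambda>" and right: "\<And>y s. y \<in> Y \<Longrightarrow> s \<in> S \<Longrightarrow> y \<otimes>\<^bsub>\<Sigma>\<^esub> mono s \<one>\<^bsub>G\<^esub> \<in> Y"
  shows "fg_projective \<Lambda> (left_ideal_module \<Lambda> Y)"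
proof (cases "Y = {\<zero>\<^bsub>\<Lambda>\<^esub>}")
  case True
  then show ?thesis by (intro fg_projective_zero left_ideal_module_left_module Y) simp
next
  case False
  interpret \<Sigma>: ring \<Sigma> by (rule \<Sigma>_ring)
  note Yp = left_idealE[OF Y]
  \<comment> \<open>\<open>mono (\<rho> a) \<rho>\<close> is \<open>x\<^sub>\<rho> a\<close>: with
    coefficients written on the right, right multiplication by \<open>S\<close> acts on
    \<open>J \<rho>\<close> without a twist.\<close>
  define J where "J \<rho> = {a \<in> S. mono (\<rho> a) \<rho> \<in> Y}" for \<rho>
  have J_S: "J \<rho> \<subseteq> S" for \<rho> by (auto simp: J_def)
  have J_g: "g \<tau> \<rho> \<otimes> b \<in> J \<tau>" if \<tau>: "\<tau> \<in> carrier G" and \<rho>: "\<rho> \<in> carrier G" and b: "b \<in> J \<rho>" for \<tau> \<rho> b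
  proof -
    have bS: "b \<in> S" "b \<in> carrier K" "mono (\<rho> b) \<rho> \<in> Y" using b S_carrier by (auto simp: J_def)
    let ?\<kappa> = "\<tau> \<otimes>\<^bsub>G\<^esub> inv\<^bsub>G\<^esub> \<rho>"
    have \<kappa>: "?\<kappa> \<in> carrier G" using \<tau> \<rho> by simp
    have kb: "?\<kappa> (\<rho> b) = \<tau> b" using act_comp[OF \<kappa> \<rho> bS(2)] \<tau> \<rho> by simp
    have "mono \<one> ?\<kappa> \<otimes>\<^bsub>\<Sigma>\<^esub> mono (\<rho> b) \<rho> = mono (\<one> \<otimes> ?\<kappa> (\<rho> b) \<otimes> f ?\<kappa> \<rho>) (?\<kappa> \<otimes>\<^bsub>G\<^esub> \<rho>)"
      using bS \<rho> \<kappa> by (intro mono_mult_mono) auto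
    also have "\<dots> = mono (\<tau> (g \<tau> \<rho> \<otimes> b)) \<tau>"
      using bS \<tau> \<rho> \<kappa> kb g_closed[OF \<tau> \<rho>] by (simp add: act_mult act_g m_comm)
    finally have "mono (\<tau> (g \<tau> \<rho> \<otimes> b)) \<tau> \<in> Y" using Yp(4)[OF mono_\<Lambda>[OF S_props(3), of ?\<kappa>] bS(3)] by simp
    then show ?thesis using S_props(5)[OF g_S[OF \<tau> \<rho>] bS(1)] by (simp add: J_def)
  qed
  have comp: "mono (y \<rho>) \<rho> \<in> Y" if "y \<in> Y" "\<rho> \<in> carrier G" for y \<rho>
    by (rule component_mem[OF Y right that])
  have comp_J: "(inv\<^bsub>G\<^esub> \<rho>) (y \<rho>) \<in> J \<rho>" if y: "y \<in> Y" and \<rho>: "\<rho> \<in> carrier G" for y \<rho>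
  proof -
    have "y \<rho> \<in> S" using \<Lambda>_S[OF Yp(1)[OF y] \<rho>] .
    then show ?thesis using comp[OF y \<rho>] \<rho> S_carrier power_bounded_act[of "y \<rho>" "inv\<^bsub>G\<^esub> \<rho>"] by (simp add: J_def)
  qed
  have "\<exists>y\<in>Y. y \<noteq> \<zero>\<^bsub>\<Sigma>\<^esub>" using False Yp(3) by (auto simp: \<Lambda>_ops)
  then obtain y where y: "y \<in> Y" "y \<noteq> \<zero>\<^bsub>\<Sigma>\<^esub>" by blast
  have "\<exists>\<rho>\<in>carrier G. y \<rho> \<noteq> \<zero>"
  proof (rule ccontr)
    assume "\<not> ?thesis"
    then have "y = \<zero>\<^bsub>\<Sigma>\<^esub>"
      by (intro cp_eqI \<Lambda>_\<Sigma>[OF Yp(1)[OF y(1)]] \<Sigma>.zero_closed) (simp add: cp_simps)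
    then show False using y by simp
  qed
  then obtain \<kappa> where \<kappa>: "\<kappa> \<in> carrier G" "y \<kappa> \<noteq> \<zero>" by blast
  define e where "e = (inv\<^bsub>G\<^esub> \<kappa>) (y \<kappa>)"
  have yK: "y \<kappa> \<in> carrier K" using \<Lambda>_S[OF Yp(1)[OF y(1)] \<kappa>(1)] S_carrier by simp
  have e: "e \<in> J \<kappa>" "e \<noteq> \<zero>" "e \<in> carrier K"
    using comp_J[OF y(1) \<kappa>(1)] act_eq_zero_iff[of "inv\<^bsub>G\<^esub> \<kappa>" "y \<kappa>"] \<kappa> yK by (simp_all add: e_def)
  \<comment> \<open>A single nonzero component suffices, because \<open>g\<close> has no zero values
    and carries it into every other component.\<close>
  have J_nz: "\<exists>a\<in>J \<rho>. a \<noteq> \<zero>" if \<rho>: "\<rho> \<in> carrier G" for \<rho>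
    using J_g[OF \<rho> \<kappa>(1) e(1)] integral[of "g \<rho> \<kappa>" e] g_nz[OF \<rho> \<kappa>(1)] g_closed[OF \<rho> \<kappa>(1)] e by blast
  have one: "\<one> \<in> gen J" by (rule one_in_gen[OF hyp J_S J_nz J_g])
  have endo: "x \<in> carrier K \<and> (\<lambda>y. y \<otimes>\<^bsub>\<Sigma>\<^esub> mono x \<one>\<^bsub>G\<^esub>) \<in> fin_endo \<Lambda> (left_ideal_module \<Lambda> Y)" if "x \<in> gen J" for x
    using that
  proof (induction rule: gen.induct)
    case (base \<mu> a c x)
    let ?\<nu> = "inv\<^bsub>G\<^esub> \<mu>"
    have \<mu>: "\<mu> \<in> carrier G" "?\<nu> \<in> carrier G" using base by auto
    have a: "a \<in> S" "a \<in> carrier K" "mono (\<mu> a) \<mu> \<in> Y" using base(2) S_carrier by (auto simp: J_def)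
    define h where "h = f ?\<nu> \<mu>"
    have h: "h \<in> carrier K" "h \<noteq> \<zero>" using f_nz[OF \<mu>(2,1)] \<mu> by (auto simp: h_def)
    then have ih: "inv h \<in> carrier K" "inv h \<otimes> h = \<one>" using field_Units by auto
    \<comment> \<open>This is \<open>c x\<^sub>\<mu>\<^sup>-\<^sup>1\<close>, since the inverse of
      \<open>x\<^sub>\<mu>\<close> in the algebra is \<open>x\<^sub>\<nu>\<close> with
      \<open>\<nu> = \<mu>\<^sup>-\<^sup>1\<close> and left coefficient
      \<open>f(\<mu>\<^sup>-\<^sup>1, \<mu>)\<^sup>-\<^sup>1\<close>.\<close>
    define z where "z = mono (c \<otimes> inv h) ?\<nu>"
    have z: "z \<in> carrier \<Sigma>" using base(3) ih by (simp add: z_def)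
    have "z \<otimes>\<^bsub>\<Sigma>\<^esub> mono (\<mu> a) \<mu> = mono ((c \<otimes> inv h) \<otimes> ?\<nu> (\<mu> a) \<otimes> f ?\<nu> \<mu>) (?\<nu> \<otimes>\<^bsub>G\<^esub> \<mu>)"
      unfolding z_def using base(3) ih a \<mu> by (intro mono_mult_mono) auto
    also have "(c \<otimes> inv h) \<otimes> ?\<nu> (\<mu> a) \<otimes> f ?\<nu> \<mu> = c \<otimes> a \<otimes> (inv h \<otimes> h)"
      unfolding h_def[symmetric] using base(3) ih(1) h a \<mu> by (simp add: m_ac)
    also have "\<dots> = x" using base ih a by simp
    also have "?\<nu> \<otimes>\<^bsub>G\<^esub> \<mu> = \<one>\<^bsub>G\<^esub>" using \<mu> by simp
    finally have zm: "z \<otimes>\<^bsub>\<Sigma>\<^esub> mono (\<mu> a) \<mu> = mono x \<one>\<^bsub>G\<^esub>" .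
    \<comment> \<open>For a component \<open>x\<^sub>\<rho> b\<close> of \<open>y\<close>, the
      divisibility of \<open>c b\<close> by \<open>g \<rho> \<mu>\<close> with quotient
      \<open>w\<close> cancels the denominator \<open>h\<close> through the cocycle identity and
      leaves the coefficient \<open>\<rho>(w)\<close> at
      \<open>\<rho>\<mu>\<^sup>-\<^sup>1\<close>.\<close>
    have yz: "y \<otimes>\<^bsub>\<Sigma>\<^esub> z \<in> carrier \<Lambda>" if y: "y \<in> Y" for y
    proof (rule \<Lambda>_I)
      have y\<Sigma>: "y \<in> carrier \<Sigma>" using \<Lambda>_\<Sigma>[OF Yp(1)[OF y]] .
      show "y \<otimes>\<^bsub>\<Sigma>\<^esub> z \<in> carrier \<Sigma>" using y\<Sigma> z by (rule cp_mult_closed)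
      fix \<rho>' assume \<rho>': "\<rho>' \<in> carrier G"
      define \<rho> where "\<rho> = \<rho>' \<otimes>\<^bsub>G\<^esub> \<mu>"
      have \<rho>: "\<rho> \<in> carrier G" "\<rho>' = \<rho> \<otimes>\<^bsub>G\<^esub> ?\<nu>" using \<rho>' \<mu> by (simp_all add: \<rho>_def)
      obtain w where w: "w \<in> S" "c \<otimes> (inv\<^bsub>G\<^esub> \<rho>) (y \<rho>) = g \<rho> \<mu> \<otimes> w"
        using base(4)[OF \<rho>(1) comp_J[OF y \<rho>(1)]] by blast
      have K: "y \<rho> \<in> carrier K" "w \<in> carrier K" "\<rho> c \<in> carrier K" "\<rho> (inv h) \<in> carrier K" "\<rho> w \<in> carrier K"
          "f \<rho>' \<mu> \<in> carrier K" "f \<rho> ?\<nu> \<in> carrier K" "\<rho> h \<in> carrier K"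
        using y\<Sigma> \<rho> \<rho>' w S_carrier base(3) ih h \<mu> by auto
      have "\<rho> (c \<otimes> (inv\<^bsub>G\<^esub> \<rho>) (y \<rho>)) = \<rho> (g \<rho> \<mu> \<otimes> w)" using w by simp
      then have e1: "\<rho> c \<otimes> y \<rho> = f \<rho>' \<mu> \<otimes> \<rho> w"
        using \<rho> K base(3) \<mu> g_closed[OF \<rho>(1) \<mu>(1)] by (simp add: act_mult act_g)
      have e2: "\<rho> h = f \<rho> ?\<nu> \<otimes> f \<rho>' \<mu>"
        using cocycle[OF \<rho>(1) \<mu>(2,1)] \<rho> \<mu> K by (simp add: h_def)
      have e3: "\<rho> (inv h) \<otimes> \<rho> h = \<one>" using act_mult[OF \<rho>(1) ih(1) h(1)] ih(2) act_1[OF \<rho>(1)] by simp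
      have "(y \<otimes>\<^bsub>\<Sigma>\<^esub> z) \<rho>' = y \<rho> \<otimes> \<rho> (c \<otimes> inv h) \<otimes> f \<rho> ?\<nu>"
        unfolding z_def using mult_mono_apply[OF _ \<mu>(2) y\<Sigma> \<rho>', of "c \<otimes> inv h"] base(3) ih \<mu> by (simp add: \<rho>_def)
      also have "\<dots> = (\<rho> c \<otimes> y \<rho>) \<otimes> \<rho> (inv h) \<otimes> f \<rho> ?\<nu>"
        using K \<rho>(1) base(3) ih(1) by (simp add: act_mult m_ac)
      also have "\<dots> = (\<rho> (inv h) \<otimes> (f \<rho> ?\<nu> \<otimes> f \<rho>' \<mu>)) \<otimes> \<rho> w" unfolding e1 using K by (simp add: m_ac)
      also have "\<dots> = \<rho> w" unfolding e2[symmetric] e3 using K by simp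
      finally show "(y \<otimes>\<^bsub>\<Sigma>\<^esub> z) \<rho>' \<in> S" using power_bounded_act[OF w(1) \<rho>(1)] by simp
    qed
    have "(\<lambda>y. y \<otimes>\<^bsub>\<Sigma>\<^esub> mono x \<one>\<^bsub>G\<^esub>) \<in> fin_endo \<Lambda> (left_ideal_module \<Lambda> Y)"
    proof (rule fin_endo.rank1[of "\<lambda>y. y \<otimes>\<^bsub>\<Sigma>\<^esub> z" _ _ "mono (\<mu> a) \<mu>"])
      show "(\<lambda>y. y \<otimes>\<^bsub>\<Sigma>\<^esub> z) \<in> left_module_hom \<Lambda> (left_ideal_module \<Lambda> Y) (left_ideal_module \<Lambda> (carrier \<Lambda>))"
        by (rule left_module_homI)
           (use yz \<Lambda>_\<Sigma> Yp(1) z in \<open>simp_all add: \<Lambda>_ops \<Sigma>.l_distr \<Sigma>.m_assoc\<close>)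
      show "mono (\<mu> a) \<mu> \<in> carrier (left_ideal_module \<Lambda> Y)" using a by simp
      fix y assume "y \<in> carrier (left_ideal_module \<Lambda> Y)"
      then have "y \<in> carrier \<Sigma>" using Yp(1) \<Lambda>_\<Sigma> by simp
      then show "y \<otimes>\<^bsub>\<Sigma>\<^esub> mono x \<one>\<^bsub>G\<^esub> = (y \<otimes>\<^bsub>\<Sigma>\<^esub> z) \<odot>\<^bsub>left_ideal_module \<Lambda> Y\<^esub> mono (\<mu> a) \<mu>"
        unfolding zm[symmetric] using z a \<mu> by (simp add: \<Lambda>_ops \<Sigma>.m_assoc)
    qed
    then show ?case using base(3,5) a(2) by simp
  next
    case (add x x')
    have "(\<lambda>y. y \<otimes>\<^bsub>\<Sigma>\<^esub> mono (x \<oplus> x') \<one>\<^bsub>G\<^esub>) \<in> fin_endo \<Lambda> (left_ideal_module \<Lambda> Y)"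
    proof (rule fin_endo.add[OF conjunct2[OF add(3)] conjunct2[OF add(4)]])
      fix y assume "y \<in> carrier (left_ideal_module \<Lambda> Y)"
      then have "y \<in> carrier \<Sigma>" using Yp(1) \<Lambda>_\<Sigma> by simp
      then show "y \<otimes>\<^bsub>\<Sigma>\<^esub> mono (x \<oplus> x') \<one>\<^bsub>G\<^esub> =
          y \<otimes>\<^bsub>\<Sigma>\<^esub> mono x \<one>\<^bsub>G\<^esub> \<oplus>\<^bsub>left_ideal_module \<Lambda> Y\<^esub> y \<otimes>\<^bsub>\<Sigma>\<^esub> mono x' \<one>\<^bsub>G\<^esub>"
        using add by (simp add: \<Lambda>_ops mono_add[symmetric] \<Sigma>.r_distr)
    qed
    then show ?case using add by simp
  qed
  have "\<forall>y\<in>Y. y \<otimes>\<^bsub>\<Sigma>\<^esub> mono \<one> \<one>\<^bsub>G\<^esub> = y" using Yp(1) \<Lambda>_\<Sigma> by (simp add: mono_one)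
  then show ?thesis using endo[OF one] unfolding fg_projective_def left_ideal_module_simps
    by (intro bexI[of _ "\<lambda>y. y \<otimes>\<^bsub>\<Sigma>\<^esub> mono \<one> \<one>\<^bsub>G\<^esub>"]) auto
qed

lemma finsum_\<Lambda>_apply:
  assumes "finite A" "\<And>i. i \<in> A \<Longrightarrow> h i \<in> carrier \<Lambda>" "\<rho> \<in> carrier G"
  shows "(\<Oplus>\<^bsub>\<Lambda>\<^esub>i\<in>A. h i) \<rho> = (\<Oplus>i\<in>A. h i \<rho>)"
  using assms(1,2)
proof (induction A rule: finite_induct)
  case empty
  interpret \<Lambda>: ring \<Lambda> by (rule \<Lambda>_ring)
  show ?case using assms(3) by (simp add: cp_simps)
next
  case (insert a A)
  interpret \<Lambda>: ring \<Lambda> by (rule \<Lambda>_ring)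
  have h: "h \<in> A \<rightarrow> carrier \<Lambda>" "h a \<in> carrier \<Lambda>" using insert by auto
  have hK: "(\<lambda>i. h i \<rho>) \<in> A \<rightarrow> carrier K" "h a \<rho> \<in> carrier K"
    using insert.prems \<Lambda>_\<Sigma> assms(3) by auto
  show ?case using insert h hK assms(3) by (simp add: \<Lambda>_ops cp_add_apply)
qed

section \<open>Reduction of arbitrary left ideals to two-sided \<open>S\<close>-stable ones\<close>

definition tuple_module :: "(('a \<Rightarrow> 'a) \<Rightarrow> ('a \<Rightarrow> 'a) \<Rightarrow> 'a) set \<Rightarrow> (('a \<Rightarrow> 'a) \<Rightarrow> 'a, ('a \<Rightarrow> 'a) \<Rightarrow> ('a \<Rightarrow> 'a) \<Rightarrow> 'a) module" where
  "tuple_module X' = \<lparr>carrier = X', monoid.mult = undefined, one = undefined,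
     ring.zero = (\<lambda>\<tau>\<in>carrier G. \<zero>\<^bsub>\<Sigma>\<^esub>), add = (\<lambda>x y. \<lambda>\<tau>\<in>carrier G. x \<tau> \<oplus>\<^bsub>\<Sigma>\<^esub> y \<tau>),
     smult = (\<lambda>a x. \<lambda>\<tau>\<in>carrier G. a \<otimes>\<^bsub>\<Sigma>\<^esub> x \<tau>)\<rparr>"

lemma tuple_module_simps:
  "carrier (tuple_module B) = B" "\<zero>\<^bsub>tuple_module B\<^esub> = (\<lambda>\<tau>\<in>carrier G. \<zero>\<^bsub>\<Sigma>\<^esub>)"
  "x \<oplus>\<^bsub>tuple_module B\<^esub> y = (\<lambda>\<tau>\<in>carrier G. x \<tau> \<oplus>\<^bsub>\<Sigma>\<^esub> y \<tau>)"
  "a \<odot>\<^bsub>tuple_module B\<^esub> x = (\<lambda>\<tau>\<in>carrier G. a \<otimes>\<^bsub>\<Sigma>\<^esub> x \<tau>)"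
  by (simp_all add: tuple_module_def)

text \<open>
  After the splitting \<open>S \<otimes> S \<cong> \<Prod>\<^sub>\<tau> S\<close>, the module \<open>\<Lambda> \<otimes> S\<close> becomes a product of copies of \<open>\<Lambda>\<close> on which
  the right action of \<open>S\<close> is twisted by the elements of the group.
\<close>

definition twisted_submodule :: "(('a \<Rightarrow> 'a) \<Rightarrow> ('a \<Rightarrow> 'a) \<Rightarrow> 'a) set \<Rightarrow> bool" where
  "twisted_submodule B \<longleftrightarrow> B \<subseteq> carrier G \<rightarrow>\<^sub>E carrier \<Lambda> \<and> (\<lambda>\<tau>\<in>carrier G. \<zero>\<^bsub>\<Sigma>\<^esub>) \<in> B \<and>
     (\<forall>x\<in>B. \<forall>y\<in>B. (\<lambda>\<tau>\<in>carrier G. x \<tau> \<oplus>\<^bsub>\<Sigma>\<^esub> y \<tau>) \<in> B) \<and>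
     (\<forall>a\<in>carrier \<Lambda>. \<forall>x\<in>B. (\<lambda>\<tau>\<in>carrier G. a \<otimes>\<^bsub>\<Sigma>\<^esub> x \<tau>) \<in> B) \<and>
     (\<forall>s\<in>S. \<forall>x\<in>B. (\<lambda>\<tau>\<in>carrier G. x \<tau> \<otimes>\<^bsub>\<Sigma>\<^esub> mono (\<tau> s) \<one>\<^bsub>G\<^esub>) \<in> B)"

lemma twisted_submoduleD:
  assumes "twisted_submodule B"
  shows "x \<in> B \<Longrightarrow> x \<in> carrier G \<rightarrow>\<^sub>E carrier \<Lambda>" "x \<in> B \<Longrightarrow> \<tau> \<in> carrier G \<Longrightarrow> x \<tau> \<in> carrier \<Lambda>"
    "(\<lambda>\<tau>\<in>carrier G. \<zero>\<^bsub>\<Sigma>\<^esub>) \<in> B"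
    "x \<in> B \<Longrightarrow> y \<in> B \<Longrightarrow> (\<lambda>\<tau>\<in>carrier G. x \<tau> \<oplus>\<^bsub>\<Sigma>\<^esub> y \<tau>) \<in> B"
    "a \<in> carrier \<Lambda> \<Longrightarrow> x \<in> B \<Longrightarrow> (\<lambda>\<tau>\<in>carrier G. a \<otimes>\<^bsub>\<Sigma>\<^esub> x \<tau>) \<in> B"
    "s \<in> S \<Longrightarrow> x \<in> B \<Longrightarrow> (\<lambda>\<tau>\<in>carrier G. x \<tau> \<otimes>\<^bsub>\<Sigma>\<^esub> mono (\<tau> s) \<one>\<^bsub>G\<^esub>) \<in> B"
proof -
  show 1: "x \<in> carrier G \<rightarrow>\<^sub>E carrier \<Lambda>" if "x \<in> B" for x using assms that unfolding twisted_submodule_def by auto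
  show "x \<tau> \<in> carrier \<Lambda>" if "x \<in> B" "\<tau> \<in> carrier G" using 1[OF that(1)] that(2) by (rule PiE_mem)
qed (use assms in \<open>simp_all add: twisted_submodule_def\<close>)

lemma tuple_eqI:
  assumes "x \<in> carrier G \<rightarrow>\<^sub>E B" "y \<in> carrier G \<rightarrow>\<^sub>E C" "\<And>\<tau>. \<tau> \<in> carrier G \<Longrightarrow> x \<tau> = y \<tau>"
  shows "x = y"
proof (rule extensionalityI)
  show "x \<in> extensional (carrier G)" "y \<in> extensional (carrier G)" using assms(1,2) by (simp_all add: PiE_def)
qed (rule assms(3))

lemma tuple_left_module:
  assumes B: "twisted_submodule B"
  shows "left_module \<Lambda> (tuple_module B)"
proof -
  interpret \<Sigma>: ring \<Sigma> by (rule \<Sigma>_ring)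
  interpret \<Lambda>: ring \<Lambda> by (rule \<Lambda>_ring)
  note Bp = twisted_submoduleD[OF B]
  have cl: "x \<tau> \<in> carrier \<Sigma>" if "x \<in> B" "\<tau> \<in> carrier G" for x \<tau> using Bp(2)[OF that] \<Lambda>_\<Sigma> by simp
  have un: "(\<lambda>\<tau>\<in>carrier G. x \<tau>) = x" if "x \<in> B" for x
    using Bp(1)[OF that] by (auto simp: PiE_def extensional_restrict)
  have "abelian_group (tuple_module B)"
  proof (rule abelian_groupI, unfold tuple_module_simps)
    show "(\<lambda>\<tau>\<in>carrier G. \<zero>\<^bsub>\<Sigma>\<^esub>) \<in> B" by (rule Bp(3))
    fix x assume x: "x \<in> B"
    show "(\<lambda>\<tau>\<in>carrier G. (\<lambda>\<tau>\<in>carrier G. \<zero>\<^bsub>\<Sigma>\<^esub>) \<tau> \<oplus>\<^bsub>\<Sigma>\<^esub> x \<tau>) = x"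
      using cl[OF x] by (subst (2) un[OF x, symmetric]) (intro restrict_ext, simp)
    have m: "\<ominus>\<^bsub>\<Lambda>\<^esub> \<one>\<^bsub>\<Lambda>\<^esub> \<in> carrier \<Lambda>" by simp
    show "\<exists>y\<in>B. (\<lambda>\<tau>\<in>carrier G. y \<tau> \<oplus>\<^bsub>\<Sigma>\<^esub> x \<tau>) = (\<lambda>\<tau>\<in>carrier G. \<zero>\<^bsub>\<Sigma>\<^esub>)"
    proof (rule bexI[OF _ Bp(5)[OF m x]], rule restrict_ext)
      fix \<tau> assume \<tau>: "\<tau> \<in> carrier G"
      have "(\<ominus>\<^bsub>\<Lambda>\<^esub> \<one>\<^bsub>\<Lambda>\<^esub> \<otimes>\<^bsub>\<Lambda>\<^esub> x \<tau>) \<oplus>\<^bsub>\<Lambda>\<^esub> x \<tau> = \<zero>\<^bsub>\<Lambda>\<^esub>" using Bp(2)[OF x \<tau>] by (simp add: \<Lambda>.l_minus \<Lambda>.l_neg)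
      then show "(\<lambda>\<tau>\<in>carrier G. \<ominus>\<^bsub>\<Lambda>\<^esub> \<one>\<^bsub>\<Lambda>\<^esub> \<otimes>\<^bsub>\<Sigma>\<^esub> x \<tau>) \<tau> \<oplus>\<^bsub>\<Sigma>\<^esub> x \<tau> = \<zero>\<^bsub>\<Sigma>\<^esub>" using \<tau> by (simp add: \<Lambda>_ops(2-4))
    qed
    fix y assume y: "y \<in> B"
    show "(\<lambda>\<tau>\<in>carrier G. x \<tau> \<oplus>\<^bsub>\<Sigma>\<^esub> y \<tau>) \<in> B" by (rule Bp(4)[OF x y])
    show "(\<lambda>\<tau>\<in>carrier G. x \<tau> \<oplus>\<^bsub>\<Sigma>\<^esub> y \<tau>) = (\<lambda>\<tau>\<in>carrier G. y \<tau> \<oplus>\<^bsub>\<Sigma>\<^esub> x \<tau>)"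
      using cl[OF x] cl[OF y] by (intro restrict_ext \<Sigma>.a_comm)
    fix z assume z: "z \<in> B"
    show "(\<lambda>\<tau>\<in>carrier G. (\<lambda>\<tau>\<in>carrier G. x \<tau> \<oplus>\<^bsub>\<Sigma>\<^esub> y \<tau>) \<tau> \<oplus>\<^bsub>\<Sigma>\<^esub> z \<tau>) =
        (\<lambda>\<tau>\<in>carrier G. x \<tau> \<oplus>\<^bsub>\<Sigma>\<^esub> (\<lambda>\<tau>\<in>carrier G. y \<tau> \<oplus>\<^bsub>\<Sigma>\<^esub> z \<tau>) \<tau>)"
      using cl[OF x] cl[OF y] cl[OF z] by (intro restrict_ext) (simp add: \<Sigma>.a_assoc)
  qed
  then show ?thesis
  proof (intro left_module.intro left_module_axioms.intro \<Lambda>_ring, unfold tuple_module_simps)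
    fix a x assume a: "a \<in> carrier \<Lambda>" and x: "x \<in> B"
    have aS: "a \<in> carrier \<Sigma>" using \<Lambda>_\<Sigma>[OF a] .
    show "(\<lambda>\<tau>\<in>carrier G. a \<otimes>\<^bsub>\<Sigma>\<^esub> x \<tau>) \<in> B" by (rule Bp(5)[OF a x])
    fix b assume b: "b \<in> carrier \<Lambda>"
    have bS: "b \<in> carrier \<Sigma>" using \<Lambda>_\<Sigma>[OF b] .
    show "(\<lambda>\<tau>\<in>carrier G. (a \<oplus>\<^bsub>\<Lambda>\<^esub> b) \<otimes>\<^bsub>\<Sigma>\<^esub> x \<tau>) =
        (\<lambda>\<tau>\<in>carrier G. (\<lambda>\<tau>\<in>carrier G. a \<otimes>\<^bsub>\<Sigma>\<^esub> x \<tau>) \<tau> \<oplus>\<^bsub>\<Sigma>\<^esub> (\<lambda>\<tau>\<in>carrier G. b \<otimes>\<^bsub>\<Sigma>\<^esub> x \<tau>) \<tau>)"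
      using cl[OF x] aS bS by (intro restrict_ext) (simp add: \<Lambda>_ops \<Sigma>.l_distr)
    show "(\<lambda>\<tau>\<in>carrier G. a \<otimes>\<^bsub>\<Lambda>\<^esub> b \<otimes>\<^bsub>\<Sigma>\<^esub> x \<tau>) = (\<lambda>\<tau>\<in>carrier G. a \<otimes>\<^bsub>\<Sigma>\<^esub> (\<lambda>\<tau>\<in>carrier G. b \<otimes>\<^bsub>\<Sigma>\<^esub> x \<tau>) \<tau>)"
      using cl[OF x] aS bS by (intro restrict_ext) (simp add: \<Lambda>_ops \<Sigma>.m_assoc)
  next
    fix a x y assume a: "a \<in> carrier \<Lambda>" and x: "x \<in> B" and y: "y \<in> B"
    have aS: "a \<in> carrier \<Sigma>" using \<Lambda>_\<Sigma>[OF a] .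
    show "(\<lambda>\<tau>\<in>carrier G. a \<otimes>\<^bsub>\<Sigma>\<^esub> (\<lambda>\<tau>\<in>carrier G. x \<tau> \<oplus>\<^bsub>\<Sigma>\<^esub> y \<tau>) \<tau>) =
        (\<lambda>\<tau>\<in>carrier G. (\<lambda>\<tau>\<in>carrier G. a \<otimes>\<^bsub>\<Sigma>\<^esub> x \<tau>) \<tau> \<oplus>\<^bsub>\<Sigma>\<^esub> (\<lambda>\<tau>\<in>carrier G. a \<otimes>\<^bsub>\<Sigma>\<^esub> y \<tau>) \<tau>)"
      using cl[OF x] cl[OF y] aS by (intro restrict_ext) (simp add: \<Sigma>.r_distr)
  next
    fix x assume x: "x \<in> B"
    show "(\<lambda>\<tau>\<in>carrier G. \<one>\<^bsub>\<Lambda>\<^esub> \<otimes>\<^bsub>\<Sigma>\<^esub> x \<tau>) = x"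
      using cl[OF x] by (subst (2) un[OF x, symmetric]) (intro restrict_ext, simp add: \<Lambda>_ops)
  qed
qed

text \<open>Induction on the set of coordinates that may be nonzero. Projection to the coordinate
  \<kappa> has a left ideal stable under right multiplication by \<open>S\<close> as its image, to
  which \<open>bimodule_fg_projective\<close> applies, and a twisted submodule with smaller support
  as its kernel; \<open>fg_projective_extension\<close> combines the two.\<close>

lemma twisted_fg_projective:
  assumes hyp: "\<And>\<tau> M. \<tau> \<in> carrier G \<Longrightarrow> maximalideal M SK \<Longrightarrow> f \<tau> (inv\<^bsub>G\<^esub> \<tau>) \<notin> M [^]\<^bsub>ideals_set SK\<^esub> (2::nat)"
    and T: "finite T" "T \<subseteq> carrier G"
    and B: "twisted_submodule B" "\<forall>x\<in>B. \<forall>\<tau>\<in>carrier G - T. x \<tau> = \<zero>\<^bsub>\<Sigma>\<^esub>"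
  shows "fg_projective \<Lambda> (tuple_module B)"
  using T B
proof (induction T arbitrary: B rule: finite_induct)
  case empty
  note Bp = twisted_submoduleD[OF empty(2)]
  have "x = (\<lambda>\<tau>\<in>carrier G. \<zero>\<^bsub>\<Sigma>\<^esub>)" if x: "x \<in> B" for x
  proof (rule tuple_eqI[OF Bp(1)[OF x]])
    show "(\<lambda>\<tau>\<in>carrier G. \<zero>\<^bsub>\<Sigma>\<^esub>) \<in> carrier G \<rightarrow>\<^sub>E UNIV" by simp
    fix \<tau> assume "\<tau> \<in> carrier G"
    then show "x \<tau> = (\<lambda>\<tau>\<in>carrier G. \<zero>\<^bsub>\<Sigma>\<^esub>) \<tau>" using bspec[OF bspec[OF empty(3) x], of \<tau>] by simp
  qed
  then have "B = {\<lambda>\<tau>\<in>carrier G. \<zero>\<^bsub>\<Sigma>\<^esub>}" using Bp(3) by blast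
  then show ?case by (intro fg_projective_zero[OF tuple_left_module[OF empty(2)]]) (simp add: tuple_module_simps)
next
  case (insert \<kappa> T)
  interpret \<Sigma>: ring \<Sigma> by (rule \<Sigma>_ring)
  note Bp = twisted_submoduleD[OF insert(5)]
  have \<kappa>: "\<kappa> \<in> carrier G" using insert.prems(1) by auto
  define Y where "Y = (\<lambda>x. x \<kappa>) ` B"
  have Y: "left_ideal Y \<Lambda>"
  proof (rule left_idealI)
    show "Y \<subseteq> carrier \<Lambda>" using Bp(2) \<kappa> by (auto simp: Y_def)
    show "\<zero>\<^bsub>\<Sigma>\<^esub> \<in> Y" using imageI[OF Bp(3), of "\<lambda>x. x \<kappa>"] \<kappa> by (simp add: Y_def)
    fix y assume "y \<in> Y"
    then obtain x where x: "x \<in> B" "y = x \<kappa>" by (auto simp: Y_def)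
    show "a \<otimes>\<^bsub>\<Sigma>\<^esub> y \<in> Y" if "a \<in> carrier \<Lambda>" for a
      using imageI[OF Bp(5)[OF that x(1)], of "\<lambda>x. x \<kappa>"] \<kappa> x by (simp add: Y_def)
    fix y' assume "y' \<in> Y"
    then obtain x' where x': "x' \<in> B" "y' = x' \<kappa>" by (auto simp: Y_def)
    show "y \<oplus>\<^bsub>\<Sigma>\<^esub> y' \<in> Y" using imageI[OF Bp(4)[OF x(1) x'(1)], of "\<lambda>x. x \<kappa>"] \<kappa> x x' by (simp add: Y_def)
  qed
  have right: "y \<otimes>\<^bsub>\<Sigma>\<^esub> mono s \<one>\<^bsub>G\<^esub> \<in> Y" if y: "y \<in> Y" and s: "s \<in> S" for y s
  proof -
    obtain x where x: "x \<in> B" "y = x \<kappa>" using y by (auto simp: Y_def)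
    have "inv\<^bsub>G\<^esub> \<kappa> \<in> carrier G" using \<kappa> by simp
    \<comment> \<open>In a single coordinate the twist is harmless: \<kappa> permutes
      \<open>S\<close>, so acting with the preimage of \<open>s\<close> gives ordinary right
      multiplication by \<open>s\<close>.\<close>
    then have "(inv\<^bsub>G\<^esub> \<kappa>) s \<in> S" using power_bounded_act[OF s] by blast
    from imageI[OF Bp(6)[OF this x(1)], of "\<lambda>x. x \<kappa>"] show ?thesis
      using \<kappa> x S_carrier[OF s] by (simp add: Y_def)
  qed
  have Yfg: "fg_projective \<Lambda> (left_ideal_module \<Lambda> Y)" by (rule bimodule_fg_projective[OF hyp Y right])
  define N where "N = {x \<in> B. x \<kappa> = \<zero>\<^bsub>\<Sigma>\<^esub>}"
  have N: "twisted_submodule N"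
    unfolding twisted_submodule_def
  proof (intro conjI ballI)
    show "N \<subseteq> carrier G \<rightarrow>\<^sub>E carrier \<Lambda>" using Bp(1) unfolding N_def by blast
    show "(\<lambda>\<tau>\<in>carrier G. \<zero>\<^bsub>\<Sigma>\<^esub>) \<in> N" using Bp(3) \<kappa> by (simp add: N_def)
    fix x assume "x \<in> N"
    then have x: "x \<in> B" "x \<kappa> = \<zero>\<^bsub>\<Sigma>\<^esub>" by (auto simp: N_def)
    show "(\<lambda>\<tau>\<in>carrier G. x \<tau> \<oplus>\<^bsub>\<Sigma>\<^esub> y \<tau>) \<in> N" if "y \<in> N" for y
      using Bp(4)[OF x(1), of y] that x \<kappa> by (simp add: N_def)
    show "(\<lambda>\<tau>\<in>carrier G. a \<otimes>\<^bsub>\<Sigma>\<^esub> x \<tau>) \<in> N" if "a \<in> carrier \<Lambda>" for a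
      using Bp(5)[OF that x(1)] x \<kappa> \<Lambda>_\<Sigma>[OF that] by (simp add: N_def)
    show "(\<lambda>\<tau>\<in>carrier G. x \<tau> \<otimes>\<^bsub>\<Sigma>\<^esub> mono (\<tau> s) \<one>\<^bsub>G\<^esub>) \<in> N" if "s \<in> S" for s
      using Bp(6)[OF that x(1)] x \<kappa> S_carrier[OF that] by (simp add: N_def)
  qed
  have zero: "x \<tau> = \<zero>\<^bsub>\<Sigma>\<^esub>" if x: "x \<in> N" and \<tau>: "\<tau> \<in> carrier G - T" for x \<tau>
  proof (cases "\<tau> = \<kappa>")
    case True
    then show ?thesis using x by (simp add: N_def)
  next
    case False
    have "x \<in> B" using x by (simp add: N_def)
    moreover have "\<tau> \<in> carrier G - insert \<kappa> T" using False \<tau> by simp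
    ultimately show ?thesis using bspec[OF bspec[OF insert.prems(3), of x], of \<tau>] by simp
  qed
  have TG: "T \<subseteq> carrier G" using insert.prems(1) by blast
  have zero': "\<forall>x\<in>N. \<forall>\<tau>\<in>carrier G - T. x \<tau> = \<zero>\<^bsub>\<Sigma>\<^esub>" using zero by blast
  have Nfg: "fg_projective \<Lambda> (tuple_module N)" by (rule insert.IH[OF TG N zero'])
  have \<pi>: "(\<lambda>x. x \<kappa>) \<in> left_module_hom \<Lambda> (tuple_module B) (left_ideal_module \<Lambda> Y)"
    unfolding left_module_hom_def tuple_module_simps left_ideal_module_simps \<Lambda>_ops(3,4) Y_def
    by (intro CollectI conjI ballI funcsetI imageI restrict_apply'[OF \<kappa>])
  have \<pi>_onto: "(\<lambda>x. x \<kappa>) ` carrier (tuple_module B) = carrier (left_ideal_module \<Lambda> Y)"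
    by (simp only: tuple_module_simps left_ideal_module_simps Y_def)
  have NB: "x \<in> B" if "x \<in> N" for x using that unfolding N_def by simp
  have \<iota>: "(\<lambda>x. x) \<in> left_module_hom \<Lambda> (tuple_module N) (tuple_module B)"
    unfolding left_module_hom_def tuple_module_simps
    by (intro CollectI conjI ballI funcsetI refl NB)
  show ?case
  proof (rule fg_projective_extension[OF tuple_left_module[OF insert.prems(2)] left_ideal_module_left_module[OF Y] Yfg
          \<pi> \<pi>_onto tuple_left_module[OF N] Nfg \<iota>])
    fix x assume "x \<in> carrier (tuple_module B)" "x \<kappa> = \<zero>\<^bsub>left_ideal_module \<Lambda> Y\<^esub>"
    then show "x \<in> carrier (tuple_module N) \<and> x = x"
      unfolding tuple_module_simps left_ideal_module_simps \<Lambda>_ops(2) N_def by (intro conjI CollectI refl)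
  qed (unfold tuple_module_simps, rule refl, rule refl)
qed

lemma mono_V_central:
  assumes v: "v \<in> V" and y: "y \<in> carrier \<Sigma>"
  shows "y \<otimes>\<^bsub>\<Sigma>\<^esub> mono v \<one>\<^bsub>G\<^esub> = mono v \<one>\<^bsub>G\<^esub> \<otimes>\<^bsub>\<Sigma>\<^esub> y"
proof (rule cp_eqI)
  have vK: "v \<in> carrier K" using V_carrier v by simp
  show "y \<otimes>\<^bsub>\<Sigma>\<^esub> mono v \<one>\<^bsub>G\<^esub> \<in> carrier \<Sigma>" "mono v \<one>\<^bsub>G\<^esub> \<otimes>\<^bsub>\<Sigma>\<^esub> y \<in> carrier \<Sigma>" using vK y cp_mult_closed by auto
  fix \<rho> assume \<rho>: "\<rho> \<in> carrier G"
  have "\<rho> v = v" using F_act v V_F \<rho> by auto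
  then show "(y \<otimes>\<^bsub>\<Sigma>\<^esub> mono v \<one>\<^bsub>G\<^esub>) \<rho> = (mono v \<one>\<^bsub>G\<^esub> \<otimes>\<^bsub>\<Sigma>\<^esub> y) \<rho>"
    using \<rho> vK y by (simp add: mult_mono_apply mono_mult_apply act_one m_comm)
qed

text \<open>\<open>I\<close> itself has no right action of \<open>S\<close>, so it is placed in a
  module that has one. On a constant tuple \<open>y\<close> the map \<open>ret s\<close> is
  multiplication by \<open>Tr s\<close>; hence constant tuples embed \<open>I\<close> into
  \<open>B\<close>, and \<open>ret t\<close> with \<open>Tr t = 1\<close> is a left inverse of this
  embedding.\<close>

lemma left_ideal_fg_projective:
  assumes hyp: "\<And>\<tau> M. \<tau> \<in> carrier G \<Longrightarrow> maximalideal M SK \<Longrightarrow> f \<tau> (inv\<^bsub>G\<^esub> \<tau>) \<notin> M [^]\<^bsub>ideals_set SK\<^esub> (2::nat)"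
    and I: "left_ideal I \<Lambda>"
  shows "fg_projective \<Lambda> (left_ideal_module \<Lambda> I)"
proof -
  interpret \<Sigma>: ring \<Sigma> by (rule \<Sigma>_ring)
  interpret \<Lambda>: ring \<Lambda> by (rule \<Lambda>_ring)
  note Ip = left_idealE[OF I]
  define m where "m s \<tau> = mono (\<tau> s) \<one>\<^bsub>G\<^esub>" for s and \<tau> :: "'a \<Rightarrow> 'a"
  have m: "m s \<tau> \<in> carrier \<Lambda>" if "s \<in> S" "\<tau> \<in> carrier G" for s \<tau>
    unfolding m_def by (rule mono_\<Lambda>[OF power_bounded_act[OF that]])
  define ret where "ret s x = (\<Oplus>\<^bsub>\<Lambda>\<^esub>\<tau>\<in>carrier G. x \<tau> \<otimes>\<^bsub>\<Lambda>\<^esub> m s \<tau>)" for s x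
  \<comment> \<open>All \<open>s\<close> are required here, not only one of trace 1: the twisted
    right action by \<open>t\<close> turns \<open>ret s\<close> into \<open>ret (t s)\<close>, so
    this is what makes \<open>B\<close> stable under it.\<close>
  define B where "B = {x \<in> carrier G \<rightarrow>\<^sub>E carrier \<Lambda>. \<forall>s\<in>S. ret s x \<in> I}"
  have Bc: "x \<tau> \<in> carrier \<Lambda>" if "x \<in> carrier G \<rightarrow>\<^sub>E carrier \<Lambda>" "\<tau> \<in> carrier G" for x \<tau>
    using that by auto
  have ret_add: "ret s (\<lambda>\<tau>\<in>carrier G. x \<tau> \<oplus>\<^bsub>\<Sigma>\<^esub> y \<tau>) = ret s x \<oplus>\<^bsub>\<Lambda>\<^esub> ret s y"
    if s: "s \<in> S" and x: "x \<in> carrier G \<rightarrow>\<^sub>E carrier \<Lambda>" and y: "y \<in> carrier G \<rightarrow>\<^sub>E carrier \<Lambda>" for s x y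
  proof -
    have "ret s (\<lambda>\<tau>\<in>carrier G. x \<tau> \<oplus>\<^bsub>\<Sigma>\<^esub> y \<tau>) = (\<Oplus>\<^bsub>\<Lambda>\<^esub>\<tau>\<in>carrier G. x \<tau> \<otimes>\<^bsub>\<Lambda>\<^esub> m s \<tau> \<oplus>\<^bsub>\<Lambda>\<^esub> y \<tau> \<otimes>\<^bsub>\<Lambda>\<^esub> m s \<tau>)"
      unfolding ret_def \<Lambda>_ops(3)[symmetric] using Bc[OF x] Bc[OF y] m[OF s]
      by (intro \<Lambda>.finsum_cong') (auto simp: \<Lambda>.l_distr)
    also have "\<dots> = ret s x \<oplus>\<^bsub>\<Lambda>\<^esub> ret s y"
      unfolding ret_def using Bc[OF x] Bc[OF y] m[OF s] by (intro \<Lambda>.finsum_addf) auto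
    finally show ?thesis .
  qed
  have ret_smult: "ret s (\<lambda>\<tau>\<in>carrier G. a \<otimes>\<^bsub>\<Sigma>\<^esub> x \<tau>) = a \<otimes>\<^bsub>\<Lambda>\<^esub> ret s x"
    if s: "s \<in> S" and a: "a \<in> carrier \<Lambda>" and x: "x \<in> carrier G \<rightarrow>\<^sub>E carrier \<Lambda>" for s a x
  proof -
    have "ret s (\<lambda>\<tau>\<in>carrier G. a \<otimes>\<^bsub>\<Sigma>\<^esub> x \<tau>) = (\<Oplus>\<^bsub>\<Lambda>\<^esub>\<tau>\<in>carrier G. a \<otimes>\<^bsub>\<Lambda>\<^esub> (x \<tau> \<otimes>\<^bsub>\<Lambda>\<^esub> m s \<tau>))"
      unfolding ret_def \<Lambda>_ops(4)[symmetric] using Bc[OF x] m[OF s] a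
      by (intro \<Lambda>.finsum_cong') (auto simp: \<Lambda>.m_assoc)
    also have "\<dots> = a \<otimes>\<^bsub>\<Lambda>\<^esub> ret s x"
      unfolding ret_def using Bc[OF x] m[OF s] a fin_G by (intro \<Lambda>.finsum_rdistr[symmetric]) auto
    finally show ?thesis .
  qed
  have ret_right: "ret s (\<lambda>\<tau>\<in>carrier G. x \<tau> \<otimes>\<^bsub>\<Sigma>\<^esub> mono (\<tau> t) \<one>\<^bsub>G\<^esub>) = ret (t \<otimes> s) x"
    if s: "s \<in> S" and t: "t \<in> S" and x: "x \<in> carrier G \<rightarrow>\<^sub>E carrier \<Lambda>" for s t x
    unfolding ret_def
  proof (rule \<Lambda>.finsum_cong')
    have ts: "t \<otimes> s \<in> S" using S_props(5)[OF t s] .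
    show "(\<lambda>\<tau>. x \<tau> \<otimes>\<^bsub>\<Lambda>\<^esub> m (t \<otimes> s) \<tau>) \<in> carrier G \<rightarrow> carrier \<Lambda>" using Bc[OF x] m[OF ts] by auto
    fix \<tau> assume \<tau>: "\<tau> \<in> carrier G"
    have K: "\<tau> t \<in> carrier K" "\<tau> s \<in> carrier K" using s t S_carrier \<tau> by auto
    have "m t \<tau> \<otimes>\<^bsub>\<Sigma>\<^esub> m s \<tau> = m (t \<otimes> s) \<tau>"
      unfolding m_def using K \<tau> s t S_carrier by (simp add: mono_mult_mono act_one act_mult)
    then show "(\<lambda>\<tau>\<in>carrier G. x \<tau> \<otimes>\<^bsub>\<Sigma>\<^esub> mono (\<tau> t) \<one>\<^bsub>G\<^esub>) \<tau> \<otimes>\<^bsub>\<Lambda>\<^esub> m s \<tau> = x \<tau> \<otimes>\<^bsub>\<Lambda>\<^esub> m (t \<otimes> s) \<tau>"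
      using \<tau> \<Lambda>.m_assoc[OF Bc[OF x \<tau>] m[OF t \<tau>] m[OF s \<tau>]] by (simp add: m_def[of t] \<Lambda>_ops)
  qed simp
  have sum_m: "(\<Oplus>\<^bsub>\<Lambda>\<^esub>\<tau>\<in>carrier G. m s \<tau>) = mono (Tr s) \<one>\<^bsub>G\<^esub>" if s: "s \<in> S" for s
  proof (rule cp_eqI)
    show "(\<Oplus>\<^bsub>\<Lambda>\<^esub>\<tau>\<in>carrier G. m s \<tau>) \<in> carrier \<Sigma>" using m[OF s] by (intro \<Lambda>_\<Sigma> \<Lambda>.finsum_closed) auto
    show "mono (Tr s) \<one>\<^bsub>G\<^esub> \<in> carrier \<Sigma>" using S_carrier[OF s] by simp
    fix \<rho> assume \<rho>: "\<rho> \<in> carrier G"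
    have "(\<Oplus>\<^bsub>\<Lambda>\<^esub>\<tau>\<in>carrier G. m s \<tau>) \<rho> = (\<Oplus>\<tau>\<in>carrier G. m s \<tau> \<rho>)"
      by (rule finsum_\<Lambda>_apply[OF fin_G m[OF s] \<rho>])
    also have "\<dots> = mono (Tr s) \<one>\<^bsub>G\<^esub> \<rho>"
    proof (cases "\<rho> = \<one>\<^bsub>G\<^esub>")
      case True
      then show ?thesis using \<rho> S_carrier[OF s] by (simp add: m_def mono_apply Tr_def)
    next
      case False
      then have "(\<Oplus>\<tau>\<in>carrier G. m s \<tau> \<rho>) = (\<Oplus>\<tau>\<in>carrier G. \<zero>)"
        using \<rho> by (intro finsum_cong') (auto simp: m_def mono_apply)
      then show ?thesis using False \<rho> by (simp add: mono_apply)
    qed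
    finally show "(\<Oplus>\<^bsub>\<Lambda>\<^esub>\<tau>\<in>carrier G. m s \<tau>) \<rho> = mono (Tr s) \<one>\<^bsub>G\<^esub> \<rho>" .
  qed
  have ret_diag: "ret s (\<lambda>\<tau>\<in>carrier G. y) = mono (Tr s) \<one>\<^bsub>G\<^esub> \<otimes>\<^bsub>\<Sigma>\<^esub> y" if s: "s \<in> S" and y: "y \<in> carrier \<Lambda>" for s y
  proof -
    have "ret s (\<lambda>\<tau>\<in>carrier G. y) = (\<Oplus>\<^bsub>\<Lambda>\<^esub>\<tau>\<in>carrier G. y \<otimes>\<^bsub>\<Lambda>\<^esub> m s \<tau>)"
      unfolding ret_def using y m[OF s] by (intro \<Lambda>.finsum_cong') auto
    also have "\<dots> = y \<otimes>\<^bsub>\<Lambda>\<^esub> (\<Oplus>\<^bsub>\<Lambda>\<^esub>\<tau>\<in>carrier G. m s \<tau>)"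
      using y m[OF s] fin_G by (intro \<Lambda>.finsum_rdistr[symmetric]) auto
    finally show ?thesis unfolding sum_m[OF s] \<Lambda>_ops using mono_V_central[OF Tr_S_V[OF s] \<Lambda>_\<Sigma>[OF y]] by simp
  qed
  have B: "twisted_submodule B"
    unfolding twisted_submodule_def
  proof (intro conjI ballI)
    show "B \<subseteq> carrier G \<rightarrow>\<^sub>E carrier \<Lambda>" by (auto simp: B_def)
    have z\<Lambda>: "\<zero>\<^bsub>\<Sigma>\<^esub> \<in> carrier \<Lambda>" using Ip(1,3) by simp
    have "ret s (\<lambda>\<tau>\<in>carrier G. \<zero>\<^bsub>\<Sigma>\<^esub>) = \<zero>\<^bsub>\<Sigma>\<^esub>" if "s \<in> S" for s
      using ret_diag[OF that z\<Lambda>] S_carrier[OF that] by simp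
    then show "(\<lambda>\<tau>\<in>carrier G. \<zero>\<^bsub>\<Sigma>\<^esub>) \<in> B" using z\<Lambda> Ip(3) by (simp add: B_def)
    fix x assume "x \<in> B"
    then have x: "x \<in> carrier G \<rightarrow>\<^sub>E carrier \<Lambda>" "\<And>s. s \<in> S \<Longrightarrow> ret s x \<in> I" by (auto simp: B_def)
    show "(\<lambda>\<tau>\<in>carrier G. x \<tau> \<oplus>\<^bsub>\<Sigma>\<^esub> y \<tau>) \<in> B" if "y \<in> B" for y
    proof -
      have y: "y \<in> carrier G \<rightarrow>\<^sub>E carrier \<Lambda>" "\<And>s. s \<in> S \<Longrightarrow> ret s y \<in> I" using that by (auto simp: B_def)
      have "(\<lambda>\<tau>\<in>carrier G. x \<tau> \<oplus>\<^bsub>\<Sigma>\<^esub> y \<tau>) \<in> carrier G \<rightarrow>\<^sub>E carrier \<Lambda>"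
        using Bc[OF x(1)] Bc[OF y(1)] \<Lambda>_closed(2) by auto
      then show ?thesis using ret_add[OF _ x(1) y(1)] x(2) y(2) Ip(2) by (simp add: B_def \<Lambda>_ops)
    qed
    show "(\<lambda>\<tau>\<in>carrier G. a \<otimes>\<^bsub>\<Sigma>\<^esub> x \<tau>) \<in> B" if a: "a \<in> carrier \<Lambda>" for a
    proof -
      have "(\<lambda>\<tau>\<in>carrier G. a \<otimes>\<^bsub>\<Sigma>\<^esub> x \<tau>) \<in> carrier G \<rightarrow>\<^sub>E carrier \<Lambda>" using Bc[OF x(1)] \<Lambda>_closed(1)[OF a] by auto
      then show ?thesis using ret_smult[OF _ a x(1)] x(2) Ip(4)[OF a] by (simp add: B_def \<Lambda>_ops)
    qed
    show "(\<lambda>\<tau>\<in>carrier G. x \<tau> \<otimes>\<^bsub>\<Sigma>\<^esub> mono (\<tau> t) \<one>\<^bsub>G\<^esub>) \<in> B" if t: "t \<in> S" for t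
    proof -
      have "(\<lambda>\<tau>\<in>carrier G. x \<tau> \<otimes>\<^bsub>\<Sigma>\<^esub> mono (\<tau> t) \<one>\<^bsub>G\<^esub>) \<in> carrier G \<rightarrow>\<^sub>E carrier \<Lambda>"
        using Bc[OF x(1)] m[OF t] \<Lambda>_closed(1) unfolding m_def by auto
      then show ?thesis using ret_right[OF _ t x(1)] x(2) S_props(5)[OF t] by (simp add: B_def)
    qed
  qed
  have Bfg: "fg_projective \<Lambda> (tuple_module B)"
    by (rule twisted_fg_projective[OF hyp fin_G subset_refl B]) auto
  obtain t where t: "t \<in> S" "Tr t = \<one>" using ex_Tr_eq_1_S by blast
  show ?thesis
  proof (rule fg_projective_retract[OF tuple_left_module[OF B] Bfg, of "\<lambda>y. \<lambda>\<tau>\<in>carrier G. y" _ "ret t"])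
    show "(\<lambda>y. \<lambda>\<tau>\<in>carrier G. y) \<in> left_module_hom \<Lambda> (left_ideal_module \<Lambda> I) (tuple_module B)"
    proof (rule left_module_homI, unfold tuple_module_simps left_ideal_module_simps)
      fix y assume y: "y \<in> I"
      have "ret s (\<lambda>\<tau>\<in>carrier G. y) \<in> I" if "s \<in> S" for s
        unfolding ret_diag[OF that Ip(1)[OF y]] by (rule Ip(4)[OF mono_\<Lambda>[OF V_S[OF Tr_S_V[OF that]]] y])
      then show "(\<lambda>\<tau>\<in>carrier G. y) \<in> B" using Ip(1)[OF y] by (simp add: B_def)
    qed (simp_all add: \<Lambda>_ops cong: restrict_cong)
    show "ret t \<in> left_module_hom \<Lambda> (tuple_module B) (left_ideal_module \<Lambda> I)"
    proof (rule left_module_homI, unfold tuple_module_simps left_ideal_module_simps)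
      fix x assume x: "x \<in> B"
      then show "ret t x \<in> I" using t by (simp add: B_def)
      show "ret t (\<lambda>\<tau>\<in>carrier G. x \<tau> \<oplus>\<^bsub>\<Sigma>\<^esub> y \<tau>) = ret t x \<oplus>\<^bsub>\<Lambda>\<^esub> ret t y" if "y \<in> B" for y
        using x that by (intro ret_add[OF t(1)]) (auto simp: B_def)
      show "ret t (\<lambda>\<tau>\<in>carrier G. a \<otimes>\<^bsub>\<Sigma>\<^esub> x \<tau>) = a \<otimes>\<^bsub>\<Lambda>\<^esub> ret t x" if "a \<in> carrier \<Lambda>" for a
        using x by (intro ret_smult[OF t(1) that]) (auto simp: B_def)
    qed
    fix y assume "y \<in> carrier (left_ideal_module \<Lambda> I)"
    then have y: "y \<in> carrier \<Lambda>" using Ip(1) by simp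
    show "ret t (\<lambda>\<tau>\<in>carrier G. y) = y"
      unfolding ret_diag[OF t(1) y] t(2) mono_one using \<Lambda>_\<Sigma>[OF y] by simp
  qed
qed

end

section \<open>A left ideal that is not projective\<close>

lemma (in abelian_group) finsum_mem:
  assumes "finite A" "\<zero> \<in> Q" "\<And>x y. x \<in> Q \<Longrightarrow> y \<in> Q \<Longrightarrow> x \<oplus> y \<in> Q" "Q \<subseteq> carrier G"
    "\<And>i. i \<in> A \<Longrightarrow> h i \<in> Q"
  shows "(\<Oplus>i\<in>A. h i) \<in> Q"
  using assms(1,5)
proof (induction A rule: finite_induct)
  case (insert a A)
  have "h \<in> A \<rightarrow> carrier G" "h a \<in> carrier G" using insert.prems assms(4) by auto
  then show ?case using insert assms(3) by simp
qed (simp add: assms(2))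

text \<open>The free module is indexed by the elements of \<open>P\<close>, each basis vector being
  sent to its index; the coordinates of a section of this surjection are the dual basis. Finite
  generation is not assumed, so the sum runs over the support at \<open>x\<close>.\<close>

lemma projective_module_dual_basis:
  fixes R :: "('a, 'b) ring_scheme" and P :: "('a, 'c, 'd) module_scheme"
  assumes P: "projective_module R P"
  obtains k where "k \<in> left_module_hom R P (free_module R (carrier P))"
    "\<And>x. x \<in> carrier P \<Longrightarrow> (\<Oplus>\<^bsub>P\<^esub>i\<in>{i \<in> carrier P. k x i \<noteq> \<zero>\<^bsub>R\<^esub>}. k x i \<odot>\<^bsub>P\<^esub> i) = x"
proof -
  interpret P: left_module R P using P by (simp add: projective_module_def)
  let ?F = "free_module R (carrier P)" and ?g = "free_lift P R (carrier P) (\<lambda>x. x)"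
  have g: "?g \<in> left_module_hom R ?F P" by (rule P.free_lift_hom) auto
  have "x \<in> ?g ` carrier ?F" if x: "x \<in> carrier P" for x
  proof -
    define e where "e = (\<lambda>j\<in>carrier P. if j = x then \<one>\<^bsub>R\<^esub> else \<zero>\<^bsub>R\<^esub>)"
    have "finite {j \<in> carrier P. e j \<noteq> \<zero>\<^bsub>R\<^esub>}" by (rule finite_subset[of _ "{x}"]) (auto simp: e_def)
    then have e: "e \<in> carrier ?F" by (auto simp: free_module_simps e_def)
    have "?g e = (\<Oplus>\<^bsub>P\<^esub>i\<in>{x}. e i \<odot>\<^bsub>P\<^esub> i)"
      by (rule P.free_lift_superset) (use x in \<open>auto simp: e_def\<close>)
    then have "?g e = x" using x by (simp add: e_def P.smult_one P.smult_closed)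
    then show ?thesis using imageI[OF e, of ?g] by simp
  qed
  then have "?g ` carrier ?F = carrier P" using left_module_homE(1)[OF g] by auto
  moreover have "(\<lambda>x. x) \<in> left_module_hom R P P" by (simp add: left_module_hom_def)
  ultimately obtain k where "k \<in> left_module_hom R P ?F" "\<forall>x\<in>carrier P. ?g (k x) = x"
    using projective_module_lifting[OF P left_module_free_module[OF P.R.ring_axioms] P.left_module_axioms g] by blast
  then show ?thesis using that unfolding free_lift_def by blast
qed

context crossed_order
begin

text \<open>Compare coefficients at \<open>\<beta>\<alpha>\<close>:
  \<open>\<beta>(w(\<alpha>)) f(\<beta>, \<alpha>)\<close> is divisible by \<open>p\<close>.
  Multiplication by \<open>f(\<beta>\<alpha>, \<alpha>\<^sup>-\<^sup>1)\<close> and the cocycle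
  identity change the factor into \<open>\<beta>(f(\<alpha>, \<alpha>\<^sup>-\<^sup>1))\<close>, and
  \<beta>, which fixes \<open>p\<close>, can be undone.\<close>

lemma coefficient_divisible:
  assumes w: "w \<in> carrier \<Lambda>" and v: "v \<in> carrier \<Lambda>" and \<beta>: "\<beta> \<in> carrier G" and \<alpha>: "\<alpha> \<in> carrier G"
    and eq: "mono \<one> \<beta> \<otimes>\<^bsub>\<Sigma>\<^esub> w = mono p \<one>\<^bsub>G\<^esub> \<otimes>\<^bsub>\<Sigma>\<^esub> v"
  shows "\<exists>t\<in>S. w \<alpha> \<otimes> f \<alpha> (inv\<^bsub>G\<^esub> \<alpha>) = p \<otimes> t"
proof -
  let ?\<nu> = "inv\<^bsub>G\<^esub> \<alpha>" and ?\<beta> = "inv\<^bsub>G\<^esub> \<beta>"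
  define \<rho> where "\<rho> = \<beta> \<otimes>\<^bsub>G\<^esub> \<alpha>"
  have G: "\<rho> \<in> carrier G" "?\<nu> \<in> carrier G" "?\<beta> \<in> carrier G" using \<beta> \<alpha> by (simp_all add: \<rho>_def)
  have pK: "p \<in> carrier K" using S_carrier[OF V_S[OF p_V]] .
  have vS: "v \<rho> \<in> S" and fS: "f \<rho> ?\<nu> \<in> S" using \<Lambda>_S[OF v G(1)] f_S[OF G(1,2)] by auto
  have K: "w \<alpha> \<in> carrier K" "v \<rho> \<in> carrier K" "f \<rho> ?\<nu> \<in> carrier K" "f \<alpha> ?\<nu> \<in> carrier K" "f \<beta> \<alpha> \<in> carrier K" "\<beta> (w \<alpha>) \<in> carrier K"
    using S_carrier[OF \<Lambda>_S[OF w \<alpha>]] S_carrier[OF vS] S_carrier[OF fS] \<beta> \<alpha> G by auto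
  have "(mono \<one> \<beta> \<otimes>\<^bsub>\<Sigma>\<^esub> w) \<rho> = (mono p \<one>\<^bsub>G\<^esub> \<otimes>\<^bsub>\<Sigma>\<^esub> v) \<rho>" unfolding eq ..
  then have e: "\<beta> (w \<alpha>) \<otimes> f \<beta> \<alpha> = p \<otimes> v \<rho>"
    using mono_mult_apply[OF one_closed \<beta> \<Lambda>_\<Sigma>[OF w] G(1)] mono_mult_apply[OF pK G.one_closed \<Lambda>_\<Sigma>[OF v] G(1)]
      K G(1) \<beta> \<alpha> pK by (simp add: \<rho>_def act_one)
  have c: "\<beta> (f \<alpha> ?\<nu>) = f \<beta> \<alpha> \<otimes> f \<rho> ?\<nu>"
    using cocycle[OF \<beta> \<alpha> G(2)] \<beta> \<alpha> K by (simp add: \<rho>_def)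
  have "\<beta> (w \<alpha> \<otimes> f \<alpha> ?\<nu>) = \<beta> (w \<alpha>) \<otimes> f \<beta> \<alpha> \<otimes> f \<rho> ?\<nu>"
    using K \<beta> by (simp add: act_mult c m_assoc)
  also have "\<dots> = p \<otimes> (v \<rho> \<otimes> f \<rho> ?\<nu>)" unfolding e using K pK by (simp add: m_assoc)
  finally have "?\<beta> (\<beta> (w \<alpha> \<otimes> f \<alpha> ?\<nu>)) = ?\<beta> (p \<otimes> (v \<rho> \<otimes> f \<rho> ?\<nu>))" by (rule arg_cong)
  moreover have "?\<beta> (\<beta> (w \<alpha> \<otimes> f \<alpha> ?\<nu>)) = w \<alpha> \<otimes> f \<alpha> ?\<nu>"
    using act_comp[OF G(3) \<beta>, of "w \<alpha> \<otimes> f \<alpha> ?\<nu>"] K \<beta> by (simp add: act_one)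
  moreover have "?\<beta> p = p" using F_act[of p ?\<beta>] p_V V_F G(3) by blast
  ultimately have "w \<alpha> \<otimes> f \<alpha> ?\<nu> = p \<otimes> ?\<beta> (v \<rho> \<otimes> f \<rho> ?\<nu>)" using K pK G(3) by (simp add: act_mult)
  then show ?thesis by (rule bexI[OF _ power_bounded_act[OF S_props(5)[OF vS fS] G(3)]])
qed

text \<open>The point is that the dual basis coefficients \<open>w\<close> of \<open>p\<close> are
  constrained by the second generator: as \<open>p\<close> is central,
  \<open>x\<^sub>\<beta> w\<close> is divisible by \<open>p\<close>. This pushes every summand of
  the expansion of \<open>p\<close> into \<open>M\<^sup>2\<close> at the identity, while
  \<open>p\<close> is not in \<open>M\<^sup>2\<close> by unramifiedness.\<close>

lemma not_projective:
  assumes \<beta>: "\<beta> \<in> carrier G" and M: "maximalideal M SK" and fM: "f (inv\<^bsub>G\<^esub> \<beta>) \<beta> \<in> M [^]\<^bsub>ideals_set SK\<^esub> (2::nat)"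
  shows "\<exists>I. left_ideal I \<Lambda> \<and> \<not> projective_module \<Lambda> (left_ideal_module \<Lambda> I)"
proof -
  interpret \<Sigma>: ring \<Sigma> by (rule \<Sigma>_ring)
  interpret \<Lambda>: ring \<Lambda> by (rule \<Lambda>_ring)
  interpret M: galois_dvr_max K G F V p M by (rule unramified_at(1)[OF M])
  have pV: "p \<in> V" by (rule p_V)
  have pS: "p \<in> S" using V_S[OF pV] .
  have pK: "p \<in> carrier K" using S_carrier[OF pS] .
  define P where "P = mono p \<one>\<^bsub>G\<^esub>"
  define C where "C = mono \<one> \<beta>"
  have P: "P \<in> carrier \<Lambda>" unfolding P_def by (rule mono_\<Lambda>[OF pS])
  have C: "C \<in> carrier \<Lambda>" unfolding C_def by (rule mono_\<Lambda>[OF S_props(3)])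
  have central: "y \<otimes>\<^bsub>\<Lambda>\<^esub> P = P \<otimes>\<^bsub>\<Lambda>\<^esub> y" if "y \<in> carrier \<Lambda>" for y
    unfolding P_def \<Lambda>_ops using mono_V_central[OF pV \<Lambda>_\<Sigma>[OF that]] .
  define I where "I = {a \<otimes>\<^bsub>\<Lambda>\<^esub> P \<oplus>\<^bsub>\<Lambda>\<^esub> b \<otimes>\<^bsub>\<Lambda>\<^esub> C | a b. a \<in> carrier \<Lambda> \<and> b \<in> carrier \<Lambda>}"
  have I_I: "a \<otimes>\<^bsub>\<Lambda>\<^esub> P \<oplus>\<^bsub>\<Lambda>\<^esub> b \<otimes>\<^bsub>\<Lambda>\<^esub> C \<in> I" if "a \<in> carrier \<Lambda>" "b \<in> carrier \<Lambda>" for a b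
    unfolding I_def using that by blast
  have I: "left_ideal I \<Lambda>"
  proof (rule left_idealI, unfold \<Lambda>_ops[symmetric])
    show "I \<subseteq> carrier \<Lambda>" using P C by (auto simp: I_def)
    show "\<zero>\<^bsub>\<Lambda>\<^esub> \<in> I" using I_I[OF \<Lambda>.zero_closed \<Lambda>.zero_closed] P C by simp
    fix y assume "y \<in> I"
    then obtain a b where y: "y = a \<otimes>\<^bsub>\<Lambda>\<^esub> P \<oplus>\<^bsub>\<Lambda>\<^esub> b \<otimes>\<^bsub>\<Lambda>\<^esub> C" "a \<in> carrier \<Lambda>" "b \<in> carrier \<Lambda>" unfolding I_def by blast
    show "c \<otimes>\<^bsub>\<Lambda>\<^esub> y \<in> I" if "c \<in> carrier \<Lambda>" for c
      using I_I[of "c \<otimes>\<^bsub>\<Lambda>\<^esub> a" "c \<otimes>\<^bsub>\<Lambda>\<^esub> b"] that y P C by (simp add: \<Lambda>.r_distr \<Lambda>.m_assoc)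
    fix y' assume "y' \<in> I"
    then obtain a' b' where y': "y' = a' \<otimes>\<^bsub>\<Lambda>\<^esub> P \<oplus>\<^bsub>\<Lambda>\<^esub> b' \<otimes>\<^bsub>\<Lambda>\<^esub> C" "a' \<in> carrier \<Lambda>" "b' \<in> carrier \<Lambda>" unfolding I_def by blast
    show "y \<oplus>\<^bsub>\<Lambda>\<^esub> y' \<in> I"
      using I_I[of "a \<oplus>\<^bsub>\<Lambda>\<^esub> a'" "b \<oplus>\<^bsub>\<Lambda>\<^esub> b'"] y y' P C by (simp add: \<Lambda>.l_distr \<Lambda>.a_ac)
  qed
  have PI: "P \<in> I" using I_I[OF \<Lambda>.one_closed \<Lambda>.zero_closed] P C by simp
  have CI: "C \<in> I" using I_I[OF \<Lambda>.zero_closed \<Lambda>.one_closed] P C by simp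
  have "\<not> projective_module \<Lambda> (left_ideal_module \<Lambda> I)"
  proof
    assume proj: "projective_module \<Lambda> (left_ideal_module \<Lambda> I)"
    interpret I: left_module \<Lambda> "left_ideal_module \<Lambda> I" by (rule left_ideal_module_left_module[OF I])
    obtain k where k: "k \<in> left_module_hom \<Lambda> (left_ideal_module \<Lambda> I) (free_module \<Lambda> I)"
      "\<And>y. y \<in> I \<Longrightarrow> (\<Oplus>\<^bsub>left_ideal_module \<Lambda> I\<^esub>i\<in>{i \<in> I. k y i \<noteq> \<zero>\<^bsub>\<Lambda>\<^esub>}. k y i \<otimes>\<^bsub>\<Lambda>\<^esub> i) = y"
      using projective_module_dual_basis[OF proj] unfolding left_ideal_module_simps by blast
    note kE = left_module_homE[OF k(1), unfolded left_ideal_module_simps free_module_simps]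
    define Q where "Q = {y \<in> I. y \<one>\<^bsub>G\<^esub> \<in> M.M2}"
    have Isub: "y \<in> I \<Longrightarrow> y \<in> carrier \<Lambda>" for y by (rule left_idealE(1)[OF I])
    have kc: "k y i \<in> carrier \<Lambda>" if "y \<in> I" "i \<in> I" for y i using kE(1)[OF that(1)] that(2) by auto
    have "(\<Oplus>\<^bsub>left_ideal_module \<Lambda> I\<^esub>i\<in>{i \<in> I. k P i \<noteq> \<zero>\<^bsub>\<Lambda>\<^esub>}. k P i \<otimes>\<^bsub>\<Lambda>\<^esub> i) \<in> Q"
    proof (rule I.M.finsum_mem)
      show "finite {i \<in> I. k P i \<noteq> \<zero>\<^bsub>\<Lambda>\<^esub>}" using kE(1)[OF PI] by simp
      have "\<zero>\<^bsub>\<Lambda>\<^esub> \<one>\<^bsub>G\<^esub> = \<zero>" by (simp add: cp_simps)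
      then show "\<zero>\<^bsub>left_ideal_module \<Lambda> I\<^esub> \<in> Q"
        using left_idealE(3)[OF I] M.M2_zero by (simp add: Q_def \<Lambda>_ops)
      show "Q \<subseteq> carrier (left_ideal_module \<Lambda> I)" by (auto simp: Q_def)
      show "x \<oplus>\<^bsub>left_ideal_module \<Lambda> I\<^esub> y \<in> Q" if "x \<in> Q" "y \<in> Q" for x y
        using that left_idealE(2)[OF I, of x y] M.M2_add by (simp add: Q_def \<Lambda>_ops cp_add_apply)
      fix i assume "i \<in> {i \<in> I. k P i \<noteq> \<zero>\<^bsub>\<Lambda>\<^esub>}"
      then have i: "i \<in> I" by simp
      obtain a b where ab: "i = a \<otimes>\<^bsub>\<Lambda>\<^esub> P \<oplus>\<^bsub>\<Lambda>\<^esub> b \<otimes>\<^bsub>\<Lambda>\<^esub> C" "a \<in> carrier \<Lambda>" "b \<in> carrier \<Lambda>" using i unfolding I_def by blast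
      define w where "w = k P i"
      define v where "v = k C i"
      have w: "w \<in> carrier \<Lambda>" and v: "v \<in> carrier \<Lambda>" unfolding w_def v_def using kc PI CI i by auto
      \<comment> \<open>Linearity of the coordinate, applied to the one element
        \<open>x\<^sub>\<beta> p = p x\<^sub>\<beta>\<close> in two ways, relates the coordinates of
        the two generators.\<close>
      have "k (C \<otimes>\<^bsub>\<Lambda>\<^esub> P) i = k (P \<otimes>\<^bsub>\<Lambda>\<^esub> C) i" unfolding central[OF C] ..
      then have "C \<otimes>\<^bsub>\<Lambda>\<^esub> w = P \<otimes>\<^bsub>\<Lambda>\<^esub> v" using kE(3)[OF C PI] kE(3)[OF P CI] i by (simp add: w_def v_def)
      then have Cw: "mono \<one> \<beta> \<otimes>\<^bsub>\<Sigma>\<^esub> w = mono p \<one>\<^bsub>G\<^esub> \<otimes>\<^bsub>\<Sigma>\<^esub> v" by (simp add: \<Lambda>_ops C_def P_def)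
      have div: "\<exists>t\<in>S. w \<alpha> \<otimes> f \<alpha> (inv\<^bsub>G\<^esub> \<alpha>) = p \<otimes> t" if "\<alpha> \<in> carrier G" for \<alpha>
        by (rule coefficient_divisible[OF w v \<beta> that Cw])
      have wa: "(w \<otimes>\<^bsub>\<Sigma>\<^esub> a) \<one>\<^bsub>G\<^esub> \<in> M"
      proof -
        have "(w \<otimes>\<^bsub>\<Sigma>\<^esub> a) \<one>\<^bsub>G\<^esub> = (\<Oplus>\<alpha>\<in>carrier G. w \<alpha> \<otimes> \<alpha> (a (inv\<^bsub>G\<^esub> \<alpha>)) \<otimes> f \<alpha> (inv\<^bsub>G\<^esub> \<alpha>))"
          unfolding cp_mult_apply[OF G.one_closed]
          using w ab(2) by (intro finsum_cong') (auto simp: \<Lambda>_\<Sigma>)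
        also have "\<dots> \<in> M"
        proof (rule finsum_mem[OF fin_G])
          fix \<alpha> assume \<alpha>: "\<alpha> \<in> carrier G"
          obtain t where t: "t \<in> S" "w \<alpha> \<otimes> f \<alpha> (inv\<^bsub>G\<^esub> \<alpha>) = p \<otimes> t" using div[OF \<alpha>] by blast
          have aS: "\<alpha> (a (inv\<^bsub>G\<^esub> \<alpha>)) \<in> S" using power_bounded_act[OF \<Lambda>_S[OF ab(2), of "inv\<^bsub>G\<^esub> \<alpha>"] \<alpha>] \<alpha> by simp
          have "w \<alpha> \<otimes> \<alpha> (a (inv\<^bsub>G\<^esub> \<alpha>)) \<otimes> f \<alpha> (inv\<^bsub>G\<^esub> \<alpha>) = \<alpha> (a (inv\<^bsub>G\<^esub> \<alpha>)) \<otimes> (w \<alpha> \<otimes> f \<alpha> (inv\<^bsub>G\<^esub> \<alpha>))"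
            using \<alpha> S_carrier[OF aS] S_carrier[OF \<Lambda>_S[OF w \<alpha>]] by (simp add: m_ac)
          also have "\<dots> = (\<alpha> (a (inv\<^bsub>G\<^esub> \<alpha>)) \<otimes> t) \<otimes> p" unfolding t(2) using S_carrier[OF aS] S_carrier[OF t(1)] pK by (simp add: m_ac)
          finally show "w \<alpha> \<otimes> \<alpha> (a (inv\<^bsub>G\<^esub> \<alpha>)) \<otimes> f \<alpha> (inv\<^bsub>G\<^esub> \<alpha>) \<in> M"
            using M.M_mult[OF S_props(5)[OF aS t(1)] M.p_M] by simp
        qed (use M.M2_M[OF M.M2_zero] M.M_add M.M_S S_carrier in auto)
        finally show ?thesis .
      qed
      have waS: "w \<otimes>\<^bsub>\<Sigma>\<^esub> a \<in> carrier \<Lambda>" "w \<otimes>\<^bsub>\<Sigma>\<^esub> b \<in> carrier \<Lambda>" using \<Lambda>_closed(1) w ab by auto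
      have "w \<otimes>\<^bsub>\<Lambda>\<^esub> i = (w \<otimes>\<^bsub>\<Lambda>\<^esub> a) \<otimes>\<^bsub>\<Lambda>\<^esub> P \<oplus>\<^bsub>\<Lambda>\<^esub> (w \<otimes>\<^bsub>\<Lambda>\<^esub> b) \<otimes>\<^bsub>\<Lambda>\<^esub> C"
        unfolding ab(1) using w ab(2,3) P C by (simp add: \<Lambda>.r_distr \<Lambda>.m_assoc)
      \<comment> \<open>The first summand is a product of two elements of \<open>M\<close> by
        \<open>coefficient_divisible\<close>; the second carries the factor assumed to lie in
        \<open>M\<^sup>2\<close>.\<close>
      then have "(w \<otimes>\<^bsub>\<Lambda>\<^esub> i) \<one>\<^bsub>G\<^esub> = (w \<otimes>\<^bsub>\<Sigma>\<^esub> a) \<one>\<^bsub>G\<^esub> \<otimes> p \<oplus> (w \<otimes>\<^bsub>\<Sigma>\<^esub> b) (inv\<^bsub>G\<^esub> \<beta>) \<otimes> f (inv\<^bsub>G\<^esub> \<beta>) \<beta>"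
        using mult_mono_apply[OF pK G.one_closed \<Lambda>_\<Sigma>[OF waS(1)] G.one_closed]
          mult_mono_apply[OF one_closed \<beta> \<Lambda>_\<Sigma>[OF waS(2)] G.one_closed] \<beta> pK \<Lambda>_\<Sigma>[OF waS(1)] \<Lambda>_\<Sigma>[OF waS(2)]
        by (simp add: \<Lambda>_ops cp_add_apply P_def C_def act_one act_1)
      moreover have "(w \<otimes>\<^bsub>\<Sigma>\<^esub> a) \<one>\<^bsub>G\<^esub> \<otimes> p \<in> M.M2" by (rule M.M2_I[OF wa M.p_M])
      moreover have "(w \<otimes>\<^bsub>\<Sigma>\<^esub> b) (inv\<^bsub>G\<^esub> \<beta>) \<otimes> f (inv\<^bsub>G\<^esub> \<beta>) \<beta> \<in> M.M2"
        using \<beta> by (intro M.M2_mult[OF _ fM] \<Lambda>_S[OF waS(2)]) simp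
      ultimately have "(w \<otimes>\<^bsub>\<Lambda>\<^esub> i) \<one>\<^bsub>G\<^esub> \<in> M.M2" using M.M2_add by simp
      then show "k P i \<otimes>\<^bsub>\<Lambda>\<^esub> i \<in> Q" using left_idealE(4)[OF I w i] by (simp add: Q_def w_def \<Lambda>_ops)
    qed
    then have "P \<one>\<^bsub>G\<^esub> \<in> M.M2" unfolding k(2)[OF PI] by (simp add: Q_def)
    then show False using unramified_at(2)[OF M] by (simp add: P_def mono_apply)
  qed
  then show ?thesis using I by blast
qed

end

section \<open>The opposite order\<close>

lemma opposite_ring_simps [simp]:
  "carrier (opposite_ring R) = carrier R" "x \<oplus>\<^bsub>opposite_ring R\<^esub> y = x \<oplus>\<^bsub>R\<^esub> y"
  "x \<otimes>\<^bsub>opposite_ring R\<^esub> y = y \<otimes>\<^bsub>R\<^esub> x" "\<zero>\<^bsub>opposite_ring R\<^esub> = \<zero>\<^bsub>R\<^esub>" "\<one>\<^bsub>opposite_ring R\<^esub> = \<one>\<^bsub>R\<^esub>"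
  by (simp_all add: opposite_ring_def)

lemma (in ring) opposite_ring_ring: "ring (opposite_ring R)"
proof (rule ringI)
  show "abelian_group (opposite_ring R)"
  proof (rule abelian_groupI, unfold opposite_ring_simps)
    show "\<exists>y\<in>carrier R. y \<oplus> x = \<zero>" if "x \<in> carrier R" for x using that by (intro bexI[of _ "\<ominus> x"]) (auto simp: l_neg)
    show "x \<oplus> y = y \<oplus> x" if "x \<in> carrier R" "y \<in> carrier R" for x y using that by (rule a_comm)
  qed (simp_all add: a_assoc)
  show "Group.monoid (opposite_ring R)" by (rule monoidI) (auto simp: m_assoc)
qed (auto simp: l_distr r_distr)

context crossed_order
begin

text \<open>
  The anti-isomorphism \<open>a x\<^sub>\<sigma> \<mapsto> x\<^sub>\<sigma>\<^sup>-\<^sup>1 a\<close> (written on coefficient functions) turns the opposite of the order into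
  the crossed product order of the cocycle \<open>f\<^sup>o\<^sup>p\<close>.
\<close>

definition fop :: "('a \<Rightarrow> 'a) \<Rightarrow> ('a \<Rightarrow> 'a) \<Rightarrow> 'a" where
  "fop \<alpha> \<beta> = (\<alpha> \<otimes>\<^bsub>G\<^esub> \<beta>) (f (inv\<^bsub>G\<^esub> \<beta>) (inv\<^bsub>G\<^esub> \<alpha>))"

definition flip :: "(('a \<Rightarrow> 'a) \<Rightarrow> 'a) \<Rightarrow> ('a \<Rightarrow> 'a) \<Rightarrow> 'a" where
  "flip x = (\<lambda>\<rho>\<in>carrier G. \<rho> (x (inv\<^bsub>G\<^esub> \<rho>)))"

lemma fop_S: "\<alpha> \<in> carrier G \<Longrightarrow> \<beta> \<in> carrier G \<Longrightarrow> fop \<alpha> \<beta> \<in> S"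
  unfolding fop_def by (rule power_bounded_act[OF f_S]) auto

text \<open>The cocycle identity of \<open>fop\<close> at \<alpha>, \<beta>, \<gamma> is the image
  under \<open>\<alpha>\<beta>\<gamma>\<close> of that of \<open>f\<close> at
  \<open>\<gamma>\<^sup>-\<^sup>1\<close>, \<open>\<beta>\<^sup>-\<^sup>1\<close>,
  \<open>\<alpha>\<^sup>-\<^sup>1\<close>, with the two sides exchanged.\<close>

lemma fop_crossed_order: "crossed_order K G F V p fop"
proof (intro crossed_order.intro unramified_galois_dvr_axioms crossed_product.intro field_action_axioms
    crossed_product_axioms.intro crossed_order_axioms.intro)
  fix \<alpha> \<beta> assume \<alpha>: "\<alpha> \<in> carrier G" and \<beta>: "\<beta> \<in> carrier G"
  show "fop \<alpha> \<beta> \<in> S" by (rule fop_S[OF \<alpha> \<beta>])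
  show "fop \<alpha> \<beta> \<in> carrier K" using S_carrier[OF fop_S[OF \<alpha> \<beta>]] .
  show "fop \<alpha> \<beta> \<noteq> \<zero>" unfolding fop_def
    using f_nz[of "inv\<^bsub>G\<^esub> \<beta>" "inv\<^bsub>G\<^esub> \<alpha>"] act_eq_zero_iff[of "\<alpha> \<otimes>\<^bsub>G\<^esub> \<beta>" "f (inv\<^bsub>G\<^esub> \<beta>) (inv\<^bsub>G\<^esub> \<alpha>)"] \<alpha> \<beta> by simp
  fix \<gamma> assume \<gamma>: "\<gamma> \<in> carrier G"
  let ?a = "inv\<^bsub>G\<^esub> \<gamma>" and ?b = "inv\<^bsub>G\<^esub> \<beta>" and ?c = "inv\<^bsub>G\<^esub> \<alpha>"
  define \<delta> where "\<delta> = \<alpha> \<otimes>\<^bsub>G\<^esub> \<beta> \<otimes>\<^bsub>G\<^esub> \<gamma>"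
  have G: "?a \<in> carrier G" "?b \<in> carrier G" "?c \<in> carrier G" "\<delta> \<in> carrier G" "\<alpha> \<otimes>\<^bsub>G\<^esub> \<beta> \<in> carrier G" "\<beta> \<otimes>\<^bsub>G\<^esub> \<gamma> \<in> carrier G"
      "?a \<otimes>\<^bsub>G\<^esub> ?b \<in> carrier G" "?b \<otimes>\<^bsub>G\<^esub> ?c \<in> carrier G"
    using \<alpha> \<beta> \<gamma> by (simp_all add: \<delta>_def)
  have da: "\<delta> \<otimes>\<^bsub>G\<^esub> ?a = \<alpha> \<otimes>\<^bsub>G\<^esub> \<beta>" using \<alpha> \<beta> \<gamma> by (simp add: \<delta>_def)
  have 1: "fop \<alpha> \<beta> = \<delta> (?a (f ?b ?c))"
    unfolding fop_def da[symmetric] by (rule act_comp) (use G in auto)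
  have 2: "fop (\<alpha> \<otimes>\<^bsub>G\<^esub> \<beta>) \<gamma> = \<delta> (f ?a (?b \<otimes>\<^bsub>G\<^esub> ?c))" using \<alpha> \<beta> by (simp add: fop_def \<delta>_def G.inv_mult_group)
  have 3: "\<alpha> (fop \<beta> \<gamma>) = \<delta> (f ?a ?b)"
    unfolding fop_def \<delta>_def using act_comp[OF \<alpha> G(6), of "f ?a ?b"] G \<alpha> \<beta> \<gamma> by (simp add: G.m_assoc)
  have 4: "fop \<alpha> (\<beta> \<otimes>\<^bsub>G\<^esub> \<gamma>) = \<delta> (f (?a \<otimes>\<^bsub>G\<^esub> ?b) ?c)"
    using \<alpha> \<beta> \<gamma> by (simp add: fop_def \<delta>_def G.inv_mult_group G.m_assoc)
  have "\<delta> (?a (f ?b ?c) \<otimes> f ?a (?b \<otimes>\<^bsub>G\<^esub> ?c)) = \<delta> (f ?a ?b \<otimes> f (?a \<otimes>\<^bsub>G\<^esub> ?b) ?c)"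
    unfolding cocycle[OF G(1-3)] ..
  then show "\<alpha> (fop \<beta> \<gamma>) \<otimes> fop \<alpha> (\<beta> \<otimes>\<^bsub>G\<^esub> \<gamma>) = fop \<alpha> \<beta> \<otimes> fop (\<alpha> \<otimes>\<^bsub>G\<^esub> \<beta>) \<gamma>"
    unfolding 1 2 3 4 using G by (simp add: act_mult)
next
  fix \<alpha> assume "\<alpha> \<in> carrier G"
  then show "fop \<one>\<^bsub>G\<^esub> \<alpha> = \<one>" "fop \<alpha> \<one>\<^bsub>G\<^esub> = \<one>" by (simp_all add: fop_def act_1)
qed

abbreviation \<Lambda>op :: "(('a \<Rightarrow> 'a) \<Rightarrow> 'a) ring" where "\<Lambda>op \<equiv> crossed_product.cp K G fop S"

lemmas fop_crossed_product = crossed_order.axioms(2)[OF fop_crossed_order]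

lemmas \<Lambda>op_simps = crossed_product.cp_simps[OF fop_crossed_product]

lemmas \<Lambda>op_ring = crossed_order.\<Lambda>_ring[OF fop_crossed_order]

lemma flip_apply: "\<rho> \<in> carrier G \<Longrightarrow> flip x \<rho> = \<rho> (x (inv\<^bsub>G\<^esub> \<rho>))"
  by (simp add: flip_def)

lemma flip_closed:
  assumes "x \<in> carrier \<Lambda>"
  shows "flip x \<in> carrier \<Lambda>"
  unfolding flip_def cp_simps(1)
proof (intro restrict_PiE_iff[THEN iffD2] ballI)
  fix \<rho> assume \<rho>: "\<rho> \<in> carrier G"
  show "\<rho> (x (inv\<^bsub>G\<^esub> \<rho>)) \<in> S" by (rule power_bounded_act[OF \<Lambda>_S[OF assms] \<rho>]) (use \<rho> in simp)
qed

lemma flip_flip: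
  assumes "x \<in> carrier \<Lambda>"
  shows "flip (flip x) = x"
proof (rule cp_eqI)
  show "flip (flip x) \<in> carrier \<Sigma>" "x \<in> carrier \<Sigma>" by (rule \<Lambda>_\<Sigma> flip_closed assms)+
  fix \<rho> assume \<rho>: "\<rho> \<in> carrier G"
  have "x \<rho> \<in> carrier K" using S_carrier[OF \<Lambda>_S[OF assms \<rho>]] .
  then show "flip (flip x) \<rho> = x \<rho>" using \<rho> act_comp[of \<rho> "inv\<^bsub>G\<^esub> \<rho>" "x \<rho>"] by (simp add: flip_apply act_one)
qed

lemma flip_add:
  assumes "x \<in> carrier \<Lambda>" "y \<in> carrier \<Lambda>"
  shows "flip (x \<oplus>\<^bsub>\<Sigma>\<^esub> y) = flip x \<oplus>\<^bsub>\<Sigma>\<^esub> flip y"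
proof (rule cp_eqI)
  show "flip (x \<oplus>\<^bsub>\<Sigma>\<^esub> y) \<in> carrier \<Sigma>" "flip x \<oplus>\<^bsub>\<Sigma>\<^esub> flip y \<in> carrier \<Sigma>"
    by (rule \<Lambda>_\<Sigma> flip_closed \<Lambda>_closed(2) assms)+
  fix \<rho> assume \<rho>: "\<rho> \<in> carrier G"
  then show "flip (x \<oplus>\<^bsub>\<Sigma>\<^esub> y) \<rho> = (flip x \<oplus>\<^bsub>\<Sigma>\<^esub> flip y) \<rho>"
    using \<Lambda>_\<Sigma>[OF assms(1)] \<Lambda>_\<Sigma>[OF assms(2)] by (simp add: flip_apply cp_add_apply act_add)
qed

lemma flip_mult:
  assumes x: "x \<in> carrier \<Lambda>" and y: "y \<in> carrier \<Lambda>"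
  shows "flip (x \<otimes>\<^bsub>\<Lambda>op\<^esub> y) = flip y \<otimes>\<^bsub>\<Lambda>\<^esub> flip x"
proof -
  have car: "carrier \<Lambda>op = carrier \<Lambda>" by (simp only: cp_simps \<Lambda>op_simps)
  have x': "x \<in> carrier \<Lambda>op" and y': "y \<in> carrier \<Lambda>op" unfolding car by fact+
  note xS = \<Lambda>_\<Sigma>[OF x] and yS = \<Lambda>_\<Sigma>[OF y]
  have "x \<otimes>\<^bsub>\<Lambda>op\<^esub> y \<in> carrier \<Lambda>op" using ring.ring_simprules(5)[OF \<Lambda>op_ring x' y'] .
  then have "x \<otimes>\<^bsub>\<Lambda>op\<^esub> y \<in> carrier \<Lambda>" unfolding car .
  then have c: "flip (x \<otimes>\<^bsub>\<Lambda>op\<^esub> y) \<in> carrier \<Sigma>" by (intro \<Lambda>_\<Sigma> flip_closed)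
  have d: "flip y \<otimes>\<^bsub>\<Sigma>\<^esub> flip x \<in> carrier \<Sigma>" by (rule \<Lambda>_\<Sigma> \<Lambda>_closed(1) flip_closed x y)+
  show ?thesis
    unfolding \<Lambda>_ops(4)
  proof (rule cp_eqI[OF c d])
    fix \<rho> assume \<rho>: "\<rho> \<in> carrier G"
    define r where "r = inv\<^bsub>G\<^esub> \<rho>"
    have r: "r \<in> carrier G" using \<rho> by (simp add: r_def)
    define T where "T \<kappa> = flip y \<kappa> \<otimes> \<kappa> (flip x (inv\<^bsub>G\<^esub> \<kappa> \<otimes>\<^bsub>G\<^esub> \<rho>)) \<otimes> f \<kappa> (inv\<^bsub>G\<^esub> \<kappa> \<otimes>\<^bsub>G\<^esub> \<rho>)" for \<kappa>
    have T: "T \<kappa> \<in> carrier K" if "\<kappa> \<in> carrier G" for \<kappa>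
      unfolding T_def using \<Lambda>_\<Sigma>[OF flip_closed[OF x]] \<Lambda>_\<Sigma>[OF flip_closed[OF y]] that \<rho> by simp
    have "flip (x \<otimes>\<^bsub>\<Lambda>op\<^esub> y) \<rho> = \<rho> (\<Oplus>\<alpha>\<in>carrier G. x \<alpha> \<otimes> \<alpha> (y (inv\<^bsub>G\<^esub> \<alpha> \<otimes>\<^bsub>G\<^esub> r)) \<otimes> fop \<alpha> (inv\<^bsub>G\<^esub> \<alpha> \<otimes>\<^bsub>G\<^esub> r))"
      unfolding flip_apply[OF \<rho>] r_def[symmetric] \<Lambda>op_simps(5) restrict_apply'[OF r] ..
    also have "\<dots> = (\<Oplus>\<alpha>\<in>carrier G. \<rho> (x \<alpha> \<otimes> \<alpha> (y (inv\<^bsub>G\<^esub> \<alpha> \<otimes>\<^bsub>G\<^esub> r)) \<otimes> fop \<alpha> (inv\<^bsub>G\<^esub> \<alpha> \<otimes>\<^bsub>G\<^esub> r)))"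
      using xS yS r \<rho> crossed_product.f_closed[OF fop_crossed_product] by (intro act_finsum) auto
    \<comment> \<open>The term of \<alpha> in the opposite product corresponds to the term of
      \<open>\<kappa> = \<rho>\<alpha>\<close> in the product of the flipped factors.\<close>
    also have "\<dots> = (\<Oplus>\<alpha>\<in>carrier G. T (\<rho> \<otimes>\<^bsub>G\<^esub> \<alpha>))"
    proof (rule finsum_cong')
      fix \<alpha> assume \<alpha>: "\<alpha> \<in> carrier G"
      let ?\<kappa> = "\<rho> \<otimes>\<^bsub>G\<^esub> \<alpha>"
      have \<kappa>: "?\<kappa> \<in> carrier G" using \<alpha> \<rho> by simp
      have ik: "inv\<^bsub>G\<^esub> ?\<kappa> = inv\<^bsub>G\<^esub> \<alpha> \<otimes>\<^bsub>G\<^esub> r" using \<alpha> \<rho> by (simp add: G.inv_mult_group r_def)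
      have ikr: "inv\<^bsub>G\<^esub> \<alpha> \<otimes>\<^bsub>G\<^esub> r \<otimes>\<^bsub>G\<^esub> \<rho> = inv\<^bsub>G\<^esub> \<alpha>" using \<alpha> \<rho> by (simp add: r_def)
      have K: "x \<alpha> \<in> carrier K" "y (inv\<^bsub>G\<^esub> \<alpha> \<otimes>\<^bsub>G\<^esub> r) \<in> carrier K" "fop \<alpha> (inv\<^bsub>G\<^esub> \<alpha> \<otimes>\<^bsub>G\<^esub> r) \<in> carrier K"
        using xS yS \<alpha> r crossed_product.f_closed[OF fop_crossed_product] by auto
      have fo: "\<rho> (fop \<alpha> (inv\<^bsub>G\<^esub> \<alpha> \<otimes>\<^bsub>G\<^esub> r)) = f ?\<kappa> (inv\<^bsub>G\<^esub> \<alpha>)"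
        using \<alpha> \<rho> act_comp[of \<rho> r "f ?\<kappa> (inv\<^bsub>G\<^esub> \<alpha>)"] by (simp add: fop_def r_def G.inv_mult_group act_one)
      have xe: "?\<kappa> (flip x (inv\<^bsub>G\<^esub> \<alpha>)) = \<rho> (x \<alpha>)"
        using \<alpha> \<rho> K(1) act_comp[of ?\<kappa> "inv\<^bsub>G\<^esub> \<alpha>" "x \<alpha>"] by (simp add: flip_apply)
      have ye: "flip y ?\<kappa> = \<rho> (\<alpha> (y (inv\<^bsub>G\<^esub> \<alpha> \<otimes>\<^bsub>G\<^esub> r)))"
        using act_comp[OF \<rho> \<alpha> K(2)] by (simp add: flip_apply[OF \<kappa>] ik)
      have "T ?\<kappa> = \<rho> (\<alpha> (y (inv\<^bsub>G\<^esub> \<alpha> \<otimes>\<^bsub>G\<^esub> r))) \<otimes> \<rho> (x \<alpha>) \<otimes> \<rho> (fop \<alpha> (inv\<^bsub>G\<^esub> \<alpha> \<otimes>\<^bsub>G\<^esub> r))"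
        unfolding T_def ik ikr xe ye fo ..
      then show "\<rho> (x \<alpha> \<otimes> \<alpha> (y (inv\<^bsub>G\<^esub> \<alpha> \<otimes>\<^bsub>G\<^esub> r)) \<otimes> fop \<alpha> (inv\<^bsub>G\<^esub> \<alpha> \<otimes>\<^bsub>G\<^esub> r)) = T ?\<kappa>"
        using K \<alpha> \<rho> r by (simp add: act_mult m_comm)
    qed (use T \<rho> in auto)
    also have "\<dots> = (\<Oplus>\<kappa>\<in>carrier G. T \<kappa>)" using T \<rho> by (intro finsum_translate) auto
    also have "\<dots> = (flip y \<otimes>\<^bsub>\<Sigma>\<^esub> flip x) \<rho>" unfolding cp_mult_apply[OF \<rho>] T_def ..
    finally show "flip (x \<otimes>\<^bsub>\<Lambda>op\<^esub> y) \<rho> = (flip y \<otimes>\<^bsub>\<Sigma>\<^esub> flip x) \<rho>" .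
  qed
qed

text \<open>\<open>flip\<close> is an involution identifying the opposite of the order with the
  order of \<open>fop\<close>. The ideal is carried there, treated as a left ideal, and carried
  back; the criterion is unchanged because \<open>fop\<close> and \<open>f\<close> agree at the
  pairs \<open>(\<tau>, \<tau>\<^sup>-\<^sup>1)\<close>.\<close>

lemma opposite_left_ideal_fg_projective:
  assumes hyp: "\<And>\<tau> M. \<tau> \<in> carrier G \<Longrightarrow> maximalideal M SK \<Longrightarrow> f \<tau> (inv\<^bsub>G\<^esub> \<tau>) \<notin> M [^]\<^bsub>ideals_set SK\<^esub> (2::nat)"
    and I: "left_ideal I (opposite_ring \<Lambda>)"
  shows "fg_projective (opposite_ring \<Lambda>) (left_ideal_module (opposite_ring \<Lambda>) I)"
proof -
  have car: "carrier \<Lambda>op = carrier \<Lambda>" by (simp only: cp_simps \<Lambda>op_simps)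
  have add: "x \<oplus>\<^bsub>\<Lambda>op\<^esub> y = x \<oplus>\<^bsub>\<Lambda>\<^esub> y" for x y by (simp only: cp_simps \<Lambda>op_simps)
  have zero: "\<zero>\<^bsub>\<Lambda>op\<^esub> = \<zero>\<^bsub>\<Lambda>\<^esub>" by (simp only: cp_simps \<Lambda>op_simps)
  interpret I: left_ideal I "opposite_ring \<Lambda>" by (rule I)
  have I\<Lambda>: "x \<in> carrier \<Lambda>" if "x \<in> I" for x using I.a_subset that by auto
  have J: "left_ideal (flip ` I) \<Lambda>op"
  proof (rule crossed_order.left_idealI[OF fop_crossed_order], unfold crossed_order.\<Lambda>_ops[OF fop_crossed_order, symmetric] car)
    show "flip ` I \<subseteq> carrier \<Lambda>" using I\<Lambda> flip_closed by auto
    have "flip \<zero>\<^bsub>\<Lambda>\<^esub> = \<zero>\<^bsub>\<Lambda>\<^esub>" unfolding flip_def cp_simps by (rule restrict_ext) (simp add: act_zero)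
    then show "\<zero>\<^bsub>\<Lambda>op\<^esub> \<in> flip ` I" using imageI[OF additive_subgroup.zero_closed[OF I.additive_subgroup_axioms], of flip] by (simp add: zero)
    fix y assume "y \<in> flip ` I"
    then obtain i where i: "i \<in> I" "y = flip i" by blast
    fix a assume a: "a \<in> carrier \<Lambda>"
    have "flip (a \<otimes>\<^bsub>\<Lambda>op\<^esub> y) = i \<otimes>\<^bsub>\<Lambda>\<^esub> flip a"
      using flip_mult[OF a flip_closed[OF I\<Lambda>[OF i(1)]]] flip_flip[OF I\<Lambda>[OF i(1)]] by (simp add: i(2))
    then have "flip (a \<otimes>\<^bsub>\<Lambda>op\<^esub> y) \<in> I" using I.left_ideal_closed[OF i(1), of "flip a"] flip_closed[OF a] by simp
    moreover have "a \<otimes>\<^bsub>\<Lambda>op\<^esub> y \<in> carrier \<Lambda>"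
      using ring.ring_simprules(5)[OF \<Lambda>op_ring, of a y] a flip_closed[OF I\<Lambda>[OF i(1)]] by (simp add: car i(2))
    ultimately show "a \<otimes>\<^bsub>\<Lambda>op\<^esub> y \<in> flip ` I" using flip_flip by (metis imageI)
  next
    fix y y' assume "y \<in> flip ` I" "y' \<in> flip ` I"
    then obtain i i' where i: "i \<in> I" "y = flip i" "i' \<in> I" "y' = flip i'" by blast
    have "y \<oplus>\<^bsub>\<Lambda>op\<^esub> y' = flip (i \<oplus>\<^bsub>\<Lambda>\<^esub> i')" using flip_add[OF I\<Lambda>[OF i(1)] I\<Lambda>[OF i(3)]] by (simp add: i add \<Lambda>_ops)
    then show "y \<oplus>\<^bsub>\<Lambda>op\<^esub> y' \<in> flip ` I" using imageI[OF additive_subgroup.a_closed[OF I.additive_subgroup_axioms i(1,3)], of flip] by simp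
  qed
  have "fop \<tau> (inv\<^bsub>G\<^esub> \<tau>) = f \<tau> (inv\<^bsub>G\<^esub> \<tau>)" if "\<tau> \<in> carrier G" for \<tau> using that by (simp add: fop_def act_one)
  then have "fg_projective \<Lambda>op (left_ideal_module \<Lambda>op (flip ` I))"
    using hyp by (intro crossed_order.left_ideal_fg_projective[OF fop_crossed_order _ J]) simp
  then have "fg_projective (opposite_ring \<Lambda>) (left_ideal_module (opposite_ring \<Lambda>) (flip ` (flip ` I)))"
  proof (rule fg_projective_ring_iso[OF \<Lambda>op_ring J, rotated -1, of flip _ flip], unfold car opposite_ring_simps add)
    show "flip \<in> carrier \<Lambda> \<rightarrow> carrier \<Lambda>" using flip_closed by auto
  qed (use flip_add flip_mult flip_flip flip_closed in \<open>simp_all add: \<Lambda>_ops(3)\<close>)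
  moreover have "flip ` (flip ` I) = I" using flip_flip I\<Lambda> by (auto simp: image_image intro: image_eqI)
  ultimately show ?thesis by simp
qed

theorem hereditary_iff:
  "hereditary \<Lambda> \<longleftrightarrow> (\<forall>\<tau>\<in>carrier G. \<forall>M. maximalideal M SK \<longrightarrow> f \<tau> (inv\<^bsub>G\<^esub> \<tau>) \<notin> M [^]\<^bsub>ideals_set SK\<^esub> (2::nat))"
proof
  assume h: "hereditary \<Lambda>"
  show "\<forall>\<tau>\<in>carrier G. \<forall>M. maximalideal M SK \<longrightarrow> f \<tau> (inv\<^bsub>G\<^esub> \<tau>) \<notin> M [^]\<^bsub>ideals_set SK\<^esub> (2::nat)"
  proof (intro ballI allI impI notI)
    fix \<tau> M assume \<tau>: "\<tau> \<in> carrier G" and M: "maximalideal M SK" "f \<tau> (inv\<^bsub>G\<^esub> \<tau>) \<in> M [^]\<^bsub>ideals_set SK\<^esub> (2::nat)"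
    have "\<exists>I. left_ideal I \<Lambda> \<and> \<not> projective_module \<Lambda> (left_ideal_module \<Lambda> I)"
      \<comment> \<open>For \<open>\<beta> = \<tau>\<^sup>-\<^sup>1\<close> the value
        \<open>f(\<beta>\<^sup>-\<^sup>1, \<beta>)\<close> of that lemma is
        \<open>f(\<tau>, \<tau>\<^sup>-\<^sup>1)\<close>.\<close>
      by (rule not_projective[of "inv\<^bsub>G\<^esub> \<tau>" M]) (use \<tau> M in simp_all)
    then show False using h unfolding hereditary_def left_hereditary_def by blast
  qed
next
  assume "\<forall>\<tau>\<in>carrier G. \<forall>M. maximalideal M SK \<longrightarrow> f \<tau> (inv\<^bsub>G\<^esub> \<tau>) \<notin> M [^]\<^bsub>ideals_set SK\<^esub> (2::nat)"
  then have hyp: "f \<tau> (inv\<^bsub>G\<^esub> \<tau>) \<notin> M [^]\<^bsub>ideals_set SK\<^esub> (2::nat)" if "\<tau> \<in> carrier G" "maximalideal M SK" for \<tau> M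
    using that by blast
  show "hereditary \<Lambda>"
    unfolding hereditary_def left_hereditary_def
  proof (intro conjI allI impI \<Lambda>_ring ring.opposite_ring_ring fg_projective_imp_projective left_ideal_module_left_module)
    show "fg_projective \<Lambda> (left_ideal_module \<Lambda> I)" if "left_ideal I \<Lambda>" for I
      by (rule left_ideal_fg_projective[OF hyp that])
    show "fg_projective (opposite_ring \<Lambda>) (left_ideal_module (opposite_ring \<Lambda>) I)" if "left_ideal I (opposite_ring \<Lambda>)" for I
      by (rule opposite_left_ideal_fg_projective[OF hyp that])
  qed
qed

end

section \<open>The Galois group\<close>

lemma galois_group_simps:
  "carrier (galois_group K F) = {\<alpha> \<in> Bij (carrier K). \<alpha> \<in> ring_hom K K \<and> (\<forall>x\<in>F. \<alpha> x = x)}"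
  "\<one>\<^bsub>galois_group K F\<^esub> = (\<lambda>x\<in>carrier K. x)"
  "\<alpha> \<in> Bij (carrier K) \<Longrightarrow> \<beta> \<in> Bij (carrier K) \<Longrightarrow> \<alpha> \<otimes>\<^bsub>galois_group K F\<^esub> \<beta> = compose (carrier K) \<alpha> \<beta>"
  by (simp_all add: galois_group_def BijGroup_def)

lemma group_galois_group:
  fixes K (structure)
  assumes K: "ring K" and F: "F \<subseteq> carrier K"
  shows "group (galois_group K F)"
proof -
  interpret ring K by (rule K)
  interpret B: group "BijGroup (carrier K)" by (rule group_BijGroup)
  let ?H = "{\<alpha> \<in> Bij (carrier K). \<alpha> \<in> ring_hom K K \<and> (\<forall>x\<in>F. \<alpha> x = x)}"
  have "subgroup ?H (BijGroup (carrier K))"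
  proof (rule B.subgroupI)
    show "?H \<subseteq> carrier (BijGroup (carrier K))" by (auto simp: BijGroup_def)
    have "(\<lambda>x\<in>carrier K. x) \<in> ?H" using F by (auto simp: id_Bij intro!: ring_hom_memI)
    then show "?H \<noteq> {}" by blast
    fix \<alpha> assume "\<alpha> \<in> ?H"
    then have \<alpha>: "\<alpha> \<in> Bij (carrier K)" "\<alpha> \<in> ring_hom K K" "\<And>x. x \<in> F \<Longrightarrow> \<alpha> x = x" by auto
    have \<alpha>i: "inj_on \<alpha> (carrier K)" using \<alpha>(1) by (simp add: Bij_def bij_betw_def)
    have inv: "inv_into (carrier K) \<alpha> (\<alpha> x) = x" if "x \<in> carrier K" for x using \<alpha>i that by (rule inv_into_f_f)
    have cl: "inv_into (carrier K) \<alpha> x \<in> carrier K" if "x \<in> carrier K" for x by (rule Bij_inv_into_mem[OF \<alpha>(1) that])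
    have "(\<lambda>x\<in>carrier K. inv_into (carrier K) \<alpha> x) \<in> ?H"
    proof (intro CollectI conjI ballI restrict_inv_into_Bij \<alpha>(1) ring_hom_memI)
      fix x y assume xy: "x \<in> carrier K" "y \<in> carrier K"
      show "(\<lambda>x\<in>carrier K. inv_into (carrier K) \<alpha> x) (x \<otimes> y) =
          (\<lambda>x\<in>carrier K. inv_into (carrier K) \<alpha> x) x \<otimes> (\<lambda>x\<in>carrier K. inv_into (carrier K) \<alpha> x) y"
        using xy Bij_inv_into_lemma[of "carrier K" \<alpha> "(\<otimes>)"] ring_hom_mult[OF \<alpha>(2)] \<alpha>(1) by simp
      show "(\<lambda>x\<in>carrier K. inv_into (carrier K) \<alpha> x) (x \<oplus> y) =
          (\<lambda>x\<in>carrier K. inv_into (carrier K) \<alpha> x) x \<oplus> (\<lambda>x\<in>carrier K. inv_into (carrier K) \<alpha> x) y"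
        using xy Bij_inv_into_lemma[of "carrier K" \<alpha> "(\<oplus>)"] ring_hom_add[OF \<alpha>(2)] \<alpha>(1) by simp
    next
      show "(\<lambda>x\<in>carrier K. inv_into (carrier K) \<alpha> x) \<one> = \<one>" using inv[OF one_closed] ring_hom_one[OF \<alpha>(2)] by simp
      fix x assume "x \<in> F"
      then show "(\<lambda>x\<in>carrier K. inv_into (carrier K) \<alpha> x) x = x" using inv[of x] \<alpha>(3)[of x] F by auto
    qed (use cl in simp)
    then show "inv\<^bsub>BijGroup (carrier K)\<^esub> \<alpha> \<in> ?H" by (simp only: inv_BijGroup[OF \<alpha>(1)])
    fix \<beta> assume "\<beta> \<in> ?H"
    then have \<beta>: "\<beta> \<in> Bij (carrier K)" "\<beta> \<in> ring_hom K K" "\<And>x. x \<in> F \<Longrightarrow> \<beta> x = x" by auto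
    have "compose (carrier K) \<alpha> \<beta> \<in> ring_hom K K"
    proof (rule ring_hom_memI)
      fix x y assume "x \<in> carrier K" "y \<in> carrier K"
      then show "compose (carrier K) \<alpha> \<beta> (x \<otimes> y) = compose (carrier K) \<alpha> \<beta> x \<otimes> compose (carrier K) \<alpha> \<beta> y"
        "compose (carrier K) \<alpha> \<beta> (x \<oplus> y) = compose (carrier K) \<alpha> \<beta> x \<oplus> compose (carrier K) \<alpha> \<beta> y"
        by (simp_all add: compose_eq ring_hom_mult[OF \<alpha>(2)] ring_hom_mult[OF \<beta>(2)] ring_hom_add[OF \<alpha>(2)]
            ring_hom_add[OF \<beta>(2)] ring_hom_closed[OF \<beta>(2)])
    qed (simp_all add: compose_eq ring_hom_closed[OF \<alpha>(2)] ring_hom_closed[OF \<beta>(2)] ring_hom_one[OF \<alpha>(2)] ring_hom_one[OF \<beta>(2)])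
    moreover have "\<forall>x\<in>F. compose (carrier K) \<alpha> \<beta> x = x" using \<alpha>(3) \<beta>(3) F by (auto simp: compose_def)
    ultimately show "\<alpha> \<otimes>\<^bsub>BijGroup (carrier K)\<^esub> \<beta> \<in> ?H" using \<alpha>(1) \<beta>(1) by (simp add: BijGroup_def compose_Bij)
  qed
  from B.subgroup_imp_group[OF this] show ?thesis unfolding galois_group_def .
qed

text \<open>An automorphism over \<open>F\<close> is determined by its values on a finite spanning
  list, and each value is a root of a fixed nonzero polynomial over \<open>F\<close>; so it embeds
  into a finite set of lists.\<close>

lemma finite_galois_group:
  fixes K (structure)
  assumes K: "field K" and F: "subfield F K" and fin: "ring.finite_dimension K F (carrier K)"
  shows "finite (carrier (galois_group K F))"
proof -
  interpret field K by (rule K)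
  have FK: "F \<subseteq> carrier K" using subfieldE(3)[OF F] .
  obtain n where "dimension n F (carrier K)" using fin unfolding finite_dimension_def by blast
  then obtain xs where xs: "set xs \<subseteq> carrier K" "Span F xs = carrier K" using exists_base[OF F] by blast
  have root: "\<exists>P\<in>carrier (poly_ring K). P \<noteq> [] \<and> set P \<subseteq> F \<and> eval P x = \<zero>" if x: "x \<in> carrier K" for x
  proof -
    have "(algebraic over F) x" by (rule finite_dimension_imp_algebraic[OF F carrier_is_subring fin x])
    then obtain P where P: "P \<in> carrier (F[X])" "P \<noteq> []" "eval P x = \<zero>"
      using algebraicE[OF subfieldE(1)[OF F] x] by blast
    have PF: "set P \<subseteq> F" using P(1) unfolding univ_poly_carrier[symmetric] polynomial_def by auto
    have "P \<in> carrier (poly_ring K)" using carrier_polynomial_shell[OF subfieldE(1)[OF F] P(1)] .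
    then show ?thesis using P PF by blast
  qed
  define P where "P x = (SOME P. P \<in> carrier (poly_ring K) \<and> P \<noteq> [] \<and> set P \<subseteq> F \<and> eval P x = \<zero>)" for x
  have P: "P x \<in> carrier (poly_ring K)" "P x \<noteq> []" "set (P x) \<subseteq> F" "eval (P x) x = \<zero>" if "x \<in> carrier K" for x
    using someI_ex[of "\<lambda>P. P \<in> carrier (poly_ring K) \<and> P \<noteq> [] \<and> set P \<subseteq> F \<and> eval P x = \<zero>"] root[OF that]
    unfolding P_def by blast+
  define U where "U = (\<Union>x\<in>set xs. {y. is_root (P x) y})"
  have U: "finite U" unfolding U_def using finite_number_of_roots P(1) xs(1) by auto
  define \<Phi> where "\<Phi> \<alpha> = map \<alpha> xs" for \<alpha> :: "'a \<Rightarrow> 'a"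
  have hom: "ring_hom_ring K K \<alpha>" if "\<alpha> \<in> carrier (galois_group K F)" for \<alpha>
    using that ring_axioms by (auto simp: galois_group_simps intro!: ring_hom_ringI2)
  have map_F: "map \<alpha> ks = ks" if "\<alpha> \<in> carrier (galois_group K F)" "set ks \<subseteq> F" for \<alpha> ks
    using that by (intro map_idI) (auto simp: galois_group_simps)
  have "\<Phi> ` carrier (galois_group K F) \<subseteq> {ys. set ys \<subseteq> U \<and> length ys = length xs}"
  proof (intro image_subsetI CollectI conjI subsetI)
    fix \<alpha> y assume \<alpha>: "\<alpha> \<in> carrier (galois_group K F)" and "y \<in> set (\<Phi> \<alpha>)"
    then obtain x where x: "x \<in> set xs" "y = \<alpha> x" by (auto simp: \<Phi>_def)
    have xK: "x \<in> carrier K" using x xs by auto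
    interpret h: ring_hom_ring K K \<alpha> by (rule hom[OF \<alpha>])
    have "eval (P x) y = \<alpha> (eval (P x) x)"
      using h.eval_hom'[OF xK, of "P x"] P(3)[OF xK] FK map_F[OF \<alpha> P(3)[OF xK]] by (auto simp: x(2))
    then have "is_root (P x) y" unfolding is_root_def using P[OF xK] h.hom_closed[OF xK] by (simp add: x(2))
    then show "y \<in> U" using x(1) by (auto simp: U_def)
  qed (simp add: \<Phi>_def)
  then have "finite (\<Phi> ` carrier (galois_group K F))"
    using finite_lists_length_eq[OF U] by (rule finite_subset)
  moreover have "inj_on \<Phi> (carrier (galois_group K F))"
  proof (rule inj_onI)
    fix \<alpha> \<beta> assume \<alpha>: "\<alpha> \<in> carrier (galois_group K F)" and \<beta>: "\<beta> \<in> carrier (galois_group K F)" and eq: "\<Phi> \<alpha> = \<Phi> \<beta>"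
    have comb: "\<gamma> (combine ks zs) = combine ks (map \<gamma> zs)"
      if \<gamma>: "\<gamma> \<in> carrier (galois_group K F)" and "set ks \<subseteq> F" "set zs \<subseteq> carrier K" for \<gamma> ks zs
      using that(2,3)
    proof (induction ks zs rule: combine.induct)
      case (1 k ks z zs)
      interpret h: ring_hom_ring K K \<gamma> by (rule hom[OF \<gamma>])
      have k: "\<gamma> k = k" "k \<in> carrier K" using 1(2) \<gamma> FK by (auto simp: galois_group_simps)
      have "combine ks zs \<in> carrier K" using 1(2,3) FK by (intro combine_in_carrier) auto
      then show ?case using 1 k by simp
    next
      case ("2_1" zs)
      interpret h: ring_hom_ring K K \<gamma> by (rule hom[OF \<gamma>])
      show ?case by simp
    next
      case ("2_2" ks)
      interpret h: ring_hom_ring K K \<gamma> by (rule hom[OF \<gamma>])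
      show ?case by simp
    qed
    show "\<alpha> = \<beta>"
    proof (rule extensionalityI[of _ "carrier K"])
      show "\<alpha> \<in> extensional (carrier K)" "\<beta> \<in> extensional (carrier K)"
        using \<alpha> \<beta> by (auto simp: galois_group_simps Bij_imp_extensional)
      fix x assume "x \<in> carrier K"
      then have "x \<in> {combine ks xs | ks. set ks \<subseteq> F}" unfolding xs(2)[symmetric] Span_eq_combine_set[OF F xs(1)] .
      then obtain ks where ks: "x = combine ks xs" "set ks \<subseteq> F" by blast
      show "\<alpha> x = \<beta> x" unfolding ks(1) comb[OF \<alpha> ks(2) xs(1)] comb[OF \<beta> ks(2) xs(1)] eq[unfolded \<Phi>_def] ..
    qed
  qed
  ultimately show ?thesis using finite_imageD by blast
qed

text \<open>Faithfulness comes from extensionality: a group element that fixes the carrier pointwise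
  equals the identity as a function.\<close>

lemma galois_group_field_action:
  fixes K (structure)
  assumes K: "field K" and F: "subfield F K" and fin: "ring.finite_dimension K F (carrier K)"
  shows "field_action K (galois_group K F)"
proof (intro field_action.intro field_action_axioms.intro K finite_galois_group[OF K F fin])
  interpret field K by (rule K)
  show "group (galois_group K F)" by (rule group_galois_group[OF ring_axioms subfieldE(3)[OF F]])
  show "\<alpha> \<in> ring_hom K K" if "\<alpha> \<in> carrier (galois_group K F)" for \<alpha> using that by (simp add: galois_group_simps)
  show "(\<alpha> \<otimes>\<^bsub>galois_group K F\<^esub> \<beta>) x = \<alpha> (\<beta> x)"
    if "\<alpha> \<in> carrier (galois_group K F)" "\<beta> \<in> carrier (galois_group K F)" "x \<in> carrier K" for \<alpha> \<beta> x
    using that by (simp add: galois_group_simps compose_eq)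
  show "\<one>\<^bsub>galois_group K F\<^esub> x = x" if "x \<in> carrier K" for x using that by (simp add: galois_group_simps)
  show "\<exists>y\<in>carrier K. \<alpha> y \<noteq> y" if \<alpha>: "\<alpha> \<in> carrier (galois_group K F)" "\<alpha> \<noteq> \<one>\<^bsub>galois_group K F\<^esub>" for \<alpha>
  proof (rule ccontr)
    assume "\<not> ?thesis"
    then have "\<alpha> = (\<lambda>x\<in>carrier K. x)"
      using \<alpha>(1) by (intro extensionalityI[of _ "carrier K"]) (auto simp: galois_group_simps Bij_imp_extensional)
    then show False using \<alpha>(2) by (simp add: galois_group_simps)
  qed
qed

text \<open>The uniformizer turns the abstract ring-theoretic hypotheses into elementwise ones. In
  particular a denominator is a unit times \<open>p^n\<close>, so powers of \<open>p\<close> clear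
  all denominators of elements of \<open>F\<close>.\<close>

lemma dvr_galois_dvr:
  fixes K (structure)
  assumes K: "field K" and V: "subring V K" and dvr: "discrete_valuation_ring (K\<lparr>carrier := V\<rparr>)"
    and F: "F = quotient_field K V" and gal: "finite_galois_extension K F"
  obtains p where "finite_galois_dvr K (galois_group K F) F V p"
proof -
  interpret field K by (rule K)
  have Fs: "subfield F K" and fin: "finite_dimension F (carrier K)"
    and fixed: "F = {x \<in> carrier K. \<forall>\<alpha>\<in>carrier (galois_group K F). \<alpha> x = x}"
    using gal unfolding finite_galois_extension_def by auto
  note Vp = subringE[OF V]
  obtain p where p: "p \<in> V" "p \<noteq> \<zero>" "p \<notin> Units (K\<lparr>carrier := V\<rparr>)"
    "\<And>a. a \<in> V \<Longrightarrow> a \<notin> Units (K\<lparr>carrier := V\<rparr>) \<Longrightarrow> \<exists>b\<in>V. a = p \<otimes> b"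
    "\<And>a. a \<in> V \<Longrightarrow> a \<noteq> \<zero> \<Longrightarrow> \<exists>n::nat. \<exists>u\<in>Units (K\<lparr>carrier := V\<rparr>). a = u \<otimes> p [^]\<^bsub>K\<lparr>carrier := V\<rparr>\<^esub> n"
    using dvr_uniformizer[OF dvr] by auto
  have U: "u \<in> Units (K\<lparr>carrier := V\<rparr>) \<longleftrightarrow> u \<in> V \<and> (\<exists>w\<in>V. u \<otimes> w = \<one>)" for u
  proof -
    have "w \<otimes> u = u \<otimes> w" if "u \<in> V" "w \<in> V" for w using that Vp(1) by (intro m_comm) auto
    then show ?thesis unfolding Units_def by auto
  qed
  have pow: "p [^]\<^bsub>K\<lparr>carrier := V\<rparr>\<^esub> n = p [^] n" for n :: nat by (rule nat_pow_consistent[symmetric])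
  have decomp: "\<exists>n::nat. \<exists>u\<in>V. \<exists>w\<in>V. u \<otimes> w = \<one> \<and> a = u \<otimes> p [^] n" if "a \<in> V" "a \<noteq> \<zero>" for a
    using p(5)[OF that] unfolding Bex_def U pow by blast
  have VF: "a \<in> F" if "a \<in> V" for a
  proof -
    have "a = a \<otimes> inv \<one>" using that Vp(1) by auto
    moreover have "\<one> \<in> V - {\<zero>}" using Vp(3) by simp
    ultimately show ?thesis unfolding F quotient_field_def mem_Collect_eq by (intro exI[of _ a] exI[of _ \<one>] conjI that)
  qed
  have frac: "\<exists>n::nat. p [^] n \<otimes> x \<in> V" if "x \<in> F" for x
  proof -
    obtain a b where ab: "x = a \<otimes> inv b" "a \<in> V" "b \<in> V" "b \<noteq> \<zero>"
      using \<open>x \<in> F\<close> unfolding F quotient_field_def by blast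
    obtain n :: nat and u w where n: "u \<in> V" "w \<in> V" "u \<otimes> w = \<one>" "b = u \<otimes> p [^] n"
      using decomp[OF ab(3,4)] by blast
    have cl: "a \<in> carrier K" "b \<in> carrier K" "u \<in> carrier K" "w \<in> carrier K" "p [^] n \<in> carrier K" "inv b \<in> carrier K" "b \<otimes> inv b = \<one>"
      using ab n p(1) Vp(1) field_Units by auto
    have "p [^] n \<otimes> x = (u \<otimes> w) \<otimes> (p [^] n \<otimes> (a \<otimes> inv b))" unfolding n(3) ab(1) using cl by simp
    also have "\<dots> = ((u \<otimes> p [^] n) \<otimes> inv b) \<otimes> (w \<otimes> a)" using cl(1-6) by (simp add: m_ac)
    also have "\<dots> = (b \<otimes> inv b) \<otimes> (w \<otimes> a)" unfolding n(4)[symmetric] ..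
    also have "\<dots> = w \<otimes> a" using cl by simp
    finally have "p [^] n \<otimes> x \<in> V" using Vp(6)[OF n(2) ab(2)] by simp
    then show ?thesis ..
  qed
  have "finite_galois_dvr K (galois_group K F) F V p"
  proof (intro finite_galois_dvr.intro galois_dvr.intro galois_group_field_action[OF K Fs fin] galois_dvr_axioms.intro
      finite_galois_dvr_axioms.intro Fs fin fixed V p(1,2) decomp frac)
    show "V \<subseteq> F" using VF by blast
    show "p \<otimes> b \<noteq> \<one>" if "b \<in> V" for b using p(1,3) that unfolding U by blast
    show "(\<exists>b\<in>V. a = p \<otimes> b) \<or> (\<exists>b\<in>V. a \<otimes> b = \<one>)" if "a \<in> V" for a using p(4)[OF that] that unfolding U by blast
  qed
  then show ?thesis by (rule that)
qed

theorem mainTheorem1: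
  fixes K :: "('a, 'b) ring_scheme"
    and F V S :: "'a set"
    and f :: "('a \<Rightarrow> 'a) \<Rightarrow> ('a \<Rightarrow> 'a) \<Rightarrow> 'a"
  assumes "field K"
    and "subring V K" and "discrete_valuation_ring (K\<lparr>carrier := V\<rparr>)"
    and "F = quotient_field K V"
    and "finite_galois_extension K F"
    and "S = integral_closure K V"
    and "unramified K V S"
    and "normalized_two_cocycle K F f"
    and "\<forall>\<sigma>\<in>carrier (galois_group K F). \<forall>\<tau>\<in>carrier (galois_group K F). f \<sigma> \<tau> \<in> S - {\<zero>\<^bsub>K\<^esub>}"
  shows "hereditary (crossed_product_order K F S f) \<longleftrightarrow>
    (\<forall>\<tau>\<in>carrier (galois_group K F). \<forall>M. maximalideal M (K\<lparr>carrier := S\<rparr>) \<longrightarrow>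
       f \<tau> (inv\<^bsub>galois_group K F\<^esub> \<tau>) \<notin> M [^]\<^bsub>ideals_set (K\<lparr>carrier := S\<rparr>)\<^esub> (2::nat))"
proof -
  obtain p where "finite_galois_dvr K (galois_group K F) F V p" by (rule dvr_galois_dvr[OF assms(1-5)])
  then interpret finite_galois_dvr K "galois_group K F" F V p .
  \<comment> \<open>The locales know the integral closure only as the set of power-bounded elements;
    from here on the two are identified.\<close>
  have S: "S = power_bounded" unfolding assms(6) by (rule integral_closure_eq)
  have co: "crossed_order K (galois_group K F) F V p f"
  proof (intro crossed_order.intro unramified_galois_dvr.intro finite_galois_dvr_axioms unramified_galois_dvr_axioms.intro
      crossed_product.intro field_action_axioms crossed_product_axioms.intro crossed_order_axioms.intro)
    show "unramified K V power_bounded" using assms(7) unfolding S .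
  qed (use assms(8,9) in \<open>auto simp: normalized_two_cocycle_def Let_def S\<close>)
  have "crossed_product_order K F S f = crossed_product.cp K (galois_group K F) f power_bounded"
    unfolding crossed_product_order_def crossed_product_algebra_def Let_def S
      crossed_product.cp_def[OF crossed_order.axioms(2)[OF co]] by simp
  then show ?thesis using crossed_order.hereditary_iff[OF co] unfolding S by simp
qed

end
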